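(* Let $(f_m)_{m\in\mathbb{N}}$ be a sequence of functions $f_m\in S$ with Taylor expansions $f_m(z)=\sum_{n=1}^{\infty}a_n^{(m)}z^n$, and suppose that (i) $(f_m)$ converges locally uniformly in $\mathbb{D}$ to a function $f\in S$ of maximal growth (i.e. with Hayman index $\alpha(f)>0$) as $m\to\infty$, such that the function $z\mapsto f(z^{-1})^{-1}$, $z\in\Delta$, is a full mapping; (ii) $\alpha_m\to\alpha$ as $m\to\infty$, where $\alpha_m$ and $\alpha$ denote the Hayman indexes of $f_m$ and $f$ respectively. Then for every $\epsilon>0$ there exists a constant $N(\epsilon)$, depending only on $\epsilon$ (for the given sequence), such that \[ \left|\frac{|a_n^{(m)}|}{n}-\alpha_m\right|<\epsilon \] whenever $m,n>N(\epsilon)$.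
   Context: $\mathbb{D}$ is the open unit disk, $\Delta=\{z\in\mathbb{C}:|z|>1\}$, and $S$ is the class of schlicht functions $f(z)=z+\sum_{n\ge2}a_nz^n$ analytic and univalent in $\mathbb{D}$. For $f\in S$ let $M_\infty(r,f)=\max\{|f(z)|:|z|=r\}$; the Hayman index of $f$ is $\alpha(f)=\lim_{r\to1^-}(1-r)^2M_\infty(r,f)\in[0,1]$. A function $g:\Delta\to\mathbb{C}$ of the form $g(z)=z+\sum_{n=0}^\infty b_nz^{-n}$, analytic and univalent in $\Delta$, is called a full mapping if the complement $\mathbb{C}\setminus g(\Delta)$ has two-dimensional Lebesgue measure zero. *)

theory Defs
  imports "HOL-Analysis.Analysis"
begin

definition ext_disk :: "complex set" where
  "ext_disk = {z. norm z > 1}"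

definition schlicht :: "(complex \<Rightarrow> complex) \<Rightarrow> bool" where
  "schlicht f \<longleftrightarrow> f holomorphic_on ball 0 1 \<and> inj_on f (ball 0 1) \<and>
                    f 0 = 0 \<and> deriv f 0 = 1"

definition taylor_coeff :: "(complex \<Rightarrow> complex) \<Rightarrow> nat \<Rightarrow> complex" where
  "taylor_coeff f n = (deriv ^^ n) f 0 / of_nat (fact n)"

definition max_modulus :: "real \<Rightarrow> (complex \<Rightarrow> complex) \<Rightarrow> real" where
  "max_modulus r f = Sup ((\<lambda>z. norm (f z)) ` sphere 0 r)"

definition hayman_index :: "(complex \<Rightarrow> complex) \<Rightarrow> real" where
  "hayman_index f = Lim (at_left 1) (\<lambda>r. (1 - r)^2 * max_modulus r f)"

text \<open>Full mapping: g(z) = z + sum_{n>=0} b_n z^(-n) analytic and univalent in Delta,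
  whose omitted set has two-dimensional Lebesgue measure zero.  The Laurent form is
  expressed as g(z) = z + h(1/z) with h holomorphic in the unit disk.\<close>
definition full_mapping :: "(complex \<Rightarrow> complex) \<Rightarrow> bool" where
  "full_mapping g \<longleftrightarrow>
     g holomorphic_on ext_disk \<and> inj_on g ext_disk \<and>
     (\<exists>h. h holomorphic_on ball 0 1 \<and> (\<forall>z\<in>ext_disk. g z = z + h (inverse z))) \<and>
     (- (g ` ext_disk)) \<in> null_sets lebesgue"

end

(*
For f schlicht put G = 1/f and let A_n(a) be the Taylor coefficients of the logarithm of
(z/f(z)) (1 - f(z)/f(a)) / (1 - z/a).  Integrating the kernel 1/((w - G(a)) conj(w - G(b))) over the
set omitted by G on a disk of radius s < 1, by the substitution w = G(exp u) and Parseval's identity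
on circles, evaluates Re sum n A_n(a) conj(A_n(b)) s^(2n) as -ln|1 - a conj b / s^2| minus an energy
of the omitted set.  Positivity of this energy gives Goluzin-type inequalities; applied to the
square-root transform they show that |f(r e)| (1 - r)^2 / r decreases in r, so the Hayman index
alpha is attained along a direction e.  Letting a tend to e gives Bazilevich's inequality
sum n |gamma_n|^2 <= -2 ln alpha, where gamma_n are the coefficients of the logarithm of the quotient
of the Koebe function with direction e by f.  For a full mapping the energy disappears as s tends
to 1, which makes the inequality an equality.
Under the hypotheses on the sequence, the total sums for f_m are asymptotically at most the sum
for f, while each gamma_n converges (along subsequences of directions); hence the tails of
sum n |gamma_n|^2 are small uniformly in m.  The second Lebedev-Milin inequality then bounds the
mean squares of the coefficient differences, and a Tauberian comparison of |a_n|/n with the Abel mean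
|f(r e)| (1 - r)^2 / r at r = 1 - 1/n is uniform in m.
*)
theory Submission
  imports Defs "HOL-Complex_Analysis.Complex_Analysis"
begin

text \<open>The weighted sums are squared norms of coefficient sequences. Control of the tails is
  then the principle that weak convergence together with convergence of norms is strong convergence.
  The full mapping supplies the lower bound for the norm of the limit; that bound is itself proved
  by weak convergence, of the sequences attached to points of a ray to the one attached to its end
  point.

  The omitted set is known only as a complement, so its energy is found as the integral over a large
  disk minus the integral over the image of an annulus with inner radius t. Both diverge
  logarithmically as t tends to 0, and the divergences cancel. Two points with |a| < |b| come first,
  because the Laurent expansions change at these two radii; the diagonal, on which positivity rests,
  follows by continuity.

  Coefficients of logarithms are given by a finite recursion, so limits inside the disk, at its
  boundary and in m are taken coefficient by coefficient, and no branch of a logarithm has to be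
  followed.\<close>

section \<open>Polar change of variables in the plane\<close>

text \<open>The change-of-variables theorem of the library is stated for \<open>real ^ 'n\<close> only.\<close>

definition vec2 :: "complex \<Rightarrow> real^2" where
  "vec2 z = vector [Re z, Im z]"

definition cpx2 :: "real^2 \<Rightarrow> complex" where
  "cpx2 v = Complex (v $ 1) (v $ 2)"

lemma vec2_nth [simp]: "vec2 z $ 1 = Re z" "vec2 z $ 2 = Im z"
  by (simp_all add: vec2_def)

lemma cpx2_vec2 [simp]: "cpx2 (vec2 z) = z"
  by (simp add: cpx2_def)

lemma vec2_cpx2 [simp]: "vec2 (cpx2 v) = v"
  by (simp add: vec2_def cpx2_def vec_eq_iff forall_2)

lemma linear_vec2: "linear vec2"
  by (rule linearI) (simp_all add: vec_eq_iff forall_2)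

lemma linear_cpx2: "linear cpx2"
  by (rule linearI) (simp_all add: cpx2_def complex_eq_iff)

lemma bounded_linear_vec2: "bounded_linear vec2"
  using linear_vec2 linear_linear by blast

lemma bounded_linear_cpx2: "bounded_linear cpx2"
  using linear_cpx2 linear_linear by blast

lemma borel_measurable_vec2 [measurable]: "vec2 \<in> borel_measurable borel"
  by (intro borel_measurable_continuous_onI linear_continuous_on bounded_linear_vec2)

lemma borel_measurable_cpx2 [measurable]: "cpx2 \<in> borel_measurable borel"
  by (intro borel_measurable_continuous_onI linear_continuous_on bounded_linear_cpx2)

lemma lborel_vec2: "distr lborel borel vec2 = lborel"
proof (rule lborel_eqI[symmetric])
  fix l u :: "real^2"
  assume le: "\<And>b. b \<in> Basis \<Longrightarrow> l \<bullet> b \<le> u \<bullet> b"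
  have le12: "l $ 1 \<le> u $ 1" "l $ 2 \<le> u $ 2"
    using le[of "axis 1 1"] le[of "axis 2 1"] by (auto simp: inner_axis)
  have eq: "vec2 -` box l u = box (cpx2 l) (cpx2 u)"
    by (auto simp: box_def Basis_complex_def cpx2_def Basis_vec_def inner_axis axis_eq_axis forall_2 exhaust_2
        dest!: spec)
  have "emeasure (distr lborel borel vec2) (box l u) = emeasure lborel (box (cpx2 l) (cpx2 u))"
    by (simp add: emeasure_distr eq)
  also have "\<dots> = ennreal ((u $ 1 - l $ 1) * (u $ 2 - l $ 2))"
    using le12 by (subst emeasure_lborel_box) (auto simp: Basis_complex_def cpx2_def complex_i_not_one)
  also have "(u $ 1 - l $ 1) * (u $ 2 - l $ 2) = (\<Prod>b\<in>Basis. (u - l) \<bullet> b)"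
  proof -
    have B: "(Basis :: (real^2) set) = {axis 1 1, axis 2 1}"
      by (auto simp: Basis_vec_def UNIV_2)
    show ?thesis unfolding B by (subst prod.insert) (auto simp: axis_eq_axis inner_axis)
  qed
  finally show "emeasure (distr lborel borel vec2) (box l u) = ennreal (\<Prod>b\<in>Basis. (u - l) \<bullet> b)"
    by simp
qed simp

definition cpair :: "real \<times> real \<Rightarrow> complex" where "cpair p = Complex (fst p) (snd p)"

lemma borel_measurable_cpair [measurable]: "cpair \<in> borel_measurable borel"
  unfolding cpair_def Complex_eq by (intro borel_measurable_continuous_onI continuous_intros)

lemma lborel_cpair: "distr (lborel \<Otimes>\<^sub>M lborel) borel cpair = lborel"
proof (rule lborel_eqI[symmetric])
  fix l u :: complex
  assume le: "\<And>b. b \<in> Basis \<Longrightarrow> l \<bullet> b \<le> u \<bullet> b"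
  have le12: "Re l \<le> Re u" "Im l \<le> Im u"
    using le[of 1] le[of \<i>] by (auto simp: Basis_complex_def)
  have eq: "cpair -` box l u = box (Re l) (Re u) \<times> box (Im l) (Im u)"
    by (auto simp: box_def Basis_complex_def cpair_def)
  have "emeasure (distr (lborel \<Otimes>\<^sub>M lborel) borel cpair) (box l u)
      = emeasure (lborel \<Otimes>\<^sub>M lborel) (box (Re l) (Re u) \<times> box (Im l) (Im u))"
    by (subst emeasure_distr) (simp_all add: eq lborel_prod space_pair_measure)
  also have "\<dots> = ennreal ((Re u - Re l) * (Im u - Im l))"
    using le12 by (subst lborel.emeasure_pair_measure_Times) (auto simp: ennreal_mult)
  finally show "emeasure (distr (lborel \<Otimes>\<^sub>M lborel) borel cpair) (box l u)
      = ennreal (\<Prod>b\<in>Basis. (u - l) \<bullet> b)"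
    by (simp add: Basis_complex_def complex_i_not_one)
qed simp

text \<open>Multiplication by \<open>c\<close> is a rotation combined with a dilation by
  \<open>cmod c\<close>; hence the Jacobian of a holomorphic map is the squared modulus of its
  derivative.\<close>

lemma det_complex_mult:
  "det (matrix (\<lambda>v. vec2 (c * cpx2 v))) = (cmod c)\<^sup>2"
  by (simp add: det_2 matrix_def cpx2_def axis_def cmod_power2) (simp add: power2_eq_square)

text \<open>\<open>absolutely_integrable_on\<close> refers to the completed measure,
  \<open>set_integrable lborel\<close> to the Borel one; the measurability hypothesis on the cut-off
  function lets integrability and value pass between them.\<close>

lemma set_integrable_vec2:
  fixes F :: "real^2 \<Rightarrow> real^2"
  assumes S: "S \<in> sets borel" and m: "(\<lambda>v. indicator (vec2 ` S) v *\<^sub>R F v) \<in> borel_measurable borel"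
  shows "F absolutely_integrable_on (vec2 ` S) \<longleftrightarrow> set_integrable lborel S (\<lambda>z. cpx2 (F (vec2 z)))"
    and "F absolutely_integrable_on (vec2 ` S) \<Longrightarrow>
         (LINT z:S|lborel. cpx2 (F (vec2 z))) = cpx2 (integral (vec2 ` S) F)"
proof -
  have ind: "indicator (vec2 ` S) (vec2 z) = (indicator S z :: real)" for z
    by (auto simp: indicator_def) (metis cpx2_vec2)
  have 1: "F absolutely_integrable_on (vec2 ` S) \<longleftrightarrow> integrable lborel (\<lambda>v. indicator (vec2 ` S) v *\<^sub>R F v)"
    unfolding set_integrable_def using m by (intro integrable_completion) auto
  have 2: "\<dots> \<longleftrightarrow> integrable lborel (\<lambda>z. indicator S z *\<^sub>R F (vec2 z))"
    by (subst lborel_vec2[symmetric], subst integrable_distr_eq) (use m in \<open>auto simp: ind\<close>)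
  have 3: "\<dots> \<longleftrightarrow> integrable lborel (\<lambda>z. indicator S z *\<^sub>R cpx2 (F (vec2 z)))" (is "integrable _ ?f \<longleftrightarrow> integrable _ ?g")
  proof
    assume "integrable lborel ?f"
    from integrable_bounded_linear[OF bounded_linear_cpx2 this] show "integrable lborel ?g"
      by (simp add: linear_cmul[OF linear_cpx2])
  next
    assume "integrable lborel ?g"
    from integrable_bounded_linear[OF bounded_linear_vec2 this] show "integrable lborel ?f"
      by (simp add: linear_cmul[OF linear_vec2])
  qed
  show "F absolutely_integrable_on (vec2 ` S) \<longleftrightarrow> set_integrable lborel S (\<lambda>z. cpx2 (F (vec2 z)))"
    using 1 2 3 by (simp add: set_integrable_def)
  assume a: "F absolutely_integrable_on (vec2 ` S)"
  have "integral (vec2 ` S) F = (LINT v:vec2 ` S|lebesgue. F v)"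
    using a set_lebesgue_integral_eq_integral(2) by metis
  also have "\<dots> = (LINT v|lborel. indicator (vec2 ` S) v *\<^sub>R F v)"
    unfolding set_lebesgue_integral_def using m by (intro integral_completion) auto
  also have "\<dots> = (LINT z|lborel. indicator S z *\<^sub>R F (vec2 z))"
    by (subst lborel_vec2[symmetric], subst integral_distr) (use m in \<open>auto simp: ind\<close>)
  finally have "cpx2 (integral (vec2 ` S) F) = (LINT z|lborel. cpx2 (indicator S z *\<^sub>R F (vec2 z)))"
    using a 1 2 integral_bounded_linear[OF bounded_linear_cpx2, of lborel "\<lambda>z. indicator S z *\<^sub>R F (vec2 z)"]
    by simp
  then show "(LINT z:S|lborel. cpx2 (F (vec2 z))) = cpx2 (integral (vec2 ` S) F)"
    by (simp add: set_lebesgue_integral_def linear_cmul[OF linear_cpx2])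
qed

theorem complex_change_of_variables:
  fixes \<Gamma> \<Gamma>' h :: "complex \<Rightarrow> complex"
  assumes S: "S \<in> sets borel" and G: "\<And>u. u \<in> S \<Longrightarrow> (\<Gamma> has_field_derivative \<Gamma>' u) (at u within S)"
    and c: "continuous_on S \<Gamma>'"
    and inj: "inj_on \<Gamma> S" and im: "\<Gamma> ` S \<in> sets borel" and h: "h \<in> borel_measurable borel"
  shows "set_integrable lborel S (\<lambda>u. of_real ((cmod (\<Gamma>' u))\<^sup>2) * h (\<Gamma> u)) \<longleftrightarrow> set_integrable lborel (\<Gamma> ` S) h"
    and "set_integrable lborel (\<Gamma> ` S) h \<Longrightarrow>
      (LINT w:\<Gamma> ` S|lborel. h w) = (LINT u:S|lborel. of_real ((cmod (\<Gamma>' u))\<^sup>2) * h (\<Gamma> u))"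
proof -
  define g where "g = (\<lambda>v. vec2 (\<Gamma> (cpx2 v)))"
  define g' where "g' = (\<lambda>x v. vec2 (\<Gamma>' (cpx2 x) * cpx2 v))"
  define f where "f = (\<lambda>v. vec2 (h (cpx2 v)))"
  let ?F = "\<lambda>x. \<bar>det (matrix (g' x))\<bar> *\<^sub>R f (g x)"
  have cG: "continuous_on S \<Gamma>"
    using G DERIV_continuous_on by blast
  have gi: "g ` vec2 ` S = vec2 ` \<Gamma> ` S"
    by (auto simp: g_def image_iff)
  have vb: "vec2 ` A \<in> sets borel" if "A \<in> sets borel" for A
  proof -
    have "vec2 ` A = cpx2 -` A \<inter> space borel"
      by (auto simp: image_iff) (metis vec2_cpx2)
    then show ?thesis using that measurable_sets[OF borel_measurable_cpx2] by metis
  qed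
  have indv: "indicator (vec2 ` A) v = (indicator A (cpx2 v) :: real)" for A v
    by (auto simp: indicator_def image_iff) (metis vec2_cpx2)
  have F: "?F x = vec2 (of_real ((cmod (\<Gamma>' (cpx2 x)))\<^sup>2) * h (\<Gamma> (cpx2 x)))" for x
    unfolding g'_def det_complex_mult f_def g_def cpx2_vec2
    by (simp add: linear_cmul[OF linear_vec2, symmetric] scaleR_conv_of_real[where 'a=complex] del: of_real_power)
  \<comment> \<open>Leaving the value \<open>b\<close> free packs integrability and equality of the
    integrals into one equivalence, from which both conclusions are read off.\<close>
  have cv: "?F absolutely_integrable_on vec2 ` S \<and> integral (vec2 ` S) ?F = b
     \<longleftrightarrow> f absolutely_integrable_on (g ` vec2 ` S) \<and> integral (g ` vec2 ` S) f = b" for b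
  proof (rule has_absolute_integral_change_of_variables)
    show "vec2 ` S \<in> sets lebesgue" using vb[OF S] by simp
    show "inj_on g (vec2 ` S)" using inj by (auto simp: inj_on_def g_def) (metis cpx2_vec2)
    fix x assume "x \<in> vec2 ` S"
    then have x: "cpx2 x \<in> S" by auto
    have 1: "(\<Gamma> has_derivative (\<lambda>v. \<Gamma>' (cpx2 x) * v)) (at (cpx2 x) within S)"
      using G[OF x] by (simp add: has_field_derivative_def)
    have 2: "(cpx2 has_derivative cpx2) (at x within vec2 ` S)"
      by (rule bounded_linear_imp_has_derivative[OF bounded_linear_cpx2])
    have Sc: "cpx2 ` vec2 ` S = S" by (auto simp: image_iff)
    have 3: "((\<lambda>x. \<Gamma> (cpx2 x)) has_derivative (\<lambda>v. \<Gamma>' (cpx2 x) * cpx2 v)) (at x within vec2 ` S)"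
      using has_derivative_in_compose[OF 2, of \<Gamma> "\<lambda>v. \<Gamma>' (cpx2 x) * v"] 1 Sc by simp
    show "(g has_derivative g' x) (at x within vec2 ` S)"
      unfolding g_def g'_def by (rule bounded_linear.has_derivative[OF bounded_linear_vec2 3])
  qed
  have "(\<lambda>u. indicator S u *\<^sub>R \<Gamma> u) \<in> borel_measurable borel"
    "(\<lambda>u. indicator S u *\<^sub>R \<Gamma>' u) \<in> borel_measurable borel"
    using borel_measurable_continuous_on_indicator[OF S] cG c by auto
  note [measurable] = this S im h
  have mS: "(\<lambda>u. indicator S u *\<^sub>R (of_real ((cmod (\<Gamma>' u))\<^sup>2) * h (\<Gamma> u))) \<in> borel_measurable borel"
  proof -
    \<comment> \<open>\<open>\<Gamma>\<close> and \<open>\<Gamma>'\<close> are known to be Borel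
      only after a cut-off to \<open>S\<close>; under the outer indicator the inner ones change
      nothing.\<close>
    have "(\<lambda>u. indicator S u *\<^sub>R (of_real ((cmod (indicator S u *\<^sub>R \<Gamma>' u))\<^sup>2) * h (indicator S u *\<^sub>R \<Gamma> u)))
      \<in> borel_measurable borel"
      by measurable
    also have "(\<lambda>u. indicator S u *\<^sub>R (of_real ((cmod (indicator S u *\<^sub>R \<Gamma>' u))\<^sup>2) * h (indicator S u *\<^sub>R \<Gamma> u)))
       = (\<lambda>u. indicator S u *\<^sub>R (of_real ((cmod (\<Gamma>' u))\<^sup>2) * h (\<Gamma> u)))"
      by (auto simp: fun_eq_iff indicator_def)
    finally show ?thesis .
  qed
  have m1: "(\<lambda>v. indicator (vec2 ` S) v *\<^sub>R ?F v) \<in> borel_measurable borel"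
  proof -
    have "(\<lambda>v. vec2 (indicator S (cpx2 v) *\<^sub>R (of_real ((cmod (\<Gamma>' (cpx2 v)))\<^sup>2) * h (\<Gamma> (cpx2 v))))) \<in> borel_measurable borel"
      using measurable_compose[OF measurable_compose[OF borel_measurable_cpx2 mS] borel_measurable_vec2] .
    then show ?thesis unfolding F indv by (simp add: linear_cmul[OF linear_vec2])
  qed
  have m2: "(\<lambda>v. indicator (vec2 ` \<Gamma> ` S) v *\<^sub>R f v) \<in> borel_measurable borel"
    unfolding indv f_def using im h by measurable
  note t1 = set_integrable_vec2[OF S m1, unfolded F cpx2_vec2]
  note t2 = set_integrable_vec2[OF im m2, unfolded f_def cpx2_vec2]
  note cv' = cv[unfolded gi F, unfolded f_def]
  show iff: "set_integrable lborel S (\<lambda>u. of_real ((cmod (\<Gamma>' u))\<^sup>2) * h (\<Gamma> u)) \<longleftrightarrow> set_integrable lborel (\<Gamma> ` S) h"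
    using t1(1) t2(1) cv' by blast
  assume i: "set_integrable lborel (\<Gamma> ` S) h"
  show "(LINT w:\<Gamma> ` S|lborel. h w) = (LINT u:S|lborel. of_real ((cmod (\<Gamma>' u))\<^sup>2) * h (\<Gamma> u))"
    using t1 t2 cv' i iff by (metis (no_types, lifting))
qed

text \<open>\<open>X\<close> is a set of logarithms of radii. The half-open range of angles makes
  \<open>exp\<close> injective without losing a ray, so \<open>w = c + exp u\<close> is a bijective
  form of polar coordinates around \<open>c\<close>.\<close>

definition strip :: "real set \<Rightarrow> complex set" where
  "strip X = {u. Re u \<in> X \<and> Im u \<in> {-pi<..pi}}"

lemma strip_borel: "X \<in> sets borel \<Longrightarrow> strip X \<in> sets borel"
proof -
  assume X: "X \<in> sets borel"
  have "strip X = (Re -` X \<inter> space borel) \<inter> (Im -` {-pi<..pi} \<inter> space borel)"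
    by (auto simp: strip_def)
  then show ?thesis using X by (metis borel_measurable_Im borel_measurable_Re greaterThanAtMost_borel measurable_ident measurable_sets sets.Int measurable_compose)
qed

lemma indicator_strip: "indicator (strip X) (Complex x y) = (indicator X x * indicator {-pi<..pi} y :: real)"
  by (auto simp: strip_def indicator_def)

lemma strip_fubini:
  fixes k :: "complex \<Rightarrow> complex"
  assumes X: "X \<in> sets borel" and k: "set_integrable lborel (strip X) k"
  shows "(LINT u:strip X|lborel. k u) = (LINT x:X|lborel. (LINT y:{-pi<..pi}|lborel. k (Complex x y)))"
    and "set_integrable lborel X (\<lambda>x. (LINT y:{-pi<..pi}|lborel. k (Complex x y)))"
proof -
  let ?K = "\<lambda>u. indicator (strip X) u *\<^sub>R k u"
  have i: "integrable lborel ?K" using k by (simp add: set_integrable_def)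
  then have m: "?K \<in> borel_measurable borel" by auto
  have i2: "integrable (lborel \<Otimes>\<^sub>M lborel) (\<lambda>p. ?K (cpair p))"
    using i by (subst (asm) lborel_cpair[symmetric], subst (asm) integrable_distr_eq) (use m in \<open>auto simp: lborel_prod\<close>)
  have e: "?K (cpair (x, y)) = indicat_real X x *\<^sub>R (indicat_real {-pi<..pi} y *\<^sub>R k (Complex x y))" for x y
    by (simp add: cpair_def indicator_strip)
  have e2: "(LINT y|lborel. ?K (cpair (x, y))) = indicat_real X x *\<^sub>R (LINT y:{-pi<..pi}|lborel. k (Complex x y))" for x
    unfolding e set_lebesgue_integral_def by (rule integral_scaleR_right)
  have "(LINT u:strip X|lborel. k u) = (LINT p|(lborel \<Otimes>\<^sub>M lborel). ?K (cpair p))"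
    unfolding set_lebesgue_integral_def
    by (subst lborel_cpair[symmetric], subst integral_distr) (use m in \<open>auto simp: lborel_prod\<close>)
  also have "\<dots> = (LINT x|lborel. LINT y|lborel. ?K (cpair (x, y)))"
    using lborel_pair.integral_fst'[OF i2] by simp
  finally show "(LINT u:strip X|lborel. k u) = (LINT x:X|lborel. (LINT y:{-pi<..pi}|lborel. k (Complex x y)))"
    unfolding e2 by (simp add: set_lebesgue_integral_def)
  show "set_integrable lborel X (\<lambda>x. (LINT y:{-pi<..pi}|lborel. k (Complex x y)))"
    using lborel_pair.integrable_fst'[OF i2] unfolding e2 by (simp add: set_integrable_def)
qed

section \<open>Integrals over circles and the logarithmic kernel\<close>

lemma set_integral_cnj: "(LINT y:A|M. cnj (f y)) = cnj (LINT y:A|M. f y)"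
proof -
  have "(\<lambda>y. indicator A y *\<^sub>R cnj (f y)) = (\<lambda>y. cnj (indicator A y *\<^sub>R f y))" by auto
  then show ?thesis unfolding set_lebesgue_integral_def by (simp only: Bochner_Integration.integral_cnj complex_cnj)
qed

lemma borel_measurable_cnj:
  "f \<in> borel_measurable M \<Longrightarrow> (\<lambda>y. cnj (f y)) \<in> borel_measurable M"
  by (rule measurable_compose[OF _ borel_measurable_continuous_onI[OF continuous_on_cnj[OF continuous_on_id]]])

lemma circle_integral_cis:
  "(LINT y:{-pi<..pi}|lborel. cis (of_int k * y)) = (if k = 0 then of_real (2*pi) else 0)"
proof -
  have c: "continuous_on {-pi..pi} (\<lambda>y. cis (of_int k * y))"
    by (intro continuous_intros)
  have ae: "(LINT y:{-pi<..pi}|lborel. cis (of_int k * y)) = (LINT y:{-pi..pi}|lborel. cis (of_int k * y))"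
    unfolding set_lebesgue_integral_def
    by (rule integral_discrete_difference[where X="{-pi}"]) (auto simp: indicator_def)
  also have "\<dots> = integral {-pi..pi} (\<lambda>y. cis (of_int k * y))"
    by (rule set_borel_integral_eq_integral(2)[OF borel_integrable_atLeastAtMost'[OF c]])
  also have "\<dots> = (if k = 0 then of_real (2*pi) else 0)"
  proof (cases "k = 0")
    case False
    have "((\<lambda>y. cis (of_int k * y)) has_integral (cis (of_int k * pi) / (\<i> * of_int k) - cis (of_int k * (-pi)) / (\<i> * of_int k))) {-pi..pi}"
    proof (rule fundamental_theorem_of_calculus)
      fix y :: real assume "y \<in> {-pi..pi}"
      have "((\<lambda>z. exp (\<i> * of_int k * z) / (\<i> * of_int k)) has_field_derivative exp (\<i> * of_int k * of_real y)) (at (of_real y))"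
        using False by (auto intro!: derivative_eq_intros)
      then have "(((\<lambda>z. exp (\<i> * of_int k * z) / (\<i> * of_int k)) \<circ> of_real) has_vector_derivative 1 * exp (\<i> * of_int k * of_real y)) (at y)"
        by (intro field_vector_diff_chain_at) (auto simp: has_vector_derivative_def scaleR_conv_of_real intro!: derivative_eq_intros)
      then show "((\<lambda>y. cis (of_int k * y) / (\<i> * of_int k)) has_vector_derivative cis (of_int k * y)) (at y within {-pi..pi})"
        by (auto intro!: has_vector_derivative_at_within simp: o_def cis_conv_exp mult_ac)
    qed simp
    moreover have "cis (of_int k * pi) = cis (of_int k * (-pi))"
    proof -
      have "cis (of_int k * pi) = cis (of_int k * (-pi) + 2 * pi * of_int k)"
        by (simp add: algebra_simps)
      also have "\<dots> = cis (of_int k * (-pi))"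
        by (simp only: cis_mult[symmetric] cis_multiple_2pi[OF Ints_of_int]) simp
      finally show ?thesis .
    qed
    ultimately show ?thesis using False by (simp add: integral_unique)
  qed (simp add: scaleR_conv_of_real)
  finally show ?thesis .
qed

text \<open>The factor \<open>B\<close> need only be bounded and Borel, so it may be another such
  series; expanding one factor at a time then yields Parseval's identity.\<close>

lemma circle_integral_series:
  fixes p :: "nat \<Rightarrow> complex" and B :: "real \<Rightarrow> complex"
  assumes p: "summable (\<lambda>n. norm (p n))" and B: "B \<in> borel_measurable borel" "\<And>y. norm (B y) \<le> M"
  shows "(\<lambda>n. p n * (LINT y:{-pi<..pi}|lborel. cis (real n * y) * B y)) sums
     (LINT y:{-pi<..pi}|lborel. (\<Sum>n. p n * cis y ^ n) * B y)"
proof -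
  let ?I = "\<lambda>y. indicator {-pi<..pi} y :: real"
  have iI: "integrable lborel ?I" by simp
  have M: "0 \<le> M" using B(2)[of 0] norm_ge_zero order_trans by blast
  note [measurable] = B(1)
  have mc: "(\<lambda>y. cis (real n * y)) \<in> borel_measurable borel" for n
    by (intro borel_measurable_continuous_onI continuous_intros)
  note [measurable] = mc
  have int: "integrable lborel (\<lambda>y. ?I y *\<^sub>R (p n * (cis (real n * y) * B y)))" for n
  proof (rule Bochner_Integration.integrable_bound[of _ "\<lambda>y. ?I y * (norm (p n) * M)"])
    show "integrable lborel (\<lambda>y. ?I y * (norm (p n) * M))" by simp
  qed (auto simp: norm_mult indicator_def abs_mult M intro!: mult_left_mono B)
  have s: "summable (\<lambda>n. norm (p n) * M)" using p by (rule summable_mult2)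
  have "(\<lambda>n. LINT y|lborel. ?I y *\<^sub>R (p n * (cis (real n * y) * B y))) sums
     (LINT y|lborel. (\<Sum>n. ?I y *\<^sub>R (p n * (cis (real n * y) * B y))))"
  proof (rule sums_integral[OF int])
    have "summable (\<lambda>n. norm (?I y *\<^sub>R (p n * (cis (real n * y) * B y))))" for y
      by (rule summable_comparison_test'[OF s, of 0]) (auto simp: norm_mult indicator_def M intro!: mult_left_mono B)
    then show "AE y in lborel. summable (\<lambda>n. norm (?I y *\<^sub>R (p n * (cis (real n * y) * B y))))" by simp
    have b: "norm (LINT y|lborel. norm (?I y *\<^sub>R (p n * (cis (real n * y) * B y)))) \<le> norm (p n) * M * (2*pi)" for n
    proof -
      have "(LINT y|lborel. norm (?I y *\<^sub>R (p n * (cis (real n * y) * B y)))) \<le> (LINT y|lborel. ?I y * (norm (p n) * M))"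
      proof (rule integral_mono)
        show "integrable lborel (\<lambda>y. norm (?I y *\<^sub>R (p n * (cis (real n * y) * B y))))"
          by (rule integrable_norm[OF int])
        show "integrable lborel (\<lambda>y. ?I y * (norm (p n) * M))" by simp
      qed (auto simp: norm_mult indicator_def M intro!: mult_left_mono B)
      then show ?thesis by (simp add: mult_ac)
    qed
    show "summable (\<lambda>n. LINT y|lborel. norm (?I y *\<^sub>R (p n * (cis (real n * y) * B y))))"
      by (rule summable_comparison_test'[OF summable_mult2[OF s, of "2*pi"], of 0]) (use b in auto)
  qed
  moreover have "(\<Sum>n. ?I y *\<^sub>R (p n * (cis (real n * y) * B y))) = ?I y *\<^sub>R ((\<Sum>n. p n * cis y ^ n) * B y)" for y
  proof -
    have "summable (\<lambda>n. p n * cis y ^ n)"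
      by (rule summable_norm_cancel) (use p in \<open>simp add: norm_mult norm_power\<close>)
    then show ?thesis
      by (subst suminf_mult2) (auto simp: indicator_def Complex.DeMoivre mult.assoc)
  qed
  moreover have "(LINT y|lborel. ?I y *\<^sub>R (p n * (cis (real n * y) * B y))) = p n * (LINT y:{-pi<..pi}|lborel. cis (real n * y) * B y)" for n
    unfolding set_lebesgue_integral_def by (subst integral_mult_right_zero[symmetric]) (simp add: scaleR_conv_of_real mult_ac)
  ultimately show ?thesis by (simp add: set_lebesgue_integral_def)
qed

lemma series_cis_bounded:
  fixes p :: "nat \<Rightarrow> complex"
  assumes p: "summable (\<lambda>n. norm (p n))"
  shows "norm (\<Sum>n. p n * cis y ^ n) \<le> (\<Sum>n. norm (p n))"
    and "summable (\<lambda>n. p n * cis y ^ n)"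
proof -
  have 1: "summable (\<lambda>n. norm (p n * cis y ^ n))" using p by (simp add: norm_mult norm_power)
  then show "summable (\<lambda>n. p n * cis y ^ n)" by (rule summable_norm_cancel)
  show "norm (\<Sum>n. p n * cis y ^ n) \<le> (\<Sum>n. norm (p n))"
    using summable_norm[OF 1] by (simp add: norm_mult norm_power)
qed

lemma series_cis_measurable:
  fixes p :: "nat \<Rightarrow> complex"
  shows "(\<lambda>y. \<Sum>n. p n * cis y ^ n) \<in> borel_measurable borel"
proof -
  have "(\<lambda>y. p n * cis y ^ n) \<in> borel_measurable borel" for n
    by (intro borel_measurable_continuous_onI continuous_intros)
  then show ?thesis by measurable
qed

lemma circle_integral_mult:
  fixes p q :: "nat \<Rightarrow> complex"
  assumes p: "summable (\<lambda>n. norm (p n))" and q: "summable (\<lambda>n. norm (q n))"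
  shows "(LINT y:{-pi<..pi}|lborel. (\<Sum>n. p n * cis y ^ n) * (\<Sum>n. q n * cis y ^ n)) = 2 * pi * (p 0 * q 0)"
proof -
  have A: "(LINT y:{-pi<..pi}|lborel. cis (real k * y) * (\<Sum>n. q n * cis y ^ n)) = (if k = 0 then 2 * pi * q 0 else 0)" for k
  proof -
    have X: "(\<lambda>n. q n * (LINT y:{-pi<..pi}|lborel. cis (real n * y) * cis (real k * y))) sums
     (LINT y:{-pi<..pi}|lborel. (\<Sum>n. q n * cis y ^ n) * cis (real k * y))"
      by (rule circle_integral_series[OF q, of _ 1]) (auto intro!: borel_measurable_continuous_onI continuous_intros)
    have Y: "(LINT y:{-pi<..pi}|lborel. cis (real n * y) * cis (real k * y)) = (if n = 0 \<and> k = 0 then 2 * pi else 0)" for n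
      using circle_integral_cis[of "int n + int k"] by (simp add: cis_mult algebra_simps)
    have fe: "(\<lambda>n. q n * complex_of_real (if n = 0 \<and> k = 0 then 2 * pi else 0)) = (\<lambda>n. if n = 0 then (if k = 0 then 2 * pi * q 0 else 0) else 0)"
      by auto
    have "(\<lambda>n. if n = 0 then (if k = 0 then 2 * pi * q 0 else 0) else 0) sums
     (LINT y:{-pi<..pi}|lborel. (\<Sum>n. q n * cis y ^ n) * cis (real k * y))"
      using X unfolding Y fe .
    moreover have "(\<lambda>n::nat. if n = 0 then (if k = 0 then 2 * pi * q 0 else 0) else 0) sums (if k = 0 then 2 * pi * q 0 else 0)"
      using sums_single[of 0 "\<lambda>n::nat. if k = 0 then 2 * pi * q 0 else 0"] by simp
    ultimately show ?thesis using sums_unique2 by (force simp: mult.commute)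
  qed
  have "(\<lambda>n. p n * (LINT y:{-pi<..pi}|lborel. cis (real n * y) * (\<Sum>n. q n * cis y ^ n))) sums
     (LINT y:{-pi<..pi}|lborel. (\<Sum>n. p n * cis y ^ n) * (\<Sum>n. q n * cis y ^ n))"
    by (rule circle_integral_series[OF p series_cis_measurable series_cis_bounded(1)[OF q]])
  then have "(\<lambda>n. if n = 0 then p 0 * (2 * pi * q 0) else 0) sums
     (LINT y:{-pi<..pi}|lborel. (\<Sum>n. p n * cis y ^ n) * (\<Sum>n. q n * cis y ^ n))"
    unfolding A by (auto simp: if_distrib cong: if_cong)
  moreover have "(\<lambda>n::nat. if n = 0 then p 0 * (2 * pi * q 0) else 0) sums (p 0 * (2 * pi * q 0))"
    using sums_single[of 0 "\<lambda>n::nat. p 0 * (2 * pi * q 0)"] by simp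
  ultimately show ?thesis using sums_unique2 by (fastforce simp: mult_ac)
qed

lemma circle_integral_mult_cnj:
  fixes p q :: "nat \<Rightarrow> complex"
  assumes p: "summable (\<lambda>n. norm (p n))" and q: "summable (\<lambda>n. norm (q n))"
  shows "(LINT y:{-pi<..pi}|lborel. (\<Sum>n. p n * cis y ^ n) * cnj (\<Sum>n. q n * cis y ^ n)) = 2 * pi * (\<Sum>n. p n * cnj (q n))"
proof -
  have cs: "cnj (\<Sum>n. q n * cis y ^ n) = (\<Sum>n. cnj (q n) * cis (-y) ^ n)" for y
    using bounded_linear.suminf[OF bounded_linear_cnj series_cis_bounded(2)[OF q, of y]] by (simp add: cis_cnj)
  have A: "(LINT y:{-pi<..pi}|lborel. cis (real k * y) * cnj (\<Sum>n. q n * cis y ^ n)) = 2 * pi * cnj (q k)" for k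
  proof -
    have X: "(\<lambda>n. q n * (LINT y:{-pi<..pi}|lborel. cis (real n * y) * cis (- real k * y))) sums
     (LINT y:{-pi<..pi}|lborel. (\<Sum>n. q n * cis y ^ n) * cis (- real k * y))"
      by (rule circle_integral_series[OF q, of _ 1]) (auto intro!: borel_measurable_continuous_onI continuous_intros)
    have Y: "(LINT y:{-pi<..pi}|lborel. cis (real n * y) * cis (- real k * y)) = (if n = k then 2 * pi else 0)" for n
      using circle_integral_cis[of "int n - int k"] by (simp add: cis_mult algebra_simps)
    have fe: "(\<lambda>n. q n * complex_of_real (if n = k then 2 * pi else 0)) = (\<lambda>n. if n = k then 2 * pi * q n else 0)"
      by auto
    have "(\<lambda>n. if n = k then 2 * pi * q n else 0) sums
     (LINT y:{-pi<..pi}|lborel. (\<Sum>n. q n * cis y ^ n) * cis (- real k * y))"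
      using X unfolding Y fe .
    moreover have "(\<lambda>n. if n = k then 2 * pi * q n else 0) sums (2 * pi * q k)"
      using sums_single[of k "\<lambda>n. 2 * pi * q n"] by simp
    ultimately have "(LINT y:{-pi<..pi}|lborel. (\<Sum>n. q n * cis y ^ n) * cis (- real k * y)) = 2 * pi * q k"
      using sums_unique2 by blast
    then have "cnj (LINT y:{-pi<..pi}|lborel. (\<Sum>n. q n * cis y ^ n) * cis (- real k * y)) = 2 * pi * cnj (q k)"
      by simp
    moreover have "cnj (LINT y:{-pi<..pi}|lborel. (\<Sum>n. q n * cis y ^ n) * cis (- real k * y))
       = (LINT y:{-pi<..pi}|lborel. cis (real k * y) * cnj (\<Sum>n. q n * cis y ^ n))"
      unfolding set_integral_cnj[symmetric] by (simp add: cis_cnj mult_ac)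
    ultimately show ?thesis by simp
  qed
  have "(\<lambda>n. p n * (LINT y:{-pi<..pi}|lborel. cis (real n * y) * cnj (\<Sum>n. q n * cis y ^ n))) sums
     (LINT y:{-pi<..pi}|lborel. (\<Sum>n. p n * cis y ^ n) * cnj (\<Sum>n. q n * cis y ^ n))"
    using borel_measurable_cnj[OF series_cis_measurable[of q]] series_cis_bounded(1)[OF q]
    by (intro circle_integral_series[OF p, of _ "\<Sum>n. norm (q n)"]) auto
  then have s: "(\<lambda>n. 2 * pi * (p n * cnj (q n))) sums
     (LINT y:{-pi<..pi}|lborel. (\<Sum>n. p n * cis y ^ n) * cnj (\<Sum>n. q n * cis y ^ n))"
    unfolding A by (simp add: mult_ac)
  from sums_mult_D[OF this] have "summable (\<lambda>n. p n * cnj (q n))"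
    by (simp add: summable_def) blast
  then show ?thesis using s by (simp add: sums_iff suminf_mult)
qed

text \<open>Nonnegative powers of \<open>cis y\<close> are orthogonal to strictly negative ones;
  \<open>v 0 = 0\<close> and \<open>w 0 = 0\<close> place the constant term in one of the two series
  only.\<close>

lemma circle_integral_laurent:
  fixes p q v w :: "nat \<Rightarrow> complex"
  assumes p: "summable (\<lambda>n. norm (p n))" and q: "summable (\<lambda>n. norm (q n))"
    and v: "summable (\<lambda>n. norm (v n))" and w: "summable (\<lambda>n. norm (w n))"
    and 0: "v 0 = 0" "w 0 = 0"
  shows "(LINT y:{-pi<..pi}|lborel. ((\<Sum>n. p n * cis y ^ n) + (\<Sum>n. v n * cis (-y) ^ n)) *
             cnj ((\<Sum>n. q n * cis y ^ n) + (\<Sum>n. w n * cis (-y) ^ n)))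
       = 2 * pi * ((\<Sum>n. p n * cnj (q n)) + (\<Sum>n. v n * cnj (w n)))"
proof -
  define P where "P p y = (\<Sum>n. p n * cis y ^ n)" for p :: "nat \<Rightarrow> complex" and y
  have cs: "P r (-y) = cnj (P (\<lambda>n. cnj (r n)) y)" if "summable (\<lambda>n. norm (r n))" for r y
    unfolding P_def using bounded_linear.suminf[OF bounded_linear_cnj series_cis_bounded(2)[of "\<lambda>n. cnj (r n)" y]] that
    by (simp add: cis_cnj)
  have sn: "summable (\<lambda>n. norm (cnj (r n)))" if "summable (\<lambda>n. norm (r n))" for r :: "nat \<Rightarrow> complex"
    using that by simp
  have int: "set_integrable lborel {-pi<..pi} (\<lambda>y. f y * g y)"
    if "f \<in> borel_measurable borel" "g \<in> borel_measurable borel" "\<And>y. norm (f y) \<le> A" "\<And>y. norm (g y) \<le> B"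
    for f g :: "real \<Rightarrow> complex" and A B
    unfolding set_integrable_def
  proof (rule Bochner_Integration.integrable_bound[of _ "\<lambda>y. indicator {-pi<..pi} y * (A * B)"])
    have "0 \<le> A" using that(3)[of 0] norm_ge_zero order_trans by blast
    then show "AE y in lborel. norm (indicat_real {- pi<..pi} y *\<^sub>R (f y * g y)) \<le> norm (indicat_real {- pi<..pi} y * (A * B))"
      by (intro AE_I2) (auto simp: norm_mult indicator_def intro!: order_trans[OF mult_mono[OF that(3,4)]])
    show "(\<lambda>y. indicat_real {- pi<..pi} y *\<^sub>R (f y * g y)) \<in> borel_measurable lborel"
      using that(1,2) by measurable
  qed simp
  have m: "P r \<in> borel_measurable borel" for r unfolding P_def by (rule series_cis_measurable)
  have mc: "(\<lambda>y. cnj (P r y)) \<in> borel_measurable borel" for r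
    by (rule borel_measurable_cnj[OF m])
  have b: "norm (P r y) \<le> (\<Sum>n. norm (r n))" if "summable (\<lambda>n. norm (r n))" for r y
    unfolding P_def by (rule series_cis_bounded(1)[OF that])
  \<comment> \<open>Conjugation turns the series in negative powers into series in positive powers,
    so every product is of a kind already integrated.\<close>
  define v' w' where "v' = (\<lambda>n. cnj (v n))" and "w' = (\<lambda>n. cnj (w n))"
  have v': "summable (\<lambda>n. norm (v' n))" and w': "summable (\<lambda>n. norm (w' n))"
    using v w by (simp_all add: v'_def w'_def)
  have bc: "norm (cnj (P r y)) \<le> (\<Sum>n. norm (r n))" if "summable (\<lambda>n. norm (r n))" for r y
    using b[OF that] by simp
  have i1: "set_integrable lborel {-pi<..pi} (\<lambda>y. P p y * cnj (P q y))"
    by (rule int[OF m mc b[OF p] bc[OF q]])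
  have i2: "set_integrable lborel {-pi<..pi} (\<lambda>y. P p y * P w' y)"
    by (rule int[OF m m b[OF p] b[OF w']])
  have i3: "set_integrable lborel {-pi<..pi} (\<lambda>y. cnj (P v' y) * cnj (P q y))"
    by (rule int[OF mc mc bc[OF v'] bc[OF q]])
  have i4: "set_integrable lborel {-pi<..pi} (\<lambda>y. cnj (P v' y) * P w' y)"
    by (rule int[OF mc m bc[OF v'] b[OF w']])
  have "(P p y + P v (-y)) * cnj (P q y + P w (-y))
      = P p y * cnj (P q y) + P p y * P w' y + cnj (P v' y) * cnj (P q y) + cnj (P v' y) * P w' y" for y
    by (simp add: cs[OF v] cs[OF w] v'_def w'_def algebra_simps)
  then have "(LINT y:{-pi<..pi}|lborel. (P p y + P v (-y)) * cnj (P q y + P w (-y)))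
     = (LINT y:{-pi<..pi}|lborel. P p y * cnj (P q y)) + (LINT y:{-pi<..pi}|lborel. P p y * P w' y)
     + (LINT y:{-pi<..pi}|lborel. cnj (P v' y) * cnj (P q y)) + (LINT y:{-pi<..pi}|lborel. cnj (P v' y) * P w' y)"
    using i1 i2 i3 i4 by (simp add: set_integral_add)
  moreover have "(LINT y:{-pi<..pi}|lborel. cnj (P v' y) * cnj (P q y)) = cnj (LINT y:{-pi<..pi}|lborel. P v' y * P q y)"
    unfolding set_integral_cnj[symmetric] by (simp add: mult_ac)
  moreover have "(LINT y:{-pi<..pi}|lborel. cnj (P v' y) * P w' y) = (LINT y:{-pi<..pi}|lborel. P w' y * cnj (P v' y))"
    by (simp add: mult.commute)
  moreover have "(LINT y:{-pi<..pi}|lborel. P p y * cnj (P q y)) = 2 * pi * (\<Sum>n. p n * cnj (q n))"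
    unfolding P_def by (rule circle_integral_mult_cnj[OF p q])
  moreover have "(LINT y:{-pi<..pi}|lborel. P w' y * cnj (P v' y)) = 2 * pi * (\<Sum>n. w' n * cnj (v' n))"
    unfolding P_def by (rule circle_integral_mult_cnj[OF w' v'])
  moreover have "(LINT y:{-pi<..pi}|lborel. P p y * P w' y) = 0"
    unfolding P_def using circle_integral_mult[OF p w'] 0 by (simp add: w'_def)
  moreover have "(LINT y:{-pi<..pi}|lborel. P v' y * P q y) = 0"
    unfolding P_def using circle_integral_mult[OF v' q] 0 by (simp add: v'_def)
  ultimately show ?thesis
    unfolding P_def by (simp add: v'_def w'_def algebra_simps)
qed

lemma circle_integral_mean:
  fixes p :: "nat \<Rightarrow> complex"
  assumes p: "summable (\<lambda>n. norm (p n))"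
  shows "(LINT y:{-pi<..pi}|lborel. (\<Sum>n. p n * cis y ^ n)) = 2 * pi * p 0"
proof -
  have s: "(\<Sum>n. (if n = 0 then 1 else 0) * cis y ^ n) = 1" for y
    by (subst suminf_finite[of "{0}"]) auto
  have "summable (\<lambda>n. norm (if n = (0::nat) then 1 else 0 :: complex))"
    by (rule summable_finite[of "{0}"]) auto
  from circle_integral_mult[OF p this] show ?thesis unfolding s by simp
qed

section \<open>Logarithmic polar coordinates around a point\<close>

lemma inj_on_exp_strip: "inj_on (\<lambda>u. c + exp u) (strip X)"
proof (rule inj_onI)
  fix u v assume uv: "u \<in> strip X" "v \<in> strip X" and e: "c + exp u = c + exp v"
  have "Ln (exp u) = u" "Ln (exp v) = v"
    using uv by (simp_all add: strip_def)
  moreover have "exp u = exp v" using e by simp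
  ultimately have "u = v" by metis
  then show "u = v" by simp
qed

lemma image_exp_strip: "(\<lambda>u. c + exp u) ` strip X = {w. w \<noteq> c \<and> ln (norm (w - c)) \<in> X}"
proof (intro set_eqI iffI)
  fix w assume w: "w \<in> {w. w \<noteq> c \<and> ln (norm (w - c)) \<in> X}"
  then have "w = c + exp (Ln (w - c))" "Ln (w - c) \<in> strip X"
    using mpi_less_Im_Ln[of "w-c"] Im_Ln_le_pi[of "w-c"] by (auto simp: strip_def)
  then show "w \<in> (\<lambda>u. c + exp u) ` strip X" by blast
qed (auto simp: strip_def norm_exp_eq_Re)

lemma punctured_ball_strip:
  assumes "R > 0"
  shows "(\<lambda>u. c + exp u) ` strip {..<ln R} = ball c R - {c}"
  using assms by (auto simp: image_exp_strip dist_norm norm_minus_commute ln_less_cancel_iff)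

lemma set_integrable_exp_lessThan: "set_integrable lborel {..<c} (\<lambda>x::real. exp x)"
proof -
  have "(\<lambda>x::real. exp (-1*x)) absolutely_integrable_on {-c..}"
    using has_integral_exp_minus_to_infinity[of 1 "-c"]
    by (intro nonnegative_absolutely_integrable_1) (auto simp: integrable_on_def)
  then have "integrable lborel (\<lambda>x::real. indicator {-c..} x *\<^sub>R exp (-x))"
    unfolding set_integrable_def by (subst (asm) integrable_completion) auto
  from lborel_integrable_real_affine[OF this, of "-1" 0]
  have "set_integrable lborel {..c} (\<lambda>x::real. exp x)"
    unfolding set_integrable_def
    by (rule back_subst[where P="integrable lborel"]) (auto simp: indicator_def)
  then show ?thesis by (rule set_integrable_subset) auto
qed

lemma set_integrable_puncture:
  fixes h :: "complex \<Rightarrow> complex"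
  assumes "h \<in> borel_measurable borel" "A \<in> sets borel"
  shows "set_integrable lborel (A - {c}) h \<longleftrightarrow> set_integrable lborel A h"
  unfolding set_integrable_def
  by (rule integrable_discrete_difference[where X="{c}"]) (use assms in \<open>auto simp: indicator_def\<close>)

lemma set_integral_puncture:
  fixes h :: "complex \<Rightarrow> complex"
  shows "(LINT w:A - {c}|lborel. h w) = (LINT w:A|lborel. h w)"
  unfolding set_lebesgue_integral_def
  by (rule integral_discrete_difference[where X="{c}"]) (auto simp: indicator_def)

lemma exp_strip_deriv:
  "((\<lambda>u. c + exp u) has_field_derivative exp u) (at u within S)"
  by (auto intro!: derivative_eq_intros)

text \<open>The Jacobian \<open>exp (2 * x)\<close> of logarithmic coordinates turns the singularity
  \<open>1 / |w - c|\<close> into \<open>exp x\<close>, which is integrable towards minus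
  infinity.\<close>

lemma set_integrable_inverse_norm:
  fixes c :: complex
  assumes R: "R > 0"
  shows "set_integrable lborel (ball c R) (\<lambda>w. complex_of_real (inverse (norm (w - c))))"
proof -
  let ?S = "strip {..<ln R}" and ?h = "\<lambda>w. complex_of_real (inverse (norm (w - c)))"
  have S: "?S \<in> sets borel" by (rule strip_borel) simp
  have hm: "?h \<in> borel_measurable borel" by measurable
  have im: "(\<lambda>u. c + exp u) ` ?S \<in> sets borel"
    using punctured_ball_strip[OF R] by simp
  have "set_integrable lborel ?S (\<lambda>u. of_real ((cmod (exp u))\<^sup>2) * ?h (c + exp u))"
  proof -
    let ?k = "\<lambda>p::real \<times> real. indicator {..<ln R} (fst p) * exp (fst p) * indicator {-pi<..pi} (snd p)"
    have "integrable (lborel \<Otimes>\<^sub>M lborel) ?k"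
    proof (rule lborel_pair.Fubini_integrable)
      show "?k \<in> borel_measurable (lborel \<Otimes>\<^sub>M lborel)" by measurable
      have "(LINT y|lborel. norm (?k (x, y))) = indicator {..<ln R} x *\<^sub>R exp x * (2 * pi)" for x
        by (simp add: abs_mult)
      then show "integrable lborel (\<lambda>x. LINT y|lborel. norm (?k (x, y)))"
        using set_integrable_exp_lessThan[of "ln R"] unfolding set_integrable_def by simp
    qed (simp add: mult.commute)
    then have "integrable (lborel \<Otimes>\<^sub>M lborel) (\<lambda>p. complex_of_real (?k p))" by (rule integrable_of_real)
    moreover have "complex_of_real (?k p) = indicator ?S (cpair p) *\<^sub>R complex_of_real (exp (Re (cpair p)))" for p
      by (auto simp: strip_def cpair_def indicator_def)
    ultimately have "integrable (lborel \<Otimes>\<^sub>M lborel) (\<lambda>p. indicator ?S (cpair p) *\<^sub>R complex_of_real (exp (Re (cpair p))))"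
      by simp
    then have "integrable lborel (\<lambda>u. indicator ?S u *\<^sub>R complex_of_real (exp (Re u)))"
      by (subst lborel_cpair[symmetric], subst integrable_distr_eq) (use S in \<open>auto simp: lborel_prod\<close>)
    moreover have "of_real ((cmod (exp u))\<^sup>2) * ?h (c + exp u) = complex_of_real (exp (Re u))" for u
    proof -
      have "(cmod (exp u))\<^sup>2 * inverse (norm (c + exp u - c)) = exp (Re u)"
        by (simp add: power2_eq_square)
      then show ?thesis by (metis of_real_mult)
    qed
    ultimately show ?thesis unfolding set_integrable_def by simp
  qed
  then have "set_integrable lborel ((\<lambda>u. c + exp u) ` ?S) ?h"
    by (subst complex_change_of_variables(1)[OF S exp_strip_deriv _ inj_on_exp_strip im hm, symmetric])
      (auto intro!: continuous_intros)
  then show ?thesis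
    unfolding punctured_ball_strip[OF R] by (subst (asm) set_integrable_puncture[OF hm]) auto
qed

text \<open>Its integral over a set is the L2 inner product of \<open>1 / (w - p)\<close> and
  \<open>1 / (w - q)\<close> there; all positivity used below comes from this Gram
  structure.\<close>

definition kern :: "complex \<Rightarrow> complex \<Rightarrow> complex \<Rightarrow> complex" where
  "kern p q w = inverse (w - p) * cnj (inverse (w - q))"

lemma norm_kern: "norm (kern p q w) = inverse (norm (w - p)) * inverse (norm (w - q))"
  by (simp only: kern_def norm_mult complex_mod_cnj norm_inverse)

lemma kern_measurable [measurable]: "kern p q \<in> borel_measurable borel"
proof -
  have "(\<lambda>w. cnj (inverse (w - q))) \<in> borel_measurable borel"
    by (rule borel_measurable_cnj) measurable
  then show ?thesis unfolding kern_def[abs_def] by measurable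
qed

text \<open>By the triangle inequality \<open>1 / (|w - p| |w - q|)\<close> is at most
  \<open>(1 / |w - p| + 1 / |w - q|) / |p - q|\<close>, so the two singularities are dealt with
  separately.\<close>

lemma set_integrable_kern_ball:
  assumes pq: "p \<noteq> q" and R: "R > 0"
  shows "set_integrable lborel (ball p R) (kern p q)"
proof -
  let ?I = "\<lambda>c w. complex_of_real (inverse (norm (w - c)))"
  have "set_integrable lborel (ball q (R + dist p q)) (?I q)"
    by (rule set_integrable_inverse_norm) (use R in \<open>auto intro: add_pos_nonneg\<close>)
  then have 1: "set_integrable lborel (ball p R) (?I q)"
  proof (rule set_integrable_subset)
    show "ball p R \<subseteq> ball q (R + dist p q)"
    proof
      fix w assume "w \<in> ball p R"
      then show "w \<in> ball q (R + dist p q)"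
        using dist_triangle[of q w p] by (simp add: dist_commute)
    qed
  qed simp
  have 2: "set_integrable lborel (ball p R) (?I p)" by (rule set_integrable_inverse_norm[OF R])
  have 3: "set_integrable lborel (ball p R) (\<lambda>w. of_real (inverse (norm (p - q))) * (?I p w + ?I q w))"
    using 1 2 by (intro set_integrable_mult_right set_integral_add)
  show ?thesis
  proof (rule set_integrable_bound[OF 3])
    show "set_borel_measurable lborel (ball p R) (kern p q)"
      unfolding set_borel_measurable_def
      using borel_measurable_scaleR[OF borel_measurable_indicator kern_measurable[of p q], of "ball p R"] by simp
    have "norm (kern p q w) \<le> norm (complex_of_real (inverse (norm (p - q))) * (?I p w + ?I q w))" for w
    proof -
      have eq: "norm (complex_of_real (inverse (norm (p - q))) * (?I p w + ?I q w))
          = inverse (norm (p - q)) * (inverse (norm (w - p)) + inverse (norm (w - q)))"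
        by (simp add: norm_mult flip: of_real_add of_real_inverse)
      show ?thesis
      proof (cases "w = p \<or> w = q")
        case False
        have "norm (p - q) \<le> norm (w - q) + norm (w - p)"
          using norm_triangle_ineq4[of "w - q" "w - p"] by simp
        then show ?thesis unfolding eq norm_kern using False pq
          by (simp add: field_simps)
      qed (auto simp: eq kern_def)
    qed
    then show "AE x in lborel. x \<in> ball p R \<longrightarrow> norm (kern p q x) \<le> norm (complex_of_real (inverse (norm (p - q))) * (?I p x + ?I q x))"
      by simp
  qed
qed

text \<open>For |z| < |d| the quotient z / (z - d) is a power series without constant term, so it
  has mean 0; for |z| > |d| it is a series in d / z with constant term 1. Under the conjugate the
  latter runs over nonnegative powers of \<open>cis y\<close>.\<close>

lemma kern_circle_integral:
  assumes d: "d \<noteq> 0" and x: "x \<noteq> ln (norm d)"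
  shows "(LINT y:{-pi<..pi}|lborel. cnj (exp (Complex x y) * inverse (exp (Complex x y) - d)))
      = (if x < ln (norm d) then 0 else 2 * pi)"
proof -
  define t where "t = exp x"
  have t: "t > 0" "t \<noteq> norm d" using x d by (auto simp: t_def) (metis ln_exp)
  have e: "exp (Complex x y) = of_real t * cis y" for y
    by (simp add: t_def exp_eq_polar)
  have lt: "x < ln (norm d) \<longleftrightarrow> t < norm d"
    using d by (simp add: t_def exp_less_cancel_iff[symmetric, of x] del: exp_less_cancel_iff)
  show ?thesis
  proof (cases "t < norm d")
    case True
    have sm: "norm (t / d) < 1" using True d t by (simp add: norm_divide)
    have s: "exp (Complex x y) * inverse (exp (Complex x y) - d) = (\<Sum>n. (if n = 0 then 0 else - ((t / d) ^ n)) * cis y ^ n)" for y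
    proof -
      let ?z = "t / d * cis y"
      have z: "norm ?z < 1" unfolding norm_mult using sm by simp
      then have "(\<lambda>n. - (?z * ?z ^ n)) sums (- (?z * (1 / (1 - ?z))))"
        by (intro sums_minus sums_mult geometric_sums)
      moreover have "(\<lambda>n. - (?z * ?z ^ n)) = (\<lambda>n. (if Suc n = 0 then 0 else - ((t / d) ^ Suc n)) * cis y ^ Suc n)"
        unfolding power_mult_distrib by (simp add: mult_ac)
      ultimately have "(\<lambda>n. (if Suc n = 0 then 0 else - ((t / d) ^ Suc n)) * cis y ^ Suc n) sums (- (?z * (1 / (1 - ?z))))"
        by simp
      then have "(\<lambda>n. (if n = 0 then 0 else - ((t / d) ^ n)) * cis y ^ n) sums (- (?z * (1 / (1 - ?z))))"
        by (subst (asm) sums_Suc_iff) simp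
      moreover have "- (?z * (1 / (1 - ?z))) = exp (Complex x y) * inverse (exp (Complex x y) - d)"
      proof -
        have "1 - ?z \<noteq> 0" using z by auto
        then have "d - t * cis y \<noteq> 0" using d by (simp add: field_simps)
        then show ?thesis unfolding e using d by (simp add: divide_simps) (simp add: algebra_simps)
      qed
      ultimately show ?thesis by (simp add: sums_iff)
    qed
    have "summable (\<lambda>n. norm (if n = 0 then 0 else - ((t / d) ^ n)))"
      by (rule summable_comparison_test'[OF summable_geometric[of "norm (t / d)"], of 0])
        (use sm in \<open>auto simp: norm_power\<close>)
    from circle_integral_mean[OF this] show ?thesis
      unfolding set_integral_cnj s using True lt by simp
  next
    case False
    then have td: "norm d < t" using t by simp
    have sm: "norm (cnj d / t) < 1" using td t by (simp add: norm_divide)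
    have s: "cnj (exp (Complex x y) * inverse (exp (Complex x y) - d)) = (\<Sum>n. (cnj d / t) ^ n * cis y ^ n)" for y
    proof -
      let ?z = "cnj d / t * cis y"
      have z: "norm ?z < 1" unfolding norm_mult using sm by simp
      have "(\<lambda>n. ?z ^ n) sums (1 / (1 - ?z))" by (rule geometric_sums[OF z])
      moreover have "1 / (1 - ?z) = cnj (exp (Complex x y) * inverse (exp (Complex x y) - d))"
      proof -
        have "1 - ?z \<noteq> 0" using z by auto
        then have ne: "t - cnj d * cis y \<noteq> 0" using t by (simp add: field_simps)
        have c: "cis y * cnj (cis y) = 1" by (simp add: cis_cnj cis_mult)
        have ne2: "t * cnj (cis y) - cnj d \<noteq> 0"
        proof
          assume "t * cnj (cis y) - cnj d = 0"
          then have "(t * cnj (cis y) - cnj d) * cis y = 0" by simp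
          then have "t * (cis y * cnj (cis y)) - cnj d * cis y = 0" by (simp add: algebra_simps)
          then show False using ne c by simp
        qed
        have "t * (t * cnj (cis y) - cnj d) = t * cnj (cis y) * (t - cnj d * cis y)"
          using c by (simp add: algebra_simps)
        then show ?thesis unfolding e using ne ne2 t by (simp add: field_simps)
      qed
      moreover have "(\<lambda>n. ?z ^ n) = (\<lambda>n. (cnj d / t) ^ n * cis y ^ n)"
        unfolding power_mult_distrib ..
      ultimately have "(\<lambda>n. (cnj d / t) ^ n * cis y ^ n) sums cnj (exp (Complex x y) * inverse (exp (Complex x y) - d))"
        by simp
      then show ?thesis using sums_unique by blast
    qed
    have "summable (\<lambda>n. norm ((cnj d / t) ^ n))"
      using sm by (simp add: norm_power summable_geometric)
    from circle_integral_mean[OF this] show ?thesis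
      unfolding s using False lt by simp
  qed
qed

text \<open>In logarithmic coordinates centred at \<open>p\<close> the Jacobian absorbs the pole at
  \<open>p\<close>, and only the radii between |q - p| and R contribute, each with the same
  amount.\<close>

lemma kern_ball_integral:
  assumes pq: "p \<noteq> q" and R: "R > norm (q - p)"
  shows "(LINT w:ball p R|lborel. kern p q w) = 2 * pi * (ln R - ln (norm (q - p)))"
proof -
  have R0: "R > 0" using R norm_ge_zero order_le_less_trans by blast
  let ?S = "strip {..<ln R}"
  let ?k = "\<lambda>u. of_real ((cmod (exp u))\<^sup>2) * kern p q (p + exp u)"
  define d where "d = q - p"
  have d: "d \<noteq> 0" using pq by (simp add: d_def)
  have S: "?S \<in> sets borel" by (rule strip_borel) simp
  have im: "(\<lambda>u. p + exp u) ` ?S \<in> sets borel"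
    using punctured_ball_strip[OF R0] by simp
  have int: "set_integrable lborel ((\<lambda>u. p + exp u) ` ?S) (kern p q)"
    unfolding punctured_ball_strip[OF R0]
    by (subst set_integrable_puncture) (use set_integrable_kern_ball[OF pq R0] in auto)
  note cv = complex_change_of_variables[OF S exp_strip_deriv _ inj_on_exp_strip im kern_measurable, of p q]
  have keq: "?k u = cnj (exp u * inverse (exp u - d))" for u
  proof -
    have "of_real ((cmod (exp u))\<^sup>2) = exp u * cnj (exp u)" by (simp add: complex_norm_square[symmetric] flip: of_real_power)
    moreover have "exp u * cnj (exp u) * (inverse (exp u) * cnj (inverse (exp u - d))) = cnj (exp u * inverse (exp u - d)) * (exp u * inverse (exp u))"
      by (simp only: complex_cnj_mult mult_ac)
    moreover have "p + exp u - p = exp u" "p + exp u - q = exp u - d" by (simp_all add: d_def)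
    moreover have "exp u * inverse (exp u) = 1" by simp
    ultimately show ?thesis by (simp only: kern_def mult_1_right)
  qed
  have "(LINT w:ball p R|lborel. kern p q w) = (LINT w:(\<lambda>u. p + exp u) ` ?S|lborel. kern p q w)"
    unfolding punctured_ball_strip[OF R0] set_integral_puncture ..
  also have "\<dots> = (LINT u:?S|lborel. ?k u)"
    by (rule cv(2)[OF _ int]) (auto intro!: continuous_intros)
  also have "\<dots> = (LINT x:{..<ln R}|lborel. (LINT y:{-pi<..pi}|lborel. ?k (Complex x y)))"
    by (rule strip_fubini(1)) (use int cv(1) continuous_on_exp[OF continuous_on_id, of ?S] in simp_all)
  also have "\<dots> = (LINT x:{ln (norm d)..<ln R}|lborel. complex_of_real (2 * pi))"
    unfolding set_lebesgue_integral_def[of _ "{..<ln R}"] set_lebesgue_integral_def[of _ "{ln (norm d)..<ln R}"]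
  proof (rule integral_discrete_difference[where X="{ln (norm d)}"])
    fix x assume "x \<notin> {ln (norm d)}"
    then show "indicat_real {..<ln R} x *\<^sub>R (LINT y:{-pi<..pi}|lborel. ?k (Complex x y))
        = indicat_real {ln (norm d)..<ln R} x *\<^sub>R complex_of_real (2 * pi)"
      unfolding keq using kern_circle_integral[OF d, of x] by (simp add: indicator_def)
  qed auto
  also have "\<dots> = 2 * pi * (ln R - ln (norm (q - p)))"
  proof -
    have "ln (norm d) < ln R" using R R0 d ln_less_cancel_iff[of "norm d" R] by (simp add: d_def)
    then show ?thesis by (simp add: set_lebesgue_integral_def d_def scaleR_conv_of_real mult_ac)
  qed
  finally show ?thesis by simp
qed

text \<open>The part of \<open>A\<close> outside the inner disk lies in an annulus of area
  \<open>4 * pi * R * C\<close>, on which the kernel is at most \<open>2 / (R - C)^2\<close>; the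
  second condition on \<open>R\<close> keeps \<open>q\<close> far from this annulus.\<close>

lemma kern_far_integral_bound:
  assumes pq: "p \<noteq> q" and C: "C > 0" and R: "R > C" "R - C > 2 * norm (q - p)"
    and A: "A \<in> sets borel" "ball p (R - C) \<subseteq> A" "A \<subseteq> ball p (R + C)"
  shows "norm ((LINT w:A|lborel. kern p q w) - 2 * pi * (ln (R - C) - ln (norm (q - p)))) \<le> 8 * pi * R * C / (R - C)\<^sup>2"
proof -
  let ?B = "ball p (R - C)" and ?B' = "ball p (R + C)"
  have i': "set_integrable lborel ?B' (kern p q)"
    by (rule set_integrable_kern_ball) (use pq C R in auto)
  have iA: "set_integrable lborel (A - ?B) (kern p q)" "set_integrable lborel ?B (kern p q)"
    by (rule set_integrable_subset[OF i']; use A R C in auto)+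
  have "(LINT w:A|lborel. kern p q w) = (LINT w:?B \<union> (A - ?B)|lborel. kern p q w)"
    using A(2) by (simp add: Un_absorb1)
  also have "\<dots> = (LINT w:?B|lborel. kern p q w) + (LINT w:A - ?B|lborel. kern p q w)"
    by (rule set_integral_Un) (use iA in auto)
  also have "(LINT w:?B|lborel. kern p q w) = 2 * pi * (ln (R - C) - ln (norm (q - p)))"
    by (rule kern_ball_integral[OF pq]) (use R norm_ge_zero[of "q-p"] in linarith)
  finally have eq: "(LINT w:A|lborel. kern p q w) - 2 * pi * (ln (R - C) - ln (norm (q - p))) = (LINT w:A - ?B|lborel. kern p q w)"
    by simp
  have f: "emeasure lborel (?B' - ?B) < \<infinity>"
    by (rule emeasure_bounded_finite) (rule bounded_subset[OF bounded_ball], auto)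
  have bd: "norm (kern p q w) \<le> 2 / (R - C)\<^sup>2" if "w \<notin> ?B" for w
  proof -
    have 1: "norm (w - p) \<ge> R - C" using that by (simp add: dist_norm norm_minus_commute)
    have "norm (w - q) \<ge> norm (w - p) - norm (q - p)"
    proof -
      have "w - q = (w - p) - (q - p)" by simp
      then show ?thesis using norm_triangle_ineq2[of "w - p" "q - p"] by metis
    qed
    then have 2: "norm (w - q) \<ge> (R - C) / 2" using 1 R(2) by (simp add: field_simps)
    have "(R - C) * ((R - C)/2) \<le> norm (w - p) * norm (w - q)"
      using 1 2 R by (intro mult_mono) auto
    moreover have "(R - C) * ((R - C)/2) > 0" using R by simp
    moreover have "norm (kern p q w) = 1 / (norm (w - p) * norm (w - q))"
      by (simp add: norm_kern field_simps)
    ultimately have "norm (kern p q w) \<le> 1 / ((R - C) * ((R - C)/2))"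
      by (metis frac_le order_refl zero_le_one)
    then show ?thesis by (simp add: power2_eq_square)
  qed
  have "norm (LINT w:A - ?B|lborel. kern p q w) \<le> (LINT w:?B' - ?B|lborel. 2 / (R - C)\<^sup>2)"
    unfolding set_lebesgue_integral_def
  proof (rule order_trans[OF integral_norm_bound integral_mono])
    show "integrable lborel (\<lambda>x. norm (indicat_real (A - ?B) x *\<^sub>R kern p q x))"
      using iA(1) unfolding set_integrable_def by (rule integrable_norm)
    show "integrable lborel (\<lambda>x. indicat_real (?B' - ?B) x *\<^sub>R (2 / (R - C)\<^sup>2))"
      using f by (auto intro!: integrable_scaleR_left)
    show "norm (indicat_real (A - ?B) x *\<^sub>R kern p q x) \<le> indicat_real (?B' - ?B) x *\<^sub>R (2 / (R - C)\<^sup>2)" for x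
      using bd[of x] A(3) by (auto simp: indicator_def)
  qed
  also have "\<dots> = measure lborel (?B' - ?B) * (2 / (R - C)\<^sup>2)"
    by (simp add: set_lebesgue_integral_def)
  also have "measure lborel (?B' - ?B) = pi * (R + C)\<^sup>2 - pi * (R - C)\<^sup>2"
  proof -
    have c: "measure lborel (ball p r) = pi * r\<^sup>2" if "r \<ge> 0" for r
      using content_ball[OF that, of p] by (simp add: unit_ball_vol_2)
    have "measure lborel (?B' - ?B) = measure lborel ?B' - measure lborel ?B"
      by (rule measure_Diff) (use C emeasure_bounded_finite[OF bounded_ball, of p "R+C"] in \<open>auto simp: less_top\<close>)
    then show ?thesis using c R C by simp
  qed
  also have "\<dots> * (2 / (R - C)\<^sup>2) = 8 * pi * R * C / (R - C)\<^sup>2"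
    by (simp add: power2_eq_square algebra_simps diff_divide_distrib add_divide_distrib)
  finally show ?thesis unfolding eq .
qed

section \<open>Logarithmic coefficients\<close>

lemma has_fps_expansion_taylor:
  assumes "f has_fps_expansion F"
  shows "taylor_coeff f n = fps_nth F n"
  using fps_nth_fps_expansion[OF assms, of n] by (simp add: taylor_coeff_def)

lemma holomorphic_fps_expansion:
  assumes "f holomorphic_on ball 0 r" "r > 0"
  shows "f has_fps_expansion Abs_fps (taylor_coeff f)"
proof -
  have "f has_fps_expansion fps_expansion f 0"
    by (rule has_fps_expansion_fps_expansion[of "ball 0 r"]) (use assms in auto)
  moreover have "fps_expansion f 0 = Abs_fps (taylor_coeff f)"
    by (simp add: fps_expansion_def taylor_coeff_def[abs_def])
  ultimately show ?thesis by simp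
qed

lemma taylor_sums:
  assumes "f holomorphic_on ball 0 r" "norm z < r"
  shows "(\<lambda>n. taylor_coeff f n * z ^ n) sums f z"
  using holomorphic_power_series[of f 0 r z] assms by (simp add: taylor_coeff_def)

lemma taylor_summable_norm:
  assumes "f holomorphic_on ball 0 r" "norm z < r"
  shows "summable (\<lambda>n. norm (taylor_coeff f n * z ^ n))"
proof -
  obtain t where t: "norm z < t" "t < r" using assms dense by blast
  then have "0 < t" using norm_ge_zero order_le_less_trans by blast
  have "summable (\<lambda>n. taylor_coeff f n * of_real t ^ n)"
    using taylor_sums[OF assms(1), of "of_real t"] t \<open>0 < t\<close> by (auto simp: sums_iff)
  then show ?thesis by (rule powser_insidea) (use t \<open>0 < t\<close> in auto)
qed

lemma taylor_coeff_unique: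
  assumes r: "r > 0" and s: "\<And>z. norm z < r \<Longrightarrow> (\<lambda>n. c n * z ^ n) sums f z"
  shows "taylor_coeff f n = c n"
proof -
  have "fps_conv_radius (Abs_fps c) \<ge> r"
    unfolding fps_conv_radius_def
  proof (rule conv_radius_geI_ex)
    fix t :: real assume t: "0 < t" "ereal t < ereal r"
    then have "summable (\<lambda>n. c n * of_real t ^ n)"
      using s[of "of_real t"] by (simp add: sums_iff)
    then show "\<exists>z. norm z = t \<and> summable (\<lambda>n. fps_nth (Abs_fps c) n * z ^ n)"
      using t by (intro exI[of _ "of_real t"]) simp
  qed
  moreover have "eventually (\<lambda>z. eval_fps (Abs_fps c) z = f z) (nhds 0)"
    unfolding eventually_nhds_metric
  proof (intro exI[of _ r] conjI allI impI r)
    fix z :: complex assume "dist z 0 < r"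
    then show "eval_fps (Abs_fps c) z = f z"
      using s[of z] by (simp add: eval_fps_def sums_iff)
  qed
  ultimately have "f has_fps_expansion Abs_fps c"
  proof -
    have "0 < ereal r" using r by simp
    then have "0 < fps_conv_radius (Abs_fps c)"
      using \<open>fps_conv_radius (Abs_fps c) \<ge> r\<close> by (rule less_le_trans)
    then show ?thesis
      using \<open>eventually (\<lambda>z. eval_fps (Abs_fps c) z = f z) (nhds 0)\<close> unfolding has_fps_expansion_def by blast
  qed
  from has_fps_expansion_taylor[OF this] show ?thesis by simp
qed

lemma taylor_coeff_0: "taylor_coeff f 0 = f 0"
  by (simp add: taylor_coeff_def)

lemma taylor_coeff_1: "taylor_coeff f (Suc 0) = deriv f 0"
  by (simp add: taylor_coeff_def)

lemma taylor_sums_mult_deriv: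
  assumes f: "f holomorphic_on ball 0 r" and z: "norm z < r"
  shows "(\<lambda>n. of_nat n * taylor_coeff f n * z ^ n) sums (z * deriv f z)"
proof -
  have r: "r > 0" using z norm_ge_zero order_le_less_trans by blast
  have d: "deriv f holomorphic_on ball 0 r" using f by (intro holomorphic_deriv) auto
  have "taylor_coeff (deriv f) n = of_nat (Suc n) * taylor_coeff f (Suc n)" for n
    using has_fps_expansion_taylor[OF has_fps_expansion_deriv[OF holomorphic_fps_expansion[OF f r]]] by simp
  then have "(\<lambda>n. z * (of_nat (Suc n) * taylor_coeff f (Suc n) * z ^ n)) sums (z * deriv f z)"
    using sums_mult[OF taylor_sums[OF d z], of z] by simp
  then have "(\<lambda>n. of_nat (Suc n) * taylor_coeff f (Suc n) * z ^ Suc n) sums (z * deriv f z)"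
    by (simp add: mult_ac)
  then show ?thesis by (subst (asm) sums_Suc_iff) simp
qed

text \<open>For \<open>d 0 = 1\<close> these are the coefficients of the logarithm of the series
  with coefficients \<open>d\<close>, from D' = L' D solved for the leading unknown. Each depends
  polynomially on finitely many values of \<open>d\<close>, so it inherits coefficientwise
  limits.\<close>

fun log_coeff :: "(nat \<Rightarrow> complex) \<Rightarrow> nat \<Rightarrow> complex" where
  "log_coeff d n = (if n = 0 then 0 else d n - (\<Sum>j\<in>{1..<n}. of_nat j * log_coeff d j * d (n - j)) / of_nat n)"

declare log_coeff.simps [simp del]

lemma log_coeff_unique:
  assumes d: "d 0 = 1" and rec: "\<And>n. n \<ge> 1 \<Longrightarrow> of_nat n * d n = (\<Sum>j\<in>{1..n}. of_nat j * L j * d (n - j))"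
  shows "n \<ge> 1 \<Longrightarrow> L n = log_coeff d n"
proof (induction n rule: less_induct)
  case (less n)
  have "{1..n} = insert n {1..<n}" using less.prems by auto
  then have "of_nat n * d n = of_nat n * L n + (\<Sum>j\<in>{1..<n}. of_nat j * L j * d (n - j))"
    using rec[OF less.prems] d by simp
  also have "(\<Sum>j\<in>{1..<n}. of_nat j * L j * d (n - j)) = (\<Sum>j\<in>{1..<n}. of_nat j * log_coeff d j * d (n - j))"
    using less.IH by (intro sum.cong) auto
  finally show ?case using less.prems by (subst log_coeff.simps) (simp add: field_simps)
qed

lemma log_coeff_tendsto:
  assumes "\<And>k. ((\<lambda>i. d i k) \<longlongrightarrow> d' k) F"
  shows "((\<lambda>i. log_coeff (d i) n) \<longlongrightarrow> log_coeff d' n) F"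
proof (induction n rule: less_induct)
  case (less n)
  show ?case
  proof (cases "n = 0")
    case False
    have "((\<lambda>i. d i n - (\<Sum>j\<in>{1..<n}. of_nat j * log_coeff (d i) j * d i (n - j)) / of_nat n) \<longlongrightarrow>
       d' n - (\<Sum>j\<in>{1..<n}. of_nat j * log_coeff d' j * d' (n - j)) / of_nat n) F"
      using False by (intro tendsto_intros assms less.IH) auto
    then show ?thesis using False by (simp add: log_coeff.simps[of _ n])
  qed (simp add: log_coeff.simps)
qed

text \<open>The equation D' = L' D is compared coefficientwise as an identity of formal power
  series. The radius is arbitrary because only germs at 0 matter, so logarithms that exist merely on
  a small disk are covered.\<close>

lemma log_coeff_exp:
  assumes L: "L holomorphic_on ball 0 r" and r: "r > 0" and D: "\<And>z. z \<in> ball 0 r \<Longrightarrow> D z = exp (L z)"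
    and L0: "L 0 = 0"
  shows "n \<ge> 1 \<Longrightarrow> taylor_coeff L n = log_coeff (taylor_coeff D) n"
proof (rule log_coeff_unique[of _ "taylor_coeff L"])
  have hD: "D holomorphic_on ball 0 r"
    by (rule holomorphic_transform[of "\<lambda>z. exp (L z)"]) (use D L in \<open>auto intro!: holomorphic_intros\<close>)
  show "taylor_coeff D 0 = 1" using D[of 0] r L0 by (simp add: taylor_coeff_0)
  note fL = holomorphic_fps_expansion[OF L r] and fD = holomorphic_fps_expansion[OF hD r]
  have "deriv D z = deriv L z * D z" if "z \<in> ball 0 r" for z
  proof -
    have "((\<lambda>z. exp (L z)) has_field_derivative exp (L z) * deriv L z) (at z)"
      using holomorphic_derivI[OF L _ that] by (auto intro!: derivative_eq_intros)
    then have "(D has_field_derivative exp (L z) * deriv L z) (at z)"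
      by (rule has_field_derivative_transform_within_open[OF _ open_ball that]) (use D in auto)
    then show ?thesis using D[OF that] by (simp add: DERIV_imp_deriv)
  qed
  then have ev: "eventually (\<lambda>z. deriv L z * D z = deriv D z) (nhds 0)"
    using r by (intro eventually_nhds_in_open[THEN eventually_mono, of "ball 0 r"]) auto
  have "(\<lambda>z. deriv L z * D z) has_fps_expansion fps_deriv (Abs_fps (taylor_coeff L)) * Abs_fps (taylor_coeff D)"
    by (intro has_fps_expansion_mult has_fps_expansion_deriv fL fD)
  then have "deriv D has_fps_expansion fps_deriv (Abs_fps (taylor_coeff L)) * Abs_fps (taylor_coeff D)"
    using has_fps_expansion_cong[OF ev refl] by blast
  from fps_expansion_unique_complex[OF this has_fps_expansion_deriv[OF fD]]
  have eq: "fps_deriv (Abs_fps (taylor_coeff L)) * Abs_fps (taylor_coeff D) = fps_deriv (Abs_fps (taylor_coeff D))" .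
  fix n :: nat assume "n \<ge> 1"
  then obtain m where m: "n = Suc m" by (cases n) auto
  have "fps_nth (fps_deriv (Abs_fps (taylor_coeff D))) m = fps_nth (fps_deriv (Abs_fps (taylor_coeff L)) * Abs_fps (taylor_coeff D)) m"
    using eq by simp
  then have "of_nat n * taylor_coeff D n = (\<Sum>i=0..m. of_nat (Suc i) * taylor_coeff L (Suc i) * taylor_coeff D (m - i))"
    by (simp add: fps_mult_nth m)
  also have "\<dots> = (\<Sum>j=Suc 0..Suc m. of_nat j * taylor_coeff L j * taylor_coeff D (n - j))"
    by (simp only: sum.shift_bounds_cl_Suc_ivl) (simp add: m)
  finally show "of_nat n * taylor_coeff D n = (\<Sum>j\<in>{1..n}. of_nat j * taylor_coeff L j * taylor_coeff D (n - j))"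
    by (simp add: m)
qed

text \<open>These are the coefficients of \<open>log (1 - z / a)\<close>; in the recursion only the
  last two summands survive, and they cancel.\<close>

lemma log_geometric_coeff:
  assumes "a \<noteq> 0" "n \<ge> 1"
  shows "log_coeff (\<lambda>k. if k = 0 then 1 else if k = 1 then - inverse a else 0) n = - (inverse a ^ n / of_nat n)"
proof -
  have "- (inverse a ^ n / of_nat n) = log_coeff (\<lambda>k. if k = 0 then 1 else if k = 1 then - inverse a else 0) n"
  proof (rule log_coeff_unique[of _ "\<lambda>n. - (inverse a ^ n / of_nat n)", OF _ _ assms(2)])
    fix n :: nat assume n: "n \<ge> 1"
    let ?d = "\<lambda>k. if k = 0 then 1 else if k = 1 then - inverse a else 0 :: complex"
    show "of_nat n * ?d n = (\<Sum>j\<in>{1..n}. of_nat j * (- (inverse a ^ j / of_nat j)) * ?d (n - j))"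
    proof (cases "n = 1")
      case False
      have "(\<Sum>j\<in>{1..n}. of_nat j * (- (inverse a ^ j / of_nat j)) * ?d (n - j))
          = (\<Sum>j\<in>{n-1,n}. of_nat j * (- (inverse a ^ j / of_nat j)) * ?d (n - j))"
        by (rule sum.mono_neutral_right) (use n False in auto)
      also have "\<dots> = inverse a ^ (n-1) * inverse a - inverse a ^ n"
        using n False by (subst sum.insert) auto
      also have "\<dots> = 0" using n by (metis diff_self power_minus_mult zero_less_one order_less_le_trans)
      finally show ?thesis using n False by simp
    qed simp
  qed simp
  then show ?thesis by simp
qed

section \<open>Logarithms attached to a schlicht function\<close>

text \<open>The branch of \<open>log (f z / z)\<close> that vanishes at 0; its coefficients are
  twice the usual logarithmic coefficients of \<open>f\<close>.\<close>

definition log_ratio :: "(complex \<Rightarrow> complex) \<Rightarrow> complex \<Rightarrow> complex" where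
  "log_ratio f = (SOME L. L holomorphic_on ball 0 1 \<and> L 0 = 0 \<and> (\<forall>z\<in>ball 0 1. f z = z * exp (L z)))"

text \<open>Since \<open>exp (- log_ratio f z)\<close> is \<open>z / f z\<close>, this is the logarithm of
  \<open>(z / f z) * (1 - f z / f a) / (1 - z / a)\<close>.\<close>

definition log_kernel :: "(complex \<Rightarrow> complex) \<Rightarrow> complex \<Rightarrow> complex \<Rightarrow> complex" where
  "log_kernel f a = (SOME P. P holomorphic_on ball 0 1 \<and> P 0 = 0 \<and>
     (\<forall>z\<in>ball 0 1. exp (- log_ratio f z) - z * inverse (f a) = (1 - z / a) * exp (P z)))"

lemma holomorphic_log_ball:
  assumes h: "T holomorphic_on ball 0 r" and nz: "\<And>z. z \<in> ball 0 r \<Longrightarrow> T z \<noteq> 0" and T0: "T 0 = 1" and r: "r > 0"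
  obtains L where "L holomorphic_on ball 0 r" "L 0 = 0" "\<And>z. z \<in> ball 0 r \<Longrightarrow> T z = exp (L z)"
proof -
  obtain g where g: "g holomorphic_on ball 0 r" "\<And>z. z \<in> ball 0 r \<Longrightarrow> T z = exp (g z)"
    using contractible_imp_holomorphic_log[OF h convex_imp_contractible[OF convex_ball] nz] by metis
  have "exp (g 0) = 1" using g(2)[of 0] T0 r by simp
  then show ?thesis
    by (intro that[of "\<lambda>z. g z - g 0"]) (use g in \<open>auto intro!: holomorphic_intros simp: exp_diff\<close>)
qed

locale schlicht_fun =
  fixes f :: "complex \<Rightarrow> complex"
  assumes schlicht: "schlicht f"
begin

lemma f_hol: "f holomorphic_on ball 0 1" and f_inj: "inj_on f (ball 0 1)"
  and f_0: "f 0 = 0" and f_deriv_0: "deriv f 0 = 1"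
  using schlicht by (auto simp: schlicht_def)

lemma f_eq_0_iff: "norm z < 1 \<Longrightarrow> f z = 0 \<longleftrightarrow> z = 0"
  using inj_onD[OF f_inj, of z 0] f_0 by auto

lemma f_deriv_nonzero: "norm z < 1 \<Longrightarrow> deriv f z \<noteq> 0"
  using holomorphic_injective_imp_regular[OF f_hol open_ball f_inj] by simp

lemma f_field_deriv: "norm z < 1 \<Longrightarrow> (f has_field_derivative deriv f z) (at z)"
  using holomorphic_derivI[OF f_hol open_ball, of z] by simp

lemma log_ratio_props:
  "log_ratio f holomorphic_on ball 0 1 \<and> log_ratio f 0 = 0 \<and> (\<forall>z\<in>ball 0 1. f z = z * exp (log_ratio f z))"
proof -
  define T where "T = (\<lambda>z. if z = 0 then deriv f 0 else (f z - f 0) / (z - 0))"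
  have "T holomorphic_on ball 0 1"
    unfolding T_def by (rule pole_lemma_open[OF f_hol open_ball])
  moreover have "T z \<noteq> 0" if "z \<in> ball 0 1" for z
    using that f_eq_0_iff[of z] by (auto simp: T_def f_deriv_0 f_0)
  moreover have "T 0 = 1" by (simp add: T_def f_deriv_0)
  ultimately obtain L where L: "L holomorphic_on ball 0 1" "L 0 = 0" "\<And>z. z \<in> ball 0 1 \<Longrightarrow> T z = exp (L z)"
    using holomorphic_log_ball[of T 1] by (metis zero_less_one)
  have "f z = z * exp (L z)" if "z \<in> ball 0 1" for z
    using L(3)[OF that, symmetric] by (simp add: T_def f_0)
  then have "\<exists>L. L holomorphic_on ball 0 1 \<and> L 0 = 0 \<and> (\<forall>z\<in>ball 0 1. f z = z * exp (L z))"
    using L by blast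
  from someI_ex[OF this] show ?thesis unfolding log_ratio_def .
qed

lemma log_ratio_hol: "log_ratio f holomorphic_on ball 0 1"
  and log_ratio_0: "log_ratio f 0 = 0"
  and log_ratio_exp: "norm z < 1 \<Longrightarrow> f z = z * exp (log_ratio f z)"
  using log_ratio_props by auto

lemma inverse_f: "norm z < 1 \<Longrightarrow> inverse (f z) = exp (- log_ratio f z) / z"
  using log_ratio_exp[of z] by (simp add: exp_minus field_simps)

lemma log_ratio_field_deriv:
  "norm z < 1 \<Longrightarrow> (log_ratio f has_field_derivative deriv (log_ratio f) z) (at z)"
  using holomorphic_derivI[OF log_ratio_hol open_ball, of z] by simp

lemma deriv_f_log_ratio:
  assumes "norm z < 1"
  shows "deriv f z = exp (log_ratio f z) * (1 + z * deriv (log_ratio f) z)"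
proof -
  have "((\<lambda>z. z * exp (log_ratio f z)) has_field_derivative exp (log_ratio f z) * (1 + z * deriv (log_ratio f) z)) (at z)"
    using log_ratio_field_deriv[OF assms] by (auto intro!: derivative_eq_intros simp: algebra_simps)
  then have "(f has_field_derivative exp (log_ratio f z) * (1 + z * deriv (log_ratio f) z)) (at z)"
    by (rule has_field_derivative_transform_within_open[of _ _ _ "ball 0 1"]) (use assms log_ratio_exp in auto)
  then show ?thesis by (rule DERIV_imp_deriv)
qed

lemma log_kernel_numerator_deriv:
  assumes "norm z < 1"
  shows "((\<lambda>z. exp (- log_ratio f z) - z * w) has_field_derivative
     - deriv (log_ratio f) z * exp (- log_ratio f z) - w) (at z)"
  using log_ratio_field_deriv[OF assms] by (auto intro!: derivative_eq_intros simp: algebra_simps)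

lemma log_kernel_numerator_deriv_at:
  assumes a: "norm a < 1" "a \<noteq> 0"
  shows "- deriv (log_ratio f) a * exp (- log_ratio f a) - inverse (f a) = - (a * deriv f a / (f a)\<^sup>2)"
  unfolding deriv_f_log_ratio[OF a(1)] log_ratio_exp[OF a(1)] using a
  by (simp add: exp_minus field_simps power2_eq_square)

text \<open>By univalence \<open>z / f z - z / f a\<close> has a single zero in the disk, a simple
  one at \<open>a\<close>. Division by \<open>1 - z / a\<close> removes it, and the quotient has a
  logarithm because the disk is simply connected.\<close>

lemma log_kernel_props:
  assumes a: "norm a < 1" "a \<noteq> 0"
  shows "log_kernel f a holomorphic_on ball 0 1 \<and> log_kernel f a 0 = 0 \<and>
     (\<forall>z\<in>ball 0 1. exp (- log_ratio f z) - z * inverse (f a) = (1 - z / a) * exp (log_kernel f a z))"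
proof -
  define N where "N = (\<lambda>z. exp (- log_ratio f z) - z * inverse (f a))"
  have Nh: "N holomorphic_on ball 0 1"
    unfolding N_def by (intro holomorphic_intros log_ratio_hol)
  have Na: "N a = 0" using a inverse_f[of a] by (simp add: N_def)
  have Nd: "deriv N a = - (a * deriv f a / (f a)\<^sup>2)"
    unfolding N_def using DERIV_imp_deriv[OF log_kernel_numerator_deriv[OF a(1)]] log_kernel_numerator_deriv_at[OF a] by simp
  \<comment> \<open>The factor \<open>- a\<close> turns division by \<open>z - a\<close> into
    division by \<open>1 - z / a\<close>, which preserves the value 1 at 0.\<close>
  define T where "T = (\<lambda>z. - a * (if z = a then deriv N a else (N z - N a) / (z - a)))"
  have Th: "T holomorphic_on ball 0 1"
    unfolding T_def by (intro holomorphic_intros pole_lemma_open[OF Nh open_ball])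
  have TN: "N z = (1 - z / a) * T z" for z
    using a Na by (auto simp: T_def field_simps)
  have T0: "T z \<noteq> 0" if "z \<in> ball 0 1" for z
  proof (cases "z = a")
    case True
    then show ?thesis using a f_deriv_nonzero[of a] f_eq_0_iff[of a] by (simp add: T_def Nd)
  next
    case False
    show ?thesis
    proof
      assume "T z = 0"
      then have Nz: "N z = 0" by (simp add: TN)
      show False
      proof (cases "z = 0")
        case True
        then show False using Nz by (simp add: N_def log_ratio_0)
      next
        case z: False
        have "inverse (f z) = inverse (f a)"
          using Nz z that inverse_f[of z] by (simp add: N_def field_simps)
        then have "f z = f a" by simp
        then show False using inj_onD[OF f_inj, of z a] that a False by auto
      qed
    qed
  qed
  have "T 0 = 1" using TN[of 0] by (simp add: N_def log_ratio_0)
  from holomorphic_log_ball[OF Th T0 this zero_less_one]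
  obtain P where "P holomorphic_on ball 0 1" "P 0 = 0" "\<And>z. z \<in> ball 0 1 \<Longrightarrow> T z = exp (P z)" by blast
  then have "\<exists>P. P holomorphic_on ball 0 1 \<and> P 0 = 0 \<and>
     (\<forall>z\<in>ball 0 1. exp (- log_ratio f z) - z * inverse (f a) = (1 - z / a) * exp (P z))"
    using TN unfolding N_def by (intro exI[of _ P]) simp
  from someI_ex[OF this] show ?thesis unfolding log_kernel_def .
qed

lemma log_kernel_hol: "norm a < 1 \<Longrightarrow> a \<noteq> 0 \<Longrightarrow> log_kernel f a holomorphic_on ball 0 1"
  and log_kernel_0: "norm a < 1 \<Longrightarrow> a \<noteq> 0 \<Longrightarrow> log_kernel f a 0 = 0"
  and log_kernel_exp: "norm a < 1 \<Longrightarrow> a \<noteq> 0 \<Longrightarrow> norm z < 1 \<Longrightarrow>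
      exp (- log_ratio f z) - z * inverse (f a) = (1 - z / a) * exp (log_kernel f a z)"
  using log_kernel_props by auto

lemma log_kernel_field_deriv:
  "norm a < 1 \<Longrightarrow> a \<noteq> 0 \<Longrightarrow> norm z < 1 \<Longrightarrow> (log_kernel f a has_field_derivative deriv (log_kernel f a) z) (at z)"
  using holomorphic_derivI[OF log_kernel_hol open_ball, of a z] by simp

text \<open>The right-hand side is symmetric in \<open>a\<close> and \<open>b\<close>, although the
  kernel function is normalised only at 0. Through this formula kernel values become statements
  about \<open>f\<close>.\<close>

lemma Re_log_kernel:
  assumes a: "norm a < 1" "a \<noteq> 0" and b: "norm b < 1" "b \<noteq> 0" and ab: "a \<noteq> b"
  shows "Re (log_kernel f a b) = ln (norm (inverse (f b) - inverse (f a)) * norm a * norm b / norm (a - b))"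
proof -
  have "inverse (f b) - inverse (f a) = (exp (- log_ratio f b) - b * inverse (f a)) / b"
    using b inverse_f[of b] by (simp add: field_simps)
  also have "\<dots> = (1 - b / a) * exp (log_kernel f a b) / b"
    using log_kernel_exp[OF a b(1)] by simp
  finally have "norm (inverse (f b) - inverse (f a)) = norm (1 - b / a) * exp (Re (log_kernel f a b)) / norm b"
    by (simp add: norm_mult norm_divide)
  moreover have "norm (1 - b / a) = norm (a - b) / norm a"
    using a by (simp add: field_simps flip: norm_divide)
  ultimately have "norm (inverse (f b) - inverse (f a)) * norm a * norm b / norm (a - b) = exp (Re (log_kernel f a b))"
    using a b ab by simp
  then show ?thesis by (simp only: ln_exp)
qed

text \<open>The limit of the preceding formula as \<open>b\<close> tends to \<open>a\<close>,
  obtained by differentiating the factorisation of the numerator at its zero.\<close>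

lemma Re_log_kernel_diag:
  assumes a: "norm a < 1" "a \<noteq> 0"
  shows "Re (log_kernel f a a) = ln (norm (deriv f a) * (norm a)\<^sup>2 / (norm (f a))\<^sup>2)"
proof -
  have "((\<lambda>z. (1 - z / a) * exp (log_kernel f a z)) has_field_derivative - (1/a) * exp (log_kernel f a a)) (at a)"
    using log_kernel_field_deriv[OF a a(1)] a by (auto intro!: derivative_eq_intros)
  then have "((\<lambda>z. exp (- log_ratio f z) - z * inverse (f a)) has_field_derivative - (1/a) * exp (log_kernel f a a)) (at a)"
    by (rule has_field_derivative_transform_within_open[of _ _ _ "ball 0 1"]) (use a log_kernel_exp in auto)
  from DERIV_unique[OF this log_kernel_numerator_deriv[OF a(1)]]
  have "(1/a) * exp (log_kernel f a a) = a * deriv f a / (f a)\<^sup>2"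
    unfolding log_kernel_numerator_deriv_at[OF a] by simp
  then have "exp (log_kernel f a a) = a\<^sup>2 * deriv f a / (f a)\<^sup>2"
    using a by (simp add: field_simps power2_eq_square)
  then have "norm (exp (log_kernel f a a)) = norm (deriv f a) * (norm a)\<^sup>2 / (norm (f a))\<^sup>2"
    by (simp add: norm_mult norm_divide norm_power mult.commute)
  then have "exp (Re (log_kernel f a a)) = norm (deriv f a) * (norm a)\<^sup>2 / (norm (f a))\<^sup>2" by simp
  then show ?thesis by (metis ln_exp)
qed

lemma inverse_f_deriv:
  assumes "norm z < 1" "z \<noteq> 0"
  shows "((\<lambda>z. inverse (f z)) has_field_derivative deriv (\<lambda>z. inverse (f z)) z) (at z)"
proof -
  have "(\<lambda>z. inverse (f z)) holomorphic_on ball 0 1 - {0}"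
    by (intro holomorphic_intros holomorphic_on_subset[OF f_hol]) (use f_eq_0_iff in auto)
  from holomorphic_derivI[OF this, of z] assms show ?thesis by (auto intro: open_delete)
qed

text \<open>After the substitution \<open>w = 1 / f z\<close> this is the factor of the integrand
  belonging to the pole \<open>1 / f a\<close>; its singularity at \<open>z = a\<close> is split off
  as a geometric term.\<close>

lemma inverse_f_log_deriv:
  assumes a: "norm a < 1" "a \<noteq> 0" and z: "norm z < 1" "z \<noteq> 0" "z \<noteq> a"
  shows "z * deriv (\<lambda>z. inverse (f z)) z * inverse (inverse (f z) - inverse (f a))
      = z * deriv (log_kernel f a) z - 1 / (1 - z / a)"
proof -
  define H where "H = (\<lambda>z. (1 - z / a) * exp (log_kernel f a z) / z)"
  have Heq: "inverse (f u) - inverse (f a) = H u" if "norm u < 1" "u \<noteq> 0" for u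
    unfolding H_def log_kernel_exp[OF a that(1), symmetric] using that inverse_f[of u] by (simp add: field_simps)
  have az: "1 - z / a \<noteq> 0" using z a by (auto simp: field_simps)
  have "((\<lambda>u. inverse (f u) - inverse (f a)) has_field_derivative deriv (\<lambda>z. inverse (f z)) z) (at z)"
    using DERIV_diff[OF inverse_f_deriv[OF z(1,2)] DERIV_const] by simp
  then have 1: "(H has_field_derivative deriv (\<lambda>z. inverse (f z)) z) (at z)"
    by (rule has_field_derivative_transform_within_open[of _ _ _ "ball 0 1 - {0}"]) (use z Heq in \<open>auto intro: open_delete\<close>)
  have 2: "(H has_field_derivative
      ((- (1 / a) * exp (log_kernel f a z) + (1 - z / a) * (exp (log_kernel f a z) * deriv (log_kernel f a) z)) * z
       - (1 - z / a) * exp (log_kernel f a z)) / z\<^sup>2) (at z)"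
    unfolding H_def using log_kernel_field_deriv[OF a z(1)] z a
    by (auto intro!: derivative_eq_intros simp: power2_eq_square)
  define E where "E = exp (log_kernel f a z)"
  define B where "B = 1 - z / a"
  have E: "E \<noteq> 0" by (simp add: E_def)
  have B: "B \<noteq> 0" using az by (simp add: B_def)
  have za: "z / a = 1 - B" by (simp add: B_def)
  have "z * deriv (\<lambda>z. inverse (f z)) z = ((- (1 / a) * E + B * (E * deriv (log_kernel f a) z)) * z - B * E) / z"
    using DERIV_unique[OF 1 2] z by (simp add: E_def B_def power2_eq_square)
  also have "\<dots> = (B * E * deriv (log_kernel f a) z * z - (z / a) * E - B * E) / z"
    by (simp add: algebra_simps)
  also have "\<dots> = (B * E * deriv (log_kernel f a) z * z - E) / z"
    unfolding za by (simp add: algebra_simps)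
  finally have 3: "z * deriv (\<lambda>z. inverse (f z)) z = (B * E * deriv (log_kernel f a) z * z - E) / z" .
  have "inverse (f z) - inverse (f a) = B * E / z" using Heq[OF z(1,2)] by (simp add: H_def E_def B_def)
  then show ?thesis
    unfolding 3 B_def[symmetric] using E B z by (simp add: field_simps)
qed

text \<open>Coefficients of \<open>z / f z - w * z\<close>. A free \<open>w\<close> makes the value
  0 available, which is the limit of \<open>1 / f a\<close> when \<open>f a\<close> tends to
  infinity.\<close>

definition inv_coeff :: "complex \<Rightarrow> nat \<Rightarrow> complex" where
  "inv_coeff w k = taylor_coeff (\<lambda>z. exp (- log_ratio f z)) k - (if k = 1 then w else 0)"

lemma taylor_coeff_numerator: "taylor_coeff (\<lambda>z. exp (- log_ratio f z) - z * w) k = inv_coeff w k"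
proof (rule taylor_coeff_unique[OF zero_less_one])
  fix z :: complex assume z: "norm z < 1"
  have "(\<lambda>z. exp (- log_ratio f z)) holomorphic_on ball 0 1"
    by (intro holomorphic_intros log_ratio_hol)
  from taylor_sums[OF this z]
  have "(\<lambda>n. taylor_coeff (\<lambda>z. exp (- log_ratio f z)) n * z ^ n - (if n = 1 then w * z ^ n else 0)) sums (exp (- log_ratio f z) - w * z ^ 1)"
    by (intro sums_diff sums_single)
  moreover have "(\<lambda>n. taylor_coeff (\<lambda>z. exp (- log_ratio f z)) n * z ^ n - (if n = 1 then w * z ^ n else 0))
      = (\<lambda>n. inv_coeff w n * z ^ n)"
    by (auto simp: inv_coeff_def algebra_simps)
  ultimately show "(\<lambda>n. inv_coeff w n * z ^ n) sums (exp (- log_ratio f z) - z * w)"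
    by (simp add: mult.commute)
qed

text \<open>This isolates the dependence on \<open>a\<close>: an explicit power and a universal
  expression in finitely many coefficients and \<open>1 / f a\<close>. In this form the coefficients
  have limits as \<open>a\<close> approaches the unit circle.\<close>

lemma taylor_coeff_log_kernel:
  assumes a: "norm a < 1" "a \<noteq> 0" and n: "n \<ge> 1"
  shows "taylor_coeff (log_kernel f a) n = inverse a ^ n / of_nat n + log_coeff (inv_coeff (inverse (f a))) n"
proof -
  \<comment> \<open>The principal logarithm of \<open>1 - z / a\<close> is used only for |z| < |a|,
    which suffices to determine coefficients.\<close>
  let ?r = "norm a" and ?g = "\<lambda>z. Ln (1 - z / a)"
  have r: "?r > 0" using a by simp
  have sub: "ball 0 ?r \<subseteq> (ball 0 1 :: complex set)" using a by auto
  have Re: "Re (1 - z / a) > 0" if "z \<in> ball 0 ?r" for z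
  proof -
    have "norm (z / a) < 1" using that a by (simp add: norm_divide)
    then have "Re (z / a) < 1" using complex_Re_le_cmod[of "z/a"] by linarith
    then show ?thesis by simp
  qed
  have g: "?g holomorphic_on ball 0 ?r"
    by (intro holomorphic_intros) (use a Re in \<open>auto simp: complex_nonpos_Reals_iff, fastforce\<close>)
  have eg: "exp (?g z) = 1 - z / a" if "z \<in> ball 0 ?r" for z
    using Re[OF that] by (intro exp_Ln) auto
  have P: "log_kernel f a holomorphic_on ball 0 ?r" using log_kernel_hol[OF a] sub holomorphic_on_subset by blast
  have s: "(\<lambda>z. log_kernel f a z + ?g z) holomorphic_on ball 0 ?r"
    by (intro holomorphic_intros P g)
  have "taylor_coeff (\<lambda>z. log_kernel f a z + ?g z) n = log_coeff (taylor_coeff (\<lambda>z. exp (- log_ratio f z) - z * inverse (f a))) n"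
  proof (rule log_coeff_exp[OF s r _ _ n])
    fix z :: complex assume z: "z \<in> ball 0 ?r"
    then show "exp (- log_ratio f z) - z * inverse (f a) = exp (log_kernel f a z + ?g z)"
      using sub log_kernel_exp[OF a, of z] eg[OF z] by (auto simp: exp_add mult.commute)
  qed (simp add: log_kernel_0[OF a])
  moreover have "taylor_coeff (\<lambda>z. log_kernel f a z + ?g z) n = taylor_coeff (log_kernel f a) n + taylor_coeff ?g n"
    using has_fps_expansion_taylor[OF has_fps_expansion_add[OF holomorphic_fps_expansion[OF P r] holomorphic_fps_expansion[OF g r]]] by simp
  moreover have "taylor_coeff ?g n = - (inverse a ^ n / of_nat n)"
  proof -
    have d: "taylor_coeff (\<lambda>z. 1 - z / a) k = (if k = 0 then 1 else if k = 1 then - inverse a else 0)" for k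
    proof (rule taylor_coeff_unique[OF zero_less_one])
      fix z :: complex
      have "(\<lambda>n. (if n = 0 then 1 else 0) - (if n = 1 then inverse a * z ^ n else 0)) sums (1 - inverse a * z ^ 1)"
        by (intro sums_diff sums_single[of 0 "\<lambda>_. 1"] sums_single)
      moreover have "(\<lambda>n. (if n = 0 then 1 else 0) - (if n = 1 then inverse a * z ^ n else 0))
          = (\<lambda>n. (if n = 0 then 1 else if n = 1 then - inverse a else 0) * z ^ n)"
        by auto
      ultimately show "(\<lambda>n. (if n = 0 then 1 else if n = 1 then - inverse a else 0) * z ^ n) sums (1 - z / a)"
        by (simp add: divide_inverse mult.commute)
    qed
    have "taylor_coeff ?g n = log_coeff (taylor_coeff (\<lambda>z. 1 - z / a)) n"
      by (rule log_coeff_exp[OF g r _ _ n]) (use eg in auto)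
    also have "taylor_coeff (\<lambda>z. 1 - z / a) = (\<lambda>k. if k = 0 then 1 else if k = 1 then - inverse a else 0)"
      using d by blast
    finally show ?thesis using log_geometric_coeff[OF a(2) n] by simp
  qed
  moreover have "taylor_coeff (\<lambda>z. exp (- log_ratio f z) - z * inverse (f a)) = inv_coeff (inverse (f a))"
    using taylor_coeff_numerator by blast
  ultimately show ?thesis by (simp add: algebra_simps)
qed

lemma log_coeff_inv_coeff_0:
  assumes "n \<ge> 1"
  shows "log_coeff (inv_coeff 0) n = - taylor_coeff (log_ratio f) n"
proof -
  have h: "(\<lambda>z. - log_ratio f z) holomorphic_on ball 0 1" by (intro holomorphic_intros log_ratio_hol)
  have "inv_coeff 0 = taylor_coeff (\<lambda>z. exp (- log_ratio f z))"
    by (auto simp: inv_coeff_def)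
  moreover have "taylor_coeff (\<lambda>z. - log_ratio f z) n = log_coeff (taylor_coeff (\<lambda>z. exp (- log_ratio f z))) n"
    by (rule log_coeff_exp[OF h zero_less_one _ _ assms]) (auto simp: log_ratio_0)
  moreover have "taylor_coeff (\<lambda>z. - log_ratio f z) n = - taylor_coeff (log_ratio f) n"
    using has_fps_expansion_taylor[OF has_fps_expansion_minus[OF holomorphic_fps_expansion[OF log_ratio_hol zero_less_one]]] by simp
  ultimately show ?thesis by simp
qed

lemma taylor_coeff_log_ratio:
  assumes "n \<ge> 1"
  shows "taylor_coeff (log_ratio f) n = log_coeff (\<lambda>k. taylor_coeff f (Suc k)) n"
proof -
  have h: "(\<lambda>z. exp (log_ratio f z)) holomorphic_on ball 0 1" by (intro holomorphic_intros log_ratio_hol)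
  have "taylor_coeff f k = (if k = 0 then 0 else taylor_coeff (\<lambda>z. exp (log_ratio f z)) (k - 1))" for k
  proof (rule taylor_coeff_unique[OF zero_less_one])
    fix z :: complex assume z: "norm z < 1"
    have "(\<lambda>n. z * (taylor_coeff (\<lambda>z. exp (log_ratio f z)) n * z ^ n)) sums (z * exp (log_ratio f z))"
      by (intro sums_mult taylor_sums[OF h z])
    then have "(\<lambda>n. (if Suc n = 0 then 0 else taylor_coeff (\<lambda>z. exp (log_ratio f z)) (Suc n - 1)) * z ^ Suc n) sums f z"
      using log_ratio_exp[OF z] by (simp add: mult_ac)
    then show "(\<lambda>n. (if n = 0 then 0 else taylor_coeff (\<lambda>z. exp (log_ratio f z)) (n - 1)) * z ^ n) sums f z"
      by (subst (asm) sums_Suc_iff) simp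
  qed
  then have "(\<lambda>k. taylor_coeff f (Suc k)) = taylor_coeff (\<lambda>z. exp (log_ratio f z))"
    by auto
  moreover have "taylor_coeff (log_ratio f) n = log_coeff (taylor_coeff (\<lambda>z. exp (log_ratio f z))) n"
    by (rule log_coeff_exp[OF log_ratio_hol zero_less_one _ _ assms]) (auto simp: log_ratio_0)
  ultimately show ?thesis by simp
qed

section \<open>Parseval's identity for the kernel derivative\<close>

abbreviation ker_coeff :: "complex \<Rightarrow> nat \<Rightarrow> complex" where
  "ker_coeff a \<equiv> taylor_coeff (log_kernel f a)"

text \<open>This is \<open>z\<close> times the logarithmic derivative of \<open>1 / f z - 1 / f a\<close>.\<close>

definition ker_diff :: "complex \<Rightarrow> complex \<Rightarrow> complex" where
  "ker_diff a z = z * deriv (log_kernel f a) z - 1 / (1 - z / a)"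

text \<open>At \<open>\<zeta> = s^2\<close> this is the weighted inner product of two coefficient
  sequences. A complex variable is kept because circle integrals carry one more factor n and are
  recognised as \<open>\<zeta>\<close> times the derivative.\<close>

definition pairing :: "complex \<Rightarrow> complex \<Rightarrow> complex \<Rightarrow> complex" where
  "pairing a b \<zeta> = (\<Sum>n. of_nat n * ker_coeff a n * cnj (ker_coeff b n) * \<zeta> ^ n)"

lemma ker_coeff_summable:
  assumes a: "norm a < 1" "a \<noteq> 0" and t: "0 \<le> t" "t < 1"
  shows "summable (\<lambda>n. norm (of_nat n * ker_coeff a n * of_real t ^ n))"
proof -
  have d: "deriv (log_kernel f a) holomorphic_on ball 0 1"
    using log_kernel_hol[OF a] by (intro holomorphic_deriv) auto
  have eq: "taylor_coeff (deriv (log_kernel f a)) n = of_nat (Suc n) * ker_coeff a (Suc n)" for n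
    using has_fps_expansion_taylor[OF has_fps_expansion_deriv[OF holomorphic_fps_expansion[OF log_kernel_hol[OF a] zero_less_one]]] by simp
  have "summable (\<lambda>n. norm (taylor_coeff (deriv (log_kernel f a)) n * of_real t ^ n))"
    by (rule taylor_summable_norm[OF d]) (use t in simp)
  then have "summable (\<lambda>n. norm (taylor_coeff (deriv (log_kernel f a)) n * of_real t ^ n) * norm t)"
    by (rule summable_mult2)
  then have "summable (\<lambda>n. norm (of_nat (Suc n) * ker_coeff a (Suc n) * of_real t ^ Suc n))"
    by (simp only: eq norm_mult[symmetric] norm_of_real[symmetric, where 'a=complex] power_Suc2 mult.assoc real_norm_def abs_of_nonneg[OF t(1)])
  then show ?thesis by (subst (asm) summable_Suc_iff)
qed

text \<open>Inside the circle through \<open>a\<close> the geometric term expands in nonnegative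
  powers. Outside it, in the next lemma, it expands in negative powers only, since it vanishes at
  infinity.\<close>

lemma ker_diff_small:
  assumes a: "norm a < 1" "a \<noteq> 0" and t: "0 \<le> t" "t < norm a"
  defines "p \<equiv> \<lambda>n. (of_nat n * ker_coeff a n - inverse a ^ n) * of_real t ^ n"
  shows "ker_diff a (of_real t * cis y) = (\<Sum>n. p n * cis y ^ n)" "summable (\<lambda>n. norm (p n))"
proof -
  define z where "z = of_real t * cis y"
  have nz: "norm z = t" using t by (simp add: z_def norm_mult)
  have za: "norm (z / a) < 1" using t a nz by (simp add: norm_divide)
  have "(\<lambda>n. of_nat n * ker_coeff a n * z ^ n - (z / a) ^ n) sums (z * deriv (log_kernel f a) z - 1 / (1 - z / a))"
    by (intro sums_diff taylor_sums_mult_deriv[OF log_kernel_hol[OF a]] geometric_sums za) (use nz t a in linarith)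
  moreover have "of_nat n * ker_coeff a n * z ^ n - (z / a) ^ n = p n * cis y ^ n" for n
    by (simp add: p_def z_def power_mult_distrib power_divide field_simps power_inverse)
  ultimately have "(\<lambda>n. p n * cis y ^ n) sums ker_diff a z" by (simp add: ker_diff_def)
  then show "ker_diff a (of_real t * cis y) = (\<Sum>n. p n * cis y ^ n)"
    by (simp add: z_def sums_iff)
  have "summable (\<lambda>n. norm (of_nat n * ker_coeff a n * of_real t ^ n) + (t / norm a) ^ n)"
    by (intro summable_add ker_coeff_summable a t summable_geometric) (use t a in \<open>auto simp: abs_of_nonneg\<close>)
  moreover have "norm (p n) \<le> norm (of_nat n * ker_coeff a n * of_real t ^ n) + (t / norm a) ^ n" for n
  proof -
    have "p n = of_nat n * ker_coeff a n * of_real t ^ n - (of_real t / a) ^ n"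
      by (simp add: p_def power_divide field_simps power_inverse)
    moreover have "norm ((of_real t / a) ^ n) = (t / norm a) ^ n"
      using t by (simp add: norm_power norm_divide)
    ultimately show ?thesis using norm_triangle_ineq4 by metis
  qed
  ultimately show "summable (\<lambda>n. norm (p n))"
    by (intro summable_comparison_test'[of _ 0 "\<lambda>n. norm (p n)"]) auto
qed

lemma ker_diff_large:
  assumes a: "norm a < 1" "a \<noteq> 0" and t: "norm a < t" "t < 1"
  defines "p \<equiv> \<lambda>n. of_nat n * ker_coeff a n * of_real t ^ n"
    and "v \<equiv> \<lambda>n. if n = 0 then 0 else (a / of_real t) ^ n"
  shows "ker_diff a (of_real t * cis y) = (\<Sum>n. p n * cis y ^ n) + (\<Sum>n. v n * cis (-y) ^ n)"
    "summable (\<lambda>n. norm (p n))" "summable (\<lambda>n. norm (v n))"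
proof -
  have t0: "0 < t" using t norm_ge_zero order_le_less_trans by blast
  define z where "z = of_real t * cis y"
  have nz: "norm z = t" using t0 by (simp add: z_def norm_mult)
  have z0: "z \<noteq> 0" using nz t0 by auto
  have za: "norm (a / z) < 1" using t t0 nz by (simp add: norm_divide)
  have 1: "(\<lambda>n. p n * cis y ^ n) sums (z * deriv (log_kernel f a) z)"
    using taylor_sums_mult_deriv[OF log_kernel_hol[OF a], of z] nz t
    by (simp add: p_def z_def power_mult_distrib mult_ac)
  have "(\<lambda>n. (a / z) * (a / z) ^ n) sums ((a / z) * (1 / (1 - a / z)))"
    by (intro sums_mult geometric_sums za)
  moreover have "(a / z) * (a / z) ^ n = v (Suc n) * cis (-y) ^ Suc n" for n
  proof -
    have "a / z = a / of_real t * cis (-y)"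
      by (simp add: z_def cis_inverse[symmetric] field_simps)
    then have "(a / z) ^ Suc n = (a / of_real t) ^ Suc n * cis (-y) ^ Suc n"
      by (simp only: power_mult_distrib)
    then show ?thesis by (simp add: v_def)
  qed
  ultimately have "(\<lambda>n. v (Suc n) * cis (-y) ^ Suc n) sums ((a / z) * (1 / (1 - a / z)))" by simp
  then have 2: "(\<lambda>n. v n * cis (-y) ^ n) sums ((a / z) * (1 / (1 - a / z)))"
    by (subst (asm) sums_Suc_iff) (simp add: v_def)
  have ne: "1 - a / z \<noteq> 0" using za by auto
  then have "a \<noteq> z" using z0 by auto
  then have "(a / z) * (1 / (1 - a / z)) = - (1 / (1 - z / a))"
    using z0 a by (simp add: divide_simps) (simp add: algebra_simps)
  then show "ker_diff a (of_real t * cis y) = (\<Sum>n. p n * cis y ^ n) + (\<Sum>n. v n * cis (-y) ^ n)"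
    using 1 2 by (simp add: ker_diff_def z_def[symmetric] sums_iff)
  show "summable (\<lambda>n. norm (p n))" unfolding p_def by (rule ker_coeff_summable) (use a t t0 in auto)
  show "summable (\<lambda>n. norm (v n))"
    by (rule summable_comparison_test'[OF summable_geometric[of "norm (a / of_real t)"], of 0])
      (use t t0 in \<open>auto simp: v_def norm_power norm_divide\<close>)
qed

lemma pairing_summable:
  assumes a: "norm a < 1" "a \<noteq> 0" and b: "norm b < 1" "b \<noteq> 0" and z: "norm \<zeta> < 1"
  shows "summable (\<lambda>n. norm (of_nat n * ker_coeff a n * cnj (ker_coeff b n) * \<zeta> ^ n))"
    "summable (\<lambda>n. norm (of_nat n * (of_nat n * ker_coeff a n * cnj (ker_coeff b n)) * \<zeta> ^ n))"
proof -
  \<comment> \<open>Half of the decay of \<open>\<zeta> ^ n\<close> is given to each of the two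
    coefficient sequences.\<close>
  define t where "t = sqrt (norm \<zeta>)"
  have t: "0 \<le> t" "t < 1" "t\<^sup>2 = norm \<zeta>" using z by (auto simp: t_def)
  let ?A = "\<lambda>n. norm (of_nat n * ker_coeff a n * of_real t ^ n)"
  let ?B = "\<lambda>n. norm (of_nat n * ker_coeff b n * of_real t ^ n)"
  have "?B \<longlonglongrightarrow> 0" by (rule summable_LIMSEQ_zero[OF ker_coeff_summable[OF b t(1,2)]])
  then have "Bseq ?B" by (rule convergent_imp_Bseq[OF convergentI])
  then obtain M where M: "\<And>n. ?B n \<le> M" by (auto simp: Bseq_def)
  have sA: "summable (\<lambda>n. ?A n * M)" by (rule summable_mult2[OF ker_coeff_summable[OF a t(1,2)]])
  have tn: "norm (\<zeta> ^ n) = t ^ n * t ^ n" for n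
    using t(3) by (simp add: norm_power power_mult_distrib[symmetric] power2_eq_square)
  have bd: "norm (of_nat n * (of_nat n * ker_coeff a n * cnj (ker_coeff b n)) * \<zeta> ^ n) \<le> ?A n * M" for n
  proof -
    have "norm (of_nat n * (of_nat n * ker_coeff a n * cnj (ker_coeff b n)) * \<zeta> ^ n) = ?A n * ?B n"
    proof -
      have "norm (complex_of_real t ^ n) = t ^ n" using t(1) by (simp add: norm_power)
      then show ?thesis by (simp only: norm_mult tn complex_mod_cnj) (simp add: mult_ac)
    qed
    then show ?thesis using M[of n] by (simp add: mult_left_mono)
  qed
  show s: "summable (\<lambda>n. norm (of_nat n * (of_nat n * ker_coeff a n * cnj (ker_coeff b n)) * \<zeta> ^ n))"
    by (rule summable_comparison_test'[OF sA, of 0]) (use bd in simp)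
  have "norm (of_nat n * ker_coeff a n * cnj (ker_coeff b n) * \<zeta> ^ n) \<le> norm (of_nat n * (of_nat n * ker_coeff a n * cnj (ker_coeff b n)) * \<zeta> ^ n)" for n
  proof (cases n)
    case (Suc m)
    have "1 * norm (of_nat n * ker_coeff a n * cnj (ker_coeff b n) * \<zeta> ^ n) \<le> real n * norm (of_nat n * ker_coeff a n * cnj (ker_coeff b n) * \<zeta> ^ n)"
      by (rule mult_right_mono) (auto simp: Suc)
    then show ?thesis by (simp add: norm_mult mult_ac)
  qed simp
  then show "summable (\<lambda>n. norm (of_nat n * ker_coeff a n * cnj (ker_coeff b n) * \<zeta> ^ n))"
    by (intro summable_comparison_test'[OF s, of 0]) simp
qed

lemma pairing_deriv:
  assumes a: "norm a < 1" "a \<noteq> 0" and b: "norm b < 1" "b \<noteq> 0" and z: "norm \<zeta> < 1"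
  shows "(pairing a b has_field_derivative deriv (pairing a b) \<zeta>) (at \<zeta>)"
    "(\<lambda>n. of_nat n * (of_nat n * ker_coeff a n * cnj (ker_coeff b n)) * \<zeta> ^ n) sums (\<zeta> * deriv (pairing a b) \<zeta>)"
proof -
  let ?c = "\<lambda>n. of_nat n * ker_coeff a n * cnj (ker_coeff b n)"
  define P where "P = pairing a b"
  have s: "(\<lambda>n. ?c n * z ^ n) sums P z" if "norm z < 1" for z
    using summable_norm_cancel[OF pairing_summable(1)[OF a b that]] by (simp add: P_def pairing_def sums_iff)
  have h: "P holomorphic_on ball 0 1"
    by (rule power_series_holomorphic[of 0 1 ?c]) (use s in auto)
  have tc: "taylor_coeff P n = ?c n" for n
    by (rule taylor_coeff_unique[OF zero_less_one s])
  show "(pairing a b has_field_derivative deriv (pairing a b) \<zeta>) (at \<zeta>)"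
    using holomorphic_derivI[OF h open_ball, of \<zeta>] z by (simp add: P_def)
  show "(\<lambda>n. of_nat n * ?c n * \<zeta> ^ n) sums (\<zeta> * deriv (pairing a b) \<zeta>)"
    using taylor_sums_mult_deriv[OF h z] by (simp add: tc) (simp add: P_def)
qed

lemma pairing_0 [simp]: "pairing a b 0 = 0"
proof -
  have "of_nat n * ker_coeff a n * cnj (ker_coeff b n) * 0 ^ n = 0" for n by (cases n) auto
  then show ?thesis by (simp add: pairing_def)
qed

section \<open>Circle integrals in three ranges of radii and their primitives\<close>

definition circ :: "complex \<Rightarrow> complex \<Rightarrow> real \<Rightarrow> complex" where
  "circ a b x = (LINT y:{-pi<..pi}|lborel. ker_diff a (exp (Complex x y)) * cnj (ker_diff b (exp (Complex x y))))"

lemma exp_Complex: "exp (Complex x y) = of_real (exp x) * cis y"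
  by (simp add: exp_eq_polar)

text \<open>Here x is the logarithm of a radius and \<open>exp (2 * x)\<close> the squared radius.
  Circle integrals come as \<open>\<zeta>\<close> times a derivative in \<open>\<zeta>\<close>, that
  is, up to the factor 2, as derivatives in x.\<close>

lemma chain_exp2:
  fixes F :: "complex \<Rightarrow> complex" and c :: complex
  assumes "(F has_field_derivative D) (at (c * of_real (exp (2 * x))))"
  shows "((\<lambda>x. F (c * of_real (exp (2 * x)))) has_vector_derivative 2 * (c * of_real (exp (2 * x)) * D)) (at x)"
proof -
  have "((\<lambda>x. exp (2 * x)) has_real_derivative 2 * exp (2 * x)) (at x)"
    by (auto intro!: derivative_eq_intros)
  then have "((\<lambda>x. complex_of_real (exp (2 * x))) has_vector_derivative of_real (2 * exp (2 * x))) (at x)"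
    by (rule has_vector_derivative_of_real)
  then have "((\<lambda>x. c * complex_of_real (exp (2 * x))) has_vector_derivative c * of_real (2 * exp (2 * x))) (at x)"
    by (rule has_vector_derivative_mult_right)
  from field_vector_diff_chain_at[OF this assms]
  show ?thesis by (simp add: o_def mult_ac)
qed

lemma of_real_exp_double: "complex_of_real (exp x) ^ n * complex_of_real (exp x) ^ n = complex_of_real (exp (2 * x)) ^ n"
  by (simp add: power_mult_distrib[symmetric] exp_double power2_eq_square flip: of_real_mult)

text \<open>Below |a| both functions have only nonnegative powers. The product of the coefficients n
  A_n - 1 / a^n and their analogues for \<open>b\<close> gives four series: the pairing, the two
  kernels at reflected points, and a geometric one.\<close>

lemma circ_inner:
  assumes a: "norm a < 1" "a \<noteq> 0" and b: "norm b < 1" and ab: "norm a < norm b" and x: "exp x < norm a"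
  defines "\<zeta> \<equiv> complex_of_real (exp (2 * x))"
  shows "circ a b x = 2 * pi * (\<zeta> * deriv (pairing a b) \<zeta>
     - (inverse (cnj b) * \<zeta>) * deriv (log_kernel f a) (inverse (cnj b) * \<zeta>)
     - cnj ((inverse (cnj a) * \<zeta>) * deriv (log_kernel f b) (inverse (cnj a) * \<zeta>))
     + 1 / (1 - inverse (a * cnj b) * \<zeta>))"
proof -
  have b0: "b \<noteq> 0" using ab by auto
  have nz: "norm \<zeta> = exp x * exp x" by (simp add: \<zeta>_def exp_double power2_eq_square norm_mult)
  have xa: "exp x * exp x < norm a * norm a" using x by (intro mult_strict_mono) auto
  have z1: "norm (inverse (cnj b) * \<zeta>) < 1" "norm (inverse (cnj a) * \<zeta>) < 1" "norm (inverse (a * cnj b) * \<zeta>) < 1" "norm \<zeta> < 1"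
  proof -
    have aa: "norm a * norm a < norm a" using a by simp
    have aab: "norm a * norm a < norm a * norm b" using ab a by simp
    show "norm (inverse (cnj b) * \<zeta>) < 1"
      unfolding norm_mult norm_inverse complex_mod_cnj nz using xa aa ab b0 by (simp add: field_simps)
    show "norm (inverse (cnj a) * \<zeta>) < 1"
      unfolding norm_mult norm_inverse complex_mod_cnj nz using order.strict_trans[OF xa aa] a by (simp add: field_simps)
    show "norm (inverse (a * cnj b) * \<zeta>) < 1"
      unfolding norm_mult norm_inverse complex_mod_cnj nz using order.strict_trans[OF xa aab] a b0 by (simp add: field_simps)
    show "norm \<zeta> < 1" unfolding nz using xa aa a by linarith
  qed
  let ?p = "\<lambda>c n. (of_nat n * ker_coeff c n - inverse c ^ n) * of_real (exp x) ^ n"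
  have "circ a b x = (LINT y:{-pi<..pi}|lborel. ((\<Sum>n. ?p a n * cis y ^ n) + (\<Sum>n. 0 * cis (-y) ^ n)) *
      cnj ((\<Sum>n. ?p b n * cis y ^ n) + (\<Sum>n. 0 * cis (-y) ^ n)))"
    unfolding circ_def exp_Complex using ker_diff_small(1)[OF a _ x] ker_diff_small(1)[OF b b0, of "exp x"] x ab by simp
  also have "\<dots> = 2 * pi * ((\<Sum>n. ?p a n * cnj (?p b n)) + (\<Sum>n::nat. 0 * cnj 0))"
    by (rule circle_integral_laurent) (use ker_diff_small(2)[OF a _ x] ker_diff_small(2)[OF b b0, of "exp x"] x ab in auto)
  also have "(\<Sum>n. ?p a n * cnj (?p b n)) = \<zeta> * deriv (pairing a b) \<zeta>
     - (inverse (cnj b) * \<zeta>) * deriv (log_kernel f a) (inverse (cnj b) * \<zeta>)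
     - cnj ((inverse (cnj a) * \<zeta>) * deriv (log_kernel f b) (inverse (cnj a) * \<zeta>))
     + 1 / (1 - inverse (a * cnj b) * \<zeta>)"
  proof (rule sums_unique[symmetric])
    have "(\<lambda>n. of_nat n * (of_nat n * ker_coeff a n * cnj (ker_coeff b n)) * \<zeta> ^ n
       - of_nat n * ker_coeff a n * (inverse (cnj b) * \<zeta>) ^ n
       - cnj (of_nat n * ker_coeff b n * (inverse (cnj a) * \<zeta>) ^ n)
       + (inverse (a * cnj b) * \<zeta>) ^ n) sums (\<zeta> * deriv (pairing a b) \<zeta>
     - (inverse (cnj b) * \<zeta>) * deriv (log_kernel f a) (inverse (cnj b) * \<zeta>)
     - cnj ((inverse (cnj a) * \<zeta>) * deriv (log_kernel f b) (inverse (cnj a) * \<zeta>))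
     + 1 / (1 - inverse (a * cnj b) * \<zeta>))"
      by (intro sums_add sums_diff sums_cnj[THEN iffD2] geometric_sums z1 pairing_deriv a b b0 taylor_sums_mult_deriv[where r=1] log_kernel_hol)
    moreover have "of_nat n * (of_nat n * ker_coeff a n * cnj (ker_coeff b n)) * \<zeta> ^ n
       - of_nat n * ker_coeff a n * (inverse (cnj b) * \<zeta>) ^ n
       - cnj (of_nat n * ker_coeff b n * (inverse (cnj a) * \<zeta>) ^ n)
       + (inverse (a * cnj b) * \<zeta>) ^ n = ?p a n * cnj (?p b n)" for n
    proof -
      define T where "T = complex_of_real (exp x) ^ n"
      have T: "\<zeta> ^ n = T * T" "cnj T = T"
        by (simp_all add: T_def \<zeta>_def of_real_exp_double)
      have cz: "cnj \<zeta> = \<zeta>" by (simp add: \<zeta>_def)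
      show ?thesis
        unfolding power_mult_distrib complex_cnj_mult complex_cnj_diff complex_cnj_power complex_cnj_inverse complex_cnj_cnj
          complex_cnj_of_nat cz T(1) T_def[symmetric] inverse_mult_distrib complex_cnj_complex_of_real
        by (simp add: algebra_simps T(2))
    qed
    ultimately show "(\<lambda>n. ?p a n * cnj (?p b n)) sums (\<zeta> * deriv (pairing a b) \<zeta>
     - (inverse (cnj b) * \<zeta>) * deriv (log_kernel f a) (inverse (cnj b) * \<zeta>)
     - cnj ((inverse (cnj a) * \<zeta>) * deriv (log_kernel f b) (inverse (cnj a) * \<zeta>))
     + 1 / (1 - inverse (a * cnj b) * \<zeta>))" by simp
  qed
  finally show ?thesis by simp
qed

text \<open>Between the two radii only \<open>ker_diff a\<close> has negative powers, and these find
  no partner in \<open>ker_diff b\<close>.\<close>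

lemma circ_middle:
  assumes a: "norm a < 1" "a \<noteq> 0" and b: "norm b < 1" and ab: "norm a < norm b" and x: "norm a < exp x" "exp x < norm b"
  defines "\<zeta> \<equiv> complex_of_real (exp (2 * x))"
  shows "circ a b x = 2 * pi * (\<zeta> * deriv (pairing a b) \<zeta>
     - (inverse (cnj b) * \<zeta>) * deriv (log_kernel f a) (inverse (cnj b) * \<zeta>))"
proof -
  have b0: "b \<noteq> 0" using ab by auto
  have nz: "norm \<zeta> = exp x * exp x" by (simp add: \<zeta>_def exp_double power2_eq_square norm_mult)
  have xa: "exp x * exp x < norm b * norm b" using x by (intro mult_strict_mono) auto
  have z1: "norm (inverse (cnj b) * \<zeta>) < 1" "norm \<zeta> < 1"
  proof -
    have aa: "norm b * norm b < norm b" using b b0 by simp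
    show "norm (inverse (cnj b) * \<zeta>) < 1"
      unfolding norm_mult norm_inverse complex_mod_cnj nz using order.strict_trans[OF xa aa] b0 by (simp add: field_simps)
    show "norm \<zeta> < 1" unfolding nz using xa aa b by linarith
  qed
  let ?p = "\<lambda>n. of_nat n * ker_coeff a n * of_real (exp x) ^ n"
  let ?v = "\<lambda>n. if n = 0 then 0 else (a / of_real (exp x)) ^ n"
  let ?q = "\<lambda>n. (of_nat n * ker_coeff b n - inverse b ^ n) * of_real (exp x) ^ n"
  have x1: "exp x < 1" using x b by linarith
  have "circ a b x = (LINT y:{-pi<..pi}|lborel. ((\<Sum>n. ?p n * cis y ^ n) + (\<Sum>n. ?v n * cis (-y) ^ n)) *
      cnj ((\<Sum>n. ?q n * cis y ^ n) + (\<Sum>n. 0 * cis (-y) ^ n)))"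
    unfolding circ_def exp_Complex using ker_diff_large(1)[OF a x(1) x1] ker_diff_small(1)[OF b b0 _ x(2)] by simp
  also have "\<dots> = 2 * pi * ((\<Sum>n. ?p n * cnj (?q n)) + (\<Sum>n. ?v n * cnj 0))"
    by (rule circle_integral_laurent) (use ker_diff_large(2,3)[OF a x(1) x1] ker_diff_small(2)[OF b b0 _ x(2)] in auto)
  also have "(\<Sum>n. ?p n * cnj (?q n)) = \<zeta> * deriv (pairing a b) \<zeta>
     - (inverse (cnj b) * \<zeta>) * deriv (log_kernel f a) (inverse (cnj b) * \<zeta>)"
  proof (rule sums_unique[symmetric])
    have "(\<lambda>n. of_nat n * (of_nat n * ker_coeff a n * cnj (ker_coeff b n)) * \<zeta> ^ n
       - of_nat n * ker_coeff a n * (inverse (cnj b) * \<zeta>) ^ n) sums (\<zeta> * deriv (pairing a b) \<zeta>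
     - (inverse (cnj b) * \<zeta>) * deriv (log_kernel f a) (inverse (cnj b) * \<zeta>))"
      by (intro sums_diff z1 pairing_deriv a b b0 taylor_sums_mult_deriv[where r=1] log_kernel_hol)
    moreover have "of_nat n * (of_nat n * ker_coeff a n * cnj (ker_coeff b n)) * \<zeta> ^ n
       - of_nat n * ker_coeff a n * (inverse (cnj b) * \<zeta>) ^ n = ?p n * cnj (?q n)" for n
    proof -
      define T where "T = complex_of_real (exp x) ^ n"
      have T: "\<zeta> ^ n = T * T" "cnj T = T"
        by (simp_all add: T_def \<zeta>_def of_real_exp_double)
      show ?thesis
        unfolding power_mult_distrib complex_cnj_mult complex_cnj_diff complex_cnj_power complex_cnj_inverse complex_cnj_cnj
          complex_cnj_of_nat T(1) T_def[symmetric] complex_cnj_complex_of_real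
        by (simp add: algebra_simps T(2))
    qed
    ultimately show "(\<lambda>n. ?p n * cnj (?q n)) sums (\<zeta> * deriv (pairing a b) \<zeta>
     - (inverse (cnj b) * \<zeta>) * deriv (log_kernel f a) (inverse (cnj b) * \<zeta>))" by simp
  qed
  finally show ?thesis by simp
qed

text \<open>Beyond |b| both functions have negative powers, which pair to a geometric series in
  \<open>a * cnj b / \<zeta>\<close>.\<close>

lemma circ_outer:
  assumes a: "norm a < 1" "a \<noteq> 0" and b: "norm b < 1" and ab: "norm a < norm b" and x: "norm b < exp x" "exp x < 1"
  defines "\<zeta> \<equiv> complex_of_real (exp (2 * x))"
  shows "circ a b x = 2 * pi * (\<zeta> * deriv (pairing a b) \<zeta> + (a * cnj b / \<zeta>) / (1 - a * cnj b / \<zeta>))"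
proof -
  have b0: "b \<noteq> 0" using ab by auto
  have nz: "norm \<zeta> = exp x * exp x" by (simp add: \<zeta>_def exp_double power2_eq_square norm_mult)
  have xa: "norm b * norm b < exp x * exp x" using x by (intro mult_strict_mono) auto
  have z1: "norm \<zeta> < 1" unfolding nz using x(2) by (metis exp_gt_zero mult_less_cancel_left2 not_less order_less_trans)
  have z2: "norm (a * cnj b / \<zeta>) < 1"
  proof -
    have "norm a * norm b < norm b * norm b" using ab b0 by simp
    then show ?thesis unfolding norm_divide norm_mult complex_mod_cnj nz using xa by (simp add: divide_simps)
  qed
  let ?p = "\<lambda>c n. of_nat n * ker_coeff c n * of_real (exp x) ^ n"
  let ?v = "\<lambda>c n. if n = 0 then 0 else (c / of_real (exp x)) ^ n"
  have xa1: "norm a < exp x" using x ab by linarith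
  have "circ a b x = (LINT y:{-pi<..pi}|lborel. ((\<Sum>n. ?p a n * cis y ^ n) + (\<Sum>n. ?v a n * cis (-y) ^ n)) *
      cnj ((\<Sum>n. ?p b n * cis y ^ n) + (\<Sum>n. ?v b n * cis (-y) ^ n)))"
    unfolding circ_def exp_Complex using ker_diff_large(1)[OF a xa1 x(2)] ker_diff_large(1)[OF b b0 x] by simp
  also have "\<dots> = 2 * pi * ((\<Sum>n. ?p a n * cnj (?p b n)) + (\<Sum>n. ?v a n * cnj (?v b n)))"
    by (rule circle_integral_laurent) (use ker_diff_large(2,3)[OF a xa1 x(2)] ker_diff_large(2,3)[OF b b0 x] in auto)
  also have "(\<Sum>n. ?p a n * cnj (?p b n)) = \<zeta> * deriv (pairing a b) \<zeta>"
  proof (rule sums_unique[symmetric])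
    have "?p a n * cnj (?p b n) = of_nat n * (of_nat n * ker_coeff a n * cnj (ker_coeff b n)) * \<zeta> ^ n" for n
      by (simp add: \<zeta>_def of_real_exp_double[symmetric])
    then have fe: "(\<lambda>n. ?p a n * cnj (?p b n)) = (\<lambda>n. of_nat n * (of_nat n * ker_coeff a n * cnj (ker_coeff b n)) * \<zeta> ^ n)"
      by (rule ext)
    show "(\<lambda>n. ?p a n * cnj (?p b n)) sums (\<zeta> * deriv (pairing a b) \<zeta>)"
      unfolding fe by (rule pairing_deriv(2)[OF a b b0 z1])
  qed
  also have "(\<Sum>n. ?v a n * cnj (?v b n)) = (a * cnj b / \<zeta>) * (1 / (1 - a * cnj b / \<zeta>))"
  proof (rule sums_unique[symmetric])
    have "(\<lambda>n. (a * cnj b / \<zeta>) * (a * cnj b / \<zeta>) ^ n) sums ((a * cnj b / \<zeta>) * (1 / (1 - a * cnj b / \<zeta>)))"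
      by (intro sums_mult geometric_sums z2)
    moreover have "(a * cnj b / \<zeta>) * (a * cnj b / \<zeta>) ^ n = ?v a (Suc n) * cnj (?v b (Suc n))" for n
    proof -
      have "\<zeta> = complex_of_real (exp x) * complex_of_real (exp x)"
        using of_real_exp_double[of x 1] by (simp add: \<zeta>_def)
      then have "a * cnj b / \<zeta> = (a / complex_of_real (exp x)) * cnj (b / complex_of_real (exp x))"
        by simp
      then have "(a * cnj b / \<zeta>) ^ Suc n = (a / complex_of_real (exp x)) ^ Suc n * cnj ((b / complex_of_real (exp x)) ^ Suc n)"
        by (simp only: power_mult_distrib complex_cnj_power)
      then show ?thesis by simp
    qed
    ultimately have "(\<lambda>n. ?v a (Suc n) * cnj (?v b (Suc n))) sums ((a * cnj b / \<zeta>) * (1 / (1 - a * cnj b / \<zeta>)))" by simp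
    then show "(\<lambda>n. ?v a n * cnj (?v b n)) sums ((a * cnj b / \<zeta>) * (1 / (1 - a * cnj b / \<zeta>)))"
      by (subst (asm) sums_Suc_iff) simp
  qed
  finally show ?thesis by simp
qed

lemma Ln_one_minus_deriv:
  assumes "norm z < 1"
  shows "((\<lambda>z. Ln (1 - z)) has_field_derivative - (1 / (1 - z))) (at z)"
proof -
  have "Re z < 1" using complex_Re_le_cmod[of z] assms by linarith
  then have "1 - z \<notin> \<real>\<^sub>\<le>\<^sub>0" by (auto simp: complex_nonpos_Reals_iff)
  then show ?thesis by (auto intro!: derivative_eq_intros simp: divide_inverse)
qed

lemma Re_Ln_one_minus: "norm z < 1 \<Longrightarrow> Re (Ln (1 - z)) = ln (norm (1 - z))"
  by (subst Re_Ln) auto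

text \<open>The nonlinear part of a primitive, in \<open>ln t\<close>, of the circle integrals over radii \<open>t\<close> below \<open>norm a\<close>.\<close>

definition inner_rest :: "complex \<Rightarrow> complex \<Rightarrow> complex \<Rightarrow> complex" where
  "inner_rest a b \<zeta> = pairing a b \<zeta> - log_kernel f a (inverse (cnj b) * \<zeta>)
      - cnj (log_kernel f b (inverse (cnj a) * cnj \<zeta>)) - Ln (1 - inverse (a * cnj b) * \<zeta>)"

text \<open>Each range of radii has its own primitive. The mismatches at the radii |a| and |b| are
  the kernel values \<open>log_kernel f b a\<close> and \<open>log_kernel f a b\<close> together
  with logarithms; all terms in |b - a|, |a| and |b| cancel, and only the difference of the values
  of \<open>1 / f\<close> is left.\<close>

lemma circ_has_integral:
  assumes a: "norm a < 1" "a \<noteq> 0" and b: "norm b < 1" and ab: "norm a < norm b" and s: "norm b < s" "s < 1"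
    and t: "0 < t" "t < norm a"
  obtains I where "(circ a b has_integral I) {ln t..ln s}"
    "Re I = - 2 * pi * ln t - 2 * pi * ln (norm (inverse (f b) - inverse (f a)))
        + pi * Re (pairing a b (of_real (s\<^sup>2))) + pi * ln (norm (1 - a * cnj b / of_real (s\<^sup>2)))
        - pi * Re (inner_rest a b (of_real (t\<^sup>2)))"
proof -
  have b0: "b \<noteq> 0" using ab by auto
  have s0: "s > 0" using s b0 norm_ge_zero[of b] by linarith
  let ?z = "\<lambda>x. complex_of_real (exp (2 * x))"
  have e2: "exp (2 * x) = exp x * exp x" for x :: real by (simp add: exp_double power2_eq_square)
  have nz: "norm (?z x) = exp x * exp x" for x by (simp add: e2 norm_mult)
  define PP where "PP = (\<lambda>x. pairing a b (1 * ?z x))"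
  define LA where "LA = (\<lambda>x. log_kernel f a (inverse (cnj b) * ?z x))"
  define LB where "LB = (\<lambda>x. log_kernel f b (inverse (cnj a) * ?z x))"
  define LI where "LI = (\<lambda>x. Ln (1 - inverse (a * cnj b) * ?z x))"
  define LO where "LO = (\<lambda>x. Ln (1 - a * cnj b * complex_of_real (exp (2 * (- x)))))"
  have small: "exp x * exp x \<le> r * r" if "exp x \<le> r" for x r :: real
  proof -
    have "0 \<le> r" using that exp_ge_zero order_trans by blast
    then show ?thesis using that by (intro mult_mono) auto
  qed
  have dP: "(PP has_vector_derivative 2 * (?z x * deriv (pairing a b) (?z x))) (at x)" if "exp x < 1" for x
  proof -
    have "norm (1 * ?z x) < 1" unfolding mult_1 nz using that mult_strict_mono[of "exp x" 1 "exp x" 1] by simp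
    from chain_exp2[OF pairing_deriv(1)[OF a b b0 this]] show ?thesis unfolding PP_def by simp
  qed
  have zb: "norm (inverse (cnj b) * ?z x) < 1" if "exp x \<le> norm b" for x
  proof -
    have "norm b * norm b < norm b" using b b0 by simp
    from order.strict_trans1[OF small[OF that] this] show ?thesis unfolding norm_mult norm_inverse complex_mod_cnj nz[unfolded norm_mult]
      using b0 nz[of x] by (simp add: field_simps norm_mult)
  qed
  have za: "norm (inverse (cnj a) * ?z x) < 1" if "exp x \<le> norm a" for x
  proof -
    have "norm a * norm a < norm a" using a by simp
    from order.strict_trans1[OF small[OF that] this] show ?thesis unfolding norm_mult norm_inverse complex_mod_cnj
      using a nz[of x] by (simp add: field_simps norm_mult)
  qed
  have zab: "norm (inverse (a * cnj b) * ?z x) < 1" if "exp x \<le> norm a" for x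
  proof -
    have "norm a * norm a < norm a * norm b" using a ab by simp
    from order.strict_trans1[OF small[OF that] this] show ?thesis unfolding norm_mult norm_inverse complex_mod_cnj
      using a b0 nz[of x] by (simp add: field_simps norm_mult)
  qed
  have zo: "norm (a * cnj b * complex_of_real (exp (2 * (- x)))) < 1" if "norm b \<le> exp x" for x
  proof -
    have "norm a * norm b < norm b * norm b" using b0 ab by simp
    also have "\<dots> \<le> exp x * exp x" using that by (intro mult_mono) auto
    finally have lt: "norm a * norm b < exp x * exp x" .
    have "norm (complex_of_real (exp (2 * (- x)))) = exp (2 * (- x))"
      unfolding norm_of_real by simp
    also have "\<dots> = 1 / (exp x * exp x)"
      using e2[of "-x"] by (simp add: exp_minus field_simps)
    finally show ?thesis
      using lt unfolding norm_mult complex_mod_cnj by (simp only:) (simp add: field_simps)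
  qed
  have dLA: "(LA has_vector_derivative 2 * ((inverse (cnj b) * ?z x) * deriv (log_kernel f a) (inverse (cnj b) * ?z x))) (at x)"
    if "exp x \<le> norm b" for x
    unfolding LA_def by (rule chain_exp2) (rule log_kernel_field_deriv[OF a zb[OF that]])
  have dLB: "(LB has_vector_derivative 2 * ((inverse (cnj a) * ?z x) * deriv (log_kernel f b) (inverse (cnj a) * ?z x))) (at x)"
    if "exp x \<le> norm a" for x
    unfolding LB_def by (rule chain_exp2) (rule log_kernel_field_deriv[OF b b0 za[OF that]])
  have dLI: "(LI has_vector_derivative 2 * ((inverse (a * cnj b) * ?z x) * - (1 / (1 - inverse (a * cnj b) * ?z x)))) (at x)"
    if "exp x \<le> norm a" for x
    unfolding LI_def by (rule chain_exp2) (rule Ln_one_minus_deriv[OF zab[OF that]])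
  have dLO: "(LO has_vector_derivative 2 * ((a * cnj b / ?z x) / (1 - a * cnj b / ?z x))) (at x)"
    if "norm b \<le> exp x" for x
  proof -
    let ?F = "\<lambda>x. Ln (1 - a * cnj b * complex_of_real (exp (2 * x)))"
    have "((\<lambda>x::real. - x) has_vector_derivative - 1) (at x)"
      by (auto intro!: derivative_eq_intros simp: has_real_derivative_iff_has_vector_derivative[symmetric])
    moreover have "(?F has_vector_derivative 2 * (a * cnj b * of_real (exp (2 * (- x))) * - (1 / (1 - a * cnj b * of_real (exp (2 * (- x))))))) (at (- x))"
      by (rule chain_exp2) (rule Ln_one_minus_deriv[OF zo[OF that]])
    ultimately have "(?F \<circ> (\<lambda>x. - x) has_vector_derivative (- 1) *\<^sub>R (2 * (a * cnj b * of_real (exp (2 * (- x))) * - (1 / (1 - a * cnj b * of_real (exp (2 * (- x)))))))) (at x)"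
      by (rule vector_diff_chain_at)
    moreover have "complex_of_real (exp (2 * (- x))) = 1 / ?z x" by (simp add: exp_minus field_simps)
    ultimately show ?thesis unfolding LO_def o_def by simp
  qed
  define J1 where "J1 = (\<lambda>x. 2 * pi * complex_of_real x + pi * (PP x - LA x - cnj (LB x) - LI x))"
  define J2 where "J2 = (\<lambda>x. pi * (PP x - LA x))"
  define J3 where "J3 = (\<lambda>x. pi * (PP x + LO x))"
  have lin: "((\<lambda>x. 2 * pi * complex_of_real x) has_vector_derivative 2 * pi) (at x)" for x
  proof -
    have "((\<lambda>x. complex_of_real x) has_vector_derivative of_real 1) (at x)"
      by (rule has_vector_derivative_of_real) (rule DERIV_ident)
    from has_vector_derivative_mult_right[OF this, of "2 * pi"] show ?thesis by simp
  qed
  have d1: "(J1 has_vector_derivative 2 * pi * (?z x * deriv (pairing a b) (?z x)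
     - (inverse (cnj b) * ?z x) * deriv (log_kernel f a) (inverse (cnj b) * ?z x)
     - cnj ((inverse (cnj a) * ?z x) * deriv (log_kernel f b) (inverse (cnj a) * ?z x))
     + 1 / (1 - inverse (a * cnj b) * ?z x))) (at x)" if "exp x \<le> norm a" for x
  proof -
    have xb: "exp x \<le> norm b" and x1: "exp x < 1" using that ab a by linarith+
    have ne: "1 - inverse (a * cnj b) * ?z x \<noteq> 0" using zab[OF that] by auto
    define u where "u = inverse (a * cnj b) * ?z x"
    have u: "1 - (u * - (1 / (1 - u))) = 1 / (1 - u)" 
    proof -
      have "1 - u \<noteq> 0" using ne unfolding u_def .
      then show ?thesis by (simp add: divide_simps)
    qed
    have H: "(J1 has_vector_derivative 2 * pi + pi * (2 * (?z x * deriv (pairing a b) (?z x))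
       - 2 * ((inverse (cnj b) * ?z x) * deriv (log_kernel f a) (inverse (cnj b) * ?z x))
       - cnj (2 * ((inverse (cnj a) * ?z x) * deriv (log_kernel f b) (inverse (cnj a) * ?z x)))
       - 2 * (u * - (1 / (1 - u))))) (at x)"
      unfolding J1_def u_def
      by (intro has_vector_derivative_add has_vector_derivative_diff has_vector_derivative_mult_right has_vector_derivative_cnj
          lin dP[OF x1] dLA[OF xb] dLB[OF that] dLI[OF that])
    have K: "2 * pi + pi * (2 * X - 2 * Y - cnj (2 * Z) - 2 * (u * - (1 / (1 - u)))) = 2 * pi * (X - Y - cnj Z + 1 / (1 - u))" for X Y Z
    proof -
      have "2 * pi + pi * (2 * X - 2 * Y - cnj (2 * Z) - 2 * (u * - (1 / (1 - u)))) = 2 * pi * (X - Y - cnj Z + (1 - (u * - (1 / (1 - u)))))"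
        by (simp add: algebra_simps)
      then show ?thesis unfolding u .
    qed
    show ?thesis using H unfolding K unfolding u_def .
  qed
  have d2: "(J2 has_vector_derivative 2 * pi * (?z x * deriv (pairing a b) (?z x)
     - (inverse (cnj b) * ?z x) * deriv (log_kernel f a) (inverse (cnj b) * ?z x))) (at x)" if "exp x \<le> norm b" for x
  proof -
    have x1: "exp x < 1" using that b by linarith
    have "(J2 has_vector_derivative pi * (2 * (?z x * deriv (pairing a b) (?z x))
       - 2 * ((inverse (cnj b) * ?z x) * deriv (log_kernel f a) (inverse (cnj b) * ?z x)))) (at x)"
      unfolding J2_def
      by (intro has_vector_derivative_diff has_vector_derivative_mult_right dP[OF x1] dLA[OF that])
    then show ?thesis by (simp add: algebra_simps)
  qed
  have d3: "(J3 has_vector_derivative 2 * pi * (?z x * deriv (pairing a b) (?z x) + (a * cnj b / ?z x) / (1 - a * cnj b / ?z x))) (at x)"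
    if "norm b \<le> exp x" "exp x < 1" for x
  proof -
    have "(J3 has_vector_derivative pi * (2 * (?z x * deriv (pairing a b) (?z x))
       + 2 * ((a * cnj b / ?z x) / (1 - a * cnj b / ?z x)))) (at x)"
      unfolding J3_def
      by (intro has_vector_derivative_add has_vector_derivative_mult_right dP[OF that(2)] dLO[OF that(1)])
    moreover have "complex_of_real pi * (2 * X + 2 * Y) = complex_of_real (2 * pi) * (X + Y)" for X Y
      by (simp add: algebra_simps)
    ultimately show ?thesis by (simp only:)
  qed
  have le: "exp x \<le> r \<longleftrightarrow> x \<le> ln r" "exp x < r \<longleftrightarrow> x < ln r" "r \<le> exp x \<longleftrightarrow> ln r \<le> x" "r < exp x \<longleftrightarrow> ln r < x" if "r > 0" for r x :: real
    using that exp_le_cancel_iff[of x "ln r"] exp_less_cancel_iff[of x "ln r"] exp_le_cancel_iff[of "ln r" x] exp_less_cancel_iff[of "ln r" x]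
    by (simp_all del: exp_le_cancel_iff exp_less_cancel_iff)
  have na: "norm a > 0" and nb: "norm b > 0" using a b0 by auto
  have o: "ln t \<le> ln (norm a)" "ln (norm a) \<le> ln (norm b)" "ln (norm b) \<le> ln s"
    using t na nb ab s s0 by simp_all
  \<comment> \<open>The formulas for \<open>circ\<close> are available only off the radii |a| and
    |b|, so differentiability is claimed in the open interval alone and the primitive is merely
    continuous at the ends.\<close>
  have i1: "(circ a b has_integral (J1 (ln (norm a)) - J1 (ln t))) {ln t..ln (norm a)}"
  proof (rule fundamental_theorem_of_calculus_interior[OF o(1)])
    show "continuous_on {ln t..ln (norm a)} J1"
    proof (intro continuous_at_imp_continuous_on ballI)
      fix x assume "x \<in> {ln t..ln (norm a)}"
      then have "exp x \<le> norm a" using le(1)[OF na, of x] by simp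
      then show "isCont J1 x" by (rule has_vector_derivative_continuous[OF d1])
    qed
    fix x assume "x \<in> {ln t<..<ln (norm a)}"
    then have "exp x < norm a" using le na by simp
    then show "(J1 has_vector_derivative circ a b x) (at x)"
      using d1[of x] circ_inner[OF a b ab] by simp
  qed
  have i2: "(circ a b has_integral (J2 (ln (norm b)) - J2 (ln (norm a)))) {ln (norm a)..ln (norm b)}"
  proof (rule fundamental_theorem_of_calculus_interior[OF o(2)])
    show "continuous_on {ln (norm a)..ln (norm b)} J2"
    proof (intro continuous_at_imp_continuous_on ballI)
      fix x assume "x \<in> {ln (norm a)..ln (norm b)}"
      then have "exp x \<le> norm b" using le(1)[OF nb, of x] by simp
      then show "isCont J2 x" by (rule has_vector_derivative_continuous[OF d2])
    qed
    fix x assume "x \<in> {ln (norm a)<..<ln (norm b)}"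
    then have "norm a < exp x" "exp x < norm b" using le na nb by simp_all
    then show "(J2 has_vector_derivative circ a b x) (at x)"
      using d2[of x] circ_middle[OF a b ab] by simp
  qed
  have x1: "exp x < 1" if "x \<le> ln s" for x using le[OF s0] that s(2) by (meson order_le_less_trans)
  have i3: "(circ a b has_integral (J3 (ln s) - J3 (ln (norm b)))) {ln (norm b)..ln s}"
  proof (rule fundamental_theorem_of_calculus_interior[OF o(3)])
    show "continuous_on {ln (norm b)..ln s} J3"
    proof (intro continuous_at_imp_continuous_on ballI)
      fix x assume "x \<in> {ln (norm b)..ln s}"
      then have "norm (b::complex) \<le> exp x" "exp x < 1" using le(3)[OF nb, of x] x1[of x] by simp_all
      then show "isCont J3 x" by (rule has_vector_derivative_continuous[OF d3])
    qed
    fix x assume "x \<in> {ln (norm b)<..<ln s}"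
    then have "norm b < exp x" "exp x < 1" using le nb x1[of x] by simp_all
    then show "(J3 has_vector_derivative circ a b x) (at x)"
      using d3[of x] circ_outer[OF a b ab] by simp
  qed
  define I where "I = (J1 (ln (norm a)) - J1 (ln t)) + (J2 (ln (norm b)) - J2 (ln (norm a))) + (J3 (ln s) - J3 (ln (norm b)))"
  have "(circ a b has_integral I) {ln t..ln s}"
    unfolding I_def
    by (rule has_integral_combine[OF order_trans[OF o(1,2)] o(3) has_integral_combine[OF o(1,2) i1 i2] i3])
  moreover have "Re I = - 2 * pi * ln t - 2 * pi * ln (norm (inverse (f b) - inverse (f a)))
        + pi * Re (pairing a b (of_real (s\<^sup>2))) + pi * ln (norm (1 - a * cnj b / of_real (s\<^sup>2)))
        - pi * Re (inner_rest a b (of_real (t\<^sup>2)))"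
  proof -
    have ez: "exp (2 * ln r) = r\<^sup>2" if "r > 0" for r :: real using that by (simp add: exp_double)
    have ez': "exp (2 * (- ln r)) = inverse (r\<^sup>2)" if "r > 0" for r :: real
      using that by (simp add: exp_minus exp_double)
    \<comment> \<open>At the radius |c| the reflected point \<open>\<zeta> / cnj c\<close> is
      \<open>c\<close> itself; this turns the boundary terms into kernel values at \<open>a\<close>
      and \<open>b\<close>.\<close>
    have cn: "inverse (cnj c) * complex_of_real ((norm c)\<^sup>2) = c" if "c \<noteq> 0" for c
      using that complex_norm_square[of c] by (simp add: field_simps del: of_real_power)
    have 1: "J1 (ln t) = 2 * pi * complex_of_real (ln t) + pi * inner_rest a b (of_real (t\<^sup>2))"
      unfolding J1_def PP_def LA_def LB_def LI_def inner_rest_def ez[OF t(1)] by simp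
    have LBa: "LB (ln (norm a)) = log_kernel f b a" unfolding LB_def ez[OF na] cn[OF a(2)] ..
    have LAb: "LA (ln (norm b)) = log_kernel f a b" unfolding LA_def ez[OF nb] cn[OF b0] ..
    have LIa: "Re (LI (ln (norm a))) = ln (norm (b - a)) - ln (norm b)"
    proof -
      have "inverse (a * cnj b) * complex_of_real ((norm a)\<^sup>2) = cnj a / cnj b"
        using a complex_norm_square[of a] by (simp add: field_simps del: of_real_power)
      moreover have "1 - cnj a / cnj b = cnj ((b - a) / b)" using b0 by (simp add: field_simps)
      ultimately have "LI (ln (norm a)) = Ln (cnj ((b - a) / b))" unfolding LI_def ez[OF na] by simp
      moreover have "b \<noteq> a" using ab by auto
      ultimately show ?thesis using b0 by (simp add: Re_Ln norm_divide ln_div del: complex_cnj_divide complex_cnj_diff)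
    qed
    have LOb: "Re (LO (ln (norm b))) = ln (norm (b - a)) - ln (norm b)"
    proof -
      have "a * cnj b * complex_of_real (inverse ((norm b)\<^sup>2)) = a / b"
        using b0 complex_norm_square[of b] by (simp add: field_simps del: of_real_power)
      moreover have "1 - a / b = (b - a) / b" using b0 by (simp add: field_simps)
      ultimately have "LO (ln (norm b)) = Ln ((b - a) / b)" unfolding LO_def ez'[OF nb] by simp
      moreover have "b \<noteq> a" using ab by auto
      ultimately show ?thesis using b0 by (simp add: Re_Ln norm_divide ln_div)
    qed
    have LOs: "Re (LO (ln s)) = ln (norm (1 - a * cnj b / of_real (s\<^sup>2)))"
    proof -
      have "LO (ln s) = Ln (1 - a * cnj b / of_real (s\<^sup>2))" unfolding LO_def ez'[OF s0] by (simp add: divide_inverse)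
      moreover have "norm (a * cnj b / of_real (s\<^sup>2)) < 1"
      proof -
        have "norm a * norm b < s * s" using ab s s0 by (intro mult_strict_mono) auto
        then show ?thesis using s0 by (simp add: norm_divide norm_mult power2_eq_square field_simps)
      qed
      ultimately show ?thesis using Re_Ln_one_minus by simp
    qed
    have PPs: "PP (ln s) = pairing a b (of_real (s\<^sup>2))" unfolding PP_def ez[OF s0] by simp
    have nab: "a \<noteq> b" using ab by auto
    have dG: "norm (inverse (f b) - inverse (f a)) > 0"
      using inj_onD[OF f_inj, of b a] nab a b by auto
    have nba: "norm (b - a) > 0" using nab by simp
    have R1: "Re (log_kernel f a b) = ln (norm (inverse (f b) - inverse (f a))) + ln (norm a) + ln (norm b) - ln (norm (b - a))"
      unfolding Re_log_kernel[OF a b b0 nab] norm_minus_commute[of a b] using dG na nb nba by (simp add: ln_mult ln_div)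
    have R2: "Re (log_kernel f b a) = ln (norm (inverse (f b) - inverse (f a))) + ln (norm a) + ln (norm b) - ln (norm (b - a))"
      unfolding Re_log_kernel[OF b b0 a nab[symmetric]] norm_minus_commute[of "inverse (f a)"] using dG na nb nba by (simp add: ln_mult ln_div)
    have "I = 2 * pi * complex_of_real (ln (norm a)) - pi * cnj (LB (ln (norm a))) - pi * LI (ln (norm a))
       - J1 (ln t) - pi * LA (ln (norm b)) - pi * LO (ln (norm b)) + pi * PP (ln s) + pi * LO (ln s)"
      unfolding I_def J2_def J3_def J1_def[THEN fun_cong, of "ln (norm a)"] by (simp add: algebra_simps)
    then have "Re I = 2 * pi * ln (norm a) - pi * Re (log_kernel f b a) - pi * Re (LI (ln (norm a)))
       - 2 * pi * ln t - pi * Re (inner_rest a b (of_real (t\<^sup>2))) - pi * Re (log_kernel f a b) - pi * Re (LO (ln (norm b)))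
       + pi * Re (pairing a b (of_real (s\<^sup>2))) + pi * Re (LO (ln s))"
      unfolding 1 LBa LAb PPs by simp
    then show ?thesis unfolding R1 R2 LIa LOb LOs by (simp add: algebra_simps)
  qed
  ultimately show ?thesis using that by blast
qed

lemma inner_rest_tendsto:
  assumes a: "norm a < 1" "a \<noteq> 0" and b: "norm b < 1" "b \<noteq> 0"
  shows "((\<lambda>t. Re (inner_rest a b (of_real (t\<^sup>2)))) \<longlongrightarrow> 0) (at_right 0)"
proof -
  have c1: "isCont (pairing a b) 0" using pairing_deriv(1)[OF a b, of 0] DERIV_isCont by simp blast
  have c2: "isCont (log_kernel f a) 0" using log_kernel_field_deriv[OF a, of 0] DERIV_isCont by simp blast
  have c3: "isCont (log_kernel f b) 0" using log_kernel_field_deriv[OF b, of 0] DERIV_isCont by simp blast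
  have z: "((\<lambda>t. c * complex_of_real (t\<^sup>2)) \<longlongrightarrow> 0) (at_right 0)" for c
  proof -
    have "((\<lambda>t. c * complex_of_real (t\<^sup>2)) \<longlongrightarrow> c * of_real (0\<^sup>2)) (at_right 0)"
      by (intro tendsto_intros)
    then show ?thesis by simp
  qed
  have "((\<lambda>t. pairing a b (1 * of_real (t\<^sup>2)) - log_kernel f a (inverse (cnj b) * of_real (t\<^sup>2))
      - cnj (log_kernel f b (inverse (cnj a) * of_real (t\<^sup>2))) - Ln (1 - inverse (a * cnj b) * of_real (t\<^sup>2)))
      \<longlongrightarrow> pairing a b 0 - log_kernel f a 0 - cnj (log_kernel f b 0) - Ln (1 - 0)) (at_right 0)"
    by (intro tendsto_diff tendsto_cnj isCont_tendsto_compose[OF c1] isCont_tendsto_compose[OF c2] isCont_tendsto_compose[OF c3]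
        isCont_tendsto_compose[OF continuous_at_Ln] z tendsto_const) auto
  from tendsto_Re[OF this] show ?thesis
    using log_kernel_0[OF a] log_kernel_0[OF b] by (simp add: inner_rest_def)
qed

section \<open>The energy of the omitted set\<close>

definition recip :: "complex \<Rightarrow> complex" where "recip z = inverse (f z)"

definition omitted :: "real \<Rightarrow> complex set" where
  "omitted s = - (recip ` (ball 0 s - {0}))"

lemma recip_hol: "recip holomorphic_on (ball 0 1 - {0})"
  unfolding recip_def[abs_def]
  by (intro holomorphic_intros holomorphic_on_subset[OF f_hol]) (use f_eq_0_iff in auto)

lemma recip_inj: "inj_on recip (ball 0 1 - {0})"
  using f_inj by (auto simp: inj_on_def recip_def)

lemma recip_open_image:
  assumes "open U" "U \<subseteq> ball 0 1 - {0}"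
  shows "open (recip ` U)"
  by (rule open_mapping_thm3[OF holomorphic_on_subset[OF recip_hol assms(2)] assms(1) inj_on_subset[OF recip_inj assms(2)]])

lemma omitted_borel: "s \<le> 1 \<Longrightarrow> omitted s \<in> sets borel"
proof -
  assume "s \<le> 1"
  then have "open (recip ` (ball 0 s - {0}))" by (intro recip_open_image) (auto intro: open_delete)
  then show ?thesis unfolding omitted_def by (intro borel_closed closed_Compl)
qed

lemma omitted_mono: "r \<le> s \<Longrightarrow> omitted s \<subseteq> omitted r"
  unfolding omitted_def by fastforce

text \<open>The image of the disk under \<open>f\<close> contains a disk around 0, so the
  reciprocals cover a neighbourhood of infinity.\<close>

lemma omitted_bounded:
  assumes "0 < s" "s \<le> 1"
  obtains M where "M > 0" "\<And>w. w \<in> omitted s \<Longrightarrow> norm w \<le> M"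
proof -
  have "open (f ` ball 0 s)"
    using assms by (intro open_mapping_thm3 holomorphic_on_subset[OF f_hol] inj_on_subset[OF f_inj]) auto
  moreover have "0 \<in> f ` ball 0 s" using f_0 assms by force
  ultimately obtain d where d: "d > 0" "cball 0 d \<subseteq> f ` ball 0 s"
    using open_contains_cball by blast
  have "norm w \<le> inverse d" if "w \<in> omitted s" for w
  proof (rule ccontr)
    assume "\<not> norm w \<le> inverse d"
    then have w: "inverse d < norm w" by simp
    then have "norm w > 0" using d by (meson inverse_positive_iff_positive less_trans)
    then have "norm (inverse w) \<le> d" using w d by (simp add: norm_inverse norm_divide field_simps)
    then obtain z where z: "z \<in> ball 0 s" "inverse w = f z" using d by fastforce
    then have "w = recip z" by (simp add: recip_def) (metis inverse_inverse_eq)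
    moreover have "z \<noteq> 0" using z f_0 \<open>norm w > 0\<close> by auto
    ultimately show False using that z by (auto simp: omitted_def)
  qed
  then show ?thesis using that[of "inverse d"] d by simp
qed

text \<open>The difference \<open>1 / f z - 1 / z\<close> has a removable singularity at 0. The
  bound measures how nearly a small circle is mapped onto a large one.\<close>

lemma recip_pole_bound:
  assumes "0 < s" "s < 1"
  obtains C where "C > 0" "\<And>z. z \<noteq> 0 \<Longrightarrow> norm z \<le> s \<Longrightarrow> norm (recip z - 1 / z) \<le> C"
proof -
  let ?h = "\<lambda>z. exp (- log_ratio f z)"
  define T where "T = (\<lambda>z. if z = 0 then deriv ?h 0 else (?h z - ?h 0) / (z - 0))"
  have "T holomorphic_on ball 0 1"
    unfolding T_def by (intro pole_lemma_open open_ball holomorphic_intros log_ratio_hol)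
  then have "continuous_on (cball 0 s) T"
    using assms by (intro holomorphic_on_imp_continuous_on) (auto elim: holomorphic_on_subset)
  then have "compact (T ` cball 0 s)" by (rule compact_continuous_image) simp
  then obtain C where C: "C > 0" "\<And>w. w \<in> T ` cball 0 s \<Longrightarrow> norm w \<le> C"
    using compact_imp_bounded bounded_pos by metis
  have "norm (recip z - 1 / z) \<le> C" if "z \<noteq> 0" "norm z \<le> s" for z
  proof -
    have "recip z - 1 / z = T z"
      using inverse_f[of z] that assms by (simp add: recip_def T_def log_ratio_0 field_simps)
    then show ?thesis using C(2)[of "T z"] that by auto
  qed
  then show ?thesis using that C by blast
qed

definition annulus_image :: "real \<Rightarrow> real \<Rightarrow> complex set" where
  "annulus_image t s = recip ` {z. t < norm z \<and> norm z < s}"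

lemma annulus_image_strip:
  assumes "0 < t" "t < s"
  shows "annulus_image t s = (\<lambda>u. recip (exp u)) ` strip {ln t<..<ln s}"
proof -
  have "exp ` strip {ln t<..<ln s} = {z. t < norm z \<and> norm z < s}"
    using image_exp_strip[of 0 "{ln t<..<ln s}"] assms
    by (auto simp: ln_less_cancel_iff) (use assms in \<open>metis ln_less_cancel_iff norm_ge_zero order_le_less order_less_trans zero_less_norm_iff\<close>)+
  then show ?thesis by (simp add: annulus_image_def image_image[symmetric])
qed

text \<open>The Jacobian is the product of the derivative and its conjugate, one factor for each
  half of the kernel; this yields the integrand of \<open>circ\<close>. The exceptional radii |a|
  and |b| form a null set.\<close>

lemma annulus_integral:
  assumes a: "norm a < 1" "a \<noteq> 0" and b: "norm b < 1" "b \<noteq> 0" and t: "0 < t" "t < s" "s < 1"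
    and int: "set_integrable lborel (annulus_image t s) (kern (recip a) (recip b))"
  shows "(LINT w:annulus_image t s|lborel. kern (recip a) (recip b) w) = (LINT x:{ln t<..<ln s}|lborel. circ a b x)"
    and "set_integrable lborel {ln t<..<ln s} (circ a b)"
proof -
  let ?S = "strip {ln t<..<ln s}"
  define \<Gamma> where "\<Gamma> = (\<lambda>u. recip (exp u))"
  define \<Gamma>' where "\<Gamma>' = (\<lambda>u. exp u * deriv recip (exp u))"
  let ?k = "\<lambda>u. of_real ((cmod (\<Gamma>' u))\<^sup>2) * kern (recip a) (recip b) (\<Gamma> u)"
  have S: "?S \<in> sets borel" by (rule strip_borel) simp
  have eS: "exp u \<in> ball 0 1 - {0}" if "u \<in> ?S" for u
  proof -
    have "Re u < ln s" using that by (simp add: strip_def)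
    then have "exp (Re u) < exp (ln s)" by simp
    then have "exp (Re u) < 1" using t by (simp del: exp_less_one_iff)
    then show ?thesis by simp
  qed
  have o: "open (ball 0 1 - {0 :: complex})" by (auto intro: open_delete)
  have d: "(\<Gamma> has_field_derivative \<Gamma>' u) (at u within ?S)" if "u \<in> ?S" for u
  proof -
    have "(recip has_field_derivative deriv recip (exp u)) (at (exp u))"
      by (rule holomorphic_derivI[OF recip_hol o eS[OF that]])
    from DERIV_chain[OF this DERIV_exp[of u]]
    have "(\<Gamma> has_field_derivative \<Gamma>' u) (at u)" by (simp add: \<Gamma>_def \<Gamma>'_def o_def mult.commute)
    then show ?thesis by (rule has_field_derivative_at_within)
  qed
  have c: "continuous_on ?S \<Gamma>'"
    unfolding \<Gamma>'_def
    by (intro continuous_intros continuous_on_compose2[OF holomorphic_on_imp_continuous_on[OF holomorphic_deriv[OF recip_hol o]], of ?S exp])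
      (use eS in auto)
  have inj: "inj_on \<Gamma> ?S"
    using inj_on_exp_strip[of 0 "{ln t<..<ln s}"] recip_inj eS unfolding \<Gamma>_def inj_on_def by (metis add_0)
  have im: "\<Gamma> ` ?S = annulus_image t s"
    unfolding \<Gamma>_def using annulus_image_strip[OF t(1,2)] by simp
  have oa: "open {z. t < norm z \<and> norm z < s}"
    by (intro open_Collect_conj open_Collect_less continuous_intros)
  have im_b: "\<Gamma> ` ?S \<in> sets borel"
    unfolding im annulus_image_def by (rule borel_open, rule recip_open_image[OF oa]) (use t in auto)
  note cv = complex_change_of_variables[OF S d c inj im_b kern_measurable]
  have ik: "set_integrable lborel ?S ?k" using cv(1)[of "recip a" "recip b"] int unfolding im by simp
  note fub = strip_fubini[OF _ ik]
  have inner: "(LINT y:{-pi<..pi}|lborel. ?k (Complex x y)) = circ a b x"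
    if x: "ln t < x" "x < ln s" "x \<noteq> ln (norm a)" "x \<noteq> ln (norm b)" for x
  proof -
    have nx: "exp x < 1" "exp x \<noteq> norm a" "exp x \<noteq> norm b"
    proof -
      have "exp x < exp (ln s)" using x by simp
      then show "exp x < 1" using t by (simp del: exp_less_one_iff)
    qed (use x in \<open>auto dest: arg_cong[where f=ln]\<close>)
    have "?k (Complex x y) = ker_diff a (exp (Complex x y)) * cnj (ker_diff b (exp (Complex x y)))" for y
    proof -
      define z where "z = exp (Complex x y)"
      have nz: "norm z = exp x" by (simp add: z_def)
      have z: "norm z < 1" "z \<noteq> 0" "z \<noteq> a" "z \<noteq> b" using nx nz by (auto simp: z_def)
      have r: "recip = (\<lambda>z. inverse (f z))" by (simp add: recip_def[abs_def])
      have A: "\<Gamma>' (Complex x y) * inverse (\<Gamma> (Complex x y) - recip a) = ker_diff a z"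
        using inverse_f_log_deriv[OF a z(1,2,3)] by (simp add: \<Gamma>'_def \<Gamma>_def ker_diff_def z_def r)
      have B: "\<Gamma>' (Complex x y) * inverse (\<Gamma> (Complex x y) - recip b) = ker_diff b z"
        using inverse_f_log_deriv[OF b z(1,2,4)] by (simp add: \<Gamma>'_def \<Gamma>_def ker_diff_def z_def r)
      have "of_real ((cmod (\<Gamma>' (Complex x y)))\<^sup>2) = \<Gamma>' (Complex x y) * cnj (\<Gamma>' (Complex x y))"
        using complex_norm_square by blast
      then have "?k (Complex x y) = (\<Gamma>' (Complex x y) * inverse (\<Gamma> (Complex x y) - recip a)) * cnj (\<Gamma>' (Complex x y) * inverse (\<Gamma> (Complex x y) - recip b))"
        by (simp only: kern_def complex_cnj_mult mult_ac)
      then show ?thesis unfolding A B z_def .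
    qed
    then show ?thesis by (simp only: circ_def)
  qed
  have ae: "indicator {ln t<..<ln s} x *\<^sub>R (LINT y:{-pi<..pi}|lborel. ?k (Complex x y)) = indicator {ln t<..<ln s} x *\<^sub>R circ a b x"
    if "x \<notin> {ln (norm a), ln (norm b)}" for x
    using inner[of x] that by (cases "x \<in> {ln t<..<ln s}") auto
  have "(LINT w:annulus_image t s|lborel. kern (recip a) (recip b) w) = (LINT u:?S|lborel. ?k u)"
    using cv(2)[of "recip a" "recip b"] int unfolding im by simp
  also have "\<dots> = (LINT x:{ln t<..<ln s}|lborel. (LINT y:{-pi<..pi}|lborel. ?k (Complex x y)))"
    by (rule fub(1)) simp
  also have "\<dots> = (LINT x:{ln t<..<ln s}|lborel. circ a b x)"
    unfolding set_lebesgue_integral_def[of _ "{ln t<..<ln s}"]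
    by (rule integral_discrete_difference[where X="{ln (norm a), ln (norm b)}"]) (use ae in auto)
  finally show "(LINT w:annulus_image t s|lborel. kern (recip a) (recip b) w) = (LINT x:{ln t<..<ln s}|lborel. circ a b x)" .
  have "set_integrable lborel {ln t<..<ln s} (\<lambda>x. (LINT y:{-pi<..pi}|lborel. ?k (Complex x y)))"
    by (rule fub(2)) simp
  then show "set_integrable lborel {ln t<..<ln s} (circ a b)"
    unfolding set_integrable_def
    by (subst integrable_discrete_difference[where X="{ln (norm a), ln (norm b)}", symmetric]) (use ae in auto)
qed

definition omitted_energy :: "real \<Rightarrow> complex \<Rightarrow> complex \<Rightarrow> complex" where
  "omitted_energy s a b = (LINT w:omitted s|lborel. kern (recip a) (recip b) w)"

text \<open>For small t the omitted set together with the image of the annulus fills, up to a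
  bounded error in the radius, the disk of radius 1 / t around \<open>recip a\<close>. The integrals
  over the disk and over the annulus are known, their multiples of \<open>ln t\<close> cancel, and t
  tends to 0.\<close>

lemma omitted_energy_eq_less:
  assumes a: "norm a < 1" "a \<noteq> 0" and b: "norm b < 1" and ab: "norm a < norm b" and s: "norm b < s" "s < 1"
  shows "Re (omitted_energy s a b) = - pi * ln (norm (1 - a * cnj b / of_real (s\<^sup>2))) - pi * Re (pairing a b (of_real (s\<^sup>2)))"
proof -
  have b0: "b \<noteq> 0" using ab by auto
  have s0: "s > 0" using s b0 norm_ge_zero[of b] by linarith
  let ?p = "recip a" and ?q = "recip b"
  have pq: "?p \<noteq> ?q" using inj_onD[OF recip_inj, of a b] a b b0 ab by auto
  let ?d = "norm (?q - ?p)"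
  obtain M where M: "M > 0" "\<And>w. w \<in> omitted s \<Longrightarrow> norm w \<le> M" using omitted_bounded[OF s0] s by auto
  obtain C0 where C0: "C0 > 0" "\<And>z. z \<noteq> 0 \<Longrightarrow> norm z \<le> s \<Longrightarrow> norm (recip z - 1 / z) \<le> C0"
    using recip_pole_bound[OF s0 s(2)] by blast
  \<comment> \<open>\<open>C0\<close> bounds the distance from \<open>recip z\<close> to
    \<open>1 / z\<close>, \<open>norm ?p\<close> pays for centring the disks at \<open>?p\<close>,
    and the summand 1 makes the inclusions strict.\<close>
  define C where "C = C0 + norm ?p + 1"
  have C: "C > 0" using C0 by (simp add: C_def add_pos_nonneg)
  define V where "V = - pi * ln (norm (1 - a * cnj b / of_real (s\<^sup>2))) - pi * Re (pairing a b (of_real (s\<^sup>2)))"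
  have bound: "\<bar>Re (omitted_energy s a b) - V - (2 * pi * ln (1 - C * t) + pi * Re (inner_rest a b (of_real (t\<^sup>2))))\<bar> \<le> 8 * pi * C * t / (1 - C * t)\<^sup>2"
    if t: "0 < t" "t < norm a" "t < 1 / M" "t < 1 / (C + 2 * ?d)" "t < 1 / C" for t
  proof -
    define R where "R = 1 / t"
    \<comment> \<open>The conditions on t say that the disk of radius R reaches beyond the omitted
      set and that both poles stay far from its rim.\<close>
    have R: "R > 0" "R > M" "R > C + 2 * ?d" "R > C"
    proof -
      have "C + 2 * ?d > 0" using C by (simp add: add_pos_nonneg)
      then show "R > C + 2 * ?d" using t(4) t(1) by (simp add: R_def less_divide_eq mult.commute)
    qed (use t M C in \<open>auto simp: R_def field_simps\<close>)
    have ts: "t < s" using t ab s by linarith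
    let ?E = "omitted s" and ?X = "annulus_image t s"
    have disj: "?E \<inter> ?X = {}" using t by (auto simp: omitted_def annulus_image_def)
    have Eb: "?E \<in> sets borel" using s by (intro omitted_borel) auto
    have "open {z. t < norm z \<and> norm z < s}"
      by (intro open_Collect_conj open_Collect_less continuous_intros)
    then have Xb: "?X \<in> sets borel"
      unfolding annulus_image_def by (intro borel_open recip_open_image) (use t s in auto)
    have sub: "?E \<union> ?X \<subseteq> ball ?p (R + C)"
    proof
      fix w assume "w \<in> ?E \<union> ?X"
      then show "w \<in> ball ?p (R + C)"
      proof
        assume "w \<in> ?E"
        then have "norm w \<le> M" using M by simp
        then have "norm (w - ?p) < R + C" using norm_triangle_ineq4[of w ?p] R C0 by (simp add: C_def)
        then show ?thesis by (simp add: dist_norm norm_minus_commute)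
      next
        assume "w \<in> ?X"
        then obtain z where z: "t < norm z" "norm z < s" "w = recip z" by (auto simp: annulus_image_def)
        then have z0: "z \<noteq> 0" using t by auto
        have 1: "norm (recip z - 1 / z) \<le> C0" using C0(2)[OF z0] z by simp
        have 2: "norm (1 / z) \<le> R" using z t by (simp add: R_def norm_divide frac_le)
        have "norm (w - ?p) = norm ((recip z - 1 / z) + 1 / z - ?p)" using z by simp
        then have "norm (w - ?p) \<le> C0 + R + norm ?p"
          using norm_triangle_ineq4[of "(recip z - 1 / z) + 1 / z" ?p] norm_triangle_ineq[of "recip z - 1 / z" "1 / z"] 1 2 by linarith
        then show ?thesis by (simp add: dist_norm norm_minus_commute C_def)
      qed
    qed
    have sup: "ball ?p (R - C) \<subseteq> ?E \<union> ?X"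
    proof
      fix w assume w: "w \<in> ball ?p (R - C)"
      show "w \<in> ?E \<union> ?X"
      proof (rule ccontr)
        assume n: "w \<notin> ?E \<union> ?X"
        then obtain z where z: "z \<in> ball 0 s - {0}" "w = recip z" unfolding omitted_def by blast
        then have zt: "norm z \<le> t" using n by (auto simp: annulus_image_def)
        have z0: "z \<noteq> 0" using z by auto
        have 1: "norm (recip z - 1 / z) \<le> C0" using C0(2)[OF z0] z by simp
        have 2: "R \<le> norm (1 / z)" using zt z0 t by (simp add: R_def norm_divide frac_le)
        have "norm (1 / z) = norm ((w - ?p) + ?p - (recip z - 1 / z))" using z by simp
        then have "norm (1 / z) \<le> norm (w - ?p) + norm ?p + C0"
          using norm_triangle_ineq4[of "(w - ?p) + ?p" "recip z - 1 / z"] norm_triangle_ineq[of "w - ?p" ?p] 1 by linarith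
        moreover have "norm (w - ?p) < R - C" using w by (simp add: dist_norm norm_minus_commute)
        ultimately show False using 2 by (simp add: C_def)
      qed
    qed
    have ib: "set_integrable lborel (ball ?p (R + C)) (kern ?p ?q)"
      by (rule set_integrable_kern_ball[OF pq]) (use R C in simp)
    have iE: "set_integrable lborel ?E (kern ?p ?q)" and iX: "set_integrable lborel ?X (kern ?p ?q)"
      by (rule set_integrable_subset[OF ib]; use sub Eb Xb in auto)+
    have far: "norm ((LINT w:?E \<union> ?X|lborel. kern ?p ?q w) - 2 * pi * (ln (R - C) - ln ?d)) \<le> 8 * pi * R * C / (R - C)\<^sup>2"
      by (rule kern_far_integral_bound[OF pq C _ _ _ sup sub]) (use R Eb Xb in auto)
    have split: "(LINT w:?E \<union> ?X|lborel. kern ?p ?q w) = omitted_energy s a b + (LINT w:?X|lborel. kern ?p ?q w)"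
      unfolding omitted_energy_def by (rule set_integral_Un[OF disj iE iX])
    note ai = annulus_integral[OF a b b0 t(1) ts s(2) iX]
    obtain I where I: "(circ a b has_integral I) {ln t..ln s}"
      "Re I = - 2 * pi * ln t - 2 * pi * ln (norm (inverse (f b) - inverse (f a)))
        + pi * Re (pairing a b (of_real (s\<^sup>2))) + pi * ln (norm (1 - a * cnj b / of_real (s\<^sup>2)))
        - pi * Re (inner_rest a b (of_real (t\<^sup>2)))"
      using circ_has_integral[OF a b ab s t(1,2)] by blast
    have "(LINT w:?X|lborel. kern ?p ?q w) = integral {ln t<..<ln s} (circ a b)"
      unfolding ai(1) by (rule set_borel_integral_eq_integral(2)[OF ai(2)])
    also have "\<dots> = I" using integral_open_interval_real[of "ln t" "ln s" "circ a b"] I(1) by (simp add: integral_unique)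
    finally have X: "(LINT w:?X|lborel. kern ?p ?q w) = I" .
    have "R - C = (1 - C * t) / t" using t by (simp add: R_def field_simps)
    moreover have Ct: "1 - C * t > 0" using t C by (simp add: field_simps)
    ultimately have l: "ln (R - C) = ln (1 - C * t) - ln t" using t by (simp add: ln_div)
    have Q: "8 * pi * R * C / (R - C)\<^sup>2 = 8 * pi * C * t / (1 - C * t)\<^sup>2"
      using t Ct unfolding \<open>R - C = (1 - C * t) / t\<close> R_def by (simp add: power2_eq_square field_simps)
    have "\<bar>Re (omitted_energy s a b + I - 2 * pi * (ln (R - C) - ln ?d))\<bar> \<le> 8 * pi * C * t / (1 - C * t)\<^sup>2"
      using order_trans[OF abs_Re_le_cmod far] unfolding split X Q by simp
    moreover have "Re (omitted_energy s a b + I - 2 * pi * (ln (R - C) - ln ?d))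
       = Re (omitted_energy s a b) - V - (2 * pi * ln (1 - C * t) + pi * Re (inner_rest a b (of_real (t\<^sup>2))))"
      using I(2) unfolding l V_def recip_def by (simp add: algebra_simps)
    ultimately show ?thesis by simp
  qed
  have "((\<lambda>t. Re (omitted_energy s a b) - V - (2 * pi * ln (1 - C * t) + pi * Re (inner_rest a b (of_real (t\<^sup>2))))) \<longlongrightarrow> 0) (at_right 0)"
  proof (rule Lim_null_comparison)
    have pos: "0 < Min {norm a, 1 / M, 1 / (C + 2 * ?d), 1 / C}"
      using a M C norm_ge_zero[of "?q - ?p"] by (simp add: add_pos_nonneg)
    show "\<forall>\<^sub>F t in at_right 0. norm (Re (omitted_energy s a b) - V - (2 * pi * ln (1 - C * t) + pi * Re (inner_rest a b (of_real (t\<^sup>2))))) \<le> 8 * pi * C * t / (1 - C * t)\<^sup>2"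
      using eventually_at_right_less[of 0] eventually_at_right_real[OF pos]
    proof eventually_elim
      case (elim t)
      then have "t < norm a" "t < 1 / M" "t < 1 / (C + 2 * ?d)" "t < 1 / C" by auto
      then show ?case using bound[of t] elim by simp
    qed
    have "((\<lambda>t. 8 * pi * C * t / (1 - C * t)\<^sup>2) \<longlongrightarrow> 8 * pi * C * 0 / (1 - C * 0)\<^sup>2) (at_right 0)"
      by (intro tendsto_intros) auto
    then show "((\<lambda>t. 8 * pi * C * t / (1 - C * t)\<^sup>2) \<longlongrightarrow> 0) (at_right 0)" by simp
  qed
  moreover have "((\<lambda>t. Re (omitted_energy s a b) - V - (2 * pi * ln (1 - C * t) + pi * Re (inner_rest a b (of_real (t\<^sup>2)))))
     \<longlongrightarrow> Re (omitted_energy s a b) - V - (2 * pi * ln (1 - C * 0) + pi * 0)) (at_right 0)"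
    by (intro tendsto_intros inner_rest_tendsto[OF a b b0]) auto
  ultimately have "Re (omitted_energy s a b) - V - (2 * pi * ln (1 - C * 0) + pi * 0) = 0"
    by (intro tendsto_unique[OF trivial_limit_at_right_real])
  then show ?thesis by (simp add: V_def)
qed

section \<open>Continuity in the second point and the case of equal moduli\<close>

lemma omitted_away:
  assumes s: "s \<le> 1" and b: "norm b < s" "b \<noteq> 0"
  obtains \<eta> where "\<eta> > 0" "\<And>w q. w \<in> omitted s \<Longrightarrow> dist q (recip b) < \<eta> \<Longrightarrow> \<eta> \<le> norm (w - q)"
proof -
  have "open (recip ` (ball 0 s - {0}))" by (intro recip_open_image) (use s in \<open>auto intro: open_delete\<close>)
  moreover have "recip b \<in> recip ` (ball 0 s - {0})" using b by auto
  ultimately obtain e where e: "e > 0" "ball (recip b) e \<subseteq> recip ` (ball 0 s - {0})"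
    using open_contains_ball by blast
  \<comment> \<open>Halving the radius makes the bound uniform in \<open>q\<close>, as dominated
    convergence requires when the pole moves.\<close>
  have "e / 2 \<le> norm (w - q)" if w: "w \<in> omitted s" and q: "dist q (recip b) < e / 2" for w q
  proof -
    have "w \<notin> ball (recip b) e" using w e by (auto simp: omitted_def)
    then have "e \<le> dist (recip b) w" by simp
    then show ?thesis using q dist_triangle[of "recip b" w q] by (simp add: dist_norm norm_minus_commute)
  qed
  then show ?thesis using that[of "e/2"] e by simp
qed

lemma recip_isCont: "norm b < 1 \<Longrightarrow> b \<noteq> 0 \<Longrightarrow> isCont recip b"
  using holomorphic_on_imp_continuous_on[OF recip_hol] by (auto simp: continuous_on_eq_continuous_at open_delete)

lemma omitted_finite: "0 < s \<Longrightarrow> s \<le> 1 \<Longrightarrow> emeasure lborel (omitted s) < \<infinity>"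
proof -
  assume s: "0 < s" "s \<le> 1"
  obtain M where "\<And>w. w \<in> omitted s \<Longrightarrow> norm w \<le> M" using omitted_bounded[OF s] by blast
  then have "bounded (omitted s)" by (auto simp: bounded_iff)
  then show ?thesis by (rule emeasure_bounded_finite)
qed

lemma kern_le:
  assumes "0 < \<eta>" "\<eta> \<le> norm (w - p)" "0 < \<eta>'" "\<eta>' \<le> norm (w - q)"
  shows "norm (kern p q w) \<le> inverse \<eta> * inverse \<eta>'"
  unfolding norm_kern using assms by (intro mult_mono le_imp_inverse_le) auto

lemma omitted_energy_tendsto:
  assumes s: "0 < s" "s \<le> 1" and a: "norm a < s" "a \<noteq> 0" and b: "norm b < s" "b \<noteq> 0" and B: "B \<longlonglongrightarrow> b"
  shows "(\<lambda>j. omitted_energy s a (B j)) \<longlonglongrightarrow> omitted_energy s a b"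
proof -
  have b1: "norm b < 1" using b s by linarith
  obtain \<eta> where e: "\<eta> > 0" "\<And>w q. w \<in> omitted s \<Longrightarrow> dist q (recip b) < \<eta> \<Longrightarrow> \<eta> \<le> norm (w - q)"
    using omitted_away[OF s(2) b] by blast
  obtain \<eta>' where e': "\<eta>' > 0" "\<And>w q. w \<in> omitted s \<Longrightarrow> dist q (recip a) < \<eta>' \<Longrightarrow> \<eta>' \<le> norm (w - q)"
    using omitted_away[OF s(2) a] by blast
  have q: "(\<lambda>j. recip (B j)) \<longlonglongrightarrow> recip b"
    by (rule isCont_tendsto_compose[OF recip_isCont[OF b1 b(2)] B])
  have "\<forall>\<^sub>F j in sequentially. dist (recip (B j)) (recip b) < \<eta>"
    using tendstoD[OF q e(1)] .
  then obtain J where J: "\<And>j. j \<ge> J \<Longrightarrow> dist (recip (B j)) (recip b) < \<eta>"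
    by (auto simp: eventually_sequentially)
  have Eb: "omitted s \<in> sets borel" by (rule omitted_borel[OF s(2)])
  have "(\<lambda>j. omitted_energy s a (B (j + J))) \<longlonglongrightarrow> omitted_energy s a b"
    unfolding omitted_energy_def set_lebesgue_integral_def
  proof (rule integral_dominated_convergence[where w="\<lambda>w. indicator (omitted s) w *\<^sub>R (inverse \<eta>' * inverse \<eta>)"])
    show "integrable lborel (\<lambda>w. indicator (omitted s) w *\<^sub>R (inverse \<eta>' * inverse \<eta>))"
      using omitted_finite[OF s] Eb by (auto intro!: integrable_scaleR_left)
    show "AE w in lborel. (\<lambda>j. indicator (omitted s) w *\<^sub>R kern (recip a) (recip (B (j + J))) w) \<longlonglongrightarrow> indicator (omitted s) w *\<^sub>R kern (recip a) (recip b) w"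
    proof (intro AE_I2)
      fix w
      show "(\<lambda>j. indicator (omitted s) w *\<^sub>R kern (recip a) (recip (B (j + J))) w) \<longlonglongrightarrow> indicator (omitted s) w *\<^sub>R kern (recip a) (recip b) w"
      proof (cases "w \<in> omitted s")
        case True
        then have "w - recip b \<noteq> 0" using e(2)[OF True, of "recip b"] e(1) by auto
        then show ?thesis unfolding kern_def by (intro tendsto_intros LIMSEQ_ignore_initial_segment[OF q])
      qed simp
    qed
    show "AE w in lborel. norm (indicator (omitted s) w *\<^sub>R kern (recip a) (recip (B (j + J))) w) \<le> indicator (omitted s) w *\<^sub>R (inverse \<eta>' * inverse \<eta>)" for j
    proof (intro AE_I2)
      fix w
      show "norm (indicator (omitted s) w *\<^sub>R kern (recip a) (recip (B (j + J))) w) \<le> indicator (omitted s) w *\<^sub>R (inverse \<eta>' * inverse \<eta>)"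
        using kern_le[OF e'(1) e'(2)[of w "recip a"] e(1) e(2)[of w "recip (B (j + J))"]] J[of "j + J"] e'(1)
        by (cases "w \<in> omitted s") auto
    qed
  qed (use Eb in auto)
  then show ?thesis by (rule LIMSEQ_offset)
qed

lemma ker_coeff_tendsto:
  assumes b: "norm b < 1" "b \<noteq> 0" and B: "B \<longlonglongrightarrow> b" and B1: "\<And>j. norm (B j) < 1 \<and> B j \<noteq> 0"
  shows "(\<lambda>j. ker_coeff (B j) n) \<longlonglongrightarrow> ker_coeff b n"
proof (cases "n = 0")
  case True
  then show ?thesis using B1 b by (simp add: taylor_coeff_0 log_kernel_0)
next
  case False
  then have n: "n \<ge> 1" by simp
  have q: "(\<lambda>j. inverse (f (B j))) \<longlonglongrightarrow> inverse (f b)"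
    using isCont_tendsto_compose[OF recip_isCont[OF b] B] by (simp add: recip_def)
  have "(\<lambda>j. inverse (B j) ^ n / of_nat n + log_coeff (inv_coeff (inverse (f (B j)))) n) \<longlonglongrightarrow>
      inverse b ^ n / of_nat n + log_coeff (inv_coeff (inverse (f b))) n"
  proof (intro tendsto_intros B b log_coeff_tendsto)
    fix k show "(\<lambda>j. inv_coeff (inverse (f (B j))) k) \<longlonglongrightarrow> inv_coeff (inverse (f b)) k"
      unfolding inv_coeff_def by (cases "k = 1") (auto intro!: tendsto_intros q)
  qed (use n in simp)
  then show ?thesis using taylor_coeff_log_kernel[OF _ _ n] B1 b by simp
qed

text \<open>Cauchy's estimate is applied to the derivative of the kernel, since
  \<open>inverse_f_log_deriv\<close> expresses it, unlike the kernel itself, without a logarithm.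
  Injectivity separates the image of the circle of radius t from that of the closed annulus of the
  points \<open>c\<close>, which bounds the denominator uniformly.\<close>

lemma ker_coeff_uniform_bound:
  assumes r: "0 < r" "r \<le> \<rho>" "\<rho> < t" "t < 1"
  obtains M where "\<And>c n. r \<le> norm c \<Longrightarrow> norm c \<le> \<rho> \<Longrightarrow> norm (ker_coeff c n) * t ^ n \<le> M"
proof -
  have t0: "0 < t" using r by linarith
  have cr: "continuous_on (ball 0 1 - {0}) recip" by (rule holomorphic_on_imp_continuous_on[OF recip_hol])
  have cdr: "continuous_on (ball 0 1 - {0}) (deriv recip)"
    by (rule holomorphic_on_imp_continuous_on[OF holomorphic_deriv[OF recip_hol]]) (auto intro: open_delete)
  have "compact (recip ` sphere 0 t)"
    by (rule compact_continuous_image[OF continuous_on_subset[OF cr]]) (use r t0 in auto)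
  moreover have "compact (cball 0 \<rho> - ball (0::complex) r)" by (intro compact_diff) auto
  then have "compact (recip ` (cball 0 \<rho> - ball 0 r))"
    by (rule compact_continuous_image[OF continuous_on_subset[OF cr], rotated]) (use r in auto)
  then have "closed (recip ` (cball 0 \<rho> - ball 0 r))" by (rule compact_imp_closed)
  moreover have "recip ` sphere 0 t \<inter> recip ` (cball 0 \<rho> - ball 0 r) = {}"
  proof -
    have False if z: "norm z = t" "norm c \<le> \<rho>" "r \<le> norm c" "recip z = recip c" for z c
    proof -
      have "z = c" by (rule inj_onD[OF recip_inj z(4)]) (use z r t0 in auto)
      then show False using z r by simp
    qed
    then show ?thesis by fastforce
  qed
  ultimately have "\<exists>\<eta>>0. \<forall>z\<in>recip ` sphere 0 t. \<forall>c\<in>recip ` (cball 0 \<rho> - ball 0 r). \<eta> \<le> dist z c"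
    by (rule separate_compact_closed)
  then obtain \<eta> where e: "\<eta> > 0" "\<And>z c. z \<in> recip ` sphere 0 t \<Longrightarrow> c \<in> recip ` (cball 0 \<rho> - ball 0 r) \<Longrightarrow> \<eta> \<le> dist z c"
    by blast
  have "compact (deriv recip ` sphere 0 t)"
    by (rule compact_continuous_image[OF continuous_on_subset[OF cdr]]) (use r t0 in auto)
  then have "bounded (deriv recip ` sphere 0 t)" by (rule compact_imp_bounded)
  then obtain D where D0: "D > 0" "\<forall>x\<in>deriv recip ` sphere 0 t. norm x \<le> D"
    unfolding bounded_pos by blast
  have D: "D > 0" "norm (deriv recip z) \<le> D" if "norm z = t" for z
    using D0 that by auto
  define K where "K = D * inverse \<eta> + inverse t * inverse (t / \<rho> - 1)"
  have tr: "t / \<rho> - 1 > 0" using r by (simp add: field_simps)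
  have K0: "0 \<le> K" using D0 e tr t0 by (simp add: K_def)
  have bd: "norm (deriv (log_kernel f c) z) \<le> K" if c: "r \<le> norm c" "norm c \<le> \<rho>" and z: "norm z = t" for c z
  proof -
    have c1: "norm c < 1" "c \<noteq> 0" using c r by auto
    have z1: "norm z < 1" "z \<noteq> 0" "z \<noteq> c" using z r c t0 by auto
    have req: "recip = (\<lambda>z. inverse (f z))" by (simp add: recip_def[abs_def])
    have "z * deriv (log_kernel f c) z = z * deriv recip z * inverse (recip z - recip c) + 1 / (1 - z / c)"
      using inverse_f_log_deriv[OF c1 z1] by (simp add: req)
    moreover have "D = A * I + inverse z * inverse B" if "z * D = z * A * I + 1 / B" for A B D I
    proof -
      have "D = inverse z * (z * D)" using z1 by simp
      also have "\<dots> = A * I + inverse z * inverse B"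
        unfolding that using z1 by (simp add: distrib_left divide_inverse)
      finally show ?thesis .
    qed
    ultimately have eq: "deriv (log_kernel f c) z = deriv recip z * inverse (recip z - recip c) + inverse z * inverse (1 - z / c)"
      by blast
    have "norm (deriv recip z * inverse (recip z - recip c)) \<le> D * inverse \<eta>"
      unfolding norm_mult norm_inverse
      using D(2)[OF z] e(2)[of "recip z" "recip c"] e(1) D0(1) z c by (intro mult_mono le_imp_inverse_le) (auto simp: dist_norm)
    moreover have "norm (inverse z * inverse (1 - z / c)) \<le> inverse t * inverse (t / \<rho> - 1)"
    proof -
      have "t / \<rho> \<le> norm (z / c)" using z c r t0 c1 by (simp add: norm_divide frac_le)
      moreover have "norm (z / c) - 1 \<le> norm (1 - z / c)" using norm_triangle_ineq2[of "z / c" 1] by (simp add: norm_minus_commute)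
      ultimately have "t / \<rho> - 1 \<le> norm (1 - z / c)" by linarith
      then show ?thesis unfolding norm_mult norm_inverse z using tr t0 by (intro mult_mono le_imp_inverse_le) auto
    qed
    ultimately show ?thesis unfolding eq K_def by (intro norm_triangle_le) linarith
  qed
  have "norm (ker_coeff c n) * t ^ n \<le> K" if c: "r \<le> norm c" "norm c \<le> \<rho>" for c n
  proof (cases n)
    case 0
    have c1: "norm c < 1" "c \<noteq> 0" using c r by auto
    then show ?thesis using 0 K0 by (simp add: taylor_coeff_0 log_kernel_0)
  next
    case (Suc m)
    have c1: "norm c < 1" "c \<noteq> 0" using c r by auto
    let ?g = "deriv (log_kernel f c)"
    have g: "?g holomorphic_on ball 0 1" using log_kernel_hol[OF c1] by (intro holomorphic_deriv) auto
    have "norm ((deriv ^^ m) ?g 0) \<le> fact m * K / t ^ m"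
    proof (rule Cauchy_inequality)
      show "?g holomorphic_on ball 0 t" "continuous_on (cball 0 t) ?g"
        by (rule holomorphic_on_subset[OF g], use r in auto)
          (rule continuous_on_subset[OF holomorphic_on_imp_continuous_on[OF g]], use r in auto)
      show "norm (?g x) \<le> K" if "norm (0 - x) = t" for x using bd[OF c, of x] that by simp
    qed (use t0 in auto)
    moreover have "(deriv ^^ m) ?g 0 = (deriv ^^ n) (log_kernel f c) 0" by (simp add: Suc funpow_swap1)
    ultimately have "norm ((deriv ^^ n) (log_kernel f c) 0) \<le> fact m * K / t ^ m" by simp
    then have "norm ((deriv ^^ n) (log_kernel f c) 0) / fact n \<le> fact m * K / t ^ m / fact n"
      by (rule divide_right_mono) simp
    then have "norm (ker_coeff c n) \<le> fact m * K / t ^ m / fact n"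
      by (simp add: taylor_coeff_def norm_divide)
    then have "norm (ker_coeff c n) * t ^ n \<le> fact m * K / t ^ m / fact n * t ^ n"
      using t0 by (intro mult_right_mono) auto
    also have "\<dots> = K * (t / real n)"
    proof -
      have gen: "y * K / x / (N * y) * (t * x) = K * (t / N)" if "x \<noteq> 0" "y \<noteq> 0" for x y N :: real
        using that by simp
      have e: "fact n = real n * fact m" "t ^ n = t * t ^ m" by (simp_all add: Suc)
      show ?thesis unfolding e by (rule gen) (use t0 in auto)
    qed
    also have "\<dots> \<le> K * 1"
      using K0 r t0 by (intro mult_left_mono) (auto simp: Suc field_simps)
    finally show ?thesis by simp
  qed
  then show ?thesis using that by blast
qed

text \<open>Tannery's theorem applies with t chosen so that |\<zeta>| < t^2: one factor
  \<open>t ^ n\<close> is spent on the uniform bound for the moving coefficients, the other on the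
  summability of the fixed ones.\<close>

lemma pairing_tendsto:
  assumes a: "norm a < 1" "a \<noteq> 0" and b: "norm b < 1" "b \<noteq> 0" and B: "B \<longlonglongrightarrow> b"
    and B1: "\<And>j. norm b \<le> norm (B j) \<and> norm (B j) \<le> \<rho>" and z: "norm \<zeta> < 1" and \<rho>: "\<rho> < 1"
  shows "(\<lambda>j. pairing a (B j) \<zeta>) \<longlonglongrightarrow> pairing a b \<zeta>"
proof -
  obtain t where t: "max \<rho> (sqrt (norm \<zeta>)) < t" "t < 1"
    using dense[of "max \<rho> (sqrt (norm \<zeta>))" 1] z \<rho> by auto
  have t0: "0 < t" using t real_sqrt_ge_zero[OF norm_ge_zero[of \<zeta>]] by linarith
  have r\<rho>: "norm b \<le> \<rho>" using B1[of 0] by linarith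
  obtain M where M: "\<And>c n. norm b \<le> norm c \<Longrightarrow> norm c \<le> \<rho> \<Longrightarrow> norm (ker_coeff c n) * t ^ n \<le> M"
    using ker_coeff_uniform_bound[of "norm b" \<rho> t] b r\<rho> t by auto
  have zt: "norm \<zeta> < t * t"
  proof -
    have "sqrt (norm \<zeta>) * sqrt (norm \<zeta>) < t * t" using t t0 by (intro mult_strict_mono) auto
    then show ?thesis by simp
  qed
  have sA: "summable (\<lambda>n. norm (of_nat n * ker_coeff a n * of_real t ^ n) * M)"
    by (rule summable_mult2[OF ker_coeff_summable[OF a]]) (use t t0 in auto)
  have lim: "(\<lambda>j. of_nat n * ker_coeff a n * cnj (ker_coeff (B j) n) * \<zeta> ^ n) \<longlonglongrightarrow> of_nat n * ker_coeff a n * cnj (ker_coeff b n) * \<zeta> ^ n" for n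
  proof -
    have "norm (B j) < 1 \<and> B j \<noteq> 0" for j using B1[of j] b \<rho> by auto
    from ker_coeff_tendsto[OF b B this] show ?thesis by (intro tendsto_intros)
  qed
  have bd: "norm (of_nat n * ker_coeff a n * cnj (ker_coeff (B j) n) * \<zeta> ^ n) \<le> norm (of_nat n * ker_coeff a n * of_real t ^ n) * M" for n j
  proof -
    have "norm \<zeta> ^ n \<le> (t * t) ^ n" using zt by (intro power_mono) auto
    then have "norm (of_nat n * ker_coeff a n * cnj (ker_coeff (B j) n) * \<zeta> ^ n) \<le> norm (of_nat n * ker_coeff a n) * norm (ker_coeff (B j) n) * (t * t) ^ n"
      unfolding norm_mult complex_mod_cnj norm_power by (intro mult_left_mono) auto
    also have "\<dots> = (norm (of_nat n * ker_coeff a n) * t ^ n) * (norm (ker_coeff (B j) n) * t ^ n)"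
      by (simp add: power_mult_distrib mult_ac)
    also have "\<dots> \<le> (norm (of_nat n * ker_coeff a n) * t ^ n) * M"
      using M[of "B j" n] B1[of j] t0 by (intro mult_left_mono) auto
    finally show ?thesis using t0 by (simp add: norm_mult norm_power)
  qed
  define T where "T = (\<lambda>n j. of_nat n * ker_coeff a n * cnj (ker_coeff (B j) n) * \<zeta> ^ n)"
  define T' where "T' = (\<lambda>n. of_nat n * ker_coeff a n * cnj (ker_coeff b n) * \<zeta> ^ n)"
  define K where "K = (\<lambda>n. norm (of_nat n * ker_coeff a n * of_real t ^ n) * M)"
  have "(\<lambda>j. T n j) \<longlonglongrightarrow> T' n" for n unfolding T_def T'_def by (rule lim)
  moreover have "\<forall>\<^sub>F (n, j) in sequentially \<times>\<^sub>F sequentially. norm (T n j) \<le> K n"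
    by (rule always_eventually) (use bd in \<open>simp add: T_def K_def\<close>)
  moreover have "summable K" unfolding K_def by (rule sA)
  ultimately have "(\<lambda>j. \<Sum>n. T n j) \<longlonglongrightarrow> suminf T'"
    using tannerys_theorem[of T T' sequentially K] sequentially_bot by blast
  then show ?thesis unfolding pairing_def T_def T'_def .
qed

text \<open>Equal moduli, and with them the diagonal a = b, are reached by moving \<open>b\<close>
  outwards along its ray, where the strict case applies.\<close>

lemma omitted_energy_eq:
  assumes a: "norm a < 1" "a \<noteq> 0" and b: "norm b < 1" and ab: "norm a \<le> norm b" and s: "norm b < s" "s < 1"
  shows "Re (omitted_energy s a b) = - pi * ln (norm (1 - a * cnj b / of_real (s\<^sup>2))) - pi * Re (pairing a b (of_real (s\<^sup>2)))"
proof -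
  have b0: "b \<noteq> 0" using a ab by auto
  have s0: "s > 0" using s norm_ge_zero[of b] by linarith
  \<comment> \<open>With this choice the largest modulus \<open>(1 + \<delta>) * norm b\<close> is
    the mean of \<open>norm b\<close> and \<open>s\<close>.\<close>
  define \<delta> where "\<delta> = (s / norm b - 1) / 2"
  have d: "\<delta> > 0" using s b0 by (simp add: \<delta>_def field_simps)
  define \<rho> where "\<rho> = (1 + \<delta>) * norm b"
  have \<rho>s: "\<rho> < s" using s b0 by (simp add: \<rho>_def \<delta>_def field_simps)
  define B where "B = (\<lambda>j. of_real (1 + \<delta> * inverse (real (Suc j))) * b)"
  have "(\<lambda>j. complex_of_real (1 + \<delta> * inverse (real (Suc j))) * b) \<longlonglongrightarrow> of_real (1 + \<delta> * 0) * b"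
    by (intro tendsto_intros LIMSEQ_inverse_real_of_nat)
  then have B: "B \<longlonglongrightarrow> b" by (simp add: B_def)
  have nB: "norm (B j) = (1 + \<delta> * inverse (real (Suc j))) * norm b" for j
  proof -
    have "0 \<le> 1 + \<delta> * inverse (real (Suc j))" using d by (simp add: add_nonneg_nonneg)
    then show ?thesis unfolding B_def norm_mult norm_of_real by simp
  qed
  have Bb: "norm b < norm (B j)" for j unfolding nB using d b0 by simp
  have B\<rho>: "norm (B j) \<le> \<rho>" for j
    unfolding nB \<rho>_def using d by (intro mult_right_mono) (auto simp: field_simps)
  have s1: "norm (complex_of_real (s\<^sup>2)) < 1" using s s0 by (simp add: norm_power power_less_one_iff)
  have eqj: "Re (omitted_energy s a (B j)) = - pi * ln (norm (1 - a * cnj (B j) / of_real (s\<^sup>2))) - pi * Re (pairing a (B j) (of_real (s\<^sup>2)))" for j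
    by (rule omitted_energy_eq_less[OF a]) (use Bb[of j] B\<rho>[of j] \<rho>s ab s in linarith)+
  have ne: "norm (1 - a * cnj b / of_real (s\<^sup>2)) \<noteq> 0"
  proof -
    have "norm a * norm b < s * s" using ab s s0 by (intro mult_strict_mono) (auto intro: order_le_less_trans)
    then have "norm (a * cnj b / of_real (s\<^sup>2)) < 1" using s0 by (simp add: norm_divide norm_mult power2_eq_square field_simps)
    then show ?thesis by auto
  qed
  have L: "(\<lambda>j. Re (omitted_energy s a (B j))) \<longlonglongrightarrow> Re (omitted_energy s a b)"
    by (intro tendsto_Re omitted_energy_tendsto[OF s0 _ _ a(2) s(1) b0 B]) (use s ab in auto)
  have "(\<lambda>j. - pi * ln (norm (1 - a * cnj (B j) / of_real (s\<^sup>2))) - pi * Re (pairing a (B j) (of_real (s\<^sup>2))))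
     \<longlonglongrightarrow> - pi * ln (norm (1 - a * cnj b / of_real (s\<^sup>2))) - pi * Re (pairing a b (of_real (s\<^sup>2)))"
    by (intro tendsto_intros B ne pairing_tendsto[OF a b b0 B _ s1, of \<rho>]) (use Bb B\<rho> \<rho>s s s0 in \<open>auto intro: less_imp_le\<close>)
  then show ?thesis using L LIMSEQ_unique unfolding eqj by blast
qed

section \<open>Goluzin-type inequalities\<close>

lemma omitted_kern_bound:
  assumes s: "s \<le> 1" and a: "norm a < s" "a \<noteq> 0" and b: "norm b < s" "b \<noteq> 0"
  obtains K where "\<And>w. w \<in> omitted s \<Longrightarrow> norm (kern (recip a) (recip b) w) \<le> K"
proof -
  obtain \<eta> where e: "\<eta> > 0" "\<And>w q. w \<in> omitted s \<Longrightarrow> dist q (recip b) < \<eta> \<Longrightarrow> \<eta> \<le> norm (w - q)"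
    using omitted_away[OF s b] by blast
  obtain \<eta>' where e': "\<eta>' > 0" "\<And>w q. w \<in> omitted s \<Longrightarrow> dist q (recip a) < \<eta>' \<Longrightarrow> \<eta>' \<le> norm (w - q)"
    using omitted_away[OF s a] by blast
  have "norm (kern (recip a) (recip b) w) \<le> inverse \<eta>' * inverse \<eta>" if "w \<in> omitted s" for w
    using kern_le[OF e'(1) e'(2)[OF that, of "recip a"] e(1) e(2)[OF that, of "recip b"]] e e' by simp
  then show ?thesis using that by blast
qed

lemma omitted_kern_integrable:
  assumes s: "0 < s" "s \<le> 1" and a: "norm a < s" "a \<noteq> 0" and b: "norm b < s" "b \<noteq> 0"
  shows "set_integrable lborel (omitted s) (kern (recip a) (recip b))"
proof -
  obtain K where K: "\<And>w. w \<in> omitted s \<Longrightarrow> norm (kern (recip a) (recip b) w) \<le> K"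
    using omitted_kern_bound[OF s(2) a b] by blast
  have Eb: "omitted s \<in> sets borel" by (rule omitted_borel[OF s(2)])
  show ?thesis unfolding set_integrable_def
  proof (rule Bochner_Integration.integrable_bound[of _ "\<lambda>w. indicator (omitted s) w *\<^sub>R K"])
    show "integrable lborel (\<lambda>w. indicator (omitted s) w *\<^sub>R K)"
      using omitted_finite[OF s] Eb by (auto intro!: integrable_scaleR_left)
    show "(\<lambda>w. indicator (omitted s) w *\<^sub>R kern (recip a) (recip b) w) \<in> borel_measurable lborel"
      using borel_measurable_scaleR[OF borel_measurable_indicator kern_measurable, of "omitted s"] Eb by simp
    show "AE w in lborel. norm (indicator (omitted s) w *\<^sub>R kern (recip a) (recip b) w) \<le> norm (indicator (omitted s) w *\<^sub>R K)"
      using order_trans[OF K abs_ge_self] by (intro AE_I2) (auto simp: indicator_def)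
  qed
qed

lemma omitted_energy_diag_nonneg:
  shows "0 \<le> Re (omitted_energy s a a)"
proof -
  have "kern p p w = of_real ((norm (inverse (w - p)))\<^sup>2)" for p w
    unfolding kern_def using complex_norm_square[of "inverse (w - p)"] by simp
  then have "omitted_energy s a a = (LINT w|lborel. of_real (indicator (omitted s) w * (norm (inverse (w - recip a)))\<^sup>2))"
    unfolding omitted_energy_def set_lebesgue_integral_def by (simp add: scaleR_conv_of_real)
  also have "\<dots> = of_real (LINT w|lborel. indicator (omitted s) w * (norm (inverse (w - recip a)))\<^sup>2)"
    by (rule integral_complex_of_real)
  finally show ?thesis by (simp add: Bochner_Integration.integral_nonneg)
qed

text \<open>The combination is the integral of the squared modulus of
  \<open>1 / (w - recip a) - 1 / (w - recip b)\<close>.\<close>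

lemma omitted_energy_diff_nonneg:
  assumes s: "0 < s" "s \<le> 1" and a: "norm a < s" "a \<noteq> 0" and b: "norm b < s" "b \<noteq> 0"
  shows "0 \<le> Re (omitted_energy s a a) + Re (omitted_energy s b b) - 2 * Re (omitted_energy s a b)"
proof -
  let ?p = "recip a" and ?q = "recip b"
  let ?K = "\<lambda>w. kern ?p ?p w + kern ?q ?q w - kern ?p ?q w - kern ?q ?p w"
  note i = omitted_kern_integrable[OF s]
  have K: "?K w = of_real ((norm (inverse (w - ?p) - inverse (w - ?q)))\<^sup>2)" for w
    unfolding kern_def using complex_norm_square[of "inverse (w - ?p) - inverse (w - ?q)"]
    by (simp add: algebra_simps)
  have "omitted_energy s b a = cnj (omitted_energy s a b)"
  proof -
    have "kern ?q ?p = (\<lambda>w. cnj (kern ?p ?q w))"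
      by (rule ext) (simp only: kern_def complex_cnj_mult complex_cnj_cnj mult.commute)
    then show ?thesis unfolding omitted_energy_def set_integral_cnj[symmetric] by (simp only:)
  qed
  then have "Re (omitted_energy s a a) + Re (omitted_energy s b b) - 2 * Re (omitted_energy s a b)
      = Re (omitted_energy s a a + omitted_energy s b b - omitted_energy s a b - omitted_energy s b a)"
    by simp
  also have "omitted_energy s a a + omitted_energy s b b - omitted_energy s a b - omitted_energy s b a = (LINT w:omitted s|lborel. ?K w)"
    unfolding omitted_energy_def
    by (simp add: set_integral_add set_integral_diff i[OF a a] i[OF b b] i[OF a b] i[OF b a])
  also have "\<dots> = (LINT w|lborel. of_real (indicator (omitted s) w * (norm (inverse (w - ?p) - inverse (w - ?q)))\<^sup>2))"
    unfolding K set_lebesgue_integral_def by (simp add: scaleR_conv_of_real)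
  also have "\<dots> = of_real (LINT w|lborel. indicator (omitted s) w * (norm (inverse (w - ?p) - inverse (w - ?q)))\<^sup>2)"
    by (rule integral_complex_of_real)
  finally show ?thesis by (simp add: Bochner_Integration.integral_nonneg)
qed

lemma pairing_sums:
  assumes a: "norm a < 1" "a \<noteq> 0" and b: "norm b < 1" "b \<noteq> 0" and z: "norm \<zeta> < 1"
  shows "(\<lambda>n. of_nat n * ker_coeff a n * cnj (ker_coeff b n) * \<zeta> ^ n) sums pairing a b \<zeta>"
  using summable_norm_cancel[OF pairing_summable(1)[OF a b z]] unfolding pairing_def by (rule summable_sums)

lemma Re_pairing_sums:
  assumes a: "norm a < 1" "a \<noteq> 0" and b: "norm b < 1" "b \<noteq> 0" and s: "0 < s" "s < 1"
  shows "(\<lambda>n. real n * Re (ker_coeff a n * cnj (ker_coeff b n)) * s ^ (2 * n)) sums Re (pairing a b (of_real (s\<^sup>2)))"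
proof -
  have "norm (complex_of_real (s\<^sup>2)) < 1" using s by (simp add: norm_power power_less_one_iff)
  from sums_Re[OF pairing_sums[OF a b this]]
  have "(\<lambda>n. Re (of_nat n * ker_coeff a n * cnj (ker_coeff b n) * complex_of_real (s\<^sup>2) ^ n)) sums Re (pairing a b (of_real (s\<^sup>2)))" .
  moreover have "Re (of_nat n * ker_coeff a n * cnj (ker_coeff b n) * complex_of_real (s\<^sup>2) ^ n) = real n * Re (ker_coeff a n * cnj (ker_coeff b n)) * s ^ (2 * n)" for n
  proof -
    have pw: "complex_of_real (s\<^sup>2) ^ n = complex_of_real (s ^ (2 * n))" by (simp only: power_mult of_real_power)
    have R: "Re (of_real r * w) = r * Re w" for r w by simp
    have E: "of_nat n * ker_coeff a n * cnj (ker_coeff b n) * complex_of_real (s\<^sup>2) ^ n = of_real (real n * s ^ (2 * n)) * (ker_coeff a n * cnj (ker_coeff b n))"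
      unfolding pw by (simp only: of_real_mult of_real_of_nat_eq mult_ac)
    show ?thesis unfolding E R by (simp only: mult_ac)
  qed
  ultimately show ?thesis by simp
qed

text \<open>Positivity of the energy gives the bound for each s < 1, where the energy formula is
  available; in a finite sum s may then tend to 1.\<close>

lemma ker_coeff_energy:
  assumes a: "norm a < 1" "a \<noteq> 0"
  shows "(\<Sum>n\<le>N. real n * (norm (ker_coeff a n))\<^sup>2) \<le> - ln (1 - (norm a)\<^sup>2)"
proof -
  have le: "(\<Sum>n\<le>N. real n * (norm (ker_coeff a n))\<^sup>2 * s ^ (2 * n)) \<le> - ln (1 - (norm a)\<^sup>2 / s\<^sup>2)" if s: "norm a < s" "s < 1" for s
  proof -
    have s0: "0 < s" using s norm_ge_zero[of a] by linarith
    have sq: "Re (ker_coeff a n * cnj (ker_coeff a n)) = (norm (ker_coeff a n))\<^sup>2" for n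
      using complex_norm_square[of "ker_coeff a n"] by (metis Re_complex_of_real)
    have "(\<Sum>n\<le>N. real n * (norm (ker_coeff a n))\<^sup>2 * s ^ (2 * n)) \<le> Re (pairing a a (of_real (s\<^sup>2)))"
      using Re_pairing_sums[OF a a s0 s(2)] unfolding sq by (intro sum_le_suminf[THEN order_trans]) (use s0 in \<open>auto simp: sums_iff\<close>)
    also have "\<dots> \<le> - ln (norm (1 - a * cnj a / of_real (s\<^sup>2)))"
    proof -
      have "0 \<le> - pi * ln (norm (1 - a * cnj a / of_real (s\<^sup>2))) - pi * Re (pairing a a (of_real (s\<^sup>2)))"
        using omitted_energy_diag_nonneg[of s a] omitted_energy_eq[OF a a(1) order_refl s] by simp
      also have "\<dots> = pi * (- ln (norm (1 - a * cnj a / of_real (s\<^sup>2))) - Re (pairing a a (of_real (s\<^sup>2))))"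
        by (simp add: algebra_simps)
      finally show ?thesis using pi_gt_zero by (auto simp: zero_le_mult_iff)
    qed
    also have "norm (1 - a * cnj a / of_real (s\<^sup>2)) = 1 - (norm a)\<^sup>2 / s\<^sup>2"
    proof -
      have "(norm a)\<^sup>2 / s\<^sup>2 < 1" using s s0 by (simp add: power_strict_mono)
      moreover have "1 - a * cnj a / of_real (s\<^sup>2) = of_real (1 - (norm a)\<^sup>2 / s\<^sup>2)"
        using complex_norm_square[of a] by simp
      ultimately show ?thesis by (simp only: norm_of_real; simp)
    qed
    finally show ?thesis .
  qed
  show ?thesis
  proof (rule tendsto_le[OF trivial_limit_at_left_real])
    have "(norm a)\<^sup>2 < 1" using a by (simp add: power_less_one_iff)
    then have n: "1 - (norm a)\<^sup>2 / 1\<^sup>2 \<noteq> 0" by simp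
    have "((\<lambda>s. - ln (1 - (norm a)\<^sup>2 / s\<^sup>2)) \<longlongrightarrow> - ln (1 - (norm a)\<^sup>2 / 1\<^sup>2)) (at_left 1)"
      by (intro tendsto_intros n) auto
    then show "((\<lambda>s. - ln (1 - (norm a)\<^sup>2 / s\<^sup>2)) \<longlongrightarrow> - ln (1 - (norm a)\<^sup>2)) (at_left 1)" by simp
    have "((\<lambda>s. \<Sum>n\<le>N. real n * (norm (ker_coeff a n))\<^sup>2 * s ^ (2 * n)) \<longlongrightarrow> (\<Sum>n\<le>N. real n * (norm (ker_coeff a n))\<^sup>2 * 1 ^ (2 * n))) (at_left 1)"
      by (intro tendsto_intros)
    then show "((\<lambda>s. \<Sum>n\<le>N. real n * (norm (ker_coeff a n))\<^sup>2 * s ^ (2 * n)) \<longlongrightarrow> (\<Sum>n\<le>N. real n * (norm (ker_coeff a n))\<^sup>2)) (at_left 1)" by simp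
    show "\<forall>\<^sub>F s in at_left 1. (\<Sum>n\<le>N. real n * (norm (ker_coeff a n))\<^sup>2 * s ^ (2 * n)) \<le> - ln (1 - (norm a)\<^sup>2 / s\<^sup>2)"
      using eventually_at_left_real[OF a(1)] by eventually_elim (use le in auto)
  qed
qed

text \<open>Positivity is now applied to the difference of the two pole functions; equal moduli make
  the two diagonal logarithms coincide.\<close>

lemma ker_coeff_diff_energy:
  assumes a: "norm a < 1" "a \<noteq> 0" and ba: "norm b = norm a"
  shows "(\<Sum>n\<le>N. real n * (norm (ker_coeff a n - ker_coeff b n))\<^sup>2) \<le> 2 * ln (norm (1 - a * cnj b)) - 2 * ln (1 - (norm a)\<^sup>2)"
proof -
  have b: "norm b < 1" "b \<noteq> 0" using a ba by auto
  have le: "(\<Sum>n\<le>N. real n * (norm (ker_coeff a n - ker_coeff b n))\<^sup>2 * s ^ (2 * n)) \<le> 2 * ln (norm (1 - a * cnj b / of_real (s\<^sup>2))) - 2 * ln (1 - (norm a)\<^sup>2 / s\<^sup>2)" if s: "norm a < s" "s < 1" for s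
  proof -
    have s0: "0 < s" using s norm_ge_zero[of a] by linarith
    have sq: "Re (ker_coeff a n * cnj (ker_coeff a n)) + Re (ker_coeff b n * cnj (ker_coeff b n)) - 2 * Re (ker_coeff a n * cnj (ker_coeff b n)) = (norm (ker_coeff a n - ker_coeff b n))\<^sup>2" for n
      unfolding cmod_power2 by (simp add: power2_eq_square algebra_simps)
    have "(\<lambda>n. real n * Re (ker_coeff a n * cnj (ker_coeff a n)) * s ^ (2 * n) + real n * Re (ker_coeff b n * cnj (ker_coeff b n)) * s ^ (2 * n)
       - 2 * (real n * Re (ker_coeff a n * cnj (ker_coeff b n)) * s ^ (2 * n))) sums
       (Re (pairing a a (of_real (s\<^sup>2))) + Re (pairing b b (of_real (s\<^sup>2))) - 2 * Re (pairing a b (of_real (s\<^sup>2))))"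
      by (intro sums_add sums_diff sums_mult Re_pairing_sums a b s0 s)
    moreover have "real n * Re (ker_coeff a n * cnj (ker_coeff a n)) * s ^ (2 * n) + real n * Re (ker_coeff b n * cnj (ker_coeff b n)) * s ^ (2 * n)
       - 2 * (real n * Re (ker_coeff a n * cnj (ker_coeff b n)) * s ^ (2 * n)) = real n * (norm (ker_coeff a n - ker_coeff b n))\<^sup>2 * s ^ (2 * n)" for n
      unfolding sq[symmetric] by (simp only: ring_distribs mult_ac)
    ultimately have sm: "(\<lambda>n. real n * (norm (ker_coeff a n - ker_coeff b n))\<^sup>2 * s ^ (2 * n)) sums
       (Re (pairing a a (of_real (s\<^sup>2))) + Re (pairing b b (of_real (s\<^sup>2))) - 2 * Re (pairing a b (of_real (s\<^sup>2))))" by simp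
    have "(\<Sum>n\<le>N. real n * (norm (ker_coeff a n - ker_coeff b n))\<^sup>2 * s ^ (2 * n)) \<le> Re (pairing a a (of_real (s\<^sup>2))) + Re (pairing b b (of_real (s\<^sup>2))) - 2 * Re (pairing a b (of_real (s\<^sup>2)))"
      using sm by (intro sum_le_suminf[THEN order_trans]) (use s0 in \<open>auto simp: sums_iff\<close>)
    also have "\<dots> \<le> 2 * ln (norm (1 - a * cnj b / of_real (s\<^sup>2))) - ln (norm (1 - a * cnj a / of_real (s\<^sup>2))) - ln (norm (1 - b * cnj b / of_real (s\<^sup>2)))"
    proof -
      have "0 \<le> Re (omitted_energy s a a) + Re (omitted_energy s b b) - 2 * Re (omitted_energy s a b)"
        by (rule omitted_energy_diff_nonneg) (use s s0 a b ba in auto)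
      also have "\<dots> = pi * (2 * ln (norm (1 - a * cnj b / of_real (s\<^sup>2))) - ln (norm (1 - a * cnj a / of_real (s\<^sup>2))) - ln (norm (1 - b * cnj b / of_real (s\<^sup>2)))
         - (Re (pairing a a (of_real (s\<^sup>2))) + Re (pairing b b (of_real (s\<^sup>2))) - 2 * Re (pairing a b (of_real (s\<^sup>2)))))"
      proof -
        have s': "norm b < s" and ab: "norm a \<le> norm b" using s ba by auto
        show ?thesis
          unfolding omitted_energy_eq[OF a a(1) order_refl s] omitted_energy_eq[OF b b(1) order_refl s' s(2)] omitted_energy_eq[OF a b(1) ab s' s(2)]
          by (simp add: algebra_simps)
      qed
      finally show ?thesis using pi_gt_zero by (auto simp: zero_le_mult_iff)
    qed
    finally have fin: "(\<Sum>n\<le>N. real n * (norm (ker_coeff a n - ker_coeff b n))\<^sup>2 * s ^ (2 * n)) \<le> 2 * ln (norm (1 - a * cnj b / of_real (s\<^sup>2))) - ln (norm (1 - a * cnj a / of_real (s\<^sup>2))) - ln (norm (1 - b * cnj b / of_real (s\<^sup>2)))" .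
    have nn: "norm (1 - c * cnj c / of_real (s\<^sup>2)) = 1 - (norm a)\<^sup>2 / s\<^sup>2" if "norm c = norm a" for c
    proof -
      have "(norm a)\<^sup>2 / s\<^sup>2 < 1" using s s0 by (simp add: power_strict_mono)
      moreover have "1 - c * cnj c / of_real (s\<^sup>2) = of_real (1 - (norm a)\<^sup>2 / s\<^sup>2)"
        using complex_norm_square[of c] that by simp
      ultimately show ?thesis by (simp only: norm_of_real; simp)
    qed
    show ?thesis using fin unfolding nn[OF refl] nn[OF ba] by simp
  qed
  show ?thesis
  proof (rule tendsto_le[OF trivial_limit_at_left_real])
    have "(norm a)\<^sup>2 < 1" using a by (simp add: power_less_one_iff)
    then have n: "1 - (norm a)\<^sup>2 / 1\<^sup>2 \<noteq> 0" by simp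
    have n2: "norm (1 - a * cnj b / of_real (1\<^sup>2)) \<noteq> 0"
    proof -
      have "norm (a * cnj b) < 1" using a ba by (simp add: norm_mult power2_eq_square[symmetric] power_less_one_iff)
      then show ?thesis by auto
    qed
    have "((\<lambda>s. 2 * ln (norm (1 - a * cnj b / of_real (s\<^sup>2))) - 2 * ln (1 - (norm a)\<^sup>2 / s\<^sup>2)) \<longlongrightarrow> 2 * ln (norm (1 - a * cnj b / of_real (1\<^sup>2))) - 2 * ln (1 - (norm a)\<^sup>2 / 1\<^sup>2)) (at_left 1)"
      by (intro tendsto_intros n n2) auto
    then show "((\<lambda>s. 2 * ln (norm (1 - a * cnj b / of_real (s\<^sup>2))) - 2 * ln (1 - (norm a)\<^sup>2 / s\<^sup>2)) \<longlongrightarrow> 2 * ln (norm (1 - a * cnj b)) - 2 * ln (1 - (norm a)\<^sup>2)) (at_left 1)" by simp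
    have "((\<lambda>s. \<Sum>n\<le>N. real n * (norm (ker_coeff a n - ker_coeff b n))\<^sup>2 * s ^ (2 * n)) \<longlongrightarrow> (\<Sum>n\<le>N. real n * (norm (ker_coeff a n - ker_coeff b n))\<^sup>2 * 1 ^ (2 * n))) (at_left 1)"
      by (intro tendsto_intros)
    then show "((\<lambda>s. \<Sum>n\<le>N. real n * (norm (ker_coeff a n - ker_coeff b n))\<^sup>2 * s ^ (2 * n)) \<longlongrightarrow> (\<Sum>n\<le>N. real n * (norm (ker_coeff a n - ker_coeff b n))\<^sup>2)) (at_left 1)" by simp
    show "\<forall>\<^sub>F s in at_left 1. (\<Sum>n\<le>N. real n * (norm (ker_coeff a n - ker_coeff b n))\<^sup>2 * s ^ (2 * n)) \<le> 2 * ln (norm (1 - a * cnj b / of_real (s\<^sup>2))) - 2 * ln (1 - (norm a)\<^sup>2 / s\<^sup>2)"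
      using eventually_at_left_real[OF a(1)] by eventually_elim (use le in auto)
  qed
qed

lemma ker_coeff_energy_summable:
  assumes a: "norm a < 1" "a \<noteq> 0"
  shows "summable (\<lambda>n. real n * (norm (ker_coeff a n))\<^sup>2)"
  by (rule bounded_imp_summable[OF _ ker_coeff_energy[OF a]]) auto

text \<open>The sets \<open>omitted (S j)\<close> decrease to a null set, and the kernel is bounded
  on the largest of them because \<open>S\<close> starts above both moduli and so keeps the poles
  away.\<close>

lemma omitted_energy_full_tendsto:
  assumes null: "omitted 1 \<in> null_sets lborel" and a: "norm a < 1" "a \<noteq> 0" and b: "norm b < 1" "b \<noteq> 0"
  defines "S \<equiv> \<lambda>j. 1 - (1 - max (norm a) (norm b)) / (real j + 2)"
  shows "(\<lambda>j. omitted_energy (S j) a b) \<longlonglongrightarrow> 0"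
proof -
  define m where "m = max (norm a) (norm b)"
  have m: "0 < m" "m < 1" using a b by (auto simp: m_def less_max_iff_disj)
  have S: "m < S j" "S j < 1" "S 0 \<le> S j" "0 < S j" for j
  proof -
    have "(1 - m) / (real j + 2) < 1 - m" using m by (simp add: divide_less_eq)
    then have "m < 1 - (1 - m) / (real j + 2)" by linarith
    then show "m < S j" by (simp only: S_def m_def)
    then show "0 < S j" using m by linarith
    show "S j < 1" using m by (simp add: S_def m_def[symmetric])
    have "(1 - m) / (real j + 2) \<le> (1 - m) / (real 0 + 2)" using m by (intro divide_left_mono) auto
    then show "S 0 \<le> S j" by (simp add: S_def m_def)
  qed
  have Eb: "omitted (S j) \<in> sets borel" for j using S by (intro omitted_borel) (auto intro: less_imp_le)
  obtain K where K: "\<And>w. w \<in> omitted (S 0) \<Longrightarrow> norm (kern (recip a) (recip b) w) \<le> K"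
    using omitted_kern_bound[of "S 0" a b] S[of 0] a b by (auto simp: m_def)
  have "(\<lambda>j. LINT w|lborel. indicator (omitted (S j)) w *\<^sub>R kern (recip a) (recip b) w) \<longlonglongrightarrow> (LINT w::complex|lborel. (0::complex))"
  proof (rule integral_dominated_convergence[where w="\<lambda>w. indicator (omitted (S 0)) w *\<^sub>R K"
        and s="\<lambda>j w. indicator (omitted (S j)) w *\<^sub>R kern (recip a) (recip b) w" and f="\<lambda>w. 0"])
    show "integrable lborel (\<lambda>w. indicator (omitted (S 0)) w *\<^sub>R K)"
      using omitted_finite[of "S 0"] S[of 0] Eb by (auto intro!: integrable_scaleR_left)
    show "(\<lambda>w. indicator (omitted (S j)) w *\<^sub>R kern (recip a) (recip b) w) \<in> borel_measurable lborel" for j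
      using borel_measurable_scaleR[OF borel_measurable_indicator kern_measurable, of "omitted (S j)"] Eb by simp
    have "AE w in lborel. w \<notin> omitted 1" by (rule AE_not_in[OF null])
    then show "AE w in lborel. (\<lambda>j. indicator (omitted (S j)) w *\<^sub>R kern (recip a) (recip b) w) \<longlonglongrightarrow> 0"
    proof eventually_elim
      case (elim w)
      then obtain z where z: "z \<in> ball 0 1 - {0}" "w = recip z" unfolding omitted_def by blast
      have "(\<lambda>j. 1 - (1 - m) / (real j + 2)) \<longlonglongrightarrow> 1" by real_asymp
      then have "\<forall>\<^sub>F j in sequentially. norm z < 1 - (1 - m) / (real j + 2)"
        by (rule order_tendstoD) (use z in auto)
      then have "\<forall>\<^sub>F j in sequentially. indicator (omitted (S j)) w *\<^sub>R kern (recip a) (recip b) w = 0"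
      proof eventually_elim
        case (elim j)
        then have "z \<in> ball 0 (S j) - {0}" using z by (simp add: S_def m_def)
        then have "w \<notin> omitted (S j)" unfolding omitted_def z(2) by blast
        then show ?case by simp
      qed
      then show ?case by (rule tendsto_eventually)
    qed
    show "AE w in lborel. norm (indicator (omitted (S j)) w *\<^sub>R kern (recip a) (recip b) w) \<le> indicator (omitted (S 0)) w *\<^sub>R K" for j
    proof (intro AE_I2)
      fix w
      show "norm (indicator (omitted (S j)) w *\<^sub>R kern (recip a) (recip b) w) \<le> indicator (omitted (S 0)) w *\<^sub>R K"
      proof (cases "w \<in> omitted (S 0)")
        case True
        then have "0 \<le> K" using K[OF True] norm_ge_zero order_trans by blast
        then show ?thesis using K[OF True] True by (simp add: indicator_def)
      next
        case False
        then have "w \<notin> omitted (S j)" using omitted_mono[OF S(3)] by blast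
        then show ?thesis using False by simp
      qed
    qed
  qed simp
  then show ?thesis by (simp add: omitted_energy_def set_lebesgue_integral_def)
qed

text \<open>The energy formula loses its energy term as s tends to 1. The passage to the limit under
  the infinite sum is justified by the energies of \<open>a\<close> and \<open>b\<close>, which are
  finite without any weight s and dominate the mixed terms.\<close>

lemma full_pairing:
  assumes null: "omitted 1 \<in> null_sets lborel" and a: "norm a < 1" "a \<noteq> 0" and b: "norm b < 1" and ab: "norm a \<le> norm b"
  shows "(\<lambda>n. real n * Re (ker_coeff a n * cnj (ker_coeff b n))) sums (- ln (norm (1 - a * cnj b)))"
proof -
  have b0: "b \<noteq> 0" using a ab by auto
  define S where "S = (\<lambda>j. 1 - (1 - max (norm a) (norm b)) / (real j + 2))"
  have S: "norm b < S j" "S j < 1" "0 < S j" for j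
  proof -
    have "(1 - norm b) / (real j + 2) < 1 - norm b" using b by (simp add: divide_less_eq)
    moreover have "max (norm a) (norm b) = norm b" using ab by simp
    ultimately show "norm b < S j" unfolding S_def by simp
    then show "0 < S j" using norm_ge_zero[of b] by linarith
    show "S j < 1" using b a by (simp add: S_def)
  qed
  have S1: "S \<longlonglongrightarrow> 1" unfolding S_def by real_asymp
  let ?T = "\<lambda>n. real n * Re (ker_coeff a n * cnj (ker_coeff b n))"
  have bd: "\<bar>?T n\<bar> \<le> real n * (norm (ker_coeff a n))\<^sup>2 + real n * (norm (ker_coeff b n))\<^sup>2" for n
  proof -
    have "\<bar>Re (ker_coeff a n * cnj (ker_coeff b n))\<bar> \<le> norm (ker_coeff a n) * norm (ker_coeff b n)"
      using abs_Re_le_cmod[of "ker_coeff a n * cnj (ker_coeff b n)"] by (simp add: norm_mult)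
    also have "\<dots> \<le> (norm (ker_coeff a n))\<^sup>2 + (norm (ker_coeff b n))\<^sup>2"
    proof -
      have "0 \<le> norm (ker_coeff a n) * norm (ker_coeff b n)" by simp
      then show ?thesis using sum_squares_bound[of "norm (ker_coeff a n)" "norm (ker_coeff b n)"] by linarith
    qed
    finally show ?thesis by (simp add: abs_mult mult_left_mono distrib_left[symmetric])
  qed
  have sK: "summable (\<lambda>n. real n * (norm (ker_coeff a n))\<^sup>2 + real n * (norm (ker_coeff b n))\<^sup>2)"
    by (intro summable_add ker_coeff_energy_summable a b b0)
  have sT: "summable ?T" by (rule summable_comparison_test'[OF sK, of 0]) (use bd in simp)
  define TT where "TT = (\<lambda>n j. ?T n * S j ^ (2 * n))"
  define T where "T = ?T"
  define K where "K = (\<lambda>n. real n * (norm (ker_coeff a n))\<^sup>2 + real n * (norm (ker_coeff b n))\<^sup>2)"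
  have "(\<lambda>j. \<Sum>n. TT n j) \<longlonglongrightarrow> suminf T"
  proof -
    have "(\<lambda>j. TT n j) \<longlonglongrightarrow> T n" for n
    proof -
      have "(\<lambda>j. ?T n * S j ^ (2 * n)) \<longlonglongrightarrow> ?T n * 1 ^ (2 * n)" by (intro tendsto_intros S1)
      then show ?thesis by (simp add: TT_def T_def)
    qed
    moreover have "\<forall>\<^sub>F (n, j) in sequentially \<times>\<^sub>F sequentially. norm (TT n j) \<le> K n"
    proof (rule always_eventually, clarify)
      fix n j
      have "norm (TT n j) = \<bar>?T n\<bar> * S j ^ (2 * n)" using S(3)[of j] by (simp add: TT_def abs_mult)
      also have "\<dots> \<le> \<bar>?T n\<bar> * 1" using S(2,3)[of j] by (intro mult_left_mono power_le_one) auto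
      finally show "norm (TT n j) \<le> K n" using bd[of n] unfolding K_def by linarith
    qed
    moreover have "summable K" unfolding K_def by (rule sK)
    ultimately show ?thesis using tannerys_theorem[of TT T sequentially K] sequentially_bot by blast
  qed
  moreover have "(\<Sum>n. TT n j) = - ln (norm (1 - a * cnj b / of_real ((S j)\<^sup>2))) - Re (omitted_energy (S j) a b) / pi" for j
    using sums_unique[OF Re_pairing_sums[OF a b b0 S(3,2)[of j]]] omitted_energy_eq[OF a b ab S(1,2)[of j]]
    by (simp add: TT_def field_simps)
  ultimately have 1: "(\<lambda>j. - ln (norm (1 - a * cnj b / of_real ((S j)\<^sup>2))) - Re (omitted_energy (S j) a b) / pi) \<longlonglongrightarrow> suminf ?T" by (simp add: T_def)
  have n2: "norm (1 - a * cnj b / of_real (1\<^sup>2)) \<noteq> 0"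
  proof -
    have "norm a * norm b < 1 * 1" using a b by (intro mult_strict_mono) auto
    then have "norm (a * cnj b) < 1" by (simp add: norm_mult)
    then show ?thesis by auto
  qed
  have "(\<lambda>j. - ln (norm (1 - a * cnj b / of_real ((S j)\<^sup>2))) - Re (omitted_energy (S j) a b) / pi) \<longlonglongrightarrow> - ln (norm (1 - a * cnj b / of_real (1\<^sup>2))) - Re 0 / pi"
    unfolding S_def by (intro tendsto_intros S1[unfolded S_def] n2 omitted_energy_full_tendsto[OF null a b b0]) auto
  then have "suminf ?T = - ln (norm (1 - a * cnj b))" using LIMSEQ_unique[OF 1] by simp
  then show ?thesis using summable_sums[OF sT] by simp
qed

end

section \<open>Growth along rays and the Hayman index\<close>

text \<open>At index 0 both sums on the right contribute 0, because x / 0 = 0; hence the hypothesis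
  on the product there.\<close>

lemma weighted_Cauchy_Schwarz:
  fixes x y :: "nat \<Rightarrow> complex"
  assumes z: "0 \<in> I \<Longrightarrow> x 0 * y 0 = 0"
  shows "norm (\<Sum>n\<in>I. x n * y n) \<le> sqrt (\<Sum>n\<in>I. real n * (norm (x n))\<^sup>2) * sqrt (\<Sum>n\<in>I. (norm (y n))\<^sup>2 / real n)"
proof -
  have "norm (\<Sum>n\<in>I. x n * y n) \<le> (\<Sum>n\<in>I. norm (x n * y n))" by (rule norm_sum)
  also have "\<dots> = (\<Sum>n\<in>I. (sqrt n * norm (x n)) * (norm (y n) / sqrt n))"
  proof (rule sum.cong[OF refl])
    fix n assume "n \<in> I"
    then show "norm (x n * y n) = (sqrt n * norm (x n)) * (norm (y n) / sqrt n)"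
      using z by (cases "n = 0") (auto simp: norm_mult)
  qed
  also have "\<dots> \<le> sqrt ((\<Sum>n\<in>I. (sqrt n * norm (x n))\<^sup>2) * (\<Sum>n\<in>I. (norm (y n) / sqrt n)\<^sup>2))"
    by (rule real_le_rsqrt) (rule Cauchy_Schwarz_ineq_sum)
  also have "\<dots> = sqrt (\<Sum>n\<in>I. real n * (norm (x n))\<^sup>2) * sqrt (\<Sum>n\<in>I. (norm (y n))\<^sup>2 / real n)"
    by (simp add: real_sqrt_mult power_mult_distrib power_divide)
  finally show ?thesis .
qed

lemma ln_one_minus_sums:
  assumes "\<bar>x\<bar> < 1"
  shows "(\<lambda>n. x ^ n / real n) sums (- ln (1 - x))"
  using sums_minus[OF ln_series'[of "- x"]] assms by simp

context schlicht_fun begin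

text \<open>The second difference of kernel values at the points a and -a is the sum of (A_n(a) -
  A_n(-a)) (a^n - (-a)^n), where A_n is \<open>ker_coeff\<close>, and Cauchy-Schwarz bounds it by 2
  L. For an odd function its real part is twice the logarithm of |a f'(a) / f(a)|.\<close>

lemma log_deriv_odd:
  assumes odd: "\<And>z. norm z < 1 \<Longrightarrow> f (- z) = - f z" and a: "norm a < 1" "a \<noteq> 0"
  shows "norm (a * deriv f a / f a) \<le> (1 + (norm a)\<^sup>2) / (1 - (norm a)\<^sup>2)"
proof -
  have b: "norm (- a) < 1" "- a \<noteq> 0" and ab: "a \<noteq> - a" using a by auto
  define x where "x = (norm a)\<^sup>2"
  have x: "0 < x" "x < 1" using a by (auto simp: x_def power_less_one_iff)
  define L where "L = ln (1 + x) - ln (1 - x)"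
  have L0: "0 \<le> L" using x by (simp add: L_def)
  let ?x = "\<lambda>n. ker_coeff a n - ker_coeff (- a) n" and ?y = "\<lambda>n. a ^ n - (- a) ^ n"
  have D1: "((\<lambda>z. f (- z)) has_field_derivative deriv f (- (- a)) * (- 1)) (at (- a))"
    by (rule DERIV_chain2[where f=f and g="\<lambda>z. - z", OF f_field_deriv]) (use a in \<open>auto intro!: derivative_eq_intros\<close>)
  have D2: "((\<lambda>z. f (- z)) has_field_derivative - deriv f (- a)) (at (- a))"
  proof (rule has_field_derivative_transform_within_open[OF DERIV_minus[OF f_field_deriv[OF b(1)]] open_ball])
    show "- a \<in> ball 0 1" using a by simp
    show "- f z = f (- z)" if "z \<in> ball 0 1" for z using odd[of z] that by simp
  qed
  have d: "deriv f (- a) = deriv f a" using DERIV_unique[OF D1 D2] by simp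
  have fa: "f (- a) = - f a" by (rule odd[OF a(1)])
  have fa0: "f a \<noteq> 0" using f_eq_0_iff[OF a(1)] a by simp
  have i1: "inverse (f (- a)) - inverse (f a) = - (2 * inverse (f a))" and i2: "inverse (f a) - inverse (f (- a)) = 2 * inverse (f a)"
    unfolding fa by simp_all
  have q: "2 * norm (inverse (f a)) * norm a * norm a / (2 * norm a) = norm a / norm (f a)"
    using a fa0 by (simp add: norm_inverse norm_divide field_simps)
  have aa: "a - - a = 2 * a" "- a - a = - (2 * a)" by simp_all
  have R1: "Re (log_kernel f a (- a)) = ln (norm a / norm (f a))"
    unfolding Re_log_kernel[OF a b ab] i1 aa norm_minus_cancel norm_mult using q by simp
  have R2: "Re (log_kernel f (- a) a) = ln (norm a / norm (f a))"
    unfolding Re_log_kernel[OF b a ab[symmetric]] i2 aa norm_minus_cancel norm_mult using q by simp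
  have R3: "Re (log_kernel f (- a) (- a)) = Re (log_kernel f a a)"
    unfolding Re_log_kernel_diag[OF a] Re_log_kernel_diag[OF b] d fa by simp
  have sm: "(\<lambda>n. ?x n * ?y n) sums (log_kernel f a a - log_kernel f a (- a) - (log_kernel f (- a) a - log_kernel f (- a) (- a)))"
  proof -
    have "(\<lambda>n. (ker_coeff a n * a ^ n - ker_coeff a n * (- a) ^ n) - (ker_coeff (- a) n * a ^ n - ker_coeff (- a) n * (- a) ^ n)) sums
       (log_kernel f a a - log_kernel f a (- a) - (log_kernel f (- a) a - log_kernel f (- a) (- a)))"
      by (intro sums_diff taylor_sums[where r=1] log_kernel_hol a b)
    moreover have "(ker_coeff a n * a ^ n - ker_coeff a n * (- a) ^ n) - (ker_coeff (- a) n * a ^ n - ker_coeff (- a) n * (- a) ^ n) = ?x n * ?y n" for n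
      by (simp add: algebra_simps)
    ultimately show ?thesis by simp
  qed
  have par: "norm (\<Sum>n<N. ?x n * ?y n) \<le> 2 * L" for N
  proof -
    have 1: "(\<Sum>n<N. real n * (norm (?x n))\<^sup>2) \<le> 2 * L"
    proof -
      have "norm (1 - a * cnj (- a)) = 1 + x"
      proof -
        have "1 - a * cnj (- a) = of_real (1 + x)" using complex_norm_square[of a] by (simp add: x_def)
        then show ?thesis using x by (simp only: norm_of_real; simp)
      qed
      then have "(\<Sum>n\<le>N. real n * (norm (?x n))\<^sup>2) \<le> 2 * L"
        using ker_coeff_diff_energy[OF a, of "- a" N] by (simp add: L_def x_def)
      moreover have "(\<Sum>n<N. real n * (norm (?x n))\<^sup>2) \<le> (\<Sum>n\<le>N. real n * (norm (?x n))\<^sup>2)"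
        by (rule sum_mono2) auto
      ultimately show ?thesis by linarith
    qed
    have 2: "(\<Sum>n<N. (norm (?y n))\<^sup>2 / real n) \<le> 2 * L"
    proof -
      \<comment> \<open>Only odd n contribute, and this form presents the sum as a difference of two
        logarithm series.\<close>
      have y: "(norm (?y n))\<^sup>2 = 2 * x ^ n - 2 * (- x) ^ n" for n
      proof (cases "even n")
        case False
        then have yn: "?y n = 2 * a ^ n" by (simp add: power_minus_odd)
        have "norm (?y n) = 2 * norm a ^ n" unfolding yn by (simp add: norm_mult norm_power)
        moreover have "x ^ n = (norm a ^ n)\<^sup>2" unfolding x_def power_mult[symmetric] by (simp only: mult.commute)
        ultimately have "(norm (?y n))\<^sup>2 = 4 * x ^ n" by (simp add: power_mult_distrib)
        then show ?thesis using False by (simp add: power_minus_odd)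
      qed simp
      have "(\<lambda>n. 2 * (x ^ n / real n) - 2 * ((- x) ^ n / real n)) sums (2 * (- ln (1 - x)) - 2 * (- ln (1 - (- x))))"
        by (intro sums_diff sums_mult ln_one_minus_sums) (use x in auto)
      then have s: "(\<lambda>n. (norm (?y n))\<^sup>2 / real n) sums (2 * L)"
        unfolding y by (simp add: L_def diff_divide_distrib algebra_simps)
      have "(\<Sum>n<N. (norm (?y n))\<^sup>2 / real n) \<le> (\<Sum>n. (norm (?y n))\<^sup>2 / real n)"
        by (rule sum_le_suminf[OF sums_summable[OF s]]) simp_all
      then show ?thesis using sums_unique[OF s] by simp
    qed
    have "norm (\<Sum>n<N. ?x n * ?y n) \<le> sqrt (\<Sum>n<N. real n * (norm (?x n))\<^sup>2) * sqrt (\<Sum>n<N. (norm (?y n))\<^sup>2 / real n)"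
      by (rule weighted_Cauchy_Schwarz) simp
    also have "\<dots> \<le> sqrt (2 * L) * sqrt (2 * L)"
      using 1 2 L0 by (intro mult_mono real_sqrt_le_mono) (auto intro!: sum_nonneg)
    also have "\<dots> = 2 * L" using L0 by simp
    finally show ?thesis .
  qed
  have "norm (log_kernel f a a - log_kernel f a (- a) - (log_kernel f (- a) a - log_kernel f (- a) (- a))) \<le> 2 * L"
    using sm par unfolding sums_def by (intro LIMSEQ_le_const2[OF tendsto_norm]) auto
  then have "Re (log_kernel f a a - log_kernel f a (- a) - (log_kernel f (- a) a - log_kernel f (- a) (- a))) \<le> 2 * L"
    by (rule order_trans[OF complex_Re_le_cmod])
  then have "ln (norm (deriv f a) * (norm a)\<^sup>2 / (norm (f a))\<^sup>2) - ln (norm a / norm (f a)) \<le> L"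
    using R1 R2 R3 Re_log_kernel_diag[OF a] by simp
  moreover have "norm (deriv f a) > 0" using f_deriv_nonzero[OF a(1)] by simp
  moreover have "ln (norm (deriv f a) * (norm a)\<^sup>2 / (norm (f a))\<^sup>2) - ln (norm a / norm (f a)) = ln (norm (a * deriv f a / f a))"
  proof -
    have "norm (deriv f a) * (norm a)\<^sup>2 / (norm (f a))\<^sup>2 / (norm a / norm (f a)) = norm (a * deriv f a / f a)"
      using a fa0 by (simp add: norm_mult norm_divide power2_eq_square field_simps)
    moreover have "norm (deriv f a) * (norm a)\<^sup>2 / (norm (f a))\<^sup>2 > 0" "norm a / norm (f a) > 0"
      using a fa0 \<open>norm (deriv f a) > 0\<close> by auto
    ultimately show ?thesis by (simp only: ln_divide_pos[symmetric])
  qed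
  ultimately have "ln (norm (a * deriv f a / f a)) \<le> ln ((1 + x) / (1 - x))"
    using x by (simp add: L_def ln_div)
  moreover have "norm (a * deriv f a / f a) > 0" using a fa0 \<open>norm (deriv f a) > 0\<close> by simp
  moreover have "(1 + x) / (1 - x) > 0" using x by simp
  ultimately show ?thesis by (simp add: x_def)
qed

end

text \<open>Half the logarithm of \<open>f z / z\<close>, taken at z^2, defines the square root
  without a branch cut. Equal values force z = w or z = -w, and oddness excludes the latter except
  at 0.\<close>

lemma square_root_transform:
  assumes "schlicht f"
  obtains h where "schlicht h" "\<And>z. norm z < 1 \<Longrightarrow> (h z)\<^sup>2 = f (z\<^sup>2)" "\<And>z. h (- z) = - h z"
proof -
  interpret schlicht_fun f by unfold_locales (rule assms)
  define h where "h = (\<lambda>z. z * exp (log_ratio f (z\<^sup>2) / 2))"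
  have sq: "(h z)\<^sup>2 = f (z\<^sup>2)" if "norm z < 1" for z
  proof -
    have n: "norm (z\<^sup>2) < 1" using that by (simp add: norm_power power_less_one_iff)
    have "(exp (log_ratio f (z\<^sup>2) / 2))\<^sup>2 = exp (log_ratio f (z\<^sup>2))" by (simp flip: exp_double)
    then show ?thesis unfolding log_ratio_exp[OF n] h_def power_mult_distrib by simp
  qed
  have odd: "h (- z) = - h z" for z by (simp add: h_def)
  have "schlicht h"
    unfolding schlicht_def
  proof (intro conjI)
    have "(\<lambda>z. log_ratio f (z\<^sup>2)) holomorphic_on ball 0 1"
      by (rule holomorphic_on_compose_gen[OF _ log_ratio_hol, unfolded o_def])
        (auto intro!: holomorphic_intros simp: norm_power power_less_one_iff)
    then show h: "h holomorphic_on ball 0 1" unfolding h_def by (intro holomorphic_intros) auto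
    show "inj_on h (ball 0 1)"
    proof (rule inj_onI)
      fix z w assume z: "z \<in> ball 0 1" and w: "w \<in> ball 0 1" and e: "h z = h w"
      have n: "norm (u\<^sup>2) < 1" if "u \<in> ball 0 1" for u :: complex using that by (simp add: norm_power power_less_one_iff)
      have "f (z\<^sup>2) = f (w\<^sup>2)" using sq[of z] sq[of w] e z w by simp
      then have "z\<^sup>2 = w\<^sup>2" using inj_onD[OF f_inj] n[OF z] n[OF w] by simp
      then have "z = w \<or> z = - w" by (simp add: power2_eq_iff)
      moreover have "z = w" if "z = - w"
      proof -
        have "h w = - h w" using e that odd[of w] by simp
        then have "h w = 0" by simp
        then show ?thesis using that by (simp add: h_def)
      qed
      ultimately show "z = w" by blast
    qed
    show "h 0 = 0" by (simp add: h_def)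
    have l: "(log_ratio f has_field_derivative deriv (log_ratio f) 0) (at (0\<^sup>2))" using log_ratio_field_deriv[of 0] by simp
    have "((\<lambda>z. log_ratio f (z\<^sup>2)) has_field_derivative deriv (log_ratio f) 0 * 0) (at 0)"
      by (rule DERIV_chain2[where f="log_ratio f" and g="\<lambda>z. z\<^sup>2", OF l]) (auto intro!: derivative_eq_intros)
    then have "((\<lambda>z. log_ratio f (z\<^sup>2)) has_field_derivative 0) (at 0)" by simp
    then have "(h has_field_derivative 1) (at 0)"
      unfolding h_def by (auto intro!: derivative_eq_intros simp: log_ratio_0)
    then show "deriv h 0 = 1" by (rule DERIV_imp_deriv)
  qed
  then show ?thesis using that sq odd by blast
qed

context schlicht_fun begin

text \<open>With z = a^2 the quantity z f'(z) / f(z) equals a h'(a) / h(a) for the odd function h,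
  so the bound in the square of |a| becomes a bound in |z|.\<close>

lemma log_deriv_bound:
  assumes z: "norm z < 1" "z \<noteq> 0"
  shows "norm (z * deriv f z / f z) \<le> (1 + norm z) / (1 - norm z)"
proof -
  obtain h where h: "schlicht h" "\<And>z. norm z < 1 \<Longrightarrow> (h z)\<^sup>2 = f (z\<^sup>2)" "\<And>z. h (- z) = - h z"
    using square_root_transform[OF schlicht] by blast
  interpret h: schlicht_fun h by unfold_locales (rule h(1))
  define a where "a = csqrt z"
  have az: "a\<^sup>2 = z" by (simp add: a_def)
  have na: "(norm a)\<^sup>2 = norm z" using az by (metis norm_power)
  have a: "norm a < 1" "a \<noteq> 0"
    using na z az by (auto simp: power_less_one_iff abs_square_less_1[symmetric]) (metis abs_norm_cancel abs_square_less_1 na)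
  have ha: "h a \<noteq> 0" using h.f_eq_0_iff[OF a(1)] a by simp
  have "((\<lambda>z. (h z)\<^sup>2) has_field_derivative 2 * h a * deriv h a) (at a)"
    using h.f_field_deriv[OF a(1)] by (auto intro!: derivative_eq_intros)
  moreover have "((\<lambda>z. (h z)\<^sup>2) has_field_derivative deriv f z * (2 * a)) (at a)"
  proof (rule has_field_derivative_transform_within_open[of "\<lambda>z. f (z\<^sup>2)" _ _ "ball 0 1"])
    have "(f has_field_derivative deriv f z) (at (a\<^sup>2))" using f_field_deriv[OF z(1)] az by simp
    then show "((\<lambda>z. f (z\<^sup>2)) has_field_derivative deriv f z * (2 * a)) (at a)"
      by (rule DERIV_chain2) (auto intro!: derivative_eq_intros)
  qed (use a h(2) in auto)
  ultimately have "2 * h a * deriv h a = deriv f z * (2 * a)" by (rule DERIV_unique)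
  then have "deriv h a = deriv f z * a / h a" using ha by (simp add: field_simps)
  then have "a * deriv h a / h a = a\<^sup>2 * deriv f z / (h a)\<^sup>2" by (simp add: power2_eq_square)
  also have "\<dots> = z * deriv f z / f z" using h(2)[OF a(1)] az by simp
  finally show ?thesis using h.log_deriv_odd[OF h(3) a] na by simp
qed

text \<open>The logarithm of |f(r e)| (1 - r)^2 / r, in a form that makes sense at r = 0 and
  vanishes there.\<close>

definition lgrow :: "complex \<Rightarrow> real \<Rightarrow> real" where
  "lgrow e r = Re (log_ratio f (of_real r * e)) + 2 * ln (1 - r)"

lemma exp_lgrow:
  assumes e: "norm e = 1" and r: "0 < r" "r < 1"
  shows "exp (lgrow e r) = norm (f (of_real r * e)) * (1 - r)\<^sup>2 / r"
proof -
  have n: "norm (of_real r * e) < 1" using e r by (simp add: norm_mult)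
  have "exp (2 * ln (1 - r)) = (1 - r)\<^sup>2" using r by (simp add: exp_double)
  moreover have "norm (f (of_real r * e)) = r * exp (Re (log_ratio f (of_real r * e)))"
    unfolding log_ratio_exp[OF n] using e r by (simp add: norm_mult)
  ultimately show ?thesis using r by (simp add: lgrow_def exp_add)
qed

text \<open>The bound on the logarithmic derivative says precisely that the radial derivative is
  nonpositive. The extremal case is the Koebe function, for which \<open>lgrow\<close> is constant
  in its direction of growth.\<close>

lemma lgrow_antimono:
  assumes e: "norm e = 1" and r: "0 \<le> r" "r \<le> s" "s < 1"
  shows "lgrow e s \<le> lgrow e r"
proof (rule DERIV_nonpos_imp_decreasing_open[OF r(2)])
  have n: "norm (of_real t * e) < 1" if "0 \<le> t" "t < 1" for t using e that by (simp add: norm_mult)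
  have d: "(lgrow e has_real_derivative Re (deriv (log_ratio f) (of_real t * e) * e) - 2 / (1 - t)) (at t)" if t: "0 \<le> t" "t < 1" for t
  proof -
    have "((\<lambda>t. of_real t * e) has_vector_derivative e) (at t)"
      by (auto intro!: derivative_eq_intros simp: has_vector_derivative_def scaleR_conv_of_real)
    from field_vector_diff_chain_at[OF this log_ratio_field_deriv[OF n[OF t]]]
    have "((\<lambda>t. log_ratio f (of_real t * e)) has_vector_derivative e * deriv (log_ratio f) (of_real t * e)) (at t)"
      by (simp add: o_def)
    then have "((\<lambda>t. Re (log_ratio f (of_real t * e))) has_vector_derivative Re (e * deriv (log_ratio f) (of_real t * e))) (at t)"
      by (rule bounded_linear.has_vector_derivative[OF bounded_linear_Re])
    then have "((\<lambda>t. Re (log_ratio f (of_real t * e))) has_real_derivative Re (deriv (log_ratio f) (of_real t * e) * e)) (at t)"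
      by (simp add: has_real_derivative_iff_has_vector_derivative mult.commute)
    moreover have "((\<lambda>t. 2 * ln (1 - t)) has_real_derivative - 2 / (1 - t)) (at t)"
      using t by (auto intro!: derivative_eq_intros)
    ultimately show ?thesis unfolding lgrow_def using DERIV_add by fastforce
  qed
  show "continuous_on {r..s} (lgrow e)"
  proof (intro continuous_at_imp_continuous_on ballI)
    fix t assume "t \<in> {r..s}"
    then have "0 \<le> t" "t < 1" using r by auto
    from DERIV_isCont[OF d[OF this]] show "isCont (lgrow e) t" .
  qed
  fix t assume "r < t" "t < s"
  then have t: "0 < t" "t < 1" using r by auto
  let ?z = "of_real t * e"
  have z: "norm ?z < 1" "?z \<noteq> 0" using n[of t] t e by auto
  have nz: "norm ?z = t" using e t by (simp add: norm_mult)
  have "?z * deriv f ?z / f ?z = 1 + ?z * deriv (log_ratio f) ?z"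
    unfolding deriv_f_log_ratio[OF z(1)] log_ratio_exp[OF z(1)] using z by simp
  then have "Re (1 + ?z * deriv (log_ratio f) ?z) \<le> (1 + t) / (1 - t)"
    using log_deriv_bound[OF z] complex_Re_le_cmod[of "?z * deriv f ?z / f ?z"] unfolding nz by (metis order_trans)
  moreover have "Re (?z * deriv (log_ratio f) ?z) = t * Re (deriv (log_ratio f) ?z * e)"
    by (simp add: algebra_simps)
  ultimately have "1 + t * Re (deriv (log_ratio f) ?z * e) \<le> (1 + t) / (1 - t)" by simp
  also have "(1 + t) / (1 - t) = 1 + t * (2 / (1 - t))" using t by (simp add: field_simps)
  finally have "t * Re (deriv (log_ratio f) ?z * e) \<le> t * (2 / (1 - t))" by linarith
  then have "Re (deriv (log_ratio f) ?z * e) \<le> 2 / (1 - t)" using mult_le_cancel_left_pos[OF t(1)] by blast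
  then show "\<exists>y. (lgrow e has_real_derivative y) (at t) \<and> y \<le> 0"
    using d[of t] t by (intro exI[of _ "Re (deriv (log_ratio f) ?z * e) - 2 / (1 - t)"]) auto
qed

lemma lgrow_nonpos: "norm e = 1 \<Longrightarrow> 0 \<le> r \<Longrightarrow> r < 1 \<Longrightarrow> lgrow e r \<le> 0"
  using lgrow_antimono[of e 0 r] by (simp add: lgrow_def log_ratio_0)

section \<open>The Hayman index and a direction in which it is attained\<close>

lemma max_modulus_attained:
  assumes r: "0 < r" "r < 1"
  obtains e where "norm e = 1" "max_modulus r f = norm (f (of_real r * e))"
proof -
  have c: "continuous_on (sphere 0 r) (\<lambda>z. norm (f z))"
    by (intro continuous_intros continuous_on_subset[OF holomorphic_on_imp_continuous_on[OF f_hol]]) (use r in auto)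
  have "sphere (0::complex) r \<noteq> {}" using r by (auto intro!: exI[of _ "of_real r"])
  then obtain z where z: "z \<in> sphere 0 r" "\<And>w. w \<in> sphere 0 r \<Longrightarrow> norm (f w) \<le> norm (f z)"
    using continuous_attains_sup[OF compact_sphere _ c] by blast
  have "max_modulus r f = norm (f z)"
    unfolding max_modulus_def by (rule cSup_eq_maximum) (use z in auto)
  then show ?thesis using z r by (intro that[of "z / of_real r"]) (auto simp: norm_divide)
qed

lemma max_modulus_ge:
  assumes r: "0 < r" "r < 1" and e: "norm e = 1"
  shows "norm (f (of_real r * e)) \<le> max_modulus r f"
  unfolding max_modulus_def
proof (rule cSup_upper)
  have c: "continuous_on (sphere 0 r) (\<lambda>z. norm (f z))"
    by (intro continuous_intros continuous_on_subset[OF holomorphic_on_imp_continuous_on[OF f_hol]]) (use r in auto)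
  show "bdd_above ((\<lambda>z. norm (f z)) ` sphere 0 r)"
    using compact_continuous_image[OF c compact_sphere] by (intro bounded_imp_bdd_above compact_imp_bounded)
  show "norm (f (of_real r * e)) \<in> (\<lambda>z. norm (f z)) ` sphere 0 r"
    using r e by (auto simp: norm_mult)
qed

definition max_growth :: "real \<Rightarrow> real" where
  "max_growth r = max_modulus r f * (1 - r)\<^sup>2 / r"

lemma max_growth_attained:
  assumes r: "0 < r" "r < 1"
  obtains e where "norm e = 1" "max_growth r = exp (lgrow e r)"
  using max_modulus_attained[OF r] exp_lgrow[OF _ r] unfolding max_growth_def by metis

lemma max_growth_ge:
  assumes r: "0 < r" "r < 1" and e: "norm e = 1"
  shows "exp (lgrow e r) \<le> max_growth r"
  unfolding max_growth_def exp_lgrow[OF e r]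
  using max_modulus_ge[OF r e] r by (intro divide_right_mono mult_right_mono) auto

lemma max_growth_antimono:
  assumes r: "0 < r" "r \<le> s" "s < 1"
  shows "max_growth s \<le> max_growth r"
proof -
  obtain e where e: "norm e = 1" "max_growth s = exp (lgrow e s)" using max_growth_attained[of s] r by auto
  then have "max_growth s \<le> exp (lgrow e r)" using lgrow_antimono[OF e(1), of r s] r by simp
  also have "\<dots> \<le> max_growth r" using max_growth_ge[of r e] r e by simp
  finally show ?thesis .
qed

text \<open>\<open>Lim\<close> carries information only when the limit exists. It does, since
  \<open>max_growth\<close> is monotone and positive: the limit is its infimum, and the extra factor
  1 / r tends to 1.\<close>

lemma hayman_index_limit:
  shows "(max_growth \<longlongrightarrow> hayman_index f) (at_left 1)" and "0 < r \<Longrightarrow> r < 1 \<Longrightarrow> hayman_index f \<le> max_growth r"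
proof -
  define L where "L = Inf (max_growth ` {0<..<1})"
  have pos: "0 < max_growth r" if "0 < r" "r < 1" for r
    using max_growth_attained[OF that] by (metis exp_gt_zero)
  have bdd: "bdd_below (max_growth ` {0<..<1})"
    by (rule bdd_belowI[of _ 0]) (use pos in \<open>auto intro: less_imp_le\<close>)
  have L: "L \<le> max_growth r" if "0 < r" "r < 1" for r
    unfolding L_def using that by (intro cInf_lower bdd) auto
  have lim: "(max_growth \<longlongrightarrow> L) (at_left 1)"
  proof (rule order_tendstoI)
    fix c assume "c < L"
    then have "\<And>r. 0 < r \<Longrightarrow> r < 1 \<Longrightarrow> c < max_growth r" using L by (meson order_less_le_trans)
    then show "\<forall>\<^sub>F r in at_left 1. c < max_growth r"
      using eventually_at_left_real[of 0 "1::real"] by (auto elim: eventually_mono)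
  next
    fix c assume "L < c"
    then obtain s where s: "0 < s" "s < 1" "max_growth s < c"
      using cInf_lessD[of "max_growth ` {0<..<1}" c] unfolding L_def by auto
    show "\<forall>\<^sub>F r in at_left 1. max_growth r < c"
      using eventually_at_left_real[OF s(2)]
    proof eventually_elim
      case (elim r)
      then have "max_growth r \<le> max_growth s" using s(1) by (intro max_growth_antimono) auto
      then show ?case using s(3) by simp
    qed
  qed
  have "((\<lambda>r. r * max_growth r) \<longlongrightarrow> 1 * L) (at_left 1)"
    by (intro tendsto_intros lim)
  moreover have "\<forall>\<^sub>F r in at_left 1. r * max_growth r = (1 - r)^2 * max_modulus r f"
    using eventually_at_left_real[OF zero_less_one] by eventually_elim (auto simp: max_growth_def)
  ultimately have "((\<lambda>r. (1 - r)^2 * max_modulus r f) \<longlongrightarrow> 1 * L) (at_left 1)"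
    by (rule Lim_transform_eventually)
  then have "((\<lambda>r. (1 - r)^2 * max_modulus r f) \<longlongrightarrow> L) (at_left 1)" by simp
  then have "hayman_index f = L"
    unfolding hayman_index_def by (intro tendsto_Lim) simp_all
  then show "(max_growth \<longlongrightarrow> hayman_index f) (at_left 1)" "0 < r \<Longrightarrow> r < 1 \<Longrightarrow> hayman_index f \<le> max_growth r"
    using lim L by auto
qed

lemma lgrow_tendsto:
  assumes "E \<longlonglongrightarrow> e" "\<And>j. norm (E j) = 1" "norm e = 1" "0 \<le> r" "r < 1"
  shows "(\<lambda>j. lgrow (E j) r) \<longlonglongrightarrow> lgrow e r"
proof -
  have "isCont (log_ratio f) (of_real r * e)"
    using log_ratio_field_deriv[of "of_real r * e"] assms DERIV_isCont by (simp add: norm_mult) blast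
  then show ?thesis unfolding lgrow_def
    by (intro tendsto_intros isCont_tendsto_compose[of _ "log_ratio f"] assms)
qed

text \<open>Maximising directions at radii tending to 1 have an accumulation point. At a fixed r,
  monotonicity along each of these rays carries the lower bound from the larger radius down to r,
  where it passes to the limit direction.\<close>

lemma growth_direction:
  obtains e where "norm e = 1" "\<And>r. 0 < r \<Longrightarrow> r < 1 \<Longrightarrow> hayman_index f \<le> exp (lgrow e r)"
proof -
  define R where "R = (\<lambda>j. 1 - 1 / (real j + 2))"
  have R: "0 < R j" "R j < 1" for j by (auto simp: R_def field_simps)
  have R1: "R \<longlonglongrightarrow> 1" unfolding R_def by real_asymp
  have "\<forall>j. \<exists>e. norm e = 1 \<and> max_growth (R j) = exp (lgrow e (R j))"
    using max_growth_attained[OF R] by blast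
  then obtain E where E: "\<And>j. norm (E j) = 1" "\<And>j. max_growth (R j) = exp (lgrow (E j) (R j))" by metis
  have "\<forall>j. E j \<in> sphere 0 1" using E by simp
  then obtain e g where e: "e \<in> sphere 0 1" "strict_mono g" "(E \<circ> g) \<longlonglongrightarrow> e"
    using compact_sphere[of 0 1] unfolding compact_def by blast
  have ne: "norm e = 1" using e by simp
  have "hayman_index f \<le> exp (lgrow e r)" if r: "0 < r" "r < 1" for r
  proof (rule LIMSEQ_le_const)
    show "(\<lambda>j. exp (lgrow ((E \<circ> g) j) r)) \<longlonglongrightarrow> exp (lgrow e r)"
      by (intro tendsto_exp lgrow_tendsto e ne) (use E r in auto)
    have "\<forall>\<^sub>F j in sequentially. r < R (g j)"
      using order_tendstoD(1)[OF LIMSEQ_subseq_LIMSEQ[OF R1 e(2)], of r] r by (simp add: o_def)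
    then obtain J where J: "\<And>j. j \<ge> J \<Longrightarrow> r < R (g j)" by (auto simp: eventually_sequentially)
    show "\<exists>N. \<forall>j\<ge>N. hayman_index f \<le> exp (lgrow ((E \<circ> g) j) r)"
    proof (intro exI allI impI)
      fix j assume "J \<le> j"
      then have "r < R (g j)" by (rule J)
      then have "lgrow (E (g j)) (R (g j)) \<le> lgrow (E (g j)) r" using lgrow_antimono[OF E(1)] r R by simp
      then have "max_growth (R (g j)) \<le> exp (lgrow (E (g j)) r)" using E(2) by simp
      then show "hayman_index f \<le> exp (lgrow ((E \<circ> g) j) r)" using hayman_index_limit(2)[OF R, of "g j"] by simp
    qed
  qed
  then show ?thesis using that ne by blast
qed

section \<open>Bazilevich's inequality and its equality case\<close>

text \<open>For the Koebe function \<open>z / (1 - cnj e * z)^2\<close> both \<open>ray_dev\<close> and \<open>koebe_dev\<close> vanish. In a direction of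
  maximal growth \<open>ray_dev e r\<close> tends to \<open>koebe_dev e\<close> as \<open>r\<close> tends to 1.\<close>

definition ray_dev :: "complex \<Rightarrow> real \<Rightarrow> nat \<Rightarrow> complex" where
  "ray_dev e r n = ker_coeff (of_real r * e) n + cnj (of_real r * e) ^ n / of_nat n"

definition koebe_dev :: "complex \<Rightarrow> nat \<Rightarrow> complex" where
  "koebe_dev e n = 2 * cnj e ^ n / of_nat n - taylor_coeff (log_ratio f) n"

lemma ray_dev_product:
  "of_nat n * (ray_dev e r n * cnj (ray_dev e s n)) =
     of_nat n * (ker_coeff (of_real r * e) n * cnj (ker_coeff (of_real s * e) n))
     + of_bool (n \<noteq> 0) * (ker_coeff (of_real r * e) n * (of_real s * e) ^ n)
     + of_bool (n \<noteq> 0) * cnj (ker_coeff (of_real s * e) n * (of_real r * e) ^ n)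
     + cnj (of_real r * e) ^ n * (of_real s * e) ^ n / of_nat n"
  by (cases "n = 0") (simp_all add: ray_dev_def field_simps)

lemma ker_coeff_0 [simp]: "norm a < 1 \<Longrightarrow> a \<noteq> 0 \<Longrightarrow> ker_coeff a 0 = 0"
  by (simp add: taylor_coeff_0 log_kernel_0)

text \<open>Expanding the square: summed over n, the right-hand side consists of the kernel pairing,
  two kernel values and a logarithm series, each of which is known.\<close>

lemma Re_ray_dev_product:
  assumes e: "norm e = 1" and r: "0 < r" "r < 1" and s: "0 < s" "s < 1"
  shows "real n * Re (ray_dev e r n * cnj (ray_dev e s n)) =
     real n * Re (ker_coeff (of_real r * e) n * cnj (ker_coeff (of_real s * e) n))
     + Re (ker_coeff (of_real r * e) n * (of_real s * e) ^ n)
     + Re (ker_coeff (of_real s * e) n * (of_real r * e) ^ n)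
     + (r * s) ^ n / real n"
proof -
  let ?a = "of_real r * e" and ?b = "of_real s * e"
  have a: "norm ?a < 1" "?a \<noteq> 0" and b: "norm ?b < 1" "?b \<noteq> 0" using e r s by (auto simp: norm_mult)
  have "cnj ?a ^ n * ?b ^ n = of_real ((r * s) ^ n)"
  proof -
    have "cnj e * e = 1" using complex_norm_square[of e] e by (simp add: mult.commute)
    then have "cnj ?a * ?b = of_real (r * s)" by (simp add: mult_ac)
    then show ?thesis by (simp only: power_mult_distrib[symmetric] of_real_power)
  qed
  then have eq: "of_nat n * (ray_dev e r n * cnj (ray_dev e s n)) =
     of_nat n * (ker_coeff ?a n * cnj (ker_coeff ?b n)) + (ker_coeff ?a n * ?b ^ n) + cnj (ker_coeff ?b n * ?a ^ n) + of_real ((r * s) ^ n / real n)"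
    unfolding ray_dev_product using a b by (cases "n = 0") simp_all
  have "real n * Re w = Re (of_nat n * w)" for w by simp
  then show ?thesis by (simp only: eq plus_complex.sel cnj.sel Re_complex_of_real)
qed

text \<open>The energy inequality bounds the first term and the logarithmic derivative bound the two
  kernel values; the contributions of \<open>ln (1 - r * r)\<close> cancel and
  \<open>- 2 * lgrow e r\<close> is left.\<close>

lemma ray_dev_energy:
  assumes e: "norm e = 1" and r: "0 < r" "r < 1"
  shows "summable (\<lambda>n. real n * (norm (ray_dev e r n))\<^sup>2)"
    and "finite I \<Longrightarrow> (\<Sum>n\<in>I. real n * (norm (ray_dev e r n))\<^sup>2) \<le> - 2 * lgrow e r"
proof -
  let ?a = "of_real r * e"
  have a: "norm ?a < 1" "?a \<noteq> 0" using e r by (auto simp: norm_mult)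
  have rr: "r * r < 1" using r by (simp add: power2_eq_square[symmetric] power_less_one_iff)
  have na: "norm ?a = r" using e r by (simp add: norm_mult)
  have sq: "Re (w * cnj w) = (norm w)\<^sup>2" for w
    using complex_norm_square[of w] by (metis Re_complex_of_real)
  have s: "(\<lambda>n. real n * (norm (ray_dev e r n))\<^sup>2) sums
     ((\<Sum>n. real n * (norm (ker_coeff ?a n))\<^sup>2) + Re (log_kernel f ?a ?a) + Re (log_kernel f ?a ?a) + - ln (1 - r * r))"
  proof -
    have "(\<lambda>n. real n * (norm (ker_coeff ?a n))\<^sup>2 + Re (ker_coeff ?a n * ?a ^ n) + Re (ker_coeff ?a n * ?a ^ n) + (r * r) ^ n / real n) sums
      ((\<Sum>n. real n * (norm (ker_coeff ?a n))\<^sup>2) + Re (log_kernel f ?a ?a) + Re (log_kernel f ?a ?a) + - ln (1 - r * r))"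
      by (intro sums_add sums_Re taylor_sums[where r=1] log_kernel_hol a ln_one_minus_sums summable_sums ker_coeff_energy_summable)
        (use rr r in simp)
    then show ?thesis using Re_ray_dev_product[OF e r r] unfolding sq by simp
  qed
  show "summable (\<lambda>n. real n * (norm (ray_dev e r n))\<^sup>2)" by (rule sums_summable[OF s])
  assume fin: "finite I"
  have "(\<Sum>n\<in>I. real n * (norm (ray_dev e r n))\<^sup>2) \<le> (\<Sum>n. real n * (norm (ray_dev e r n))\<^sup>2)"
    by (rule sum_le_suminf[OF sums_summable[OF s] fin]) simp
  also have "\<dots> = (\<Sum>n. real n * (norm (ker_coeff ?a n))\<^sup>2) + 2 * Re (log_kernel f ?a ?a) - ln (1 - r * r)"
    using sums_unique[OF s] by simp
  also have "(\<Sum>n. real n * (norm (ker_coeff ?a n))\<^sup>2) \<le> - ln (1 - r * r)"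
  proof (rule suminf_le_const[OF ker_coeff_energy_summable[OF a]])
    fix N
    have "(\<Sum>n<N. real n * (norm (ker_coeff ?a n))\<^sup>2) \<le> (\<Sum>n\<le>N. real n * (norm (ker_coeff ?a n))\<^sup>2)"
      by (rule sum_mono2) auto
    then show "(\<Sum>n<N. real n * (norm (ker_coeff ?a n))\<^sup>2) \<le> - ln (1 - r * r)"
      using ker_coeff_energy[OF a, of N] na by (simp add: power2_eq_square)
  qed
  also have "Re (log_kernel f ?a ?a) \<le> - lgrow e r + ln (1 - r * r)"
  proof -
    have fa: "f ?a \<noteq> 0" using f_eq_0_iff[OF a(1)] a by simp
    have fd: "deriv f ?a \<noteq> 0" by (rule f_deriv_nonzero[OF a(1)])
    have "norm (?a * deriv f ?a / f ?a) \<le> (1 + r) / (1 - r)" using log_deriv_bound[OF a] na by simp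
    then have "r * norm (deriv f ?a) / norm (f ?a) \<le> (1 + r) / (1 - r)" using na by (simp add: norm_mult norm_divide)
    then have "r * norm (deriv f ?a) / norm (f ?a) * (r / norm (f ?a)) \<le> (1 + r) / (1 - r) * (r / norm (f ?a))"
      using r by (intro mult_right_mono) auto
    then have "norm (deriv f ?a) * (norm ?a)\<^sup>2 / (norm (f ?a))\<^sup>2 \<le> (1 + r) / (1 - r) * (r / norm (f ?a))"
      unfolding na by (simp add: power2_eq_square mult_ac)
    also have "\<dots> = (1 - r * r) / exp (lgrow e r)"
    proof -
      define d where "d = 1 - r"
      have "1 - r * r = (1 + r) * d" by (simp add: d_def algebra_simps)
      moreover have "d \<noteq> 0" using r by (simp add: d_def)
      ultimately show ?thesis
        unfolding exp_lgrow[OF e r] d_def[symmetric] using r fa by (simp add: power2_eq_square)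
    qed
    finally have "ln (norm (deriv f ?a) * (norm ?a)\<^sup>2 / (norm (f ?a))\<^sup>2) \<le> ln ((1 - r * r) / exp (lgrow e r))"
      by (intro ln_mono) (use fa fd a in auto)
    moreover have "1 - r * r > 0" using rr by simp
    ultimately show ?thesis unfolding Re_log_kernel_diag[OF a] by (simp add: ln_divide_pos)
  qed
  finally show "(\<Sum>n\<in>I. real n * (norm (ray_dev e r n))\<^sup>2) \<le> - 2 * lgrow e r" by simp
qed

lemma inverse_f_direction_tendsto:
  assumes e: "norm e = 1" and \<alpha>: "\<alpha> > 0" and dir: "\<And>r. 0 < r \<Longrightarrow> r < 1 \<Longrightarrow> \<alpha> \<le> exp (lgrow e r)"
    and R: "R \<longlonglongrightarrow> 1" "\<And>j. 0 < R j \<and> R j < 1"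
  shows "(\<lambda>j. inverse (f (of_real (R j) * e))) \<longlonglongrightarrow> 0"
proof -
  let ?a = "\<lambda>j. of_real (R j) * e"
  have a: "norm (?a j) < 1" "?a j \<noteq> 0" for j using R(2)[of j] e by (auto simp: norm_mult)
  show ?thesis
  proof (rule Lim_null_comparison)
    show "\<forall>\<^sub>F j in sequentially. norm (inverse (f (?a j))) \<le> (1 - R j)\<^sup>2 / (\<alpha> * R j)"
    proof (rule always_eventually, rule allI)
      fix j
      have Rj: "0 < R j" "R j < 1" using R(2) by auto
      have "\<alpha> \<le> norm (f (?a j)) * (1 - R j)\<^sup>2 / R j" using dir[OF Rj] exp_lgrow[OF e Rj] by simp
      then have "\<alpha> * R j \<le> norm (f (?a j)) * (1 - R j)\<^sup>2" using Rj by (simp add: field_simps)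
      moreover have "norm (f (?a j)) > 0" using f_eq_0_iff[OF a(1)[of j]] a(2)[of j] by simp
      ultimately show "norm (inverse (f (?a j))) \<le> (1 - R j)\<^sup>2 / (\<alpha> * R j)"
        using Rj \<alpha> by (simp add: norm_inverse norm_divide field_simps)
    qed
    have "(\<lambda>j. (1 - R j)\<^sup>2 / (\<alpha> * R j)) \<longlonglongrightarrow> (1 - 1)\<^sup>2 / (\<alpha> * 1)"
      by (intro tendsto_intros R) (use \<alpha> in simp)
    then show "(\<lambda>j. (1 - R j)\<^sup>2 / (\<alpha> * R j)) \<longlonglongrightarrow> 0" by simp
  qed
qed

text \<open>Along a direction of growth \<open>f\<close> tends to infinity, so the parameter of
  \<open>inv_coeff\<close> tends to 0. Each kernel coefficient involves finitely many coefficients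
  and extends to the boundary point \<open>e\<close>, where
  \<open>inverse e = cnj e\<close>.\<close>

lemma koebe_dev_tendsto:
  assumes e: "norm e = 1" and \<alpha>: "\<alpha> > 0" and dir: "\<And>r. 0 < r \<Longrightarrow> r < 1 \<Longrightarrow> \<alpha> \<le> exp (lgrow e r)"
    and R: "R \<longlonglongrightarrow> 1" "\<And>j. 0 < R j \<and> R j < 1"
  shows "(\<lambda>j. ray_dev e (R j) n) \<longlonglongrightarrow> koebe_dev e n"
proof (cases "n = 0")
  case True
  have "ray_dev e (R j) n = 0" for j
  proof -
    have "norm (of_real (R j) * e) < 1" "of_real (R j) * e \<noteq> 0" using R(2)[of j] e by (auto simp: norm_mult)
    from ker_coeff_0[OF this] show ?thesis using True by (simp add: ray_dev_def)
  qed
  moreover have "koebe_dev e n = 0" using True by (simp add: koebe_dev_def taylor_coeff_0 log_ratio_0)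
  ultimately show ?thesis by simp
next
  case False
  then have n: "n \<ge> 1" by simp
  let ?a = "\<lambda>j. of_real (R j) * e"
  have a: "norm (?a j) < 1" "?a j \<noteq> 0" for j using R(2)[of j] e by (auto simp: norm_mult)
  have al: "?a \<longlonglongrightarrow> of_real 1 * e" by (intro tendsto_intros R)
  have e0: "e \<noteq> 0" using e by auto
  have inv_e: "inverse e = cnj e"
    using complex_norm_square[of e] e e0 by (simp add: field_simps)
  have w: "(\<lambda>j. inverse (f (?a j))) \<longlonglongrightarrow> 0"
    by (rule inverse_f_direction_tendsto[OF e \<alpha> dir R])
  have "(\<lambda>j. inverse (?a j) ^ n / of_nat n + log_coeff (inv_coeff (inverse (f (?a j)))) n + cnj (?a j) ^ n / of_nat n) \<longlonglongrightarrow>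
      inverse (of_real 1 * e) ^ n / of_nat n + log_coeff (inv_coeff 0) n + cnj (of_real 1 * e) ^ n / of_nat n"
  proof (intro tendsto_intros R log_coeff_tendsto)
    fix k show "(\<lambda>j. inv_coeff (inverse (f (?a j))) k) \<longlonglongrightarrow> inv_coeff 0 k"
      unfolding inv_coeff_def by (cases "k = 1") (use tendsto_diff[OF tendsto_const w] in auto)
  qed (use n e0 in auto)
  moreover have "inverse (of_real 1 * e) ^ n / of_nat n + log_coeff (inv_coeff 0) n + cnj (of_real 1 * e) ^ n / of_nat n = koebe_dev e n"
    unfolding log_coeff_inv_coeff_0[OF n] by (simp add: inv_e koebe_dev_def)
  ultimately show ?thesis using taylor_coeff_log_kernel[OF a n] by (simp add: ray_dev_def)
qed

text \<open>The bound on the ray is uniform because \<open>lgrow\<close> stays above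
  \<open>ln \<alpha>\<close>; in a finite sum the coefficientwise limit can be taken, with no
  convergence of norms.\<close>

theorem bazilevich:
  assumes e: "norm e = 1" and \<alpha>: "\<alpha> > 0" and dir: "\<And>r. 0 < r \<Longrightarrow> r < 1 \<Longrightarrow> \<alpha> \<le> exp (lgrow e r)" and I: "finite I"
  shows "(\<Sum>n\<in>I. real n * (norm (koebe_dev e n))\<^sup>2) \<le> - 2 * ln \<alpha>"
proof (rule LIMSEQ_le_const2)
  define R where "R = (\<lambda>j. 1 - 1 / (real j + 2))"
  have R: "0 < R j \<and> R j < 1" for j by (auto simp: R_def field_simps)
  have R1: "R \<longlonglongrightarrow> 1" unfolding R_def by real_asymp
  show "(\<lambda>j. \<Sum>n\<in>I. real n * (norm (ray_dev e (R j) n))\<^sup>2) \<longlonglongrightarrow> (\<Sum>n\<in>I. real n * (norm (koebe_dev e n))\<^sup>2)"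
    by (intro tendsto_intros koebe_dev_tendsto[OF e \<alpha> dir R1 R])
  show "\<exists>N. \<forall>j\<ge>N. (\<Sum>n\<in>I. real n * (norm (ray_dev e (R j) n))\<^sup>2) \<le> - 2 * ln \<alpha>"
  proof (intro exI allI impI)
    fix j
    have Rj: "0 < R j" "R j < 1" using R by auto
    have "ln \<alpha> \<le> lgrow e (R j)" using ln_mono[OF dir[OF Rj] \<alpha>] by simp
    then show "(\<Sum>n\<in>I. real n * (norm (ray_dev e (R j) n))\<^sup>2) \<le> - 2 * ln \<alpha>"
      using ray_dev_energy(2)[OF e Rj I] by simp
  qed
qed

section \<open>The equality case for full mappings\<close>

lemma ray_dev_pairing_full:
  assumes null: "omitted 1 \<in> null_sets lborel" and e: "norm e = 1" and r: "0 < r" "r < s" "s < 1"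
  shows "(\<lambda>n. real n * Re (ray_dev e r n * cnj (ray_dev e s n))) sums
     (- 2 * ln (1 - r * s) + 2 * ln (norm (inverse (f (of_real s * e)) - inverse (f (of_real r * e))) * r * s / (s - r)))"
proof -
  let ?a = "of_real r * e" and ?b = "of_real s * e"
  have a: "norm ?a < 1" "?a \<noteq> 0" and b: "norm ?b < 1" "?b \<noteq> 0" using e r by (auto simp: norm_mult)
  have na: "norm ?a = r" "norm ?b = s" using e r by (auto simp: norm_mult)
  have ab: "?a \<noteq> ?b" using r e by auto
  have nab: "norm (?a - ?b) = s - r"
  proof -
    have "?a - ?b = of_real (r - s) * e" by (simp add: algebra_simps)
    then have "norm (?a - ?b) = \<bar>r - s\<bar>" using e by (simp only: norm_mult norm_of_real mult_1_right)
    then show ?thesis using r by simp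
  qed
  have rs: "\<bar>r * s\<bar> < 1" using r mult_strict_mono[of r 1 s 1] by (simp add: abs_mult)
  have nn: "norm (1 - ?a * cnj ?b) = 1 - r * s"
  proof -
    have "e * cnj e = 1" using complex_norm_square[of e] e by simp
    then have "?a * cnj ?b = of_real (r * s)" by (simp add: mult_ac)
    then have "1 - ?a * cnj ?b = of_real (1 - r * s)" by simp
    then show ?thesis using rs by (simp only: norm_of_real)
  qed
  have "(\<lambda>n. real n * Re (ker_coeff ?a n * cnj (ker_coeff ?b n)) + Re (ker_coeff ?a n * ?b ^ n) + Re (ker_coeff ?b n * ?a ^ n) + (r * s) ^ n / real n) sums
     (- ln (norm (1 - ?a * cnj ?b)) + Re (log_kernel f ?a ?b) + Re (log_kernel f ?b ?a) + - ln (1 - r * s))"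
    by (intro sums_add sums_Re full_pairing[OF null] taylor_sums[where r=1] log_kernel_hol a b ln_one_minus_sums rs) (use na r in simp)
  moreover have "Re (log_kernel f ?b ?a) = Re (log_kernel f ?a ?b)"
    unfolding Re_log_kernel[OF a b ab] Re_log_kernel[OF b a ab[symmetric]] norm_minus_commute[of ?a ?b] norm_minus_commute[of "inverse (f ?a)"]
    by (simp add: mult_ac)
  ultimately show ?thesis
    unfolding Re_ray_dev_product[OF e r(1) order.strict_trans[OF r(2,3)] order.strict_trans[OF r(1,2)] r(3), symmetric]
    unfolding nn Re_log_kernel[OF a b ab] na nab by (simp add: mult_ac)
qed

text \<open>This is why two different radii are paired: off the diagonal the kernel values involve
  \<open>f\<close> but not its derivative, so when one radius tends to 1 it is enough that
  \<open>1 / f\<close> tends to 0.\<close>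

lemma ray_dev_pairing_limit:
  assumes e: "norm e = 1" and \<alpha>: "\<alpha> > 0" and dir: "\<And>r. 0 < r \<Longrightarrow> r < 1 \<Longrightarrow> \<alpha> \<le> exp (lgrow e r)"
    and R: "R \<longlonglongrightarrow> 1" "\<And>j. 0 < R j \<and> R j < 1" and r: "0 < r" "r < 1"
    and w: "(\<lambda>j. inverse (f (of_real (R j) * e))) \<longlonglongrightarrow> 0"
  shows "(\<lambda>j. - 2 * ln (1 - r * R j) + 2 * ln (norm (inverse (f (of_real (R j) * e)) - inverse (f (of_real r * e))) * r * R j / (R j - r)))
     \<longlonglongrightarrow> - 2 * lgrow e r"
proof -
  have a: "norm (of_real r * e) < 1" "of_real r * e \<noteq> 0" using e r by (auto simp: norm_mult)
  have fa: "f (of_real r * e) \<noteq> 0" using f_eq_0_iff[OF a(1)] a by simp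
  have "(\<lambda>j. - 2 * ln (1 - r * R j) + 2 * ln (norm (inverse (f (of_real (R j) * e)) - inverse (f (of_real r * e))) * r * R j / (R j - r)))
     \<longlonglongrightarrow> - 2 * ln (1 - r * 1) + 2 * ln (norm (0 - inverse (f (of_real r * e))) * r * 1 / (1 - r))"
    by (intro tendsto_intros R w) (use r fa in auto)
  moreover have "- 2 * ln (1 - r * 1) + 2 * ln (norm (0 - inverse (f (of_real r * e))) * r * 1 / (1 - r)) = - 2 * lgrow e r"
  proof -
    have "lgrow e r = ln (norm (f (of_real r * e)) * (1 - r)\<^sup>2 / r)"
      unfolding exp_lgrow[OF e r, symmetric] by simp
    also have "\<dots> = ln (norm (f (of_real r * e))) + 2 * ln (1 - r) - ln r"
      using r fa by (simp add: ln_mult ln_div power2_eq_square)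
    finally show ?thesis using r fa by (simp add: norm_inverse ln_mult ln_div ln_inverse)
  qed
  ultimately show ?thesis by simp
qed

lemma koebe_dev_summable:
  assumes e: "norm e = 1" and \<alpha>: "\<alpha> > 0" and dir: "\<And>r. 0 < r \<Longrightarrow> r < 1 \<Longrightarrow> \<alpha> \<le> exp (lgrow e r)"
  shows "summable (\<lambda>n. real n * (norm (koebe_dev e n))\<^sup>2)"
  by (rule bounded_imp_summable[OF _ bazilevich[OF e \<alpha> dir finite_atMost]]) auto

lemma weighted_pairing_bound:
  "\<bar>\<Sum>n\<in>I. real n * Re (x n * cnj (y n))\<bar> \<le> sqrt (\<Sum>n\<in>I. real n * (norm (x n))\<^sup>2) * sqrt (\<Sum>n\<in>I. real n * (norm (y n))\<^sup>2)"
proof -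
  have "(\<Sum>n\<in>I. real n * Re (x n * cnj (y n))) = Re (\<Sum>n\<in>I. x n * (of_nat n * cnj (y n)))"
    unfolding Re_sum by (intro sum.cong refl) (simp add: algebra_simps)
  then have "\<bar>\<Sum>n\<in>I. real n * Re (x n * cnj (y n))\<bar> \<le> norm (\<Sum>n\<in>I. x n * (of_nat n * cnj (y n)))"
    by (simp only: abs_Re_le_cmod)
  also have "\<dots> \<le> sqrt (\<Sum>n\<in>I. real n * (norm (x n))\<^sup>2) * sqrt (\<Sum>n\<in>I. (norm (of_nat n * cnj (y n)))\<^sup>2 / real n)"
    by (rule weighted_Cauchy_Schwarz) simp
  also have "(\<Sum>n\<in>I. (norm (of_nat n * cnj (y n)))\<^sup>2 / real n) = (\<Sum>n\<in>I. real n * (norm (y n))\<^sup>2)"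
    by (intro sum.cong refl) (simp add: norm_mult power_mult_distrib power2_eq_square)
  finally show ?thesis .
qed

text \<open>With X = - 2 * \<open>lgrow e r\<close> and D the sum on the right, the pairings of
  \<open>ray_dev e r\<close> with \<open>ray_dev e (R j)\<close> tend to X. The second factor
  converges weakly to \<open>koebe_dev e\<close>, whence X \<le> sqrt X * sqrt D, as the energy of
  the first factor is at most X.\<close>

lemma koebe_dev_full_ray:
  assumes null: "omitted 1 \<in> null_sets lborel" and e: "norm e = 1" and \<alpha>: "\<alpha> > 0"
    and dir: "\<And>r. 0 < r \<Longrightarrow> r < 1 \<Longrightarrow> \<alpha> \<le> exp (lgrow e r)" and r: "0 < r" "r < 1"
  shows "- 2 * lgrow e r \<le> (\<Sum>n. real n * (norm (koebe_dev e n))\<^sup>2)"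
proof -
  define X where "X = - 2 * lgrow e r"
  define B where "B = - 2 * ln \<alpha>"
  define D where "D = (\<Sum>n. real n * (norm (koebe_dev e n))\<^sup>2)"
  have X0: "0 \<le> X" using lgrow_nonpos[OF e, of r] r by (simp add: X_def)
  have B: "- 2 * lgrow e s \<le> B" if "0 < s" "s < 1" for s
    using ln_mono[OF dir[OF that] \<alpha>] by (simp add: B_def)
  have B0: "0 \<le> B" using B[OF r] X0 by (simp add: X_def)
  have sD: "summable (\<lambda>n. real n * (norm (koebe_dev e n))\<^sup>2)" by (rule koebe_dev_summable[OF e \<alpha> dir])
  have D0: "0 \<le> D" unfolding D_def by (rule suminf_nonneg[OF sD]) simp
  define R where "R = (\<lambda>j. 1 - (1 - r) / (real j + 2))"
  have Rr: "r < R j" "R j < 1" for j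
  proof -
    have "(1 - r) / (real j + 2) < 1 - r" using r by (simp add: divide_less_eq)
    then show "r < R j" by (simp add: R_def)
    show "R j < 1" using r by (simp add: R_def)
  qed
  have R: "0 < R j \<and> R j < 1" for j using Rr[of j] r by simp
  have R1: "R \<longlonglongrightarrow> 1" unfolding R_def by real_asymp
  define V where "V = (\<lambda>j. - 2 * ln (1 - r * R j) + 2 * ln (norm (inverse (f (of_real (R j) * e)) - inverse (f (of_real r * e))) * r * R j / (R j - r)))"
  have V: "V \<longlonglongrightarrow> X"
    unfolding V_def X_def by (rule ray_dev_pairing_limit[OF e \<alpha> dir R1 R r inverse_f_direction_tendsto[OF e \<alpha> dir R1 R]])
  have Vs: "(\<lambda>n. real n * Re (ray_dev e r n * cnj (ray_dev e (R j) n))) sums V j" for j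
    unfolding V_def by (rule ray_dev_pairing_full[OF null e r(1) Rr])
  have main: "X \<le> sqrt X * sqrt D + \<eta> * sqrt B" if \<eta>: "\<eta> > 0" for \<eta>
  proof -
    have "(\<lambda>N. \<Sum>n<N. real n * (norm (ray_dev e r n))\<^sup>2) \<longlonglongrightarrow> (\<Sum>n. real n * (norm (ray_dev e r n))\<^sup>2)"
      using summable_LIMSEQ[OF ray_dev_energy(1)[OF e r]] .
    moreover have "(\<Sum>n. real n * (norm (ray_dev e r n))\<^sup>2) - \<eta>\<^sup>2 < (\<Sum>n. real n * (norm (ray_dev e r n))\<^sup>2)" using \<eta> by simp
    ultimately have "\<forall>\<^sub>F N in sequentially. (\<Sum>n. real n * (norm (ray_dev e r n))\<^sup>2) - \<eta>\<^sup>2 < (\<Sum>n<N. real n * (norm (ray_dev e r n))\<^sup>2)"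
      by (rule order_tendstoD(1))
    then obtain K where K: "(\<Sum>n. real n * (norm (ray_dev e r n))\<^sup>2) - \<eta>\<^sup>2 < (\<Sum>n<K. real n * (norm (ray_dev e r n))\<^sup>2)"
      by (auto simp: eventually_sequentially)
    have tail: "(\<Sum>n\<in>{K..<N}. real n * (norm (ray_dev e r n))\<^sup>2) \<le> \<eta>\<^sup>2" for N
    proof (cases "K \<le> N")
      case True
      have "(\<Sum>n<N. real n * (norm (ray_dev e r n))\<^sup>2) \<le> (\<Sum>n. real n * (norm (ray_dev e r n))\<^sup>2)"
        by (rule sum_le_suminf[OF ray_dev_energy(1)[OF e r]]) auto
      moreover have "(\<Sum>n<N. real n * (norm (ray_dev e r n))\<^sup>2) = (\<Sum>n<K. real n * (norm (ray_dev e r n))\<^sup>2) + (\<Sum>n\<in>{K..<N}. real n * (norm (ray_dev e r n))\<^sup>2)"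
        using True by (simp add: sum.atLeastLessThan_concat lessThan_atLeast0)
      ultimately show ?thesis using K by linarith
    qed simp
    \<comment> \<open>The tail of \<open>ray_dev e r\<close> is small once and for all and
      \<open>ray_dev e (R j)\<close> has bounded energy, so cutting the pairing at K costs at most
      \<open>\<eta> * sqrt B\<close> for every j.\<close>
    have VK: "V j \<le> (\<Sum>n<K. real n * Re (ray_dev e r n * cnj (ray_dev e (R j) n))) + \<eta> * sqrt B" for j
    proof (rule LIMSEQ_le_const2)
      show "(\<lambda>N. \<Sum>n<N. real n * Re (ray_dev e r n * cnj (ray_dev e (R j) n))) \<longlonglongrightarrow> V j"
        using Vs[of j] unfolding sums_def .
      show "\<exists>N0. \<forall>N\<ge>N0. (\<Sum>n<N. real n * Re (ray_dev e r n * cnj (ray_dev e (R j) n))) \<le> (\<Sum>n<K. real n * Re (ray_dev e r n * cnj (ray_dev e (R j) n))) + \<eta> * sqrt B"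
      proof (intro exI allI impI)
        fix N assume N: "K \<le> N"
        have "(\<Sum>n<N. real n * Re (ray_dev e r n * cnj (ray_dev e (R j) n))) = (\<Sum>n<K. real n * Re (ray_dev e r n * cnj (ray_dev e (R j) n))) + (\<Sum>n\<in>{K..<N}. real n * Re (ray_dev e r n * cnj (ray_dev e (R j) n)))"
          using N by (simp add: sum.atLeastLessThan_concat lessThan_atLeast0)
        also have "(\<Sum>n\<in>{K..<N}. real n * Re (ray_dev e r n * cnj (ray_dev e (R j) n))) \<le> sqrt (\<Sum>n\<in>{K..<N}. real n * (norm (ray_dev e r n))\<^sup>2) * sqrt (\<Sum>n\<in>{K..<N}. real n * (norm (ray_dev e (R j) n))\<^sup>2)"
          using weighted_pairing_bound[of "ray_dev e r" "ray_dev e (R j)" "{K..<N}"] by linarith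
        also have "\<dots> \<le> sqrt (\<eta>\<^sup>2) * sqrt B"
          using tail[of N] order_trans[OF ray_dev_energy(2)[OF e, of "R j" "{K..<N}"] B[of "R j"]] R[of j]
          by (intro mult_mono real_sqrt_le_mono) (auto intro!: sum_nonneg)
        finally show "(\<Sum>n<N. real n * Re (ray_dev e r n * cnj (ray_dev e (R j) n))) \<le> (\<Sum>n<K. real n * Re (ray_dev e r n * cnj (ray_dev e (R j) n))) + \<eta> * sqrt B"
          using \<eta> by simp
      qed
    qed
    have "X \<le> (\<Sum>n<K. real n * Re (ray_dev e r n * cnj (koebe_dev e n))) + \<eta> * sqrt B"
    proof (rule LIMSEQ_le[OF V])
      show "(\<lambda>j. (\<Sum>n<K. real n * Re (ray_dev e r n * cnj (ray_dev e (R j) n))) + \<eta> * sqrt B) \<longlonglongrightarrow> (\<Sum>n<K. real n * Re (ray_dev e r n * cnj (koebe_dev e n))) + \<eta> * sqrt B"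
        by (intro tendsto_intros koebe_dev_tendsto[OF e \<alpha> dir R1 R])
      show "\<exists>N. \<forall>j\<ge>N. V j \<le> (\<Sum>n<K. real n * Re (ray_dev e r n * cnj (ray_dev e (R j) n))) + \<eta> * sqrt B"
        using VK by blast
    qed
    also have "(\<Sum>n<K. real n * Re (ray_dev e r n * cnj (koebe_dev e n))) \<le> sqrt (\<Sum>n<K. real n * (norm (ray_dev e r n))\<^sup>2) * sqrt (\<Sum>n<K. real n * (norm (koebe_dev e n))\<^sup>2)"
      using weighted_pairing_bound[of "ray_dev e r" "koebe_dev e" "{..<K}"] by linarith
    also have "\<dots> \<le> sqrt X * sqrt D"
      unfolding X_def D_def using ray_dev_energy(2)[OF e r, of "{..<K}"] sum_le_suminf[OF sD, of "{..<K}"]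
      by (intro mult_mono real_sqrt_le_mono) (use X0 in \<open>auto simp: X_def intro!: sum_nonneg suminf_nonneg[OF sD]\<close>)
    finally show ?thesis by simp
  qed
  have "X \<le> sqrt X * sqrt D"
  proof (rule field_le_epsilon)
    fix \<epsilon> :: real assume e: "\<epsilon> > 0"
    define \<eta> where "\<eta> = \<epsilon> / (sqrt B + 1)"
    have p: "sqrt B + 1 > 0" using B0 by (simp add: add_nonneg_pos)
    have "\<eta> > 0" using e p by (simp add: \<eta>_def)
    moreover have "\<eta> * sqrt B \<le> \<epsilon>" using e p B0 by (simp add: \<eta>_def field_simps)
    ultimately show "X \<le> sqrt X * sqrt D + \<epsilon>" using main[of \<eta>] by linarith
  qed
  then have XD: "sqrt X * sqrt X \<le> sqrt X * sqrt D" using X0 by simp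
  have "X \<le> D" if "X > 0"
  proof -
    have "sqrt X \<le> sqrt D" by (rule mult_left_le_imp_le[OF XD]) (use that in simp)
    then show ?thesis by simp
  qed
  then show ?thesis using D0 unfolding X_def D_def by (cases "X > 0") (auto simp: X_def)
qed

text \<open>\<open>max_growth r\<close> dominates the growth on the ray and has the Hayman index as
  its limit, so the inequality on the ray survives the passage of r to 1.\<close>

theorem bazilevich_full:
  assumes null: "omitted 1 \<in> null_sets lborel" and e: "norm e = 1" and \<alpha>: "hayman_index f > 0"
    and dir: "\<And>r. 0 < r \<Longrightarrow> r < 1 \<Longrightarrow> hayman_index f \<le> exp (lgrow e r)"
  shows "- 2 * ln (hayman_index f) \<le> (\<Sum>n. real n * (norm (koebe_dev e n))\<^sup>2)"
proof (rule tendsto_upperbound[OF _ _ trivial_limit_at_left_real])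
  show "((\<lambda>r. - 2 * ln (max_growth r)) \<longlongrightarrow> - 2 * ln (hayman_index f)) (at_left 1)"
    by (intro tendsto_intros hayman_index_limit(1)) (use \<alpha> in simp)
  show "\<forall>\<^sub>F r in at_left 1. - 2 * ln (max_growth r) \<le> (\<Sum>n. real n * (norm (koebe_dev e n))\<^sup>2)"
    using eventually_at_left_real[OF zero_less_one]
  proof eventually_elim
    case (elim r)
    then have r: "0 < r" "r < 1" by auto
    have "ln (exp (lgrow e r)) \<le> ln (max_growth r)" by (rule ln_mono[OF max_growth_ge[OF r e] exp_gt_zero])
    then show ?case using koebe_dev_full_ray[OF null e \<alpha> dir r] by simp
  qed
qed

end

section \<open>A Tauberian estimate for exponentiated series\<close>

lemma square_weighted_sum_bound:
  "(\<Sum>k<N. (real k + 1)\<^sup>2 * r ^ k) \<le> 2 / (1 - r) ^ 3" if r: "0 \<le> r" "r < 1" for r :: real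
proof -
  define d where "d = 1 - r"
  have d: "d > 0" and rd: "r = 1 - d" using r by (simp_all add: d_def)
  \<comment> \<open>\<open>V k\<close> is the closed form of the tail of the infinite series from
    index k on, so the finite sum telescopes.\<close>
  define V where "V = (\<lambda>k::nat. r ^ k * ((real k + 1)\<^sup>2 / d + 2 * (real k + 1) * r / d\<^sup>2 + r * (1 + r) / d ^ 3))"
  have step: "V k - V (Suc k) = (real k + 1)\<^sup>2 * r ^ k" for k
  proof -
    define x where "x = real k + 1"
    have "V k - V (Suc k) = r ^ k * ((x\<^sup>2 / d + 2 * x * r / d\<^sup>2 + r * (1 + r) / d ^ 3) - r * ((x + 1)\<^sup>2 / d + 2 * (x + 1) * r / d\<^sup>2 + r * (1 + r) / d ^ 3))"
      by (simp add: V_def x_def algebra_simps)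
    also have "(x\<^sup>2 / d + 2 * x * r / d\<^sup>2 + r * (1 + r) / d ^ 3) - r * ((x + 1)\<^sup>2 / d + 2 * (x + 1) * r / d\<^sup>2 + r * (1 + r) / d ^ 3) = x\<^sup>2"
    proof -
      have "x\<^sup>2 * d\<^sup>2 + 2 * x * r * d + r * (1 + r) - r * ((x + 1)\<^sup>2 * d\<^sup>2 + 2 * (x + 1) * r * d + r * (1 + r)) = x\<^sup>2 * d ^ 3"
        unfolding rd by (simp add: power2_eq_square power3_eq_cube algebra_simps)
      then have "(x\<^sup>2 * d\<^sup>2 + 2 * x * r * d + r * (1 + r) - r * ((x + 1)\<^sup>2 * d\<^sup>2 + 2 * (x + 1) * r * d + r * (1 + r))) / d ^ 3 = x\<^sup>2"
        using d by simp
      moreover have "(x\<^sup>2 * d\<^sup>2 + 2 * x * r * d + r * (1 + r) - r * ((x + 1)\<^sup>2 * d\<^sup>2 + 2 * (x + 1) * r * d + r * (1 + r))) / d ^ 3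
        = (x\<^sup>2 / d + 2 * x * r / d\<^sup>2 + r * (1 + r) / d ^ 3) - r * ((x + 1)\<^sup>2 / d + 2 * (x + 1) * r / d\<^sup>2 + r * (1 + r) / d ^ 3)"
      proof -
        have 1: "y * d\<^sup>2 / d ^ 3 = y / d" "y * d / d ^ 3 = y / d\<^sup>2" for y
          using d by (simp_all add: power2_eq_square power3_eq_cube)
        have "(x\<^sup>2 * d\<^sup>2 + 2 * x * r * d + r * (1 + r) - r * ((x + 1)\<^sup>2 * d\<^sup>2 + 2 * (x + 1) * r * d + r * (1 + r))) / d ^ 3
          = x\<^sup>2 * d\<^sup>2 / d ^ 3 + (2 * x * r) * d / d ^ 3 + r * (1 + r) / d ^ 3 - r * ((x + 1)\<^sup>2 * d\<^sup>2 / d ^ 3 + (2 * (x + 1) * r) * d / d ^ 3 + r * (1 + r) / d ^ 3)"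
        proof -
          have "(A + B + C - r * (A' + B' + C')) / D = A / D + B / D + C / D - r * (A' / D + B' / D + C' / D)" for A B C A' B' C' D :: real
            by (simp add: add_divide_distrib diff_divide_distrib distrib_left)
          then show ?thesis .
        qed
        then show ?thesis unfolding 1 .
      qed
      ultimately show ?thesis by simp
    qed
    finally show ?thesis by (simp add: x_def mult.commute)
  qed
  have "(\<Sum>k<N. (real k + 1)\<^sup>2 * r ^ k) = (\<Sum>k<N. V k - V (Suc k))" using step by simp
  also have "\<dots> = V 0 - V N" by (induction N) auto
  also have "V N \<ge> 0" using r d by (auto simp: V_def intro!: mult_nonneg_nonneg add_nonneg_nonneg divide_nonneg_pos)
  then have "V 0 - V N \<le> V 0" by simp
  also have "V 0 = (d\<^sup>2 + 2 * r * d + r * (1 + r)) / d ^ 3"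
    using d by (simp add: V_def add_divide_distrib power2_eq_square power3_eq_cube)
  also have "d\<^sup>2 + 2 * r * d + r * (1 + r) = 1 + r" unfolding rd by (simp add: power2_eq_square algebra_simps)
  also have "(1 + r) / d ^ 3 \<le> 2 / d ^ 3" using r d by (intro divide_right_mono) auto
  finally show ?thesis by (simp add: d_def)
qed

text \<open>Here \<open>s\<close> are the Taylor coefficients of \<open>exp (\<Sum>j. c j * z ^ j) / (1 - z)\<close>.\<close>

locale log_recursion =
  fixes c s :: "nat \<Rightarrow> complex" and M :: real and \<phi> :: "real \<Rightarrow> complex"
  assumes s0: "s 0 = 1" and c0: "c 0 = 0"
    and rec: "n \<ge> 1 \<Longrightarrow> of_nat n * s n = (\<Sum>j\<in>{1..n}. (of_nat j * c j + 1) * s (n - j))"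
    and energy: "finite I \<Longrightarrow> (\<Sum>j\<in>I. real j * (norm (c j))\<^sup>2) \<le> M"
    and \<phi>: "0 < r \<Longrightarrow> r < 1 \<Longrightarrow> (\<lambda>j. c j * of_real r ^ j) sums \<phi> r" "0 < r \<Longrightarrow> r < 1 \<Longrightarrow> Re (\<phi> r) \<le> 0"
begin

lemma M_nonneg: "0 \<le> M" using energy[of "{}"] by simp

text \<open>A bound for \<open>exp (F n)\<close>: \<open>M\<close> bounds the quadratic part of
  \<open>F\<close>, and \<open>2 * sqrt (2 * M)\<close> is twice the bound for the Fejer mean that
  forms its linear part.\<close>

definition Q :: real where "Q = exp (M + 2 * sqrt (2 * M))"

lemma Q_pos: "Q > 0" by (simp add: Q_def)

text \<open>The Fejer mean of the logarithm series is compared with the Abel mean at radius 1 - 1 /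
  (n + 1), whose real part is nonpositive. The weights differ so little that Cauchy-Schwarz against
  the energy bounds the error independently of n.\<close>

lemma fejer_bound:
  assumes n: "n \<ge> 1"
  shows "Re (\<Sum>j\<in>{1..n}. c j * of_real (1 - real j / (real n + 1))) \<le> sqrt (2 * M)"
proof -
  define r where "r = 1 - 1 / (real n + 1)"
  have r: "0 < r" "r < 1" using n by (auto simp: r_def field_simps)
  define w where "w = (\<lambda>j. (if j \<le> n then 1 - real j / (real n + 1) else 0) - r ^ j)"
  have w1: "(w j)\<^sup>2 / real j \<le> 1 / (real n + 1)\<^sup>2 * real j" if "j \<le> n" for j
  proof -
    \<comment> \<open>Both weights lie between 1 - j / (n + 1) and 1, so they differ by at most j /
      (n + 1).\<close>
    have "1 - real j / (real n + 1) \<le> r ^ j"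
      using Bernoulli_inequality[of "- 1 / (real n + 1)" j] by (simp add: r_def)
    moreover have "r ^ j \<le> 1" using r by (simp add: power_le_one)
    ultimately have "\<bar>w j\<bar> \<le> real j / (real n + 1)" using that by (simp add: w_def)
    then have "(w j)\<^sup>2 \<le> (real j / (real n + 1))\<^sup>2" by (metis abs_ge_zero power2_abs power_mono)
    then have "(w j)\<^sup>2 / real j \<le> (real j / (real n + 1))\<^sup>2 / real j" by (intro divide_right_mono) auto
    also have "\<dots> = 1 / (real n + 1)\<^sup>2 * real j" by (cases "j = 0") (auto simp: power_divide power2_eq_square)
    finally show ?thesis .
  qed
  have W: "(\<Sum>j<N. (w j)\<^sup>2 / real j) \<le> 2" if N: "n < N" for N
  proof -
    have "(\<Sum>j<N. (w j)\<^sup>2 / real j) = (\<Sum>j<Suc n. (w j)\<^sup>2 / real j) + (\<Sum>j\<in>{Suc n..<N}. (w j)\<^sup>2 / real j)"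
      using N by (simp only: lessThan_atLeast0 sum.atLeastLessThan_concat)
    moreover have "(\<Sum>j<Suc n. (w j)\<^sup>2 / real j) \<le> 1"
    proof -
      have "(\<Sum>j<Suc n. (w j)\<^sup>2 / real j) \<le> (\<Sum>j<Suc n. 1 / (real n + 1)\<^sup>2 * real n)"
      proof (rule sum_mono)
        fix j assume "j \<in> {..<Suc n}"
        then have j: "j \<le> n" by simp
        have "1 / (real n + 1)\<^sup>2 * real j \<le> 1 / (real n + 1)\<^sup>2 * real n" using j by (intro mult_left_mono) auto
        then show "(w j)\<^sup>2 / real j \<le> 1 / (real n + 1)\<^sup>2 * real n" using w1[OF j] by linarith
      qed
      also have "\<dots> = (real n + 1) * (1 / (real n + 1)\<^sup>2 * real n)" by (simp add: add.commute)
      also have "\<dots> = real n / (real n + 1)"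
      proof -
        have "x * (1 / x\<^sup>2 * z) = z / x" if "x \<noteq> 0" for x z :: real using that by (simp add: power2_eq_square)
        then show ?thesis by simp
      qed
      also have "\<dots> \<le> 1" by simp
      finally show ?thesis .
    qed
    moreover have "(\<Sum>j\<in>{Suc n..<N}. (w j)\<^sup>2 / real j) \<le> 1"
    proof -
      have "(\<Sum>j\<in>{Suc n..<N}. (w j)\<^sup>2 / real j) \<le> (\<Sum>j\<in>{Suc n..<N}. r ^ j * (1 - r))"
      proof (rule sum_mono)
        fix j assume "j \<in> {Suc n..<N}"
        then have j: "real n + 1 \<le> real j" "\<not> j \<le> n" by auto
        have "(w j)\<^sup>2 = r ^ j * r ^ j" using j by (simp add: w_def power2_eq_square)
        also have "\<dots> \<le> r ^ j * 1" using r by (intro mult_left_mono) (auto simp: power_le_one)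
        finally have "(w j)\<^sup>2 \<le> r ^ j" by simp
        then have "(w j)\<^sup>2 / real j \<le> r ^ j / (real n + 1)" using j r by (intro frac_le) auto
        then show "(w j)\<^sup>2 / real j \<le> r ^ j * (1 - r)" by (simp add: r_def)
      qed
      also have "\<dots> \<le> (\<Sum>j<N. r ^ j * (1 - r))" using r by (intro sum_mono2) auto
      also have "\<dots> = 1 - r ^ N" using one_diff_power_eq[of r N] by (simp add: sum_distrib_left mult.commute)
      also have "\<dots> \<le> 1" using r by simp
      finally show ?thesis .
    qed
    ultimately show ?thesis by linarith
  qed
  have fin: "Re ((\<Sum>j\<in>{1..n}. c j * of_real (1 - real j / (real n + 1))) - (\<Sum>j<N. c j * of_real r ^ j)) \<le> sqrt (2 * M)" if N: "n < N" for N
  proof -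
    have "(\<Sum>j\<in>{1..n}. c j * of_real (1 - real j / (real n + 1))) = (\<Sum>j<N. c j * of_real (if j \<le> n then 1 - real j / (real n + 1) else 0))"
      by (rule sum.mono_neutral_cong_left) (use N c0 in \<open>auto simp: not_le\<close>)
    then have E: "(\<Sum>j\<in>{1..n}. c j * of_real (1 - real j / (real n + 1))) - (\<Sum>j<N. c j * of_real r ^ j) = (\<Sum>j<N. c j * of_real (w j))"
      by (simp only: w_def sum_subtractf[symmetric] of_real_diff of_real_power right_diff_distrib)
    have "norm (\<Sum>j<N. c j * of_real (w j)) \<le> sqrt (\<Sum>j<N. real j * (norm (c j))\<^sup>2) * sqrt (\<Sum>j<N. (norm (complex_of_real (w j)))\<^sup>2 / real j)"
      by (rule weighted_Cauchy_Schwarz) (simp add: c0)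
    moreover have "\<dots> \<le> sqrt M * sqrt 2"
      using W[OF N] energy[of "{..<N}"] M_nonneg by (intro mult_mono real_sqrt_le_mono) (auto intro!: sum_nonneg)
    moreover have "sqrt M * sqrt 2 = sqrt (2 * M)" by (simp add: real_sqrt_mult mult.commute)
    ultimately show ?thesis unfolding E
      using complex_Re_le_cmod[of "\<Sum>j<N. c j * of_real (w j)"] by linarith
  qed
  have "Re ((\<Sum>j\<in>{1..n}. c j * of_real (1 - real j / (real n + 1))) - \<phi> r) \<le> sqrt (2 * M)"
  proof (rule LIMSEQ_le_const2)
    show "(\<lambda>N. Re ((\<Sum>j\<in>{1..n}. c j * of_real (1 - real j / (real n + 1))) - (\<Sum>j<N. c j * of_real r ^ j))) \<longlonglongrightarrow>
      Re ((\<Sum>j\<in>{1..n}. c j * of_real (1 - real j / (real n + 1))) - \<phi> r)"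
      using \<phi>(1)[OF r] unfolding sums_def by (intro tendsto_intros)
    show "\<exists>N0. \<forall>N\<ge>N0. Re ((\<Sum>j\<in>{1..n}. c j * of_real (1 - real j / (real n + 1))) - (\<Sum>j<N. c j * of_real r ^ j)) \<le> sqrt (2 * M)"
      using fin by (intro exI[of _ "Suc n"]) auto
  qed
  then show ?thesis using \<phi>(2)[OF r] by simp
qed

section \<open>The second Lebedev-Milin inequality\<close>

definition y :: "nat \<Rightarrow> real" where "y j = (norm (of_nat j * c j + 1))\<^sup>2 - 1"

text \<open>The exponent of the inequality in summed form: the average, over m from 0 to n, of the
  sums of \<open>y j / j\<close> for j up to m.\<close>

definition F :: "nat \<Rightarrow> real" where "F n = (\<Sum>j\<in>{1..n}. y j * (1 / real j - 1 / (real n + 1)))"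

lemma F_Suc: "F (Suc n) - F n = (\<Sum>j\<in>{1..Suc n}. y j) / (real (Suc n) * (real (Suc n) + 1))"
proof -
  have "F (Suc n) - F n = (\<Sum>j\<in>{1..n}. y j * (1 / real j - 1 / (real (Suc n) + 1)) - y j * (1 / real j - 1 / (real n + 1))) + y (Suc n) * (1 / real (Suc n) - 1 / (real (Suc n) + 1))"
    by (simp add: F_def sum_subtractf)
  also have "(\<Sum>j\<in>{1..n}. y j * (1 / real j - 1 / (real (Suc n) + 1)) - y j * (1 / real j - 1 / (real n + 1))) = (\<Sum>j\<in>{1..n}. y j * (1 / real (Suc n) - 1 / (real (Suc n) + 1)))"
    by (intro sum.cong refl) (simp add: algebra_simps)
  also have "\<dots> = (\<Sum>j\<in>{1..n}. y j) * (1 / real (Suc n) - 1 / (real (Suc n) + 1))" by (simp add: sum_distrib_right)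
  also have "\<dots> + y (Suc n) * (1 / real (Suc n) - 1 / (real (Suc n) + 1)) = (\<Sum>j\<in>{1..Suc n}. y j) * (1 / real (Suc n) - 1 / (real (Suc n) + 1))"
    by (simp add: algebra_simps)
  also have "1 / real (Suc n) - 1 / (real (Suc n) + 1) = 1 / (real (Suc n) * (real (Suc n) + 1))"
    by (simp add: field_simps)
  finally show ?thesis by simp
qed

text \<open>Expanding the square in \<open>y\<close> gives a quadratic part, bounded by the energy,
  and a linear part, which is twice the real part of a Fejer mean.\<close>

lemma F_bound: "F n \<le> M + 2 * sqrt (2 * M)"
proof (cases "n \<ge> 1")
  case True
  have "F n = (\<Sum>j\<in>{1..n}. real j * (norm (c j))\<^sup>2 * (1 - real j / (real n + 1)) + 2 * Re (c j * of_real (1 - real j / (real n + 1))))"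
    unfolding F_def
  proof (rule sum.cong[OF refl])
    fix j assume "j \<in> {1..n}"
    then have j: "real j > 0" by simp
    have "y j = (real j)\<^sup>2 * (norm (c j))\<^sup>2 + 2 * real j * Re (c j)"
      unfolding y_def cmod_power2 by (simp add: power2_eq_square algebra_simps)
    moreover have "1 / real j - 1 / (real n + 1) = (1 - real j / (real n + 1)) / real j" using j by (simp add: diff_divide_distrib)
    ultimately have "y j * (1 / real j - 1 / (real n + 1)) = ((real j)\<^sup>2 * (norm (c j))\<^sup>2 + 2 * real j * Re (c j)) * ((1 - real j / (real n + 1)) / real j)"
      by (simp only:)
    also have "\<dots> = real j * (norm (c j))\<^sup>2 * (1 - real j / (real n + 1)) + 2 * Re (c j) * (1 - real j / (real n + 1))"
    proof -
      have "((real j)\<^sup>2 * A + 2 * real j * B) * (W / real j) = real j * A * W + 2 * B * W" for A B W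
        using j by (simp add: power2_eq_square field_simps)
      then show ?thesis .
    qed
    also have "2 * Re (c j) * (1 - real j / (real n + 1)) = 2 * Re (c j * of_real (1 - real j / (real n + 1)))"
      by (simp only: Re_complex_of_real times_complex.sel Im_complex_of_real) simp
    finally show "y j * (1 / real j - 1 / (real n + 1)) = real j * (norm (c j))\<^sup>2 * (1 - real j / (real n + 1)) + 2 * Re (c j * of_real (1 - real j / (real n + 1)))" .
  qed
  also have "\<dots> = (\<Sum>j\<in>{1..n}. real j * (norm (c j))\<^sup>2 * (1 - real j / (real n + 1))) + 2 * Re (\<Sum>j\<in>{1..n}. c j * of_real (1 - real j / (real n + 1)))"
    by (simp only: sum.distrib sum_distrib_left Re_sum)
  also have "(\<Sum>j\<in>{1..n}. real j * (norm (c j))\<^sup>2 * (1 - real j / (real n + 1))) \<le> (\<Sum>j\<in>{1..n}. real j * (norm (c j))\<^sup>2)"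
    by (intro sum_mono mult_right_le_one_le) (auto simp: field_simps)
  also have "\<dots> \<le> M" by (rule energy) simp
  finally show ?thesis using fejer_bound[OF True] by linarith
next
  case False
  then have "n = 0" by simp
  then show ?thesis using M_nonneg by (simp add: F_def)
qed

text \<open>Cauchy-Schwarz in the recursion bounds the new square by the product of A / m^2 and the
  preceding sum of squares; the resulting factor is compared with the increment of the
  exponent.\<close>

lemma lebedev_milin: "(\<Sum>k\<le>n. (norm (s k))\<^sup>2) \<le> (real n + 1) * exp (F n)"
proof (induction n)
  case 0
  then show ?case by (simp add: s0 F_def)
next
  case (Suc n)
  define A where "A = (\<Sum>j\<in>{1..Suc n}. (norm (of_nat j * c j + 1))\<^sup>2)"
  define S where "S = (\<Sum>k\<le>n. (norm (s k))\<^sup>2)"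
  define m where "m = real (Suc n)"
  have m: "m > 0" by (simp add: m_def)
  have A0: "0 \<le> A" unfolding A_def by (rule sum_nonneg) simp
  have "norm (of_nat (Suc n) * s (Suc n)) \<le> (\<Sum>j\<in>{1..Suc n}. norm (of_nat j * c j + 1) * norm (s (Suc n - j)))"
  proof -
    have "of_nat (Suc n) * s (Suc n) = (\<Sum>j\<in>{1..Suc n}. (of_nat j * c j + 1) * s (Suc n - j))" by (rule rec) simp
    then show ?thesis by (simp only:) (rule order_trans[OF norm_sum], simp only: norm_mult order_refl)
  qed
  then have "(norm (of_nat (Suc n) * s (Suc n)))\<^sup>2 \<le> (\<Sum>j\<in>{1..Suc n}. norm (of_nat j * c j + 1) * norm (s (Suc n - j)))\<^sup>2"
    by (rule power_mono) simp
  also have "\<dots> \<le> A * (\<Sum>j\<in>{1..Suc n}. (norm (s (Suc n - j)))\<^sup>2)"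
    unfolding A_def by (rule Cauchy_Schwarz_ineq_sum)
  also have "(\<Sum>j\<in>{1..Suc n}. (norm (s (Suc n - j)))\<^sup>2) = S"
    unfolding S_def by (rule sum.reindex_bij_witness[of _ "\<lambda>k. Suc n - k" "\<lambda>j. Suc n - j"]) auto
  finally have "m\<^sup>2 * (norm (s (Suc n)))\<^sup>2 \<le> A * S" by (simp only: norm_mult norm_of_nat power_mult_distrib m_def)
  then have sn: "(norm (s (Suc n)))\<^sup>2 \<le> A / m\<^sup>2 * S" using m by (simp add: field_simps)
  have y: "(\<Sum>j\<in>{1..Suc n}. y j) = A - m" by (simp add: y_def A_def m_def sum_subtractf)
  \<comment> \<open>The quotient (m + 1) / m is the growth of the linear factor in the claim; the
    other factor is 1 plus the increment of \<open>F\<close>, hence at most its exponential.\<close>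
  have eq: "1 + A / m\<^sup>2 = (m + 1) / m * (1 + (A - m) / (m * (m + 1)))"
  proof -
    have "p / m * (1 + x / (m * p)) = p / m + x / m\<^sup>2" if "p \<noteq> 0" for p x
      using m that by (simp add: distrib_left power2_eq_square)
    from this[of "m + 1" "A - m"] show ?thesis
      using m by (simp add: add_divide_distrib diff_divide_distrib power2_eq_square)
  qed
  have "(\<Sum>k\<le>Suc n. (norm (s k))\<^sup>2) \<le> (1 + A / m\<^sup>2) * S" using sn by (simp add: S_def[symmetric] algebra_simps)
  also have "\<dots> \<le> (1 + A / m\<^sup>2) * (m * exp (F n))"
    using Suc.IH A0 by (intro mult_left_mono) (auto simp: S_def m_def add.commute)
  also have "\<dots> = (m + 1) * (1 + (A - m) / (m * (m + 1))) * exp (F n)" unfolding eq using m by simp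
  also have "\<dots> \<le> (m + 1) * exp ((A - m) / (m * (m + 1))) * exp (F n)"
    using m by (intro mult_right_mono mult_left_mono exp_ge_add_one_self) auto
  also have "\<dots> = (m + 1) * exp (F (Suc n))"
    using F_Suc[of n] unfolding y m_def[symmetric] by (simp add: exp_add[symmetric] mult.assoc)
  finally show ?case by (simp add: m_def)
qed

lemma partial_energy_Q: "(\<Sum>k<n. (norm (s k))\<^sup>2) \<le> real n * Q"
proof (cases n)
  case (Suc m)
  have "(\<Sum>k<n. (norm (s k))\<^sup>2) \<le> (real m + 1) * exp (F m)" using lebedev_milin[of m] by (simp add: Suc lessThan_Suc_atMost)
  also have "\<dots> \<le> (real m + 1) * Q" unfolding Q_def using F_bound by (intro mult_left_mono) auto
  finally show ?thesis by (simp add: Suc add.commute)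
qed simp

text \<open>In the application \<open>norm (\<sigma> n)\<close> is the modulus of the n-th Taylor
  coefficient divided by n.\<close>

definition \<sigma> :: "nat \<Rightarrow> complex" where "\<sigma> n = (\<Sum>k<n. s k) / of_nat n"

lemma \<sigma>_bound: "norm (\<sigma> n) \<le> sqrt Q"
proof (cases "n = 0")
  case False
  have "(norm (\<Sum>k<n. s k))\<^sup>2 \<le> (\<Sum>k<n. norm (s k) * 1)\<^sup>2" by (intro power_mono) (auto intro: norm_sum)
  also have "\<dots> \<le> (\<Sum>k<n. (norm (s k))\<^sup>2) * (\<Sum>k<n. 1\<^sup>2)" by (rule Cauchy_Schwarz_ineq_sum)
  also have "\<dots> \<le> (real n * Q) * real n" using partial_energy_Q[of n] Q_pos by (intro mult_mono) auto
  also have "\<dots> = (real n * sqrt Q)\<^sup>2" using Q_pos by (simp add: power_mult_distrib power2_eq_square)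
  finally have "norm (\<Sum>k<n. s k) \<le> real n * sqrt Q"
    by (rule power2_le_imp_le) (use Q_pos in auto)
  then show ?thesis using False by (simp add: \<sigma>_def norm_divide field_simps)
qed (use Q_pos in \<open>simp add: \<sigma>_def\<close>)

text \<open>By the recursion the increment is a convolution of \<open>j * c j\<close> with
  \<open>s\<close>. In the squared norm of the first factor the indices up to K cost at most K M and
  the others at most n \<delta>, so it is at most 2 n \<delta>; the second factor is bounded by n
  Q.\<close>

lemma \<sigma>_step:
  assumes \<delta>: "\<delta> > 0" and tail: "\<And>I. finite I \<Longrightarrow> I \<subseteq> {K<..} \<Longrightarrow> (\<Sum>j\<in>I. real j * (norm (c j))\<^sup>2) \<le> \<delta>"
    and n: "n \<ge> 1" "real K * M \<le> real n * \<delta>"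
  shows "norm (\<sigma> (Suc n) - \<sigma> n) \<le> sqrt (2 * \<delta> * Q) / real n"
proof -
  have e: "(\<Sum>j\<in>{1..n}. (norm (of_nat j * c j))\<^sup>2) \<le> 2 * real n * \<delta>"
  proof -
    have sq: "(norm (of_nat j * c j))\<^sup>2 = real j * (real j * (norm (c j))\<^sup>2)" for j
      by (simp add: norm_mult power2_eq_square mult_ac)
    have sp: "(\<Sum>j\<in>{1..n}. (norm (of_nat j * c j))\<^sup>2) = (\<Sum>j\<in>{1..n} \<inter> {..K}. (norm (of_nat j * c j))\<^sup>2) + (\<Sum>j\<in>{1..n} \<inter> {K<..}. (norm (of_nat j * c j))\<^sup>2)"
      by (subst sum.union_disjoint[symmetric]) (auto intro!: sum.cong)
    have "(\<Sum>j\<in>{1..n} \<inter> {..K}. (norm (of_nat j * c j))\<^sup>2) \<le> (\<Sum>j\<in>{1..n} \<inter> {..K}. real K * (real j * (norm (c j))\<^sup>2))"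
      unfolding sq by (rule sum_mono) (auto intro!: mult_right_mono)
    also have "\<dots> \<le> real K * M" unfolding sum_distrib_left[symmetric] by (intro mult_left_mono energy) auto
    finally have 1: "(\<Sum>j\<in>{1..n} \<inter> {..K}. (norm (of_nat j * c j))\<^sup>2) \<le> real n * \<delta>" using n by linarith
    have "(\<Sum>j\<in>{1..n} \<inter> {K<..}. (norm (of_nat j * c j))\<^sup>2) \<le> (\<Sum>j\<in>{1..n} \<inter> {K<..}. real n * (real j * (norm (c j))\<^sup>2))"
      unfolding sq by (rule sum_mono) (auto intro!: mult_right_mono)
    also have "\<dots> \<le> real n * \<delta>" unfolding sum_distrib_left[symmetric] by (intro mult_left_mono tail) auto
    finally show ?thesis using 1 sp by linarith
  qed
  have "of_nat n * s n - (\<Sum>k<n. s k) = (\<Sum>j\<in>{1..n}. of_nat j * c j * s (n - j))"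
  proof -
    have "(\<Sum>k<n. s k) = (\<Sum>j\<in>{1..n}. s (n - j))"
      by (rule sum.reindex_bij_witness[of _ "\<lambda>j. n - j" "\<lambda>k. n - k"]) auto
    then show ?thesis unfolding rec[OF n(1)] by (simp add: algebra_simps sum.distrib)
  qed
  then have "norm (of_nat n * s n - (\<Sum>k<n. s k)) \<le> (\<Sum>j\<in>{1..n}. norm (of_nat j * c j) * norm (s (n - j)))"
    by (simp only:) (rule order_trans[OF norm_sum], simp add: norm_mult)
  then have "(norm (of_nat n * s n - (\<Sum>k<n. s k)))\<^sup>2 \<le> (\<Sum>j\<in>{1..n}. norm (of_nat j * c j) * norm (s (n - j)))\<^sup>2"
    by (rule power_mono) simp
  also have "\<dots> \<le> (\<Sum>j\<in>{1..n}. (norm (of_nat j * c j))\<^sup>2) * (\<Sum>j\<in>{1..n}. (norm (s (n - j)))\<^sup>2)"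
    by (rule Cauchy_Schwarz_ineq_sum)
  also have "(\<Sum>j\<in>{1..n}. (norm (s (n - j)))\<^sup>2) = (\<Sum>k<n. (norm (s k))\<^sup>2)"
    by (rule sum.reindex_bij_witness[of _ "\<lambda>k. n - k" "\<lambda>j. n - j"]) auto
  also have "(\<Sum>j\<in>{1..n}. (norm (of_nat j * c j))\<^sup>2) * (\<Sum>k<n. (norm (s k))\<^sup>2) \<le> (2 * real n * \<delta>) * (real n * Q)"
    using e partial_energy_Q[of n] \<delta> by (intro mult_mono) (auto intro!: sum_nonneg)
  also have "\<dots> = (real n * sqrt (2 * \<delta> * Q))\<^sup>2" using \<delta> Q_pos by (simp add: power_mult_distrib power2_eq_square)
  finally have b: "norm (of_nat n * s n - (\<Sum>k<n. s k)) \<le> real n * sqrt (2 * \<delta> * Q)"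
    by (rule power2_le_imp_le) (use \<delta> Q_pos in auto)
  have "\<sigma> (Suc n) - \<sigma> n = (of_nat n * s n - (\<Sum>k<n. s k)) / (of_nat n * of_nat (Suc n))"
  proof -
    have "of_nat n \<noteq> (0::complex)" "of_nat (Suc n) \<noteq> (0::complex)" using n by (auto simp del: of_nat_Suc)
    then show ?thesis unfolding \<sigma>_def by (simp add: divide_simps del: of_nat_Suc) (simp add: algebra_simps)
  qed
  then have "norm (\<sigma> (Suc n) - \<sigma> n) = norm (of_nat n * s n - (\<Sum>k<n. s k)) / (real n * real (Suc n))"
    by (simp only: norm_divide norm_mult norm_of_nat)
  also have "\<dots> \<le> real n * sqrt (2 * \<delta> * Q) / (real n * real (Suc n))"
    using b by (intro divide_right_mono) auto
  also have "\<dots> = sqrt (2 * \<delta> * Q) / real (Suc n)" using n by simp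
  also have "\<dots> \<le> sqrt (2 * \<delta> * Q) / real n" using n \<delta> Q_pos by (intro divide_left_mono) auto
  finally show ?thesis .
qed

text \<open>Summing the steps would give a logarithm of q / p; the cruder symmetric ratio suffices
  and is easily summed against \<open>r ^ k\<close>.\<close>

lemma \<sigma>_slow:
  assumes \<eta>: "\<eta> \<ge> 0" and step: "\<And>n. n \<ge> N \<Longrightarrow> norm (\<sigma> (Suc n) - \<sigma> n) \<le> \<eta> / real n" and N: "N \<ge> 1" and pq: "p \<ge> N" "q \<ge> N"
  shows "norm (\<sigma> p - \<sigma> q) \<le> \<eta> * (real p / real q + real q / real p)"
proof -
  have up: "norm (\<sigma> (p + k) - \<sigma> p) \<le> \<eta> * (real k / real p)" if p: "p \<ge> N" for p k
  proof (induction k)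
    case (Suc k)
    have "norm (\<sigma> (p + Suc k) - \<sigma> p) \<le> norm (\<sigma> (Suc (p + k)) - \<sigma> (p + k)) + norm (\<sigma> (p + k) - \<sigma> p)"
      using norm_triangle_ineq[of "\<sigma> (Suc (p + k)) - \<sigma> (p + k)" "\<sigma> (p + k) - \<sigma> p"] by simp
    also have "\<dots> \<le> \<eta> / real (p + k) + \<eta> * (real k / real p)"
      using Suc.IH step[of "p + k"] p by simp
    also have "\<eta> / real (p + k) \<le> \<eta> / real p" using \<eta> p N by (intro divide_left_mono) auto
    finally show ?case by (simp add: algebra_simps add_divide_distrib)
  qed simp
  have le: "norm (\<sigma> p - \<sigma> q) \<le> \<eta> * (real p / real q + real q / real p)" if "p \<ge> N" "p \<le> q" for p q
  proof -
    have "norm (\<sigma> q - \<sigma> p) \<le> \<eta> * (real (q - p) / real p)" using up[OF that(1), of "q - p"] that by simp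
    also have "\<dots> \<le> \<eta> * (real p / real q + real q / real p)"
    proof (rule mult_left_mono[OF _ \<eta>])
      have "real (q - p) / real p \<le> real q / real p" by (intro divide_right_mono) auto
      moreover have "0 \<le> real p / real q" by simp
      ultimately show "real (q - p) / real p \<le> real p / real q + real q / real p" by linarith
    qed
    finally show ?thesis by (simp add: norm_minus_commute)
  qed
  show ?thesis
  proof (cases "p \<le> q")
    case False
    then show ?thesis using le[OF pq(2), of p] by (simp add: norm_minus_commute add.commute)
  qed (use le pq in blast)
qed

text \<open>For r = 1 - 1 / n the weights (k + 1) r^k / n^2 have sum 1, so g / n^2 is an average of
  the values of \<open>\<sigma>\<close>. The indices below N contribute the first error term; the
  slow variation contributes 2 \<eta> from the second moment of the weights and \<eta> from the
  geometric sum.\<close>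

lemma abel_mean_close:
  assumes \<eta>: "\<eta> \<ge> 0" and step: "\<And>n. n \<ge> N \<Longrightarrow> norm (\<sigma> (Suc n) - \<sigma> n) \<le> \<eta> / real n" and N: "N \<ge> 1" and n: "n \<ge> N" "n \<ge> 2"
    and g: "(\<lambda>k. (\<Sum>j\<le>k. s j) * of_real (1 - 1 / real n) ^ k) sums g"
  shows "norm (g / of_nat n ^ 2 - \<sigma> n) \<le> 2 * real N ^ 2 * sqrt Q / real n ^ 2 + 3 * \<eta>"
proof -
  define r where "r = 1 - 1 / real n"
  have n0: "real n > 0" using n by simp
  have r: "0 < r" "r < 1" using n by (auto simp: r_def field_simps)
  have r1: "1 - r = 1 / real n" by (simp add: r_def)
  have nr: "norm (complex_of_real r) < 1" using r by simp
  have "(\<lambda>k. of_nat (Suc k) * complex_of_real r ^ k) sums (1 / (1 - of_real r)\<^sup>2)"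
    by (rule geometric_deriv_sums[OF nr])
  moreover have "1 / (1 - complex_of_real r)\<^sup>2 = of_nat n ^ 2"
  proof -
    have "1 - complex_of_real r = of_real (1 - r)" by simp
    then show ?thesis unfolding r1 using n0 by (simp add: power_divide)
  qed
  ultimately have "(\<lambda>k. of_nat (Suc k) * complex_of_real r ^ k * \<sigma> n) sums (of_nat n ^ 2 * \<sigma> n)"
    using sums_mult2 by metis
  from sums_diff[OF g[folded r_def] this]
  have d: "(\<lambda>k. (\<Sum>j\<le>k. s j) * of_real r ^ k - of_nat (Suc k) * complex_of_real r ^ k * \<sigma> n) sums (g - of_nat n ^ 2 * \<sigma> n)" .
  define T where "T = (\<lambda>k. of_nat (Suc k) * (\<sigma> (Suc k) - \<sigma> n) * complex_of_real r ^ k)"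
  have "(\<Sum>j\<le>k. s j) * of_real r ^ k - of_nat (Suc k) * complex_of_real r ^ k * \<sigma> n = T k" for k
  proof -
    have "(\<Sum>j\<le>k. s j) = of_nat (Suc k) * \<sigma> (Suc k)" by (simp add: \<sigma>_def lessThan_Suc_atMost del: of_nat_Suc)
    then show ?thesis by (simp add: T_def algebra_simps)
  qed
  then have dT: "T sums (g - of_nat n ^ 2 * \<sigma> n)" using d by simp
  \<comment> \<open>Below N only the boundedness of \<open>\<sigma>\<close> is available, from N on
    its slow variation.\<close>
  have Tb: "norm (T k) \<le> (if Suc k < N then 2 * real N * sqrt Q else 0) + \<eta> * ((real k + 1)\<^sup>2 * r ^ k / real n + real n * r ^ k)" for k
  proof -
    have nT: "norm (T k) = (real k + 1) * norm (\<sigma> (Suc k) - \<sigma> n) * r ^ k"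
      using r by (simp add: T_def norm_mult norm_power del: of_nat_Suc)
    have pos: "0 \<le> \<eta> * ((real k + 1)\<^sup>2 * r ^ k / real n + real n * r ^ k)" using \<eta> r by simp
    show ?thesis
    proof (cases "Suc k < N")
      case True
      have "norm (\<sigma> (Suc k) - \<sigma> n) \<le> 2 * sqrt Q" using norm_triangle_ineq4[of "\<sigma> (Suc k)" "\<sigma> n"] \<sigma>_bound[of "Suc k"] \<sigma>_bound[of n] by linarith
      then have "(real k + 1) * norm (\<sigma> (Suc k) - \<sigma> n) * r ^ k \<le> real N * (2 * sqrt Q) * 1"
        using True r Q_pos by (intro mult_mono) (auto simp: power_le_one)
      then show ?thesis unfolding nT using True pos by (simp add: mult_ac)
    next
      case False
      have "norm (\<sigma> (Suc k) - \<sigma> n) \<le> \<eta> * (real (Suc k) / real n + real n / real (Suc k))"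
        by (rule \<sigma>_slow[OF \<eta> step N]) (use False n in auto)
      then have "(real k + 1) * norm (\<sigma> (Suc k) - \<sigma> n) * r ^ k \<le> (real k + 1) * (\<eta> * (real (Suc k) / real n + real n / real (Suc k))) * r ^ k"
        using r by (intro mult_right_mono mult_left_mono) auto
      also have "\<dots> = \<eta> * ((real k + 1)\<^sup>2 * r ^ k / real n + real n * r ^ k)"
      proof -
        define x where "x = real k + 1"
        have "x > 0" "real (Suc k) = x" by (simp_all add: x_def)
        then show ?thesis unfolding x_def[symmetric] using n0 by (simp add: field_simps power2_eq_square)
      qed
      finally show ?thesis unfolding nT using False by simp
    qed
  qed
  have par: "norm (\<Sum>k<m. T k) \<le> 2 * real N ^ 2 * sqrt Q + \<eta> * (3 * real n ^ 2)" for m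
  proof -
    have "norm (\<Sum>k<m. T k) \<le> (\<Sum>k<m. (if Suc k < N then 2 * real N * sqrt Q else 0) + \<eta> * ((real k + 1)\<^sup>2 * r ^ k / real n + real n * r ^ k))"
      by (rule order_trans[OF norm_sum sum_mono[OF Tb]])
    also have "\<dots> = (\<Sum>k<m. if Suc k < N then 2 * real N * sqrt Q else 0) + \<eta> * ((\<Sum>k<m. (real k + 1)\<^sup>2 * r ^ k) / real n + real n * (\<Sum>k<m. r ^ k))"
      by (simp only: sum.distrib sum_distrib_left[symmetric] sum_divide_distrib[symmetric])
    also have "(\<Sum>k<m. if Suc k < N then 2 * real N * sqrt Q else 0) \<le> 2 * real N ^ 2 * sqrt Q"
    proof -
      have "(\<Sum>k<m. if Suc k < N then 2 * real N * sqrt Q else 0) = (\<Sum>k\<in>{..<m} \<inter> {k. Suc k < N}. 2 * real N * sqrt Q)"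
        by (simp add: sum.If_cases)
      also have "\<dots> \<le> (\<Sum>k<N. 2 * real N * sqrt Q)" using Q_pos by (intro sum_mono2) auto
      finally show ?thesis by (simp add: power2_eq_square mult_ac)
    qed
    also have "\<eta> * ((\<Sum>k<m. (real k + 1)\<^sup>2 * r ^ k) / real n + real n * (\<Sum>k<m. r ^ k)) \<le> \<eta> * (3 * real n ^ 2)"
    proof (rule mult_left_mono[OF _ \<eta>])
      have "(\<Sum>k<m. (real k + 1)\<^sup>2 * r ^ k) \<le> 2 / (1 - r) ^ 3" by (rule square_weighted_sum_bound) (use r in auto)
      also have "\<dots> = 2 * real n ^ 3" unfolding r1 by (simp add: power_divide)
      finally have "(\<Sum>k<m. (real k + 1)\<^sup>2 * r ^ k) / real n \<le> 2 * real n ^ 3 / real n" by (intro divide_right_mono) auto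
      also have "\<dots> = 2 * real n ^ 2" using n0 by (simp add: power3_eq_cube power2_eq_square)
      finally have 1: "(\<Sum>k<m. (real k + 1)\<^sup>2 * r ^ k) / real n \<le> 2 * real n ^ 2" .
      have "(1 - r) * (\<Sum>k<m. r ^ k) = 1 - r ^ m" using one_diff_power_eq[of r m] by simp
      then have "(1 - r) * (\<Sum>k<m. r ^ k) \<le> 1" using r by simp
      then have "(\<Sum>k<m. r ^ k) \<le> real n" unfolding r1 using n0 by (simp add: field_simps)
      then have "real n * (\<Sum>k<m. r ^ k) \<le> real n * real n" using n0 by (intro mult_left_mono) auto
      then show "(\<Sum>k<m. (real k + 1)\<^sup>2 * r ^ k) / real n + real n * (\<Sum>k<m. r ^ k) \<le> 3 * real n ^ 2"
        using 1 by (simp add: power2_eq_square)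
    qed
    finally show ?thesis by simp
  qed
  have "norm (g - of_nat n ^ 2 * \<sigma> n) \<le> 2 * real N ^ 2 * sqrt Q + \<eta> * (3 * real n ^ 2)"
    using dT par unfolding sums_def by (intro LIMSEQ_le_const2[OF tendsto_norm]) auto
  then have "norm (g - of_nat n ^ 2 * \<sigma> n) / real n ^ 2 \<le> (2 * real N ^ 2 * sqrt Q + \<eta> * (3 * real n ^ 2)) / real n ^ 2"
    by (intro divide_right_mono) auto
  moreover have "g / of_nat n ^ 2 - \<sigma> n = (g - of_nat n ^ 2 * \<sigma> n) / of_nat n ^ 2" using n by (simp add: diff_divide_distrib)
  ultimately show ?thesis using n0 by (simp add: norm_divide norm_power add_divide_distrib)
qed

end

lemma log_coeff_rec:
  assumes d: "d 0 = 1" and n: "n \<ge> 1"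
  shows "of_nat n * d n = (\<Sum>j\<in>{1..n}. of_nat j * log_coeff d j * d (n - j))"
proof -
  have "{1..n} = insert n {1..<n}" using n by auto
  then have "(\<Sum>j\<in>{1..n}. of_nat j * log_coeff d j * d (n - j)) = of_nat n * log_coeff d n + (\<Sum>j\<in>{1..<n}. of_nat j * log_coeff d j * d (n - j))"
    using d by simp
  also have "of_nat n * log_coeff d n = of_nat n * d n - (\<Sum>j\<in>{1..<n}. of_nat j * log_coeff d j * d (n - j))"
    using n by (subst log_coeff.simps) (simp add: field_simps)
  finally show ?thesis by simp
qed

section \<open>Rotation of the direction of growth to 1 and the coefficient estimate\<close>

context schlicht_fun begin

definition rot_coeff :: "complex \<Rightarrow> nat \<Rightarrow> complex" where
  "rot_coeff e k = taylor_coeff f (Suc k) * e ^ k"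

text \<open>The coefficients of (1 - z) f(e z) / (e z); for the Koebe function with direction
  \<open>e\<close> all of them are 1.\<close>

definition rot_diff :: "complex \<Rightarrow> nat \<Rightarrow> complex" where
  "rot_diff e n = rot_coeff e n - (if n = 0 then 0 else rot_coeff e (n - 1))"

text \<open>For unimodular \<open>e\<close> these are the coefficients of the logarithm of (1 - z)^2
  f(e z) / (e z), with the same moduli as \<open>koebe_dev e\<close>.\<close>

definition rot_dev :: "complex \<Rightarrow> nat \<Rightarrow> complex" where
  "rot_dev e j = - (e ^ j * koebe_dev e j)"

lemma sum_rot_diff: "(\<Sum>k\<le>n. rot_diff e k) = rot_coeff e n"
  by (induction n) (simp_all add: rot_diff_def)

lemma rot_coeff_0: "rot_coeff e 0 = 1"
  by (simp add: rot_coeff_def taylor_coeff_1 f_deriv_0)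

lemma unimodular_cnj:
  assumes "norm e = 1"
  shows "e ^ j * cnj e ^ j = 1"
proof -
  have "e * cnj e = 1" using complex_norm_square[of e] assms by simp
  then show ?thesis by (simp only: power_mult_distrib[symmetric] power_one)
qed

lemma rot_dev_eq:
  assumes e: "norm e = 1" and j: "j \<ge> 1"
  shows "of_nat j * rot_dev e j = of_nat j * log_coeff (\<lambda>k. taylor_coeff f (Suc k)) j * e ^ j - 2"
proof -
  have "of_nat j * rot_dev e j = of_nat j * taylor_coeff (log_ratio f) j * e ^ j - 2 * (e ^ j * cnj e ^ j)"
    using j by (simp add: rot_dev_def koebe_dev_def field_simps)
  then show ?thesis unfolding unimodular_cnj[OF e] taylor_coeff_log_ratio[OF j] by simp
qed

text \<open>The logarithmic derivative of f(e z) / (e z) gives a recursion for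
  \<open>rot_coeff\<close> with coefficients h j. Multiplying the function by 1 - z lowers each of
  them by 1, and h j - 1 is \<open>j * rot_dev e j + 1\<close>.\<close>

lemma rot_diff_rec:
  assumes e: "norm e = 1" and n: "n \<ge> 1"
  shows "of_nat n * rot_diff e n = (\<Sum>j\<in>{1..n}. (of_nat j * rot_dev e j + 1) * rot_diff e (n - j))"
proof -
  define d where "d = (\<lambda>k. taylor_coeff f (Suc k))"
  define b where "b = rot_coeff e"
  define h where "h = (\<lambda>j. of_nat j * log_coeff d j * e ^ j)"
  have d0: "d 0 = 1" by (simp add: d_def taylor_coeff_1 f_deriv_0)
  have B: "of_nat m * b m = (\<Sum>j\<in>{1..m}. h j * b (m - j))" for m
  proof (cases "m \<ge> 1")
    case True
    have "of_nat m * b m = (of_nat m * d m) * e ^ m" by (simp add: b_def rot_coeff_def d_def)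
    also have "\<dots> = (\<Sum>j\<in>{1..m}. h j * b (m - j))"
      unfolding log_coeff_rec[of d m, OF d0 True] sum_distrib_right
    proof (rule sum.cong[OF refl])
      fix j assume "j \<in> {1..m}"
      then have "e ^ m = e ^ j * e ^ (m - j)" by (simp add: power_add[symmetric])
      then show "of_nat j * log_coeff d j * d (m - j) * e ^ m = h j * b (m - j)"
        by (simp add: h_def b_def rot_coeff_def d_def)
    qed
    finally show ?thesis .
  qed simp
  obtain m where m: "n = Suc m" using n by (cases n) auto
  have "(\<Sum>j\<in>{1..n}. h j * rot_diff e (n - j)) = (\<Sum>j\<in>{1..n}. h j * b (n - j)) - (\<Sum>j\<in>{1..n}. h j * (if n - j = 0 then 0 else b (n - j - 1)))"
    by (simp only: rot_diff_def b_def sum_subtractf right_diff_distrib)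
  also have "(\<Sum>j\<in>{1..n}. h j * (if n - j = 0 then 0 else b (n - j - 1))) = (\<Sum>j\<in>{1..m}. h j * b (m - j))"
    by (rule sum.mono_neutral_cong_right) (auto simp: m Suc_diff_le)
  also have "\<dots> = of_nat m * b m" by (rule B[symmetric])
  finally have 1: "(\<Sum>j\<in>{1..n}. h j * rot_diff e (n - j)) = of_nat n * b n - of_nat m * b m" unfolding B[of n, symmetric] .
  have 2: "(\<Sum>j\<in>{1..n}. rot_diff e (n - j)) = b m"
  proof -
    have "(\<Sum>j\<in>{1..n}. rot_diff e (n - j)) = (\<Sum>k\<le>m. rot_diff e k)"
      by (rule sum.reindex_bij_witness[of _ "\<lambda>k. n - k" "\<lambda>j. n - j"]) (auto simp: m)
    then show ?thesis by (simp add: sum_rot_diff b_def)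
  qed
  have "(\<Sum>j\<in>{1..n}. (of_nat j * rot_dev e j + 1) * rot_diff e (n - j)) = (\<Sum>j\<in>{1..n}. h j * rot_diff e (n - j) - rot_diff e (n - j))"
    by (rule sum.cong[OF refl]) (simp add: rot_dev_eq[OF e] h_def d_def algebra_simps)
  also have "\<dots> = of_nat n * b n - of_nat m * b m - b m"
    unfolding sum_subtractf 1 2 ..
  also have "\<dots> = of_nat n * rot_diff e n"
    by (simp add: rot_diff_def b_def m algebra_simps)
  finally show ?thesis by simp
qed

text \<open>The required sign holds because the real part of the logarithm series along the positive
  axis is \<open>lgrow e\<close>, which decreases from 0.\<close>

lemma rot_recursion:
  assumes e: "norm e = 1" and energy: "\<And>I. finite I \<Longrightarrow> (\<Sum>n\<in>I. real n * (norm (koebe_dev e n))\<^sup>2) \<le> M"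
  shows "log_recursion (rot_dev e) (rot_diff e) M (\<lambda>r. log_ratio f (of_real r * e) + 2 * of_real (ln (1 - r)))"
proof
  show "rot_diff e 0 = 1" by (simp add: rot_diff_def rot_coeff_0)
  show "rot_dev e 0 = 0" by (simp add: rot_dev_def koebe_dev_def taylor_coeff_0 log_ratio_0)
  show "of_nat n * rot_diff e n = (\<Sum>j\<in>{1..n}. (of_nat j * rot_dev e j + 1) * rot_diff e (n - j))" if "n \<ge> 1" for n
    by (rule rot_diff_rec[OF e that])
  show "(\<Sum>j\<in>I. real j * (norm (rot_dev e j))\<^sup>2) \<le> M" if "finite I" for I
    using energy[OF that] e by (simp add: rot_dev_def norm_mult norm_power)
  fix r :: real assume r: "0 < r" "r < 1"
  have n: "norm (of_real r * e) < 1" using e r by (simp add: norm_mult)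
  have "(\<lambda>j. taylor_coeff (log_ratio f) j * (of_real r * e) ^ j + 2 * of_real (- (r ^ j / real j))) sums
      (log_ratio f (of_real r * e) + 2 * of_real (ln (1 - r)))"
    using sums_minus[OF ln_one_minus_sums[of r]] r
    by (intro sums_add sums_mult sums_of_real taylor_sums[OF log_ratio_hol n]) simp
  moreover have "taylor_coeff (log_ratio f) j * (of_real r * e) ^ j + 2 * of_real (- (r ^ j / real j)) = rot_dev e j * of_real r ^ j" for j
  proof -
    have "rot_dev e j = e ^ j * taylor_coeff (log_ratio f) j - 2 * (e ^ j * cnj e ^ j) / of_nat j"
      by (simp add: rot_dev_def koebe_dev_def algebra_simps)
    then have rd: "rot_dev e j = e ^ j * taylor_coeff (log_ratio f) j - 2 / of_nat j"
      unfolding unimodular_cnj[OF e] by simp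
    show ?thesis unfolding rd by (simp add: power_mult_distrib algebra_simps)
  qed
  ultimately show "(\<lambda>j. rot_dev e j * of_real r ^ j) sums (log_ratio f (of_real r * e) + 2 * of_real (ln (1 - r)))" by simp
  show "Re (log_ratio f (of_real r * e) + 2 * of_real (ln (1 - r))) \<le> 0"
    using lgrow_nonpos[OF e, of r] r by (simp add: lgrow_def)
qed

text \<open>The hypotheses on \<open>\<delta>\<close>, \<open>K\<close>, \<open>M\<close> and \<open>N\<close> do not mention \<open>f\<close>, so the estimate is uniform over
  families of schlicht functions.\<close>

lemma coeff_close_growth:
  assumes e: "norm e = 1" and energy: "\<And>I. finite I \<Longrightarrow> (\<Sum>n\<in>I. real n * (norm (koebe_dev e n))\<^sup>2) \<le> M"
    and \<delta>: "\<delta> > 0" and tail: "\<And>I. finite I \<Longrightarrow> I \<subseteq> {K<..} \<Longrightarrow> (\<Sum>n\<in>I. real n * (norm (koebe_dev e n))\<^sup>2) \<le> \<delta>"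
    and N: "N \<ge> 1" "real K * M \<le> real N * \<delta>" and n: "n \<ge> N" "n \<ge> 2"
  shows "\<bar>norm (taylor_coeff f n) / real n - exp (lgrow e (1 - 1 / real n))\<bar>
     \<le> 2 * real N ^ 2 * sqrt (exp (M + 2 * sqrt (2 * M))) / real n ^ 2 + 3 * sqrt (2 * \<delta> * exp (M + 2 * sqrt (2 * M)))"
proof -
  interpret L: log_recursion "rot_dev e" "rot_diff e" M "\<lambda>r. log_ratio f (of_real r * e) + 2 * of_real (ln (1 - r))"
    by (rule rot_recursion[OF e energy])
  have tl: "(\<Sum>j\<in>I. real j * (norm (rot_dev e j))\<^sup>2) \<le> \<delta>" if "finite I" "I \<subseteq> {K<..}" for I
    using tail[OF that] e by (simp add: rot_dev_def norm_mult norm_power)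
  have step: "norm (L.\<sigma> (Suc m) - L.\<sigma> m) \<le> sqrt (2 * \<delta> * L.Q) / real m" if "m \<ge> N" for m
  proof (rule L.\<sigma>_step[OF \<delta> tl])
    show "real K * M \<le> real m * \<delta>"
      using N(2) that \<delta> by (meson mult_right_mono of_nat_le_iff order_trans less_imp_le)
  qed (use that N in auto)
  \<comment> \<open>For this radius 1 / n^2 = (1 - r)^2, so the normalised Abel sum has modulus
    \<open>exp (lgrow e r)\<close>.\<close>
  define r where "r = 1 - 1 / real n"
  have r: "0 < r" "r < 1" using n by (auto simp: r_def field_simps)
  have z: "norm (of_real r * e) < 1" "of_real r * e \<noteq> 0" using e r by (auto simp: norm_mult)
  have g: "(\<lambda>k. (\<Sum>j\<le>k. rot_diff e j) * of_real r ^ k) sums (f (of_real r * e) / (of_real r * e))"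
  proof -
    have "(\<lambda>k. taylor_coeff f (Suc k) * (of_real r * e) ^ Suc k) sums f (of_real r * e)"
      using taylor_sums[OF f_hol z(1)] by (subst sums_Suc_iff) (simp add: taylor_coeff_0 f_0)
    from sums_divide[OF this, of "of_real r * e"]
    have "(\<lambda>k. taylor_coeff f (Suc k) * (of_real r * e) ^ Suc k / (of_real r * e)) sums (f (of_real r * e) / (of_real r * e))" .
    moreover have "taylor_coeff f (Suc k) * (of_real r * e) ^ Suc k / (of_real r * e) = (\<Sum>j\<le>k. rot_diff e j) * of_real r ^ k" for k
      using z(2) by (simp add: sum_rot_diff rot_coeff_def power_mult_distrib)
    ultimately show ?thesis by simp
  qed
  have "norm (f (of_real r * e) / (of_real r * e) / of_nat n ^ 2 - L.\<sigma> n) \<le> 2 * real N ^ 2 * sqrt L.Q / real n ^ 2 + 3 * sqrt (2 * \<delta> * L.Q)"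
    unfolding r_def by (rule L.abel_mean_close[OF _ step N(1) n g[unfolded r_def]]) (use \<delta> L.Q_pos in auto)
  then have "\<bar>norm (L.\<sigma> n) - norm (f (of_real r * e) / (of_real r * e) / of_nat n ^ 2)\<bar> \<le> 2 * real N ^ 2 * sqrt L.Q / real n ^ 2 + 3 * sqrt (2 * \<delta> * L.Q)"
    using norm_triangle_ineq3[of "L.\<sigma> n" "f (of_real r * e) / (of_real r * e) / of_nat n ^ 2"] by (simp add: norm_minus_commute)
  moreover have "norm (L.\<sigma> n) = norm (taylor_coeff f n) / real n"
  proof -
    obtain m where m: "n = Suc m" using n by (cases n) auto
    then have "(\<Sum>k<n. rot_diff e k) = taylor_coeff f n * e ^ m" by (simp add: lessThan_Suc_atMost sum_rot_diff rot_coeff_def)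
    then show ?thesis unfolding L.\<sigma>_def using e by (simp add: norm_divide norm_mult norm_power)
  qed
  moreover have "norm (f (of_real r * e) / (of_real r * e) / of_nat n ^ 2) = exp (lgrow e r)"
  proof -
    have "(1 - r)\<^sup>2 = 1 / real n ^ 2" by (simp add: r_def power_divide)
    then show ?thesis unfolding exp_lgrow[OF e r] using e r by (simp add: norm_divide norm_mult norm_power)
  qed
  ultimately show ?thesis by (simp add: r_def L.Q_def)
qed

end

section \<open>Sequences converging to a full mapping\<close>

locale full_schlicht_sequence =
  fixes fs :: "nat \<Rightarrow> complex \<Rightarrow> complex" and f :: "complex \<Rightarrow> complex"
  assumes S_fs: "\<And>m. schlicht (fs m)"
    and S_f: "schlicht f"
    and conv: "\<And>K. compact K \<Longrightarrow> K \<subseteq> ball 0 1 \<Longrightarrow> uniform_limit K fs f sequentially"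
    and maxgrowth: "hayman_index f > 0"
    and full: "full_mapping (\<lambda>z. inverse (f (inverse z)))"
    and idx: "(\<lambda>m. hayman_index (fs m)) \<longlonglongrightarrow> hayman_index f"
begin

sublocale F: schlicht_fun f by unfold_locales (rule S_f)

sublocale Fs: schlicht_fun "fs m" for m by unfold_locales (rule S_fs)

lemma omitted_null: "F.omitted 1 \<in> null_sets lborel"
proof -
  have "(\<lambda>z. inverse (f (inverse z))) ` ext_disk = F.recip ` (ball 0 1 - {0})"
  proof (intro set_eqI iffI)
    fix w assume "w \<in> (\<lambda>z. inverse (f (inverse z))) ` ext_disk"
    then obtain z where z: "norm z > 1" "w = inverse (f (inverse z))" by (auto simp: ext_disk_def)
    then have "inverse z \<in> ball 0 1 - {0}" by (auto simp: norm_inverse inverse_less_1_iff)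
    then show "w \<in> F.recip ` (ball 0 1 - {0})" using z(2) by (auto simp: F.recip_def)
  next
    fix w assume "w \<in> F.recip ` (ball 0 1 - {0})"
    then obtain z where z0: "z \<in> ball 0 1 - {0}" "w = F.recip z" by blast
    then have z: "norm z < 1" "z \<noteq> 0" "w = inverse (f z)" by (auto simp: F.recip_def inverse_eq_divide)
    then have "inverse z \<in> ext_disk" by (simp add: ext_disk_def norm_inverse one_less_inverse_iff)
    then show "w \<in> (\<lambda>z. inverse (f (inverse z))) ` ext_disk" using z(3) by (intro image_eqI[of _ _ "inverse z"]) auto
  qed
  then have "F.omitted 1 \<in> null_sets lebesgue" using full by (simp add: full_mapping_def F.omitted_def)
  then have "F.omitted 1 \<in> null_sets (completion lborel)" .
  then show ?thesis using F.omitted_borel[of 1] null_sets_completion_iff[of "F.omitted 1" lborel] by simp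
qed

lemma taylor_coeff_tendsto: "(\<lambda>m. taylor_coeff (fs m) k) \<longlonglongrightarrow> taylor_coeff f k"
proof -
  have "(\<lambda>m. (deriv ^^ k) (fs m) 0) \<longlonglongrightarrow> (deriv ^^ k) f 0"
  proof (rule higher_deriv_complex_uniform_limit)
    show "uniform_limit (ball 0 (1/2)) fs f sequentially"
      by (rule uniform_limit_on_subset[OF conv[of "cball 0 (1/2)"]]) auto
    show "\<forall>\<^sub>F m in sequentially. fs m holomorphic_on ball 0 (1/2)"
      by (intro always_eventually allI holomorphic_on_subset[OF Fs.f_hol]) auto
  qed auto
  then show ?thesis unfolding taylor_coeff_def by (intro tendsto_intros) auto
qed

text \<open>The logarithmic coefficient is a polynomial in finitely many Taylor coefficients, so no
  convergence of the chosen logarithms themselves has to be established.\<close>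

lemma koebe_dev_seq_tendsto:
  assumes g: "strict_mono g" and E: "(\<lambda>j. E (g j)) \<longlonglongrightarrow> e"
  shows "(\<lambda>j. Fs.koebe_dev (g j) (E (g j)) n) \<longlonglongrightarrow> F.koebe_dev e n"
proof (cases "n = 0")
  case True
  then show ?thesis by (simp add: Fs.koebe_dev_def F.koebe_dev_def taylor_coeff_0 F.log_ratio_0 Fs.log_ratio_0)
next
  case False
  then have n: "n \<ge> 1" by simp
  have "(\<lambda>m. log_coeff (\<lambda>k. taylor_coeff (fs m) (Suc k)) n) \<longlonglongrightarrow> log_coeff (\<lambda>k. taylor_coeff f (Suc k)) n"
    by (intro log_coeff_tendsto taylor_coeff_tendsto)
  then have "(\<lambda>m. taylor_coeff (log_ratio (fs m)) n) \<longlonglongrightarrow> taylor_coeff (log_ratio f) n"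
    using F.taylor_coeff_log_ratio[OF n] Fs.taylor_coeff_log_ratio[OF n] by simp
  from LIMSEQ_subseq_LIMSEQ[OF this g]
  show ?thesis unfolding Fs.koebe_dev_def F.koebe_dev_def o_def
    by (intro tendsto_intros E) (use n in auto)
qed

lemma value_tendsto:
  assumes g: "strict_mono g" and E: "(\<lambda>j. E (g j)) \<longlonglongrightarrow> e" "\<And>m. norm (E m) = 1" "norm e = 1" and r: "0 < r" "r < 1"
  shows "(\<lambda>j. fs (g j) (of_real r * E (g j))) \<longlonglongrightarrow> f (of_real r * e)"
proof -
  have "uniform_limit (sphere 0 r) fs f sequentially" using r by (intro conv) auto
  then have u: "uniform_limit (sphere 0 r) (\<lambda>j. fs (g j)) f sequentially"
    using g by (rule filterlim_compose[where g="\<lambda>m. fs m", OF _ filterlim_subseq, unfolded o_def])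
  have "isCont f (of_real r * e)"
    using F.f_field_deriv[of "of_real r * e"] E r DERIV_isCont by (simp add: norm_mult) blast
  moreover have "(\<lambda>j. of_real r * E (g j)) \<longlonglongrightarrow> of_real r * e" by (intro tendsto_intros E)
  ultimately have 1: "(\<lambda>j. f (of_real r * E (g j))) \<longlonglongrightarrow> f (of_real r * e)" by (rule isCont_tendsto_compose)
  have "(\<lambda>j. fs (g j) (of_real r * E (g j)) - f (of_real r * E (g j))) \<longlonglongrightarrow> 0"
  proof (rule tendstoI)
    fix \<epsilon> :: real assume "\<epsilon> > 0"
    from uniform_limitD[OF u this]
    show "\<forall>\<^sub>F j in sequentially. dist (fs (g j) (of_real r * E (g j)) - f (of_real r * E (g j))) 0 < \<epsilon>"
      by eventually_elim (use E r in \<open>auto simp: dist_norm norm_mult\<close>)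
  qed
  from tendsto_add[OF this 1] show ?thesis by simp
qed

text \<open>At a fixed radius both sides converge, the left one by the assumption on the Hayman
  indexes; hence a limit of directions of growth is a direction of growth of
  \<open>f\<close>.\<close>

lemma direction_limit:
  assumes g: "strict_mono g" and E: "(\<lambda>j. E (g j)) \<longlonglongrightarrow> e" "\<And>m. norm (E m) = 1" "norm e = 1"
    and dir: "\<And>m r. 0 < r \<Longrightarrow> r < 1 \<Longrightarrow> hayman_index (fs m) \<le> exp (Fs.lgrow m (E m) r)" and r: "0 < r" "r < 1"
  shows "hayman_index f \<le> exp (F.lgrow e r)"
proof (rule LIMSEQ_le)
  show "(\<lambda>j. hayman_index (fs (g j))) \<longlonglongrightarrow> hayman_index f"
    using LIMSEQ_subseq_LIMSEQ[OF idx g] by (simp add: o_def)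
  show "(\<lambda>j. exp (Fs.lgrow (g j) (E (g j)) r)) \<longlonglongrightarrow> exp (F.lgrow e r)"
    unfolding F.exp_lgrow[OF E(3) r] Fs.exp_lgrow[OF E(2) r]
    by (intro tendsto_intros value_tendsto[OF g E r]) (use r in auto)
  show "\<exists>N. \<forall>j\<ge>N. hayman_index (fs (g j)) \<le> exp (Fs.lgrow (g j) (E (g j)) r)"
    using dir[OF r] by blast
qed

text \<open>The directions need not converge, so a failure is followed along a subsequence on which
  they do. There the heads approach almost the whole sum for \<open>f\<close>, the totals cannot
  asymptotically exceed that sum, and no room is left for a tail of size \<delta>.\<close>

lemma uniform_tails:
  assumes E: "\<And>m. norm (E m) = 1"
    and dir: "\<And>m r. 0 < r \<Longrightarrow> r < 1 \<Longrightarrow> hayman_index (fs m) \<le> exp (Fs.lgrow m (E m) r)" and \<delta>: "\<delta> > 0"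
  shows "\<exists>K. \<forall>m\<ge>K. \<forall>I. finite I \<longrightarrow> I \<subseteq> {K<..} \<longrightarrow> (\<Sum>n\<in>I. real n * (norm (Fs.koebe_dev m (E m) n))\<^sup>2) \<le> \<delta>"
proof (rule ccontr)
  assume neg: "\<not> ?thesis"
  have "\<exists>m I. m \<ge> K \<and> finite I \<and> I \<subseteq> {K<..} \<and> (\<Sum>n\<in>I. real n * (norm (Fs.koebe_dev m (E m) n))\<^sup>2) > \<delta>" for K
    using neg by (meson not_le)
  then obtain m I where mI: "\<And>K. m K \<ge> K" "\<And>K. finite (I K)" "\<And>K. I K \<subseteq> {K<..}"
    "\<And>K. (\<Sum>n\<in>I K. real n * (norm (Fs.koebe_dev (m K) (E (m K)) n))\<^sup>2) > \<delta>" by metis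
  obtain h1 :: "nat \<Rightarrow> nat" where h1: "strict_mono h1" "strict_mono (m \<circ> h1)"
  proof -
    \<comment> \<open>\<open>m K\<close> is only known to be at least K; starting each choice above
      the previous value makes \<open>m\<close> strictly increasing along \<open>h\<close>.\<close>
    define h where "h = rec_nat 0 (\<lambda>_ k. Suc (m k))"
    have h: "h (Suc j) = Suc (m (h j))" for j by (simp add: h_def)
    have "h j < h (Suc j)" for j using mI(1)[of "h j"] by (simp add: h)
    moreover have "m (h j) < m (h (Suc j))" for j using mI(1)[of "h (Suc j)"] by (simp add: h)
    ultimately show ?thesis by (intro that[of h]) (auto simp: strict_mono_Suc_iff)
  qed
  have "\<forall>j. (E \<circ> m \<circ> h1) j \<in> sphere 0 1" using E by simp
  then obtain e h2 where e: "e \<in> sphere 0 1" "strict_mono h2" "((E \<circ> m \<circ> h1) \<circ> h2) \<longlonglongrightarrow> e"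
    using compact_sphere[of 0 1] unfolding compact_def by blast
  define k where "k = h1 \<circ> h2"
  define g where "g = m \<circ> k"
  have k: "strict_mono k" unfolding k_def by (rule strict_mono_o[OF h1(1) e(2)])
  have g: "strict_mono g" unfolding g_def k_def using strict_mono_o[OF h1(2) e(2)] by (simp add: o_assoc)
  have Eg: "(\<lambda>j. E (g j)) \<longlonglongrightarrow> e" using e(3) by (simp add: g_def k_def o_def)
  have ne: "norm e = 1" using e(1) by simp
  define \<alpha> where "\<alpha> = hayman_index f"
  have dirf: "\<alpha> \<le> exp (F.lgrow e r)" if "0 < r" "r < 1" for r
    unfolding \<alpha>_def by (rule direction_limit[OF g Eg E ne dir that])
  have \<alpha>: "\<alpha> > 0" using maxgrowth by (simp add: \<alpha>_def)
  have sm: "summable (\<lambda>n. real n * (norm (F.koebe_dev e n))\<^sup>2)" by (rule F.koebe_dev_summable[OF ne \<alpha> dirf])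
  have "- 2 * ln \<alpha> \<le> (\<Sum>n. real n * (norm (F.koebe_dev e n))\<^sup>2)"
    unfolding \<alpha>_def by (rule F.bazilevich_full[OF omitted_null ne maxgrowth dirf[unfolded \<alpha>_def]])
  then have "- 2 * ln \<alpha> - \<delta> / 3 < (\<Sum>n. real n * (norm (F.koebe_dev e n))\<^sup>2)" using \<delta> by linarith
  from order_tendstoD(1)[OF summable_LIMSEQ[OF sm] this]
  obtain K where K: "- 2 * ln \<alpha> - \<delta> / 3 < (\<Sum>n<K. real n * (norm (F.koebe_dev e n))\<^sup>2)"
    by (auto simp: eventually_sequentially)
  have "(\<lambda>j. \<Sum>n<K. real n * (norm (Fs.koebe_dev (g j) (E (g j)) n))\<^sup>2) \<longlonglongrightarrow> (\<Sum>n<K. real n * (norm (F.koebe_dev e n))\<^sup>2)"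
    by (intro tendsto_intros koebe_dev_seq_tendsto[OF g Eg])
  then have ev1: "\<forall>\<^sub>F j in sequentially. - 2 * ln \<alpha> - \<delta> / 3 < (\<Sum>n<K. real n * (norm (Fs.koebe_dev (g j) (E (g j)) n))\<^sup>2)"
    by (rule order_tendstoD(1)) (rule K)
  have ig: "(\<lambda>j. hayman_index (fs (g j))) \<longlonglongrightarrow> \<alpha>" using LIMSEQ_subseq_LIMSEQ[OF idx g] by (simp add: o_def \<alpha>_def)
  have ev2: "\<forall>\<^sub>F j in sequentially. 0 < hayman_index (fs (g j))" by (rule order_tendstoD(1)[OF ig \<alpha>])
  have "(\<lambda>j. - 2 * ln (hayman_index (fs (g j)))) \<longlonglongrightarrow> - 2 * ln \<alpha>" by (intro tendsto_intros ig) (use \<alpha> in simp)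
  then have ev3: "\<forall>\<^sub>F j in sequentially. - 2 * ln (hayman_index (fs (g j))) < - 2 * ln \<alpha> + \<delta> / 3"
    by (rule order_tendstoD(2)) (use \<delta> in simp)
  have ev4: "\<forall>\<^sub>F j in sequentially. K \<le> j" by (rule eventually_ge_at_top)
  have "\<forall>\<^sub>F j in sequentially. False"
    using ev1 ev2 ev3 ev4
  proof eventually_elim
    case (elim j)
    let ?T = "\<lambda>n. real n * (norm (Fs.koebe_dev (g j) (E (g j)) n))\<^sup>2"
    have "K \<le> k j" using elim(4) strict_mono_imp_increasing[OF k, of j] by linarith
    then have sub: "I (k j) \<subseteq> {K<..}" using mI(3)[of "k j"] by auto
    have "(\<Sum>n<K. ?T n) + (\<Sum>n\<in>I (k j). ?T n) = (\<Sum>n\<in>{..<K} \<union> I (k j). ?T n)"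
      by (rule sum.union_disjoint[symmetric]) (use sub mI(2) in auto)
    also have "\<dots> \<le> - 2 * ln (hayman_index (fs (g j)))"
      by (rule Fs.bazilevich[OF E elim(2) dir]) (use mI(2) in auto)
    \<comment> \<open>The head exceeds - 2 ln \<alpha> - \<delta> / 3 and the total is below - 2 ln
      \<alpha> + \<delta> / 3, so less than 2 \<delta> / 3 remains.\<close>
    finally have "(\<Sum>n\<in>I (k j). ?T n) \<le> \<delta>" using elim(1,3) \<delta> by linarith
    then show False using mI(4)[of "k j"] by (simp add: g_def)
  qed
  then show False by simp
qed

text \<open>Monotonicity squeezes the value at 1 - 1 / n between the Hayman index of
  \<open>fs m\<close> and the value at a fixed radius r. At that single radius uniform convergence
  on a circle compares \<open>fs m\<close> with \<open>f\<close>, so the choice of N is independent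
  of the directions.\<close>

lemma growth_along_directions_tendsto:
  assumes E: "\<And>m. norm (E m) = 1"
    and dir: "\<And>m r. 0 < r \<Longrightarrow> r < 1 \<Longrightarrow> hayman_index (fs m) \<le> exp (Fs.lgrow m (E m) r)" and \<epsilon>: "\<epsilon> > 0"
  obtains N where "\<And>m n. m \<ge> N \<Longrightarrow> n \<ge> N \<Longrightarrow> \<bar>exp (Fs.lgrow m (E m) (1 - 1 / real n)) - hayman_index (fs m)\<bar> < \<epsilon>"
proof -
  have "\<forall>\<^sub>F r in at_left 1. F.max_growth r < hayman_index f + \<epsilon> / 3"
    by (rule order_tendstoD(2)[OF F.hayman_index_limit(1)]) (use \<epsilon> in simp)
  moreover have "\<forall>\<^sub>F r in at_left (1::real). 0 < r \<and> r < 1"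
    unfolding eventually_at_left_field by (intro exI[of _ 0]) auto
  ultimately have "\<forall>\<^sub>F r in at_left 1. 0 < r \<and> r < 1 \<and> F.max_growth r < hayman_index f + \<epsilon> / 3"
    by eventually_elim auto
  from eventually_happens'[OF _ this] obtain r where r: "0 < r" "r < 1" "F.max_growth r < hayman_index f + \<epsilon> / 3"
    by auto
  have "uniform_limit (sphere 0 r) fs f sequentially" using r by (intro conv) auto
  \<comment> \<open>The factor r compensates the division by r in \<open>exp_lgrow\<close>.\<close>
  from uniform_limitD[OF this, of "\<epsilon> / 3 * r"] have
    ev1: "\<forall>\<^sub>F m in sequentially. \<forall>z\<in>sphere 0 r. dist (fs m z) (f z) < \<epsilon> / 3 * r" using r \<epsilon> by simp
  have ev2: "\<forall>\<^sub>F m in sequentially. hayman_index f - \<epsilon> / 3 < hayman_index (fs m)"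
    by (rule order_tendstoD(1)[OF idx]) (use \<epsilon> in simp)
  obtain N1 where N1: "\<And>m. m \<ge> N1 \<Longrightarrow> (\<forall>z\<in>sphere 0 r. dist (fs m z) (f z) < \<epsilon> / 3 * r) \<and> hayman_index f - \<epsilon> / 3 < hayman_index (fs m)"
    using eventually_conj[OF ev1 ev2] unfolding eventually_sequentially by blast
  obtain N2 :: nat where N2: "real N2 > 1 / (1 - r)" using reals_Archimedean2 by blast
  show ?thesis
  proof (rule that[of "max N1 (max N2 2)"])
    fix m n assume mn: "m \<ge> max N1 (max N2 2)" "n \<ge> max N1 (max N2 2)"
    let ?s = "1 - 1 / real n" and ?z = "of_real r * E m"
    have "real n > 1 / (1 - r)" "n \<ge> 2" using N2 mn by auto
    then have s: "0 < ?s" "?s < 1" "r \<le> ?s" using r by (auto simp: field_simps)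
    have z: "?z \<in> sphere 0 r" using r E by (simp add: norm_mult)
    have "norm (fs m ?z) \<le> norm (f ?z) + norm (fs m ?z - f ?z)" using norm_triangle_sub by blast
    also have "\<dots> \<le> norm (f ?z) + \<epsilon> / 3 * r" using N1[of m] mn z by (auto simp: dist_norm less_imp_le)
    finally have "norm (fs m ?z) * (1 - r)\<^sup>2 / r \<le> (norm (f ?z) + \<epsilon> / 3 * r) * (1 - r)\<^sup>2 / r"
      using r by (intro divide_right_mono mult_right_mono) auto
    also have "\<dots> = norm (f ?z) * (1 - r)\<^sup>2 / r + \<epsilon> / 3 * (1 - r)\<^sup>2" using r by (simp add: field_simps)
    also have "\<dots> \<le> norm (f ?z) * (1 - r)\<^sup>2 / r + \<epsilon> / 3 * 1"
      using r \<epsilon> by (intro add_left_mono mult_left_mono) (auto simp: power_le_one)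
    finally have "exp (Fs.lgrow m (E m) r) \<le> exp (F.lgrow (E m) r) + \<epsilon> / 3"
      using Fs.exp_lgrow[OF E r(1,2)] F.exp_lgrow[OF E r(1,2)] by simp
    moreover have "exp (F.lgrow (E m) r) \<le> F.max_growth r" by (rule F.max_growth_ge[OF r(1,2) E])
    moreover have "exp (Fs.lgrow m (E m) ?s) \<le> exp (Fs.lgrow m (E m) r)"
      using Fs.lgrow_antimono[OF E, of r ?s] r s by simp
    moreover have "hayman_index (fs m) \<le> exp (Fs.lgrow m (E m) ?s)" by (rule dir[OF s(1,2)])
    moreover have "hayman_index f - \<epsilon> / 3 < hayman_index (fs m)" using N1[of m] mn by simp
    ultimately show "\<bar>exp (Fs.lgrow m (E m) ?s) - hayman_index (fs m)\<bar> < \<epsilon>" using r(3) by linarith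
  qed
qed

lemma coeff_close_hayman_index:
  assumes \<epsilon>: "\<epsilon> > 0"
  obtains N where "\<And>m n. m \<ge> N \<Longrightarrow> n \<ge> N \<Longrightarrow> \<bar>norm (taylor_coeff (fs m) n) / real n - hayman_index (fs m)\<bar> < \<epsilon>"
proof -
  have "\<forall>m. \<exists>e. norm e = 1 \<and> (\<forall>r. 0 < r \<longrightarrow> r < 1 \<longrightarrow> hayman_index (fs m) \<le> exp (Fs.lgrow m e r))"
    using Fs.growth_direction by metis
  then obtain E where E: "\<And>m. norm (E m) = 1"
    and dir: "\<And>m r. 0 < r \<Longrightarrow> r < 1 \<Longrightarrow> hayman_index (fs m) \<le> exp (Fs.lgrow m (E m) r)" by metis
  \<comment> \<open>For large m the index of \<open>fs m\<close> exceeds half that of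
    \<open>f\<close>, so this bounds all energies at once.\<close>
  define M where "M = - 2 * ln (hayman_index f / 2)"
  define Q where "Q = exp (M + 2 * sqrt (2 * M))"
  have Q: "Q > 0" by (simp add: Q_def)
  \<comment> \<open>Chosen so that \<open>3 * sqrt (2 * \<delta> * Q)\<close> equals
    \<open>\<epsilon> / 4\<close>; another quarter goes to the finitely many low indices and a half
    to the growth along the directions.\<close>
  define \<delta> where "\<delta> = (\<epsilon> / 12)\<^sup>2 / (2 * Q)"
  have \<delta>: "\<delta> > 0" using \<epsilon> Q by (simp add: \<delta>_def)
  have "2 * \<delta> * Q = (\<epsilon> / 12)\<^sup>2" using Q by (simp add: \<delta>_def)
  then have \<delta>Q: "3 * sqrt (2 * \<delta> * Q) = \<epsilon> / 4" using \<epsilon> by simp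
  have "\<forall>\<^sub>F m in sequentially. hayman_index f / 2 < hayman_index (fs m)"
    by (rule order_tendstoD(1)[OF idx]) (use maxgrowth in simp)
  then obtain N0 where N0: "\<And>m. m \<ge> N0 \<Longrightarrow> hayman_index f / 2 < hayman_index (fs m)"
    by (auto simp: eventually_sequentially)
  have energy: "(\<Sum>n\<in>I. real n * (norm (Fs.koebe_dev m (E m) n))\<^sup>2) \<le> M" if m: "m \<ge> N0" and I: "finite I" for m I
  proof -
    have p: "0 < hayman_index (fs m)" using N0[OF m] maxgrowth by simp
    have "(\<Sum>n\<in>I. real n * (norm (Fs.koebe_dev m (E m) n))\<^sup>2) \<le> - 2 * ln (hayman_index (fs m))"
      by (rule Fs.bazilevich[OF E p dir I])
    also have "\<dots> \<le> M" unfolding M_def using N0[OF m] maxgrowth p by simp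
    finally show ?thesis .
  qed
  obtain K where K: "\<And>m I. m \<ge> K \<Longrightarrow> finite I \<Longrightarrow> I \<subseteq> {K<..} \<Longrightarrow> (\<Sum>n\<in>I. real n * (norm (Fs.koebe_dev m (E m) n))\<^sup>2) \<le> \<delta>"
    using uniform_tails[OF E dir \<delta>] by metis
  obtain N1' :: nat where N1': "real K * M / \<delta> < real N1'" using reals_Archimedean2 by blast
  define N1 where "N1 = Suc N1'"
  have N1: "N1 \<ge> 1" "real K * M \<le> real N1 * \<delta>"
    using N1' \<delta> by (auto simp: N1_def field_simps)
  have "(\<lambda>n. 2 * real N1 ^ 2 * sqrt Q / real n ^ 2) \<longlonglongrightarrow> 0" by real_asymp
  from order_tendstoD(2)[OF this, of "\<epsilon> / 4"] \<epsilon>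
  obtain N2 where N2: "\<And>n. n \<ge> N2 \<Longrightarrow> 2 * real N1 ^ 2 * sqrt Q / real n ^ 2 < \<epsilon> / 4"
    by (auto simp: eventually_sequentially)
  obtain N3 where N3: "\<And>m n. m \<ge> N3 \<Longrightarrow> n \<ge> N3 \<Longrightarrow> \<bar>exp (Fs.lgrow m (E m) (1 - 1 / real n)) - hayman_index (fs m)\<bar> < \<epsilon> / 2"
    by (rule growth_along_directions_tendsto[OF E dir, of "\<epsilon> / 2"]) (use \<epsilon> in auto)
  show ?thesis
  proof (rule that[of "Max {N0, K, N1, N2, N3, 2}"])
    fix m n assume "m \<ge> Max {N0, K, N1, N2, N3, 2}" "n \<ge> Max {N0, K, N1, N2, N3, 2}"
    then have mn: "m \<ge> N0" "m \<ge> K" "m \<ge> N3" "n \<ge> N1" "n \<ge> N2" "n \<ge> N3" "n \<ge> 2" by auto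
    have "\<bar>norm (taylor_coeff (fs m) n) / real n - exp (Fs.lgrow m (E m) (1 - 1 / real n))\<bar>
        \<le> 2 * real N1 ^ 2 * sqrt Q / real n ^ 2 + 3 * sqrt (2 * \<delta> * Q)"
      unfolding Q_def by (rule Fs.coeff_close_growth[OF E energy[OF mn(1)] \<delta> K[OF mn(2)] N1 mn(4,7)])
    then show "\<bar>norm (taylor_coeff (fs m) n) / real n - hayman_index (fs m)\<bar> < \<epsilon>"
      using N2[OF mn(5)] N3[OF mn(3,6)] \<delta>Q by linarith
  qed
qed

end

theorem theorem2:
  fixes fs :: "nat \<Rightarrow> complex \<Rightarrow> complex" and f :: "complex \<Rightarrow> complex"
  assumes S_fs: "\<And>m. schlicht (fs m)"
    and S_f: "schlicht f"
    and conv: "\<And>K. compact K \<Longrightarrow> K \<subseteq> ball 0 1 \<Longrightarrow> uniform_limit K fs f sequentially"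
    and maxgrowth: "hayman_index f > 0"
    and full: "full_mapping (\<lambda>z. inverse (f (inverse z)))"
    and idx: "(\<lambda>m. hayman_index (fs m)) \<longlonglongrightarrow> hayman_index f"
  shows "\<forall>\<epsilon>>0. \<exists>N::nat. \<forall>m n. m > N \<and> n > N \<longrightarrow>
           \<bar>norm (taylor_coeff (fs m) n) / real n - hayman_index (fs m)\<bar> < \<epsilon>"
proof -
  interpret full_schlicht_sequence fs f
    by unfold_locales (fact S_fs S_f conv maxgrowth full idx)+
  show ?thesis by (meson coeff_close_hayman_index less_imp_le)
qed

end
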